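(* Let $n\ge3$, $A\in M(\lambda,L)$, let $\Gamma$ be the fundamental solution of $-\mathrm{div}(A\nabla\cdot)$ in $\mathbb{R}^n$ with pole at the origin, and let $u\in H^1(B_1)$ be a weak solution of $\mathrm{div}(A\nabla u)=0$ in $B_1$. Then there exist $\alpha=\alpha(n,\lambda,L)\in(0,1)$ and $C=C(n,\lambda,L)>0$ such that $$\int_{B_r}\Gamma(x)\,A\nabla u\cdot\nabla u\,dx\le C\left(\frac rR\right)^{2\alpha}\int_{B_R}\Gamma(x)\,A\nabla u\cdot\nabla u\,dx\qquad\text{for all }0<r<R\le\tfrac12.$$ Moreover, $u\in C^{0,\alpha}(B_{1/2})$.
   Context: For $0<\lambda\le L<\infty$, $M(\lambda,L)$ denotes the set of symmetric matrix-valued functions $A=(a_{ij})$ on $\mathbb{R}^n$ with bounded measurable coefficients satisfying $\lambda|\xi|^2\le A(x)\xi\cdot\xi\le L|\xi|^2$ for all $\xi\in\mathbb{R}^n$ and a.e. $x\in\mathbb{R}^n$. $B_r$ is the ball of radius $r$ centered at the origin. The fundamental solution $\Gamma$ is the positive function with $-\mathrm{div}(A\nabla\Gamma)=\delta_0$ in $\mathbb{R}^n$ and $\Gamma\to0$ at infinity; it satisfies $C_1|x|^{2-n}\le\Gamma(x)\le C_2|x|^{2-n}$ with $C_1,C_2>0$ depending only on $n,\lambda,L$. *)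

theory Defs
  imports "HOL-Analysis.Analysis"
begin

definition pderiv :: "(real^'n \<Rightarrow> real) \<Rightarrow> 'n \<Rightarrow> real^'n \<Rightarrow> real" where
  "pderiv f i x = frechet_derivative f (at x) (axis i 1)"

definition grad :: "(real^'n \<Rightarrow> real) \<Rightarrow> real^'n \<Rightarrow> real^'n" where
  "grad f x = (\<chi> i. pderiv f i x)"

fun Ck :: "nat \<Rightarrow> (real^'n \<Rightarrow> real) \<Rightarrow> bool" where
  "Ck 0 f = continuous_on UNIV f"
| "Ck (Suc k) f = ((\<forall>x. f differentiable (at x)) \<and> (\<forall>i. Ck k (pderiv f i)))"

definition smooth :: "(real^'n \<Rightarrow> real) \<Rightarrow> bool" where
  "smooth f = (\<forall>k. Ck k f)"

definition test_fun :: "(real^'n) set \<Rightarrow> (real^'n \<Rightarrow> real) \<Rightarrow> bool" where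
  "test_fun U \<phi> = (smooth \<phi> \<and> compact (closure {x. \<phi> x \<noteq> 0}) \<and> closure {x. \<phi> x \<noteq> 0} \<subseteq> U)"

definition loc_integrable :: "(real^'n) set \<Rightarrow> (real^'n \<Rightarrow> real) \<Rightarrow> bool" where
  "loc_integrable U f = (\<forall>K. compact K \<and> K \<subseteq> U \<longrightarrow> set_integrable lebesgue K f)"

definition weak_grad :: "(real^'n) set \<Rightarrow> (real^'n \<Rightarrow> real) \<Rightarrow> (real^'n \<Rightarrow> real^'n) \<Rightarrow> bool" where
  "weak_grad U u g = (loc_integrable U u \<and> (\<forall>i. loc_integrable U (\<lambda>x. g x $ i)) \<and>
     (\<forall>\<phi> i. test_fun U \<phi> \<longrightarrow>
        (\<integral>x. u x * pderiv \<phi> i x \<partial>lebesgue) = - (\<integral>x. g x $ i * \<phi> x \<partial>lebesgue)))"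

definition H1 :: "(real^'n) set \<Rightarrow> (real^'n \<Rightarrow> real) \<Rightarrow> (real^'n \<Rightarrow> real^'n) \<Rightarrow> bool" where
  "H1 U u g = (weak_grad U u g \<and> set_integrable lebesgue U (\<lambda>x. (u x)\<^sup>2) \<and>
     (\<forall>i. set_integrable lebesgue U (\<lambda>x. (g x $ i)\<^sup>2)))"

definition elliptic_class :: "real \<Rightarrow> real \<Rightarrow> (real^'n \<Rightarrow> real^'n^'n) set" where
  "elliptic_class lam L = {A. (\<forall>i j. (\<lambda>x. A x $ i $ j) \<in> borel_measurable lebesgue) \<and>
     (AE x in lebesgue. transpose (A x) = A x \<and>
        (\<forall>\<xi>. lam * (norm \<xi>)\<^sup>2 \<le> (A x *v \<xi>) \<bullet> \<xi> \<and> (A x *v \<xi>) \<bullet> \<xi> \<le> L * (norm \<xi>)\<^sup>2))}"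

definition weak_solution :: "(real^'n \<Rightarrow> real^'n^'n) \<Rightarrow> (real^'n) set \<Rightarrow> (real^'n \<Rightarrow> real) \<Rightarrow> (real^'n \<Rightarrow> real^'n) \<Rightarrow> bool" where
  "weak_solution A U u Du = (H1 U u Du \<and>
     (\<forall>\<phi>. test_fun U \<phi> \<longrightarrow> (\<integral>x. (A x *v Du x) \<bullet> grad \<phi> x \<partial>lebesgue) = 0))"

definition fundamental_solution :: "(real^'n \<Rightarrow> real^'n^'n) \<Rightarrow> (real^'n \<Rightarrow> real) \<Rightarrow> (real^'n \<Rightarrow> real^'n) \<Rightarrow> bool" where
  "fundamental_solution A G DG = ((\<forall>x. x \<noteq> 0 \<longrightarrow> G x > 0) \<and> weak_grad UNIV G DG \<and>
     (\<forall>\<rho>>0. \<forall>i. set_integrable lebesgue (- cball 0 \<rho>) (\<lambda>x. (DG x $ i)\<^sup>2)) \<and>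
     (\<forall>\<phi>. test_fun UNIV \<phi> \<longrightarrow> (\<integral>x. (A x *v DG x) \<bullet> grad \<phi> x \<partial>lebesgue) = \<phi> 0) \<and>
     (G \<longlongrightarrow> 0) at_infinity)"

definition holder_class :: "real \<Rightarrow> (real^'n) set \<Rightarrow> (real^'n \<Rightarrow> real) \<Rightarrow> bool" where
  "holder_class \<alpha> U u = (\<exists>v K. (AE x in lebesgue. x \<in> U \<longrightarrow> u x = v x) \<and>
     (\<forall>x\<in>U. \<forall>y\<in>U. \<bar>v x - v y\<bar> \<le> K * dist x y powr \<alpha>))"

end

theory Submission
 imports Defs
begin

text \<open>
 The decay of the oscillation of a solution is the De Giorgi--Moser theory: Caccioppoli's inequality on superlevel
 sets and the Faber--Krahn inequality bound subsolutions locally, and applying this to the logarithm of a positive supersolution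
 shows that a supersolution which is large on a fixed portion of a ball is bounded below on a smaller ball.

 The truncations \<open>min \<Gamma> k\<close> are supersolutions with energy at most \<open>k / lam\<close>. Together with Hardy's inequality, local
 boundedness and the growth of supersolutions this gives two-sided bounds of \<open>\<Gamma>\<close> by \<open>|x|\<^bsup>2-n\<^esup>\<close>.

 Testing the equation of \<open>u\<close> with \<open>\<Phi>'(u - c) (\<Gamma> - k)\<^sup>+\<close>, where \<open>\<Phi>'' \<ge> 1/2\<close> on the range of \<open>u - c\<close>, bounds the
 weighted energy in a ball by the square of the oscillation of \<open>u\<close> in a comparable ball. The oscillation decays
 like \<open>(r / R)\<^bsup>\<alpha>\<^esup>\<close>, and at scale \<open>R\<close> its square is bounded by the weighted energy because of local boundedness, Poincare's
 inequality and the lower bound of \<open>\<Gamma>\<close>.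
\<close>

text \<open>Near the pole \<Gamma> is known only to be locally integrable with a locally integrable
  weak gradient, so it can neither be tested with nor be inserted into energy estimates there. All
  work is done with its truncations: they are bounded, and since a point has zero capacity for n >=
  3, bounded functions of finite energy can be treated across the pole. The energy bound k / lam is
  k times the unit flux of \<Gamma>, and this flux also forces the lower bound: a function too small
  on most of an annulus could not carry it. For the upper bound Hardy's inequality makes the L^2
  estimate linear in the supremum, while local boundedness is quadratic in it; this gap lets an
  iteration forget the initial bound. In the decay estimate k bounds \<Gamma> outside a ball, and
  the two-sided bounds give \<Gamma> >= 2k in a ball smaller by a fixed factor, where (\<Gamma> -
  k)^+ is comparable to \<Gamma>. The weighted energy is not known to be finite beforehand, hence
  the extended nonnegative integrals.\<close>

notation scaleR (infixr "*." 75)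

abbreviation ind :: "'a set => 'a => 'b::zero_neq_one" where "ind \<equiv> indicator"

abbreviation ae :: "('a::euclidean_space => bool) => bool" (binder "AEL " 10) where
 "ae P \<equiv> eventually P (ae_filter lborel)"

abbreviation nn_int :: "('a::euclidean_space => ennreal) => ennreal" (binder "NN " 10) where
 "nn_int f \<equiv> nn_integral lborel f"

abbreviation Borel :: "('a::topological_space => 'b::topological_space) set" where
 "Borel \<equiv> borel_measurable borel"

abbreviation seq_tendsto :: "(nat => 'a::topological_space) => 'a => bool" (infixr "--->" 60) where
 "X ---> l \<equiv> X \<longlonglongrightarrow> l"

section \<open>Gradients of functions of class C^1\<close>

lemma vec_inner_axis_sum:
 fixes v h :: "real^'n"
 shows "v \<bullet> h = (\<Sum>i\<in>UNIV. h $ i * v $ i)"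
 by (simp add: inner_vec_def mult.commute)

lemma linear_axis_expansion:
 fixes D :: "real^'n => real"
 assumes "linear D"
 shows "D h = (\<chi> i. D (axis i 1)) \<bullet> h"
proof -
 have "h = (\<Sum>i\<in>UNIV. h $ i *. axis i 1)"
  using basis_expansion[of h] by (simp add: scalar_mult_eq_scaleR)
 then have "D h = D (\<Sum>i\<in>UNIV. h $ i *. axis i 1)" by simp
 also have "\<dots> = (\<Sum>i\<in>UNIV. h $ i * D (axis i 1))"
  using assms by (simp add: linear_sum linear_scale)
 finally show ?thesis by (simp add: vec_inner_axis_sum)
qed

lemma pderiv_eq:
 assumes "(f has_derivative D) (at x)"
 shows "pderiv f i x = D (axis i 1)"
 unfolding pderiv_def using frechet_derivative_at[OF assms] by simp

lemma grad_eq: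
 assumes "(f has_derivative (%h. v \<bullet> h)) (at x)"
 shows "grad f x = v"
 using pderiv_eq[OF assms] by (simp add: grad_def vec_eq_iff inner_axis)

lemma differentiable_grad:
 fixes f :: "real^'n => real"
 assumes "f differentiable (at x)"
 shows "(f has_derivative (%h. grad f x \<bullet> h)) (at x)"
proof -
 obtain D where D: "(f has_derivative D) (at x)"
  using assms by (auto simp: differentiable_def)
 have "D h = grad f x \<bullet> h" for h
  using linear_axis_expansion[OF has_derivative_linear[OF D], of h]
  by (simp add: grad_def pderiv_eq[OF D])
 then have "D = (%h. grad f x \<bullet> h)" by blast
 with D show ?thesis by simp
qed

definition C1 :: "(real^'n => real) => bool" where
 "C1 f \<longleftrightarrow> (ALL x. (f has_derivative (%h. grad f x \<bullet> h)) (at x)) & continuous_on UNIV (grad f)"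

lemma C1I:
 assumes "!!x. (f has_derivative (%h. g x \<bullet> h)) (at x)" and "continuous_on UNIV g"
 shows "C1 f" and "grad f = g"
proof -
 show "grad f = g" using grad_eq[OF assms(1)] by (auto simp: fun_eq_iff)
 then show "C1 f" using assms by (simp add: C1_def)
qed

lemma C1D: "C1 f ==> (f has_derivative (%h. grad f x \<bullet> h)) (at x)"
 by (simp add: C1_def)

lemma C1_continuous_grad: "C1 f ==> continuous_on UNIV (grad f)"
 by (simp add: C1_def)

lemma C1_continuous: "C1 f ==> continuous_on UNIV f"
 by (meson C1D continuous_at_imp_continuous_on has_derivative_continuous)

lemma C1_measurable: "C1 f ==> f : Borel"
 by (simp add: C1_continuous borel_measurable_continuous_onI)

lemma grad_measurable: "C1 f ==> grad f : Borel"
 by (simp add: C1_continuous_grad borel_measurable_continuous_onI)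

lemma C1_const: "C1 (%x. c)" and grad_const: "grad (%x. c) = (%x. 0)"
proof -
 have *: "((%x::real^'n. c) has_derivative (%h. 0 \<bullet> h)) (at x)" for x
  by (auto intro!: derivative_eq_intros)
 from C1I[OF *] show "C1 (%x::real^'n. c)" "grad (%x::real^'n. c) = (%x. 0)" by auto
qed

lemma
 assumes "C1 f" "C1 g"
 shows C1_mult: "C1 (%x. f x * g x)"
  and grad_mult: "grad (%x. f x * g x) = (%x. f x *. grad g x + g x *. grad f x)"
proof -
 have *: "((%x. f x * g x) has_derivative (%h. (f x *. grad g x + g x *. grad f x) \<bullet> h)) (at x)" for x
  by (rule derivative_eq_intros C1D assms | simp add: inner_add_left fun_eq_iff)+
 have "continuous_on UNIV (%x. f x *. grad g x + g x *. grad f x)"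
  using assms by (intro continuous_intros C1_continuous_grad C1_continuous)
 from C1I[OF * this] show "C1 (%x. f x * g x)"
  "grad (%x. f x * g x) = (%x. f x *. grad g x + g x *. grad f x)" by auto
qed

lemma
 assumes "C1 f" and "!!t. (F has_real_derivative F' t) (at t)" and "continuous_on UNIV F'"
 shows C1_compose: "C1 (%x. F (f x))"
  and grad_compose: "grad (%x. F (f x)) = (%x. F' (f x) *. grad f x)"
proof -
 have *: "((%x. F (f x)) has_derivative (%h. (F' (f x) *. grad f x) \<bullet> h)) (at x)" for x
  using has_derivative_compose[OF C1D[OF assms(1)] assms(2)[of "f x", unfolded has_field_derivative_def]]
  by simp
 have "continuous_on UNIV (%x. F' (f x) *. grad f x)"
  using assms
  by (intro continuous_intros C1_continuous_grad continuous_on_compose2[OF assms(3)] C1_continuous) auto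
 from C1I[OF * this] show "C1 (%x. F (f x))"
  "grad (%x. F (f x)) = (%x. F' (f x) *. grad f x)" by auto
qed

lemma C1_minus_const: "C1 f ==> C1 (%x. f x - c)"
 by (rule C1_compose[where F="%t. t - c" and F'="%t. 1"]) (auto intro!: derivative_eq_intros)

lemma grad_zero_open:
 assumes "open U" "x : U" "!!y. y : U ==> f y = 0"
 shows "grad f x = 0"
proof -
 have "(f has_derivative (%h. 0 \<bullet> h)) (at x)"
  by (rule has_derivative_transform_within_open[of "%_. 0" _ _ _ U]) (use assms in auto)
 from grad_eq[OF this] show ?thesis .
qed

lemma grad_zero_outside:
 assumes "!!y. y ~: K ==> f y = 0" "closed K" "x ~: K"
 shows "grad f x = 0"
 using grad_zero_open[of "-K" x f] assms by auto

lemma pderiv_zero_outside: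
 assumes "!!y. y ~: K ==> f y = 0" "closed K" "x ~: K"
 shows "pderiv f i x = 0"
 using grad_zero_outside[of K f x, OF assms] by (simp add: grad_def vec_eq_iff)

subsection \<open>Smooth kernels\<close>

lemma Ck_continuous: "Ck k f ==> continuous_on UNIV f"
 by (cases k)
  (auto intro: differentiable_imp_continuous_within continuous_at_imp_continuous_on)

lemma Ck_Suc_imp: "Ck (Suc k) f ==> Ck k f"
proof (induction k arbitrary: f)
 case 0 then show ?case using Ck_continuous Ck.simps(1) by blast
next
 case (Suc k)
 then show ?case by (metis Ck.simps(2))
qed

lemma Ck_C1: "Ck (Suc k) f ==> C1 f"
proof -
 assume *: "Ck (Suc k) f"
 then have "continuous_on UNIV (pderiv f i)" for i using Ck_continuous[of k "pderiv f i"] by simp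
 then have "continuous_on UNIV (grad f)"
  unfolding grad_def[abs_def] by (intro continuous_on_vec_lambda) simp
 then show "C1 f" unfolding C1_def using * differentiable_grad by auto
qed

lemma Ck_SucI:
 assumes "!!x. (f has_derivative D x) (at x)" "!!i. Ck k (%x. D x (axis i 1))"
 shows "Ck (Suc k) f"
proof -
 have "pderiv f i = (%x. D x (axis i 1))" for i using pderiv_eq[OF assms(1)] by auto
 then show ?thesis using assms by (auto simp: differentiable_def)
qed

lemma Ck_has_derivative: "Ck (Suc k) f ==> (f has_derivative (%h. grad f x \<bullet> h)) (at x)"
 using Ck_C1 C1D by blast

lemma grad_axis: "grad f x \<bullet> axis i 1 = pderiv f i x"
 by (simp add: grad_def inner_axis)

lemma Ck_const: "Ck k (%x::real^'n. c)"
proof (induction k arbitrary: c)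
 case (Suc k)
 show ?case by (rule Ck_SucI[of _ "%x h. 0"]) (auto simp: Suc)
qed simp

lemma Ck_add: "Ck k f ==> Ck k g ==> Ck k (%x. f x + g x)"
proof (induction k arbitrary: f g)
 case (Suc k)
 have "((%x. f x + g x) has_derivative (%h. grad f x \<bullet> h + grad g x \<bullet> h)) (at x)" for x
  using has_derivative_add[OF Ck_has_derivative[OF Suc.prems(1)] Ck_has_derivative[OF Suc.prems(2)]] .
 then show ?case
  by (rule Ck_SucI) (use Suc in \<open>auto simp: grad_axis\<close>)
qed (auto intro: continuous_intros)

lemma Ck_mult: "Ck k f ==> Ck k g ==> Ck k (%x. f x * g x)"
proof (induction k arbitrary: f g)
 case (Suc k)
 have "((%x. f x * g x) has_derivative (%h. f x * (grad g x \<bullet> h) + (grad f x \<bullet> h) * g x)) (at x)" for x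
  using has_derivative_mult[OF Ck_has_derivative[OF Suc.prems(1)] Ck_has_derivative[OF Suc.prems(2)]] .
 then show ?case
  by (rule Ck_SucI)
   (use Suc in \<open>auto simp: grad_axis intro!: Ck_add Suc.IH Ck_Suc_imp[OF Suc.prems(1)] Ck_Suc_imp[OF Suc.prems(2)]\<close>)
qed (auto intro: continuous_intros)

lemma Ck_component: "Ck k (%x::real^'n. x $ i)"
proof (cases k)
 case (Suc j)
 have "((%x::real^'n. x $ i) has_derivative (%h. h $ i)) (at x)" for x
  by (rule bounded_linear_imp_has_derivative) (rule bounded_linear_vec_nth)
 from Ck_SucI[OF this, of j] show ?thesis unfolding Suc by (simp add: Ck_const)
qed (auto intro: continuous_intros)

lemma Ck_reflect: "Ck k f ==> Ck k (%y. f (x - y))"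
proof (induction k arbitrary: f)
 case 0
 then show ?case by (auto intro!: continuous_intros continuous_on_compose2[of UNIV f])
next
 case (Suc k)
 have "((%y. f (x - y)) has_derivative (%h. grad f (x - y) \<bullet> (- h))) (at y)" for y
  by (rule has_derivative_compose[OF _ Ck_has_derivative[OF Suc.prems]]) (auto intro!: derivative_eq_intros)
 then show ?case
 proof (rule Ck_SucI)
  show "Ck k (%y. grad f (x - y) \<bullet> - axis i 1)" for i
   using Ck_mult[OF Ck_const[of k "-1"] Suc.IH[of "pderiv f i"]] Suc.prems by (simp add: grad_axis)
 qed
qed

lemma pderiv_reflect:
 assumes "C1 f"
 shows "pderiv (%y. f (x - y)) i y = - pderiv f i (x - y)"
proof -
 have "((%y. f (x - y)) has_derivative (%h. grad f (x - y) \<bullet> (- h))) (at y)"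
  by (rule has_derivative_compose[OF _ C1D[OF assms]]) (auto intro!: derivative_eq_intros)
 from pderiv_eq[OF this, of i] show ?thesis by (simp add: grad_axis)
qed

text \<open>The family t^-m exp(-1/t), continued by 0 to t <= 0, is closed under differentiation up
  to linear combinations; this is why the index m is carried along. Composed with c - |x|^2 it gives
  bump functions.\<close>

definition flat :: "nat => real => real" where
 "flat m t = (if t > 0 then (1 / t) ^ m * exp (- (1 / t)) else 0)"

text \<open>With y = 1/t the term of index m + 2 of the exponential series gives y^(m+2) <= (m+2)!
  exp y. The two extra powers make \<open>flat m\<close> vanish to second order at 0, hence its
  derivative there is 0.\<close>

lemma flat_bound: "\<bar>flat m t\<bar> <= fact (m + 2) * t\<^sup>2"
proof (cases "t > 0")
 case True
 define y where "y = 1 / t"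
 have y: "y > 0" "t = 1 / y" using True by (auto simp: y_def)
 have "(\<Sum>k\<in>{m+2}. y ^ k /\<^sub>R fact k) <= (\<Sum>k. y ^ k /\<^sub>R fact k)"
  using y by (intro sum_le_suminf summable_exp_generic) auto
 then have "inverse (fact (m + 2)) * y ^ (m + 2) <= exp y" by (simp add: exp_def)
 then have "fact (m + 2) * (inverse (fact (m + 2)) * y ^ (m + 2)) <= fact (m + 2) * exp y"
  by (rule mult_left_mono) simp
 then have "y ^ m * y\<^sup>2 <= fact (m + 2) * exp y"
  by (simp add: mult.assoc[symmetric] power_add del: fact_Suc power_Suc add_2_eq_Suc')
 then have "y ^ m * y\<^sup>2 * (exp (- y) * t\<^sup>2) <= fact (m + 2) * exp y * (exp (- y) * t\<^sup>2)"
  by (rule mult_right_mono) simp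
 moreover have "y\<^sup>2 * t\<^sup>2 = 1" using y by (simp add: power2_eq_square)
 moreover have "exp y * exp (- y) = 1" by (simp add: exp_minus)
 ultimately have "y ^ m * exp (- y) <= fact (m + 2) * t\<^sup>2"
  by (metis (no_types, opaque_lifting) mult.assoc mult.commute mult.left_commute mult_1)
 then show ?thesis using True by (simp add: flat_def y_def)
qed (simp add: flat_def)

lemma flat_deriv:
 "(flat m has_real_derivative (- real m * flat (m + 1) t + flat (m + 2) t)) (at t)"
proof -
 consider "t > 0" | "t < 0" | "t = 0" by linarith
 then show ?thesis
 proof cases
  case 1
  have "((%t. (1 / t) ^ m * exp (- (1 / t))) has_real_derivative
    (- real m * flat (m + 1) t + flat (m + 2) t)) (at t)"
  proof -
   have "((%t. (1 / t) ^ m * exp (- (1 / t))) has_real_derivative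
    (real m * ((1 / t) ^ (m - 1) * (- (1 / t)\<^sup>2))) * exp (- (1 / t)) + (1 / t) ^ m * (exp (- (1 / t)) * (1 / t)^2)) (at t)"
    using 1 by (auto intro!: derivative_eq_intros simp: power2_eq_square divide_inverse)
   moreover have "(real m * ((1 / t) ^ (m - 1) * (- (1 / t)\<^sup>2))) * exp (- (1 / t)) + (1 / t) ^ m * (exp (- (1 / t)) * (1 / t)^2)
    = - real m * flat (m + 1) t + flat (m + 2) t"
   proof (cases m)
    case 0
    then show ?thesis using 1 by (simp add: flat_def power2_eq_square)
   next
    case (Suc k)
    have "(1 / t) ^ (m + 1) = (1 / t) ^ (m - 1) * (1 / t)^2" using Suc by (simp add: power2_eq_square)
    moreover have "(1 / t) ^ (m + 2) = (1 / t) ^ m * (1 / t)^2" by (rule power_add)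
    ultimately show ?thesis using 1 by (simp only: flat_def if_True) (simp add: algebra_simps)
   qed
   ultimately show ?thesis by simp
  qed
  then show ?thesis
   by (rule has_field_derivative_transform_within_open[of _ _ _ "{0<..}"]) (use 1 in \<open>auto simp: flat_def\<close>)
 next
  case 2
  have "((%t. 0) has_real_derivative (- real m * flat (m + 1) t + flat (m + 2) t)) (at t)"
   using 2 by (auto simp: flat_def)
  then show ?thesis
   by (rule has_field_derivative_transform_within_open[of _ _ _ "{..<0}"]) (use 2 in \<open>auto simp: flat_def\<close>)
 next
  case 3
  have "((%h. flat m h / h) \<longlongrightarrow> 0) (at 0)"
  proof (rule Lim_null_comparison)
   show "\<forall>\<^sub>F h in at 0. norm (flat m h / h) <= fact (m + 2) * \<bar>h\<bar>"
   proof (rule always_eventually, rule allI)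
    fix h :: real
    have "\<bar>flat m h\<bar> / \<bar>h\<bar> <= fact (m + 2) * h\<^sup>2 / \<bar>h\<bar>"
     by (intro divide_right_mono flat_bound) simp
    also have "\<dots> = fact (m + 2) * \<bar>h\<bar>"
     by (cases "h = 0") (auto simp: power2_eq_square abs_if simp del: fact_Suc)
    finally show "norm (flat m h / h) <= fact (m + 2) * \<bar>h\<bar>" by (simp add: abs_divide)
   qed
   show "((%h::real. fact (m + 2) * \<bar>h\<bar>) \<longlongrightarrow> 0) (at 0)"
    by (auto intro!: tendsto_eq_intros)
  qed
  then show ?thesis using 3 by (simp add: DERIV_def flat_def)
 qed
qed

text \<open>Induction on k with m arbitrary, because differentiation raises the index to m + 1 and m
  + 2.\<close>

lemma Ck_flat: "Ck k (%x::real^'n. flat m (c - x \<bullet> x))"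
proof (induction k arbitrary: m)
 case 0
 have "isCont (flat m) t" for t using flat_deriv DERIV_isCont by blast
 then have "continuous_on UNIV (flat m)" by (simp add: continuous_at_imp_continuous_on)
 then show ?case by (auto intro!: continuous_on_compose2[of UNIV "flat m"] continuous_intros)
next
 case (Suc k)
 have d: "((%x::real^'n. flat m (c - x \<bullet> x)) has_derivative
   (%h. (- real m * flat (m + 1) (c - x \<bullet> x) + flat (m + 2) (c - x \<bullet> x)) * (- (2 * (x \<bullet> h))))) (at x)" for x
  by (rule has_derivative_compose[OF _ flat_deriv[unfolded has_field_derivative_def]])
   (auto intro!: derivative_eq_intros simp: inner_commute)
 then show ?case
 proof (rule Ck_SucI)
  fix i
  have "Ck k (%x::real^'n. (- real m * flat (m + 1) (c - x \<bullet> x) + flat (m + 2) (c - x \<bullet> x)) * ((- 2) * x $ i))"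
   by (intro Ck_mult Ck_add Ck_const Ck_component Suc.IH)
  then show "Ck k (%x::real^'n. (- real m * flat (m + 1) (c - x \<bullet> x) + flat (m + 2) (c - x \<bullet> x)) *
    - (2 * (x \<bullet> axis i 1)))"
   by (simp add: inner_axis)
 qed
qed

text \<open>A mollifier of radius e. The mass is stated with the nonnegative integral, so that
  Tonelli's theorem applies to it directly.\<close>

definition kernel :: "real => (real^'n => real) => bool" where
 "kernel e \<rho> \<longleftrightarrow> smooth \<rho> & (ALL z. 0 <= \<rho> z) & (ALL z. e <= norm z --> \<rho> z = 0) &
  (NN z. ennreal (\<rho> z)) = 1"

lemma kernel_exists:
 assumes "e > 0"
 shows "EX \<rho>::real^'n => real. kernel e \<rho>"
proof -
 define b where "b = (%x::real^'n. flat 0 (e\<^sup>2 - x \<bullet> x))"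
 have b0: "0 <= b x" "b x <= 1" for x by (auto simp: b_def flat_def)
 have bz: "b x = 0 \<longleftrightarrow> e <= norm x" for x
 proof -
  have "e\<^sup>2 - x \<bullet> x > 0 \<longleftrightarrow> norm x < e"
   using assms power_strict_mono[of "norm x" e 2] power2_less_imp_less[of "norm x" e]
   by (auto simp: dot_square_norm)
  then show ?thesis by (auto simp: b_def flat_def)
 qed
 have bm [measurable]: "b : Borel"
  using Ck_flat[of 0 0 "e\<^sup>2"] by (auto simp: b_def intro: borel_measurable_continuous_onI)
 define c where "c = (NN z. ennreal (b z))"
 have "c <= (NN z. ind (cball (0::real^'n) e) z)"
  unfolding c_def by (intro nn_integral_mono) (use b0 bz in \<open>auto simp: indicator_def ennreal_le_1\<close>)
 also have "\<dots> < \<infinity>" using emeasure_lborel_cball_finite[of "0::real^'n" e] by simp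
 finally have cf: "c < \<infinity>" .
 have "c ~= 0"
 proof
  assume "c = 0"
  then have "AEL z. ennreal (b z) = 0"
   unfolding c_def by (subst (asm) nn_integral_0_iff_AE) auto
  then have "AEL z. z ~: ball (0::real^'n) e"
  proof eventually_elim
   fix z :: "real^'n" assume "ennreal (b z) = 0"
   then have "b z = 0" using b0(1)[of z] by (simp add: ennreal_eq_0_iff)
   then show "z ~: ball 0 e" using bz[of z] by simp
  qed
  then have "emeasure lborel (ball (0::real^'n) e) = 0"
   by (subst (asm) AE_iff_measurable[of "ball 0 e"]) auto
  then show False
   using content_ball_pos[of e "0::real^'n"] assms by (simp add: measure_def)
 qed
 then obtain r where r: "c = ennreal r" "r > 0"
  using cf by (cases c) (auto simp: ennreal_eq_0_iff not_le)
 have "smooth (%x. (1/r) * b x)"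
  unfolding smooth_def b_def by (intro allI Ck_mult Ck_const Ck_flat)
 moreover have "(NN z. ennreal ((1/r) * b z)) = 1"
 proof -
  have "(NN z. ennreal ((1/r) * b z)) = ennreal (1/r) * c"
  proof -
   have "(NN z. ennreal ((1/r) * b z)) = (NN z. ennreal (1/r) * ennreal (b z))"
    using r by (intro nn_integral_cong) (simp add: ennreal_mult'[symmetric])
   then show ?thesis by (simp add: nn_integral_cmult c_def)
  qed
  also have "\<dots> = 1" using r by (simp add: ennreal_mult'[symmetric])
  finally show ?thesis .
 qed
 ultimately have "kernel e (%x. (1/r) * b x)"
  using b0 bz r by (auto simp: kernel_def)
 then show ?thesis by blast
qed

lemma kernel_Ck: "kernel e \<rho> ==> Ck k \<rho>"
 by (simp add: kernel_def smooth_def)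

lemma kernel_C1: "kernel e \<rho> ==> C1 \<rho>"
 using kernel_Ck Ck_C1 by blast

lemma kernel_zero: "kernel e \<rho> ==> ALL z. z ~: cball 0 e --> \<rho> z = 0"
 by (auto simp: kernel_def)

lemma test_funI:
 assumes "smooth \<phi>" "!!y. y ~: K ==> \<phi> y = 0" "compact K" "K <= U"
 shows "test_fun U \<phi>"
proof -
 have "closure {x. \<phi> x ~= 0} <= K"
  using assms by (intro closure_minimal) (auto intro: compact_imp_closed)
 then show ?thesis
  unfolding test_fun_def using assms
  by (meson bounded_subset closed_closure compact_eq_bounded_closed order_trans)
qed

lemma kernel_test_fun:
 assumes "kernel e \<rho>" "cball x e <= U"
 shows "test_fun U (%y. \<rho> (x - y))"
proof (rule test_funI)
 show "smooth (%y. \<rho> (x - y))"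
  using assms by (auto simp: smooth_def intro: Ck_reflect kernel_Ck)
 show "\<rho> (x - y) = 0" if "y ~: cball x e" for y
  using that assms(1) by (auto simp: kernel_def dist_norm)
qed (use assms in auto)

subsection \<open>Convolution\<close>

definition conv :: "(real^'n => real) => (real^'n => real) => real^'n => real" where
 "conv \<kappa> f x = (LBINT y. \<kappa> (x - y) * f y)"

lemma uniformly_continuous_compact_support:
 fixes f :: "'a::euclidean_space => 'b::real_normed_vector"
 assumes "continuous_on UNIV f" "ALL z. z ~: cball 0 e --> f z = 0"
 shows "uniformly_continuous_on UNIV f"
 unfolding uniformly_continuous_on_def
proof (intro allI impI)
 fix \<epsilon> :: real assume "\<epsilon> > 0"
 have "uniformly_continuous_on (cball 0 (e + 1)) f"
  using assms by (intro compact_uniformly_continuous) (auto intro: continuous_on_subset)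
 then obtain d where d: "d > 0" "!!x y. x : cball 0 (e+1) ==> y : cball 0 (e+1) ==> dist x y < d ==> dist (f x) (f y) < \<epsilon>"
  using \<open>\<epsilon> > 0\<close> unfolding uniformly_continuous_on_def by metis
 have "dist (f y) (f x) < \<epsilon>" if "dist y x < min d 1" for x y
 proof (cases "x : cball 0 e \<or> y : cball 0 e")
  case True
  have "norm x <= norm y + dist y x" "norm y <= norm x + dist y x"
   by (metis dist_commute dist_norm norm_triangle_sub)+
  then show ?thesis using True that by (intro d) auto
 next
  case False
  then show ?thesis using assms(2) \<open>\<epsilon> > 0\<close> by simp
 qed
 then show "EX d>0. ALL x:UNIV. ALL y:UNIV. dist y x < d --> dist (f y) (f x) < \<epsilon>"
  using d(1) by (intro exI[of _ "min d 1"]) auto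
qed

lemma bounded_compact_support:
 fixes f :: "'a::euclidean_space => 'b::real_normed_vector"
 assumes "continuous_on UNIV f" "ALL z. z ~: K --> f z = 0" "compact K"
 shows "EX B>0. ALL z. norm (f z) <= B"
proof -
 have "bounded (f ` K)"
  using assms by (intro compact_imp_bounded compact_continuous_image) (auto intro: continuous_on_subset)
 then obtain B where "B > 0" "!!z. z : K ==> norm (f z) <= B" by (auto simp: bounded_pos)
 then show ?thesis using assms(2) by (metis less_imp_le norm_zero)
qed

lemma conv_integrable:
 fixes \<kappa> f :: "real^'n => real"
 assumes "continuous_on UNIV \<kappa>" "ALL z. z ~: cball 0 e --> \<kappa> z = 0" "integrable lborel f"
 shows "integrable lborel (%y. \<kappa> (x - y) * f y)"
proof -
 obtain B where B: "!!z. norm (\<kappa> z) <= B"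
  using bounded_compact_support[OF assms(1,2) compact_cball] by auto
 have [measurable]: "f : Borel" using assms(3) by auto
 have "continuous_on UNIV (%y. \<kappa> (x - y))"
  by (intro continuous_on_compose2[OF assms(1)] continuous_intros) auto
 then have [measurable]: "(%y. \<kappa> (x - y)) : Borel"
  by (rule borel_measurable_continuous_onI)
 show ?thesis
 proof (rule Bochner_Integration.integrable_bound)
  show "integrable lborel (%y. B * f y)" using assms(3) by simp
  show "AEL y. norm (\<kappa> (x - y) * f y) <= norm (B * f y)"
   using order_trans[OF B abs_ge_self] by (auto simp: abs_mult intro!: mult_right_mono)
 qed measurable
qed

lemma conv_continuous:
 assumes "continuous_on UNIV \<kappa>" "ALL z. z ~: cball 0 e --> \<kappa> z = 0" "integrable lborel f"
 shows "continuous_on UNIV (conv \<kappa> f)"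
proof -
 define J where "J = (LBINT y. \<bar>f y\<bar>) + 1"
 have J: "J > 0" unfolding J_def by (simp add: add_nonneg_pos)
 have uc: "uniformly_continuous_on UNIV \<kappa>" by (rule uniformly_continuous_compact_support[OF assms(1,2)])
 have "uniformly_continuous_on UNIV (conv \<kappa> f)"
  unfolding uniformly_continuous_on_def
 proof (intro allI impI)
  fix \<epsilon> :: real assume "\<epsilon> > 0"
  then obtain d where d: "d > 0" "!!a b. dist a b < d ==> dist (\<kappa> a) (\<kappa> b) < \<epsilon> / J"
   using uc J unfolding uniformly_continuous_on_def by (metis UNIV_I zero_less_divide_iff)
  have "dist (conv \<kappa> f a) (conv \<kappa> f b) < \<epsilon>" if ab: "dist a b < d" for a b
  proof -
   have "conv \<kappa> f a - conv \<kappa> f b = (LBINT y. \<kappa> (a - y) * f y - \<kappa> (b - y) * f y)"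
    unfolding conv_def by (subst Bochner_Integration.integral_diff) (auto intro: conv_integrable[OF assms])
   also have "\<bar>\<dots>\<bar> <= (LBINT y. (\<epsilon> / J) * \<bar>f y\<bar>)"
   proof (rule integral_abs_bound_integral)
    show "integrable lborel (%y. \<kappa> (a - y) * f y - \<kappa> (b - y) * f y)"
     by (intro Bochner_Integration.integrable_diff conv_integrable[OF assms])
    show "\<bar>\<kappa> (a - y) * f y - \<kappa> (b - y) * f y\<bar> <= (\<epsilon> / J) * \<bar>f y\<bar>" for y
    proof -
     have "\<bar>\<kappa> (a - y) - \<kappa> (b - y)\<bar> <= \<epsilon> / J"
      using d(2)[of "a - y" "b - y"] ab by (simp add: dist_norm)
     from mult_right_mono[OF this abs_ge_zero[of "f y"]] show ?thesis
      by (simp add: abs_mult[symmetric] left_diff_distrib)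
    qed
   qed (use assms(3) in auto)
   also have "\<dots> = (\<epsilon> / J) * (LBINT y. \<bar>f y\<bar>)" by simp
   also have "\<dots> < (\<epsilon> / J) * J" using \<open>\<epsilon> > 0\<close> J by (intro mult_strict_left_mono) (auto simp: J_def)
   finally show ?thesis using J by (simp add: dist_real_def)
  qed
  then show "EX d>0. ALL x:UNIV. ALL y:UNIV. dist y x < d --> dist (conv \<kappa> f y) (conv \<kappa> f x) < \<epsilon>"
   using d(1) by blast
 qed
 then show ?thesis by (rule uniformly_continuous_imp_continuous)
qed

lemma C1_linearization:
 assumes "C1 \<kappa>" "!!b. norm (b - a) <= norm h ==> norm (grad \<kappa> b - grad \<kappa> a) <= w"
 shows "\<bar>\<kappa> (a + h) - \<kappa> a - grad \<kappa> a \<bullet> h\<bar> <= norm h * w"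
proof -
 have "norm (\<kappa> (a + h) - \<kappa> a - grad \<kappa> a \<bullet> (a + h - a)) <= norm (a + h - a) * w"
 proof (rule differentiable_bound_linearization[where S="cball a (norm h)" and f'="%x h. grad \<kappa> x \<bullet> h"])
  show "a + t *. (a + h - a) : cball a (norm h)" if "t : {0..1}" for t
   using that by (auto simp: dist_norm mult_left_le_one_le)
  show "(\<kappa> has_derivative (%h. grad \<kappa> x \<bullet> h)) (at x within cball a (norm h))" for x
   using C1D[OF assms(1)] has_derivative_at_withinI by blast
  show "onorm ((%i. grad \<kappa> x \<bullet> i) - (%i. grad \<kappa> a \<bullet> i)) <= w" if "x : cball a (norm h)" for x
   unfolding fun_diff_def
  proof (rule onorm_le)
   fix i
   have "norm (grad \<kappa> x \<bullet> i - grad \<kappa> a \<bullet> i) = \<bar>(grad \<kappa> x - grad \<kappa> a) \<bullet> i\<bar>"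
    by (simp add: inner_diff_left)
   also have "\<dots> <= norm (grad \<kappa> x - grad \<kappa> a) * norm i" by (rule Cauchy_Schwarz_ineq2)
   also have "\<dots> <= w * norm i"
    using that by (intro mult_right_mono assms(2)) (auto simp: dist_norm norm_minus_commute)
   finally show "norm (grad \<kappa> x \<bullet> i - grad \<kappa> a \<bullet> i) <= w * norm i" .
  qed
 qed auto
 then show ?thesis by simp
qed

text \<open>The first order error of \<kappa> is at most |h| times the modulus of continuity of its
  gradient, uniformly in the point, so it can be integrated against |f|.\<close>

lemma conv_has_derivative:
 assumes "C1 \<kappa>" "ALL z. z ~: cball 0 e --> \<kappa> z = 0" "integrable lborel f"
 shows "(conv \<kappa> f has_derivative (%h. (\<Sum>i\<in>UNIV. h $ i * conv (pderiv \<kappa> i) f x))) (at x)"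
proof -
 define J where "J = (LBINT y. \<bar>f y\<bar>) + 1"
 have J: "J > 0" unfolding J_def by (simp add: add_nonneg_pos)
 have gz: "ALL z. z ~: cball 0 e --> grad \<kappa> z = 0"
  using grad_zero_outside[of "cball 0 e" \<kappa>] assms(2) by auto
 have pz: "ALL z. z ~: cball 0 e --> pderiv \<kappa> i z = 0" for i
  using gz by (simp add: grad_def vec_eq_iff)
 have pc: "continuous_on UNIV (pderiv \<kappa> i)" for i
 proof -
  have "continuous_on UNIV (%x. grad \<kappa> x $ i)"
   by (intro continuous_intros C1_continuous_grad assms)
  then show ?thesis by (simp add: grad_def)
 qed
 have uc: "uniformly_continuous_on UNIV (grad \<kappa>)"
  by (rule uniformly_continuous_compact_support[OF C1_continuous_grad[OF assms(1)] gz])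
 note int = conv_integrable[OF C1_continuous[OF assms(1)] assms(2,3)]
  conv_integrable[OF pc pz assms(3)]
 show ?thesis
  unfolding has_derivative_at_alt
 proof (intro conjI allI impI)
  show "bounded_linear (%h. \<Sum>i\<in>UNIV. h $ i * conv (pderiv \<kappa> i) f x)"
   by (intro bounded_linear_sum bounded_linear_mult_left[THEN bounded_linear_compose] bounded_linear_vec_nth)
  fix \<epsilon> :: real assume "\<epsilon> > 0"
  then obtain d where d: "d > 0" "!!a b. dist a b < d ==> dist (grad \<kappa> a) (grad \<kappa> b) < \<epsilon> / J"
   using uc J unfolding uniformly_continuous_on_def by (metis UNIV_I zero_less_divide_iff)
  have "norm (conv \<kappa> f y - conv \<kappa> f x - (\<Sum>i\<in>UNIV. (y - x) $ i * conv (pderiv \<kappa> i) f x)) <= \<epsilon> * norm (y - x)"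
   if yd: "norm (y - x) < d" for y
  proof -
   define h where "h = y - x"
   have lin: "\<bar>\<kappa> (x - z + h) - \<kappa> (x - z) - grad \<kappa> (x - z) \<bullet> h\<bar> <= norm h * (\<epsilon> / J)" for z
    by (rule C1_linearization[OF assms(1)])
     (use d(2) yd in \<open>force simp: h_def dist_norm intro!: less_imp_le\<close>)
   have "conv \<kappa> f y - conv \<kappa> f x - (\<Sum>i\<in>UNIV. h $ i * conv (pderiv \<kappa> i) f x)
    = (LBINT z. \<kappa> (y - z) * f z - \<kappa> (x - z) * f z - (\<Sum>i\<in>UNIV. h $ i * (pderiv \<kappa> i (x - z) * f z)))"
    unfolding conv_def using int
    by (simp add: Bochner_Integration.integral_diff Bochner_Integration.integral_sum)
   also have "\<dots> = (LBINT z. (\<kappa> (x - z + h) - \<kappa> (x - z) - grad \<kappa> (x - z) \<bullet> h) * f z)"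
    by (intro Bochner_Integration.integral_cong)
     (auto simp: h_def vec_inner_axis_sum grad_def algebra_simps sum_distrib_left sum_subtractf)
   also have "\<bar>\<dots>\<bar> <= (LBINT z. (norm h * (\<epsilon> / J)) * \<bar>f z\<bar>)"
   proof (rule integral_abs_bound_integral)
    have "integrable lborel (%z. \<kappa> (y - z) * f z - \<kappa> (x - z) * f z - (\<Sum>i\<in>UNIV. h $ i * (pderiv \<kappa> i (x - z) * f z)))"
     using int by (intro Bochner_Integration.integrable_diff Bochner_Integration.integrable_sum
      Bochner_Integration.integrable_mult_right) auto
    then show "integrable lborel (%z. (\<kappa> (x - z + h) - \<kappa> (x - z) - grad \<kappa> (x - z) \<bullet> h) * f z)"
     by (rule Bochner_Integration.integrable_cong[THEN iffD1, rotated 2])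
      (auto simp: h_def vec_inner_axis_sum grad_def algebra_simps sum_distrib_left sum_subtractf)
    show "\<bar>(\<kappa> (x - z + h) - \<kappa> (x - z) - grad \<kappa> (x - z) \<bullet> h) * f z\<bar> <= (norm h * (\<epsilon> / J)) * \<bar>f z\<bar>" for z
     unfolding abs_mult by (rule mult_right_mono[OF lin abs_ge_zero])
   qed (use assms(3) in auto)
   also have "\<dots> = (norm h * (\<epsilon> / J)) * (LBINT y. \<bar>f y\<bar>)" by simp
   also have "\<dots> <= (norm h * (\<epsilon> / J)) * J" using \<open>\<epsilon> > 0\<close> J by (intro mult_left_mono) (auto simp: J_def)
   finally show ?thesis using J by (simp add: h_def mult.commute)
  qed
  then show "EX d>0. ALL y. norm (y - x) < d --> norm (conv \<kappa> f y - conv \<kappa> f x - (\<Sum>i\<in>UNIV. (y - x) $ i * conv (pderiv \<kappa> i) f x)) <= \<epsilon> * norm (y - x)"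
   using d(1) by blast
 qed
qed

lemma conv_pderiv:
 assumes "C1 \<kappa>" "ALL z. z ~: cball 0 e --> \<kappa> z = 0" "integrable lborel f"
 shows "pderiv (conv \<kappa> f) i x = conv (pderiv \<kappa> i) f x"
 using pderiv_eq[OF conv_has_derivative[OF assms, of x], of i]
 by (simp add: axis_def if_distrib[of "%t. t * _"] cong: if_cong)

lemma conv_Ck:
 assumes "Ck k \<kappa>" "ALL z. z ~: cball 0 e --> \<kappa> z = 0" "integrable lborel f"
 shows "Ck k (conv \<kappa> f)"
 using assms(1,2)
proof (induction k arbitrary: \<kappa>)
 case 0
 then show ?case using conv_continuous[OF _ 0(2) assms(3)] by simp
next
 case (Suc k)
 have C: "C1 \<kappa>" using Suc.prems Ck_C1 by blast
 have "pderiv (conv \<kappa> f) i = conv (pderiv \<kappa> i) f" for i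
  using conv_pderiv[OF C Suc.prems(2) assms(3)] by blast
 moreover have "ALL z. z ~: cball 0 e --> pderiv \<kappa> i z = 0" for i
  using pderiv_zero_outside[of "cball 0 e" \<kappa>] Suc.prems(2) by auto
 ultimately have "Ck k (pderiv (conv \<kappa> f) i)" for i
  using Suc.IH[of "pderiv \<kappa> i"] Suc.prems(1) by simp
 then show ?case
  using conv_has_derivative[OF C Suc.prems(2) assms(3)] by (auto simp: differentiable_def)
qed

lemma conv_kernel_smooth:
 assumes "kernel e \<rho>" "integrable lborel f"
 shows "smooth (conv \<rho> f)"
 unfolding smooth_def using conv_Ck[OF kernel_Ck[OF assms(1)] kernel_zero[OF assms(1)] assms(2)] by blast

subsection \<open>Square integrals\<close>

lemma ennreal_tendsto_0I:
 fixes X :: "'a => ennreal"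
 assumes "!!e::real. e > 0 ==> \<forall>\<^sub>F n in F. X n <= ennreal e"
 shows "(X \<longlongrightarrow> 0) F"
proof (rule order_tendstoI)
 fix a :: ennreal assume "0 < a"
 then obtain b where b: "0 < b" "b < a" using dense by blast
 then obtain r where r: "b = ennreal r" "r > 0" by (cases b) (auto simp: top_unique)
 from assms[OF r(2)] show "\<forall>\<^sub>F n in F. X n < a"
  by eventually_elim (use b r in auto)
qed simp

lemma ennreal_tendsto_0D:
 fixes X :: "'a => ennreal"
 assumes "(X \<longlongrightarrow> 0) F" "e > 0"
 shows "\<forall>\<^sub>F n in F. X n < ennreal e"
 using order_tendstoD(2)[OF assms(1), of "ennreal e"] assms(2) by simp

lemma ennreal_tendsto_0_le:
 fixes X :: "'a => ennreal"
 assumes "(X \<longlongrightarrow> 0) F" "!!n. Y n <= X n"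
 shows "(Y \<longlongrightarrow> 0) F"
 by (rule tendsto_sandwich[OF _ _ tendsto_const assms(1)]) (auto simp: assms(2))

lemma ennreal_tendsto_0_lincomb:
 fixes X Y :: "'a => ennreal"
 assumes "(X \<longlongrightarrow> 0) F" "(Y \<longlongrightarrow> 0) F" "a < \<infinity>" "b < \<infinity>"
 shows "((%n. a * X n + b * Y n) \<longlongrightarrow> 0) F"
 using tendsto_add[OF ennreal_tendsto_cmult[OF _ assms(1), of a] ennreal_tendsto_cmult[OF _ assms(2), of b]] assms(3,4)
 by simp

text \<open>\<open>L2 S f\<close> is the square of the \<open>L\<^sup>2(S)\<close> norm.\<close>

definition L2 :: "'a::euclidean_space set => ('a => 'b::real_normed_vector) => ennreal" where
 "L2 S f = (NN x. ennreal ((norm (f x))^2) * ind S x)"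

lemma L2_mono_set: "S <= T ==> L2 S f <= L2 T f"
 unfolding L2_def by (intro nn_integral_mono mult_left_mono) (auto simp: indicator_def)

lemma L2_mono:
 assumes "!!x. x : S ==> norm (f x) <= norm (g x)"
 shows "L2 S f <= L2 S g"
 unfolding L2_def
 by (intro nn_integral_mono) (auto simp: indicator_def assms intro!: ennreal_leI power_mono)

lemma L2_cong_AE:
 assumes "AE x\<in>S in lborel. norm (f x) = norm (g x)"
 shows "L2 S f = L2 S g"
 unfolding L2_def
 by (intro nn_integral_cong_AE, use assms in eventually_elim) (auto simp: indicator_def)

lemma L2_minus_commute: "L2 S (%x. f x - g x) = L2 S (%x. g x - f x)"
 by (simp add: L2_def norm_minus_commute)

lemma norm_add_square_le:
 "(norm (a + b))^2 <= 2 * (norm a)^2 + 2 * (norm (b::'a::real_normed_vector))^2"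
proof -
 have "(norm (a + b))^2 <= (norm a + norm b)^2"
  by (intro power_mono norm_triangle_ineq) simp
 also have "\<dots> <= 2 * (norm a)^2 + 2 * (norm b)^2"
  using sum_squares_bound[of "norm a" "norm b"] by (simp add: power2_sum)
 finally show ?thesis .
qed

lemma L2_add:
 fixes f g :: "'a::euclidean_space => 'b::euclidean_space"
 assumes [measurable]: "f : Borel" "g : Borel" "S : sets borel"
 shows "L2 S (%x. f x + g x) <= 2 * L2 S f + 2 * L2 S g"
proof -
 have "L2 S (%x. f x + g x) <= (NN x. 2 * (ennreal ((norm (f x))^2) * ind S x) + 2 * (ennreal ((norm (g x))^2) * ind S x))"
  unfolding L2_def
 proof (intro nn_integral_mono)
  fix x
  have "ennreal ((norm (f x + g x))^2) <= ennreal (2 * (norm (f x))^2 + 2 * (norm (g x))^2)"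
   by (intro ennreal_leI norm_add_square_le)
  also have "\<dots> = 2 * ennreal ((norm (f x))^2) + 2 * ennreal ((norm (g x))^2)"
   by (simp add: ennreal_plus ennreal_mult' ennreal_numeral)
  finally show "ennreal ((norm (f x + g x))^2) * ind S x <=
    2 * (ennreal ((norm (f x))^2) * ind S x) + 2 * (ennreal ((norm (g x))^2) * ind S x)"
   by (auto simp: indicator_def)
 qed
 also have "\<dots> = 2 * L2 S f + 2 * L2 S g"
  unfolding L2_def by (subst nn_integral_add) (auto simp: nn_integral_cmult)
 finally show ?thesis .
qed

lemma L2_triangle:
 fixes f g h :: "'a::euclidean_space => 'b::euclidean_space"
 assumes "f : Borel" "g : Borel" "h : Borel" "S : sets borel"
 shows "L2 S (%x. f x - h x) <= 2 * L2 S (%x. f x - g x) + 2 * L2 S (%x. g x - h x)"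
 using L2_add[of "%x. f x - g x" "%x. g x - h x" S] assms by simp

lemma L2_bound_mult:
 fixes f :: "'a::euclidean_space => 'b::euclidean_space"
 assumes [measurable]: "f : Borel" "S : sets borel"
  and "!!x. x : S ==> norm (h x) <= M * norm (f x)" "0 <= M"
 shows "L2 S h <= ennreal (M\<^sup>2) * L2 S f"
proof -
 have "L2 S h <= (NN x. ennreal (M\<^sup>2) * (ennreal ((norm (f x))^2) * ind S x))"
  unfolding L2_def
 proof (intro nn_integral_mono)
  fix x
  show "ennreal ((norm (h x))^2) * ind S x <= ennreal (M\<^sup>2) * (ennreal ((norm (f x))^2) * ind S x)"
   using power_mono[OF assms(3)[of x], of 2] assms(4)
   by (auto simp: indicator_def power_mult_distrib ennreal_mult'[symmetric] intro!: ennreal_leI)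
 qed
 also have "\<dots> = ennreal (M\<^sup>2) * L2 S f"
  unfolding L2_def by (subst nn_integral_cmult) auto
 finally show ?thesis .
qed

lemma L2_bounded:
 assumes "!!x. x : S ==> norm (h x) <= M" "0 <= M" and [measurable]: "S : sets borel"
 shows "L2 S h <= ennreal (M\<^sup>2) * emeasure lborel S"
proof -
 have "L2 S h <= (NN x. ennreal (M\<^sup>2) * ind S x)"
  unfolding L2_def
  by (intro nn_integral_mono) (auto simp: indicator_def intro!: ennreal_leI power_mono assms)
 also have "\<dots> = ennreal (M\<^sup>2) * emeasure lborel S" by (subst nn_integral_cmult) auto
 finally show ?thesis .
qed

lemma L2_finite_if_close:
 fixes f g :: "'a::euclidean_space => 'b::euclidean_space"
 assumes "f : Borel" "g : Borel" "S : sets borel"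
  "L2 S (%x. f x - g x) < \<infinity>" "L2 S f < \<infinity>"
 shows "L2 S g < \<infinity>"
proof -
 have "L2 S g <= 2 * L2 S f + 2 * L2 S (%x. g x - f x)"
  using L2_add[of f "%x. g x - f x" S] assms by simp
 also have "\<dots> < \<infinity>" using assms by (simp add: L2_minus_commute[of S g f] ennreal_mult_less_top)
 finally show ?thesis .
qed

lemma L2_dominated:
 fixes f :: "nat => 'a::euclidean_space => 'b::euclidean_space"
 assumes [measurable]: "!!j. f j : Borel" "h : Borel" "S : sets borel"
  and bd: "!!j x. x : S ==> norm (f j x) <= norm (h x)" and fin: "L2 S h < \<infinity>"
  and lim: "AE x\<in>S in lborel. (%j. f j x) ---> 0"
 shows "(%j. L2 S (f j)) ---> 0"
proof -
 have "(%j. NN x. ennreal ((norm (f j x))^2) * ind S x) ---> (\<integral>\<^sup>+x. 0 \<partial>(lborel :: 'a measure))"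
 proof (rule nn_integral_dominated_convergence[where w="%x. ennreal ((norm (h x))^2) * ind S x"])
  show "AEL x. ennreal ((norm (f j x))^2) * ind S x <= ennreal ((norm (h x))^2) * ind S x" for j
   by (auto simp: indicator_def intro!: ennreal_leI power_mono bd)
  show "(NN x. ennreal ((norm (h x))^2) * ind S x) < \<infinity>" using fin by (simp add: L2_def)
  show "AEL x. (%i. ennreal ((norm (f i x))^2) * ind S x) ---> 0"
   using lim
  proof eventually_elim
   fix x assume *: "x : S --> (%j. f j x) ---> 0"
   show "(%i. ennreal ((norm (f i x))^2) * ind S x) ---> 0"
   proof (cases "x : S")
    case True
    then have "(%i. (norm (f i x))^2) ---> 0"
     using * by (auto intro!: tendsto_eq_intros)
    then have "(%i. ennreal ((norm (f i x))^2)) ---> ennreal 0" by (rule tendsto_ennrealI)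
    then show ?thesis using True by simp
   qed simp
  qed
 qed measurable
 then show ?thesis by (simp add: L2_def)
qed

lemma L2_AE_subseq:
 fixes f :: "nat => 'a::euclidean_space => 'b::euclidean_space"
 assumes [measurable]: "!!j. f j : Borel" "S : sets borel"
  and lim: "(%j. L2 S (f j)) ---> 0"
 shows "EX r::nat => nat. strict_mono r & (AE x\<in>S in lborel. (%j. f (r j) x) ---> 0)"
proof -
 obtain N where N: "!!j. j \<ge> N ==> L2 S (f j) < 1"
  using ennreal_tendsto_0D[OF lim, of 1] by (auto simp: eventually_sequentially)
 define q where "q = (%j x. (norm (f (j + N) x))^2 * ind S x :: real)"
 have [measurable]: "q j : Borel" for j unfolding q_def by measurable
 have qn: "0 <= q j x" for j x by (simp add: q_def)
 have qL: "(NN x. ennreal (q j x)) = L2 S (f (j + N))" for j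
  unfolding L2_def q_def by (intro nn_integral_cong) (auto simp: indicator_def)
 have int: "integrable lborel (q j)" for j
  using N[of "j + N"] qL[of j] qn
  by (intro integrableI_nonneg) (auto intro: order_less_trans[OF _ ennreal_one_less_top])
 have "(%j. ennreal (LBINT x. norm (q j x))) ---> ennreal 0"
 proof -
  have "ennreal (LBINT x. norm (q j x)) = L2 S (f (j + N))" for j
   using nn_integral_eq_integral[OF int[of j]] qn qL[of j] by simp
  then show ?thesis using LIMSEQ_ignore_initial_segment[OF lim, of N] by simp
 qed
 then have "(%j. (LBINT x. norm (q j x))) ---> 0"
  by (subst (asm) tendsto_ennreal_iff) auto
 from tendsto_L1_AE_subseq[OF int this] obtain r where r: "strict_mono r" "AEL x. (%n. q (r n) x) ---> 0"
  by blast
 have "AE x\<in>S in lborel. (%j. f (r j + N) x) ---> 0"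
  using r(2)
 proof eventually_elim
  fix x assume *: "(%n. q (r n) x) ---> 0"
  show "x : S --> (%j. f (r j + N) x) ---> 0"
  proof
   assume "x : S"
   then have "(%n. sqrt (q (r n) x)) ---> sqrt 0" using * by (intro tendsto_real_sqrt)
   moreover have "sqrt (q (r n) x) = norm (f (r n + N) x)" for n using \<open>x : S\<close> by (simp add: q_def)
   ultimately show "(%j. f (r j + N) x) ---> 0"
    by (simp add: tendsto_norm_zero_iff)
  qed
 qed
 then show ?thesis
  using r(1) by (intro exI[of _ "%j. r j + N"]) (auto simp: strict_mono_def)
qed

subsection \<open>Translations and mollification\<close>

lemma nn_integral_affine:
 fixes f :: "'a::euclidean_space => ennreal"
 assumes [measurable]: "f : Borel" and "c ~= 0"
 shows "(NN x. f x) = ennreal (\<bar>c\<bar> ^ DIM('a)) * (NN x. f (t + c *. x))"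
 by (subst lborel_affine[OF assms(2), of t])
  (simp add: nn_integral_density nn_integral_distr nn_integral_cmult)

lemma nn_integral_shift:
 fixes f :: "'a::euclidean_space => ennreal"
 assumes "f : Borel"
 shows "(NN x. f (x + h)) = (NN x. f x)"
 using nn_integral_affine[OF assms, of 1 h] by (simp add: add.commute)

text \<open>A point of an open set stays in it under small shifts, so the integrand tends to 0 at
  every point. For a general measurable set this can fail pointwise, which is why indicators are
  later compared with those of open supersets.\<close>

lemma shift_open_tendsto:
 fixes U :: "'a::euclidean_space set"
 assumes "open U" and fin: "emeasure lborel U < \<infinity>" and h: "h ---> 0"
 shows "(%n. NN x. ind U x * (1 - ind U (x + h n))) ---> 0"
proof -
 have [measurable]: "U : sets borel" using assms by auto
 have "(%n. NN x. ind U x * (1 - ind U (x + h n))) ---> (\<integral>\<^sup>+x. 0 \<partial>(lborel :: 'a measure))"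
 proof (rule nn_integral_dominated_convergence[where w="ind U"])
  show "AEL x. (%n. ind U x * (1 - ind U (x + h n)) :: ennreal) ---> 0"
  proof (rule AE_I2)
   fix x
   show "(%n. ind U x * (1 - ind U (x + h n)) :: ennreal) ---> 0"
   proof (cases "x : U")
    case True
    have "(%n. x + h n) ---> x" using h by (auto intro!: tendsto_eq_intros)
    then have "\<forall>\<^sub>F n in sequentially. x + h n : U"
     using topological_tendstoD True assms(1) by blast
    then have "\<forall>\<^sub>F n in sequentially. (ind U x * (1 - ind U (x + h n)) :: ennreal) = 0"
     by eventually_elim simp
    then show ?thesis by (rule tendsto_eventually)
   qed simp
  qed
  show "(NN x. ind U x) < \<infinity>" using fin by simp
 qed (auto simp: indicator_def)
 then show ?thesis by simp
qed

text \<open>Induction over integrable functions. For an indicator, outer regularity gives an open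
  superset with small excess, whose shifts are controlled in both directions; sums and limits follow
  from the triangle inequality and translation invariance.\<close>

lemma shift_L1_tendsto:
 fixes f :: "'a::euclidean_space => real"
 assumes "integrable lborel f" and h: "h ---> 0"
 shows "(%n. NN x. ennreal \<bar>f (x + h n) - f x\<bar>) ---> 0"
 using assms(1)
proof (induction rule: integrable_induct)
 case (base A c)
 then have [measurable]: "A : sets borel" by simp
 show ?case
 proof (rule ennreal_tendsto_0I)
  fix e :: real assume "e > 0"
  define d where "d = e / (4 * (\<bar>c\<bar> + 1))"
  have d: "d > 0" "\<bar>c\<bar> * (4 * d) <= e" using \<open>e > 0\<close> by (auto simp: d_def field_simps)
  obtain U where U: "open U" "A <= U" "emeasure lebesgue (U - A) < ennreal d"
   by (rule sets_lebesgue_outer_open[of A d]) (use d base in auto)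
  have [measurable]: "U : sets borel" using U by auto
  have UA: "emeasure lborel (U - A) < ennreal d" using U(3) by simp
  have "emeasure lborel U <= emeasure lborel A + emeasure lborel (U - A)"
   using emeasure_subadditive[of A lborel "U - A"] U(2) by (simp add: Un_absorb1)
  also have "\<dots> < \<infinity>" using base UA by (simp add: less_top[symmetric]) (metis ennreal_less_top less_trans order_less_irrefl)
  finally have Uf: "emeasure lborel U < \<infinity>" .
  define P where "P n = (NN x. ind U x * (1 - ind U (x + h n)))" for n
  define N where "N n = (NN x. ind U x * (1 - ind U (x + - h n)))" for n
  have P: "P ---> 0" unfolding P_def using shift_open_tendsto[OF U(1) Uf h] .
  have N: "N ---> 0" unfolding N_def
   using shift_open_tendsto[OF U(1) Uf, of "%n. - h n"] tendsto_minus[OF h] by simp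
  \<comment> \<open>Two points are separated by A only if they are separated by U, in one direction
    or the other, or if one of them lies in the excess U - A. These four cases account for the 4 in
    the choice of d.\<close>
  have bound: "(NN x. ennreal \<bar>ind A (x + h n) *. c - ind A x *. c\<bar>)
    <= ennreal \<bar>c\<bar> * (P n + N n + 2 * ennreal d)" for n
  proof -
   have "(NN x. ennreal \<bar>ind A (x + h n) *. c - ind A x *. c\<bar>)
    <= (NN x. ennreal \<bar>c\<bar> * (ind U x * (1 - ind U (x + h n))
      + ind U (x + h n) * (1 - ind U x) + ind (U - A) (x + h n) + ind (U - A) x))"
    using U(2) by (intro nn_integral_mono) (auto simp: indicator_def)
   also have "\<dots> = ennreal \<bar>c\<bar> * (P n + (NN x. ind U (x + h n) * (1 - ind U x))
     + (NN x. ind (U - A) (x + h n)) + (NN x. ind (U - A) x))"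
    unfolding P_def by (simp add: nn_integral_cmult nn_integral_add)
   also have "(NN x. ind (U - A) (x + h n)) = emeasure lborel (U - A)"
    by (subst nn_integral_shift[of "ind (U - A)"]) auto
   also have "(NN x. ind U (x + h n) * (1 - ind U x)) = N n"
    unfolding N_def using nn_integral_shift[of "%x. ind U x * (1 - ind U (x + - h n))" "h n"] by simp
   also have "ennreal \<bar>c\<bar> * (P n + N n + emeasure lborel (U - A) + (NN x. ind (U - A) x))
     <= ennreal \<bar>c\<bar> * (P n + N n + 2 * ennreal d)"
    using UA by (intro mult_left_mono) (auto simp: add.assoc mult_2 intro!: add_mono)
   finally show ?thesis .
  qed
  show "\<forall>\<^sub>F n in sequentially. (NN x. ennreal \<bar>ind A (x + h n) *. c - ind A x *. c\<bar>) <= ennreal e"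
   using ennreal_tendsto_0D[OF P d(1)] ennreal_tendsto_0D[OF N d(1)]
  proof eventually_elim
   fix n assume *: "P n < ennreal d" "N n < ennreal d"
   have "ennreal \<bar>c\<bar> * (P n + N n + 2 * ennreal d) <= ennreal \<bar>c\<bar> * (ennreal d + ennreal d + 2 * ennreal d)"
    using * by (intro mult_left_mono add_mono) auto
   also have "\<dots> = ennreal (\<bar>c\<bar> * (4 * d))"
   proof -
    have "ennreal d + ennreal d + 2 * ennreal d = ennreal (4 * d)"
     using d(1) by (subst mult_2) (simp add: ennreal_plus[symmetric] del: ennreal_plus)
    then show ?thesis using d(1) by (simp add: ennreal_mult)
   qed
   also have "\<dots> <= ennreal e" using d(2) by (rule ennreal_leI)
   finally show "(NN x. ennreal \<bar>ind A (x + h n) *. c - ind A x *. c\<bar>) <= ennreal e"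
    using bound[of n] by (rule order_trans[rotated])
  qed
 qed
next
 case (add f g)
 have [measurable]: "f : Borel" "g : Borel" using add by auto
 have "(NN x. ennreal \<bar>(f (x + h n) + g (x + h n)) - (f x + g x)\<bar>) <=
   1 * (NN x. ennreal \<bar>f (x + h n) - f x\<bar>) + 1 * (NN x. ennreal \<bar>g (x + h n) - g x\<bar>)" for n
  unfolding mult_1 by (subst nn_integral_add[symmetric])
   (auto simp: ennreal_plus[symmetric] simp del: ennreal_plus intro!: nn_integral_mono ennreal_leI)
 then show ?case
  by (intro ennreal_tendsto_0_le[OF ennreal_tendsto_0_lincomb[OF add.IH(1,2), of 1 1]]) auto
next
 case (lim f s)
 have [measurable]: "f : Borel" "!!i. s i : Borel" using lim by auto
 have "(%i. NN x. norm (f x - s i x)) ---> 0"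
 proof (rule nn_integral_dominated_convergence_norm[where w="%x. 2 * norm (f x)"])
  have "(NN x. ennreal (2 * norm (f x))) = 2 * (NN x. ennreal (norm (f x)))"
   by (subst nn_integral_cmult[symmetric]) (auto simp: ennreal_mult')
  also have "\<dots> < \<infinity>" using lim by (auto simp: integrable_iff_bounded ennreal_mult_less_top)
  finally show "(NN x. ennreal (2 * norm (f x))) < \<infinity>" .
 qed (use lim in auto)
 then have sf: "(%i. NN x. ennreal \<bar>f x - s i x\<bar>) ---> 0" by simp
 show ?case
 proof (rule ennreal_tendsto_0I)
  fix e :: real assume "e > 0"
  obtain i where i: "(NN x. ennreal \<bar>f x - s i x\<bar>) < ennreal (e / 3)"
   using ennreal_tendsto_0D[OF sf, of "e/3"] \<open>e > 0\<close> by (auto simp: eventually_sequentially)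
  show "\<forall>\<^sub>F n in sequentially. (NN x. ennreal \<bar>f (x + h n) - f x\<bar>) <= ennreal e"
   using ennreal_tendsto_0D[OF lim.IH(1)[of i] divide_pos_pos[OF \<open>e > 0\<close> zero_less_numeral[of "num.Bit1 num.One"]]]
  proof (eventually_elim, goal_cases)
   case (1 n)
   have "(NN x. ennreal \<bar>f (x + h n) - f x\<bar>) <=
     (NN x. ennreal \<bar>f (x + h n) - s i (x + h n)\<bar> + ennreal \<bar>s i (x + h n) - s i x\<bar> + ennreal \<bar>f x - s i x\<bar>)"
    by (auto simp: ennreal_plus[symmetric] simp del: ennreal_plus intro!: nn_integral_mono ennreal_leI)
   also have "\<dots> = (NN x. ennreal \<bar>f (x + h n) - s i (x + h n)\<bar>) +
     (NN x. ennreal \<bar>s i (x + h n) - s i x\<bar>) + (NN x. ennreal \<bar>f x - s i x\<bar>)"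
    by (simp add: nn_integral_add)
   also have "(NN x. ennreal \<bar>f (x + h n) - s i (x + h n)\<bar>) = (NN x. ennreal \<bar>f x - s i x\<bar>)"
    by (rule nn_integral_shift[of "%x. ennreal \<bar>f x - s i x\<bar>"]) measurable
   also have "\<dots> + (NN x. ennreal \<bar>s i (x + h n) - s i x\<bar>) + \<dots> <= ennreal (e/3) + ennreal (e/3) + ennreal (e/3)"
    using i 1 by (intro add_mono) auto
   also have "\<dots> = ennreal e" using \<open>e > 0\<close> by (simp add: ennreal_plus[symmetric] del: ennreal_plus)
   finally show ?case .
  qed
 qed
qed

text \<open>Reduction to L^1: |a - b|^2 <= |a^2 - b^2| for a, b >= 0, applied to the positive and
  the negative part, whose squares are integrable.\<close>

lemma shift_L2_tendsto:
 fixes f :: "'a::euclidean_space => real"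
 assumes [measurable]: "f : Borel" and fin: "L2 UNIV f < \<infinity>" and h: "h ---> 0"
 shows "(%n. NN x. ennreal ((f (x + h n) - f x)^2)) ---> 0"
proof -
 define p where "p = (%x. (max (f x) 0)^2)"
 define q where "q = (%x. (max (- f x) 0)^2)"
 have [measurable]: "p : Borel" "q : Borel" by (auto simp: p_def q_def)
 have pq: "0 <= p x" "p x <= (f x)^2" "0 <= q x" "q x <= (f x)^2" for x
  by (auto simp: p_def q_def max_def)
 have f2: "(NN x. ennreal ((f x)^2)) < \<infinity>" using fin by (simp add: L2_def)
 have le: "(NN x. ennreal (p x)) <= (NN x. ennreal ((f x)^2))"
  "(NN x. ennreal (q x)) <= (NN x. ennreal ((f x)^2))"
  using pq by (intro nn_integral_mono ennreal_leI; simp)+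
 have ip: "integrable lborel p"
  using pq order_le_less_trans[OF le(1) f2] by (intro integrableI_nonneg) auto
 have iq: "integrable lborel q"
  using pq order_le_less_trans[OF le(2) f2] by (intro integrableI_nonneg) auto
 have sq: "\<bar>a - b\<bar>\<^sup>2 <= \<bar>a\<^sup>2 - b\<^sup>2\<bar>" if "0 <= a" "0 <= b" for a b :: real
 proof -
  have "\<bar>a - b\<bar> * \<bar>a - b\<bar> <= \<bar>a - b\<bar> * (a + b)" using that by (intro mult_left_mono) auto
  also have "\<dots> = \<bar>(a - b) * (a + b)\<bar>" using that by (simp add: abs_mult)
  finally show ?thesis by (simp add: power2_eq_square algebra_simps)
 qed
 have bd: "(a - b)^2 <= 2 * \<bar>(max a 0)\<^sup>2 - (max b 0)\<^sup>2\<bar> + 2 * \<bar>(max (-a) 0)\<^sup>2 - (max (-b) 0)\<^sup>2\<bar>" for a b :: real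
 proof -
  have "a - b = (max a 0 - max b 0) + (max (-b) 0 - max (-a) 0)" by (simp add: max_def)
  then have "(a - b)^2 <= 2 * (max a 0 - max b 0)^2 + 2 * (max (-b) 0 - max (-a) 0)^2"
   using norm_add_square_le[of "max a 0 - max b 0" "max (-b) 0 - max (-a) 0"] by simp
  then show ?thesis using sq[of "max a 0" "max b 0"] sq[of "max (-b) 0" "max (-a) 0"]
   by (simp add: abs_minus_commute[of "(max (-b) 0)^2"])
 qed
 have "(NN x. ennreal ((f (x + h n) - f x)^2)) <=
   2 * (NN x. ennreal \<bar>p (x + h n) - p x\<bar>) + 2 * (NN x. ennreal \<bar>q (x + h n) - q x\<bar>)" for n
 proof -
  have "(NN x. ennreal ((f (x + h n) - f x)^2)) <=
   (NN x. 2 * ennreal \<bar>p (x + h n) - p x\<bar> + 2 * ennreal \<bar>q (x + h n) - q x\<bar>)"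
  proof (intro nn_integral_mono)
   fix x
   have "ennreal ((f (x + h n) - f x)^2) <= ennreal (2 * \<bar>p (x + h n) - p x\<bar> + 2 * \<bar>q (x + h n) - q x\<bar>)"
    unfolding p_def q_def by (intro ennreal_leI bd)
   then show "ennreal ((f (x + h n) - f x)^2) <= 2 * ennreal \<bar>p (x + h n) - p x\<bar> + 2 * ennreal \<bar>q (x + h n) - q x\<bar>"
    by (simp add: ennreal_plus ennreal_mult' ennreal_numeral)
  qed
  then show ?thesis by (simp add: nn_integral_add nn_integral_cmult)
 qed
 then show ?thesis
  by (intro ennreal_tendsto_0_le[OF ennreal_tendsto_0_lincomb[OF shift_L1_tendsto[OF ip h] shift_L1_tendsto[OF iq h], of 2 2]]) auto
qed

text \<open>Uniformity in the shift: a convolution averages over all shifts in a ball, so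
  convergence along each single sequence has to be turned into a bound for all small shifts at
  once.\<close>

lemma small_of_sequences:
 fixes T :: "'a::real_normed_vector => ennreal"
 assumes "!!h. h ---> 0 ==> (%n. T (h n)) ---> 0" "e > 0"
 shows "EX d>0. ALL z. norm z < d --> T z <= ennreal e"
proof (rule ccontr)
 assume "\<not> ?thesis"
 then have "ALL n::nat. EX z. norm z < 1 / Suc n & ennreal e < T z"
  by (metis of_nat_0_less_iff zero_less_Suc zero_less_divide_1_iff linorder_not_le)
 then obtain h where h: "!!n. norm (h n) < 1 / Suc n" "!!n. ennreal e < T (h n)" by metis
 have "h ---> 0"
  by (rule Lim_null_comparison[OF _ LIMSEQ_inverse_real_of_nat])
   (use h(1) in \<open>auto simp: inverse_eq_divide less_imp_le\<close>)
 from ennreal_tendsto_0D[OF assms(1)[OF this] assms(2)] obtain n where "T (h n) < ennreal e"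
  by (auto simp: eventually_sequentially)
 with h(2)[of n] show False by simp
qed

lemma kernel_measurable: "kernel e \<rho> ==> \<rho> : Borel"
 using kernel_C1 C1_measurable by blast

lemma kernel_reflect_integral:
 assumes k: "kernel e \<rho>"
 shows "(NN y. ennreal (\<rho> (x - y))) = 1"
 using nn_integral_affine[of "%z. ennreal (\<rho> z)" "-1" x] kernel_measurable[OF k] k
 by (simp add: kernel_def)

text \<open>After Tonelli's theorem and the substitution x = y + z the left side is an average over
  z, with density \<rho>, of the distances between f and its shifts. Below, \<open>p\<close> is the
  absolute value or the square.\<close>

lemma kernel_double_integral:
 fixes f :: "real^'n => real"
 assumes k: "kernel e \<rho>" and [measurable]: "f : Borel" "p : Borel"
  and small: "!!z. norm z < e ==> (NN y. ennreal (p (f (y + z) - f y))) <= \<epsilon>"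
  and sym: "!!t. p (- t) = p t"
 shows "(NN x. (NN y. ennreal (\<rho> (x - y)) * ennreal (p (f y - f x)))) <= \<epsilon>"
proof -
 have [measurable]: "\<rho> : Borel" by (rule kernel_measurable[OF k])
 have "(NN x. (NN y. ennreal (\<rho> (x - y)) * ennreal (p (f y - f x))))
   = (NN y. (NN x. ennreal (\<rho> (x - y)) * ennreal (p (f y - f x))))"
  by (rule lborel_pair.Fubini'[symmetric]) measurable
 also have "\<dots> = (NN y. (NN z. ennreal (\<rho> z) * ennreal (p (f (y + z) - f y))))"
 proof (rule nn_integral_cong)
  fix y
  have "p (f y - f (z + y)) = p (f (y + z) - f y)" for z
   using sym[of "f (y + z) - f y"] by (simp add: add.commute)
  then show "(NN x. ennreal (\<rho> (x - y)) * ennreal (p (f y - f x))) =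
    (NN z. ennreal (\<rho> z) * ennreal (p (f (y + z) - f y)))"
   using nn_integral_shift[of "%x. ennreal (\<rho> (x - y)) * ennreal (p (f y - f x))" y] by simp
 qed
 also have "\<dots> = (NN z. (NN y. ennreal (\<rho> z) * ennreal (p (f (y + z) - f y))))"
  by (rule lborel_pair.Fubini') measurable
 also have "\<dots> = (NN z. ennreal (\<rho> z) * (NN y. ennreal (p (f (y + z) - f y))))"
  by (intro nn_integral_cong nn_integral_cmult) measurable
 also have "\<dots> <= (NN z. ennreal (\<rho> z) * \<epsilon>)"
 proof (rule nn_integral_mono)
  fix z
  show "ennreal (\<rho> z) * (NN y. ennreal (p (f (y + z) - f y))) <= ennreal (\<rho> z) * \<epsilon>"
   using small[of z] k by (cases "norm z < e") (auto simp: kernel_def intro: mult_left_mono)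
 qed
 also have "\<dots> = \<epsilon>" using k by (simp add: nn_integral_multc kernel_def)
 finally show ?thesis .
qed

lemma conv_diff_le:
 assumes k: "kernel e \<rho>" and f: "integrable lborel f"
 shows "ennreal \<bar>conv \<rho> f x - f x\<bar> <= (NN y. ennreal (\<rho> (x - y)) * ennreal \<bar>f y - f x\<bar>)"
proof -
 have [measurable]: "\<rho> : Borel" "f : Borel"
  using kernel_measurable[OF k] f by auto
 have r0: "0 <= \<rho> z" for z using k by (simp add: kernel_def)
 have i1: "integrable lborel (%y. \<rho> (x - y) * f y)"
  by (rule conv_integrable[OF C1_continuous[OF kernel_C1[OF k]] kernel_zero[OF k] f])
 have i2: "integrable lborel (%y. \<rho> (x - y))"
  using kernel_reflect_integral[OF k, of x] r0 by (intro integrableI_nonneg) auto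
 have one: "(LBINT y. \<rho> (x - y)) = 1"
  using kernel_reflect_integral[OF k, of x] r0 by (subst integral_eq_nn_integral) auto
 have "conv \<rho> f x - f x = (LBINT y. \<rho> (x - y) * f y) - (LBINT y. \<rho> (x - y) * f x)"
  by (simp add: conv_def one)
 also have "\<dots> = (LBINT y. \<rho> (x - y) * (f y - f x))"
  using i1 i2 by (subst Bochner_Integration.integral_diff[symmetric]) (auto simp: right_diff_distrib)
 finally have "ennreal \<bar>conv \<rho> f x - f x\<bar> <= (NN y. norm (\<rho> (x - y) * (f y - f x)))"
  using integral_norm_bound_ennreal[of lborel "%y. \<rho> (x - y) * (f y - f x)"] i1 i2
  by (auto simp: right_diff_distrib)
 also have "\<dots> = (NN y. ennreal (\<rho> (x - y)) * ennreal \<bar>f y - f x\<bar>)"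
  using r0 by (intro nn_integral_cong) (auto simp: abs_mult ennreal_mult)
 finally show ?thesis .
qed

lemma moll_L1_tendsto:
 assumes f: "integrable lborel f" and k: "!!j. kernel (e j) (\<rho> j)" and e: "e ---> 0"
 shows "(%j. NN x. ennreal \<bar>conv (\<rho> j) f x - f x\<bar>) ---> 0"
proof (rule ennreal_tendsto_0I)
 fix \<epsilon> :: real assume "\<epsilon> > 0"
 have [measurable]: "f : Borel" using f by auto
 have "EX d>0. ALL z. norm z < d --> (NN x. ennreal \<bar>f (x + z) - f x\<bar>) <= ennreal \<epsilon>"
  by (rule small_of_sequences[OF _ \<open>\<epsilon> > 0\<close>]) (rule shift_L1_tendsto[OF f])
 then obtain d where d: "d > 0" "!!z. norm z < d ==> (NN x. ennreal \<bar>f (x + z) - f x\<bar>) <= ennreal \<epsilon>"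
  by blast
 show "\<forall>\<^sub>F j in sequentially. (NN x. ennreal \<bar>conv (\<rho> j) f x - f x\<bar>) <= ennreal \<epsilon>"
  using order_tendstoD(2)[OF e d(1)]
 proof eventually_elim
  fix j assume "e j < d"
  have "(NN x. ennreal \<bar>conv (\<rho> j) f x - f x\<bar>) <=
    (NN x. (NN y. ennreal (\<rho> j (x - y)) * ennreal \<bar>f y - f x\<bar>))"
   by (intro nn_integral_mono conv_diff_le[OF k f])
  also have "\<dots> <= ennreal \<epsilon>"
   using kernel_double_integral[OF k, of f abs j "ennreal \<epsilon>"] d(2) \<open>e j < d\<close> by auto
  finally show "(NN x. ennreal \<bar>conv (\<rho> j) f x - f x\<bar>) <= ennreal \<epsilon>" .
 qed
qed

lemma moll_L2_tendsto:
 assumes f: "integrable lborel f" and fin: "L2 UNIV f < \<infinity>"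
  and k: "!!j. kernel (e j) (\<rho> j)" and e: "e ---> 0"
 shows "(%j. L2 UNIV (%x. conv (\<rho> j) f x - f x)) ---> 0"
proof (rule ennreal_tendsto_0I)
 fix \<epsilon> :: real assume "\<epsilon> > 0"
 have [measurable]: "f : Borel" using f by auto
 have "EX d>0. ALL z. norm z < d --> (NN x. ennreal ((f (x + z) - f x)^2)) <= ennreal \<epsilon>"
  by (rule small_of_sequences[OF _ \<open>\<epsilon> > 0\<close>]) (rule shift_L2_tendsto[OF _ fin], measurable)
 then obtain d where d: "d > 0" "!!z. norm z < d ==> (NN x. ennreal ((f (x + z) - f x)^2)) <= ennreal \<epsilon>"
  by blast
 show "\<forall>\<^sub>F j in sequentially. L2 UNIV (%x. conv (\<rho> j) f x - f x) <= ennreal \<epsilon>"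
  using order_tendstoD(2)[OF e d(1)]
 proof eventually_elim
  fix j assume "e j < d"
  have [measurable]: "\<rho> j : Borel" by (rule kernel_measurable[OF k])
  have r0: "0 <= \<rho> j z" for z using k[of j] by (simp add: kernel_def)
  \<comment> \<open>Jensen's inequality for the probability density y -> \<rho>(x - y), obtained
    from Cauchy-Schwarz by splitting off the square root of the density.\<close>
  have pw: "ennreal ((conv (\<rho> j) f x - f x)^2) <= (NN y. ennreal (\<rho> j (x - y)) * ennreal ((f y - f x)^2))" for x
  proof -
   have "ennreal \<bar>conv (\<rho> j) f x - f x\<bar> <= (NN y. ennreal (sqrt (\<rho> j (x - y))) * ennreal (sqrt (\<rho> j (x - y)) * \<bar>f y - f x\<bar>))"
    using conv_diff_le[OF k f, of j x] r0 by (simp add: ennreal_mult[symmetric] mult.assoc[symmetric])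
   then have "(ennreal \<bar>conv (\<rho> j) f x - f x\<bar>)^2 <= (NN y. ennreal (sqrt (\<rho> j (x - y))) * ennreal (sqrt (\<rho> j (x - y)) * \<bar>f y - f x\<bar>))^2"
    by (rule power_mono) simp
   also have "\<dots> <= (NN y. (ennreal (sqrt (\<rho> j (x - y))))^2) * (NN y. (ennreal (sqrt (\<rho> j (x - y)) * \<bar>f y - f x\<bar>))^2)"
    by (rule Cauchy_Schwarz_nn_integral) measurable
   also have "(NN y. (ennreal (sqrt (\<rho> j (x - y))))^2) = 1"
    using kernel_reflect_integral[OF k, of j x] r0 by (simp add: ennreal_power)
   also have "(NN y. (ennreal (sqrt (\<rho> j (x - y)) * \<bar>f y - f x\<bar>))^2) = (NN y. ennreal (\<rho> j (x - y)) * ennreal ((f y - f x)^2))"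
    using r0 by (intro nn_integral_cong) (simp add: ennreal_power power_mult_distrib ennreal_mult)
   finally show ?thesis by (simp add: ennreal_power)
  qed
  have "L2 UNIV (%x. conv (\<rho> j) f x - f x) <=
    (NN x. (NN y. ennreal (\<rho> j (x - y)) * ennreal ((f y - f x)^2)))"
   unfolding L2_def using pw by (intro nn_integral_mono) simp
  also have "\<dots> <= ennreal \<epsilon>"
   using kernel_double_integral[OF k, of f "%t. t\<^sup>2" j "ennreal \<epsilon>"] d(2) \<open>e j < d\<close> by auto
  finally show "L2 UNIV (%x. conv (\<rho> j) f x - f x) <= ennreal \<epsilon>" .
 qed
qed

subsection \<open>Closures of classes of differentiable functions\<close>

text \<open>\<open>approx S X u g\<close> replaces membership in a Sobolev space: \<open>(u, g)\<close> is an \<open>L\<^sup>2(S)\<close> limit of pairs \<open>(w, \<nabla>w)\<close> with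
 \<open>w : X\<close>. Sign, size and support conditions on the approximating functions are kept in the class \<open>X\<close>.\<close>

definition approx :: "(real^'n) set => (real^'n => real) set => (real^'n => real) => (real^'n => real^'n) => bool" where
 "approx S X u g \<longleftrightarrow> S : sets borel & X <= Collect C1 &
  u : Borel & g : Borel & L2 S u < \<infinity> & L2 S g < \<infinity> &
  (EX w. (ALL j::nat. w j : X) & (%j. L2 S (%x. w j x - u x)) ---> 0 &
    (%j. L2 S (%x. grad (w j) x - g x)) ---> 0 &
    (AE x\<in>S in lborel. (%j. w j x) ---> u x))"

lemma approxI:
 assumes [measurable]: "S : sets borel" and X: "X <= Collect C1"
  and [measurable]: "u : Borel" "g : Borel"
  and "L2 S u < \<infinity>" "L2 S g < \<infinity>" and w: "!!j::nat. w j : X"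
  and lim: "(%j. L2 S (%x. w j x - u x)) ---> 0" "(%j. L2 S (%x. grad (w j) x - g x)) ---> 0"
 shows "approx S X u g"
proof -
 have [measurable]: "w j : Borel" for j using X w C1_measurable by blast
 obtain r :: "nat => nat" where r: "strict_mono r"
  "AE x\<in>S in lborel. (%j. w (r j) x - u x) ---> 0"
  using L2_AE_subseq[of "%j x. w j x - u x" S] lim(1) by auto
 have "AE x\<in>S in lborel. (%j. w (r j) x) ---> u x"
  using r(2) by eventually_elim (simp add: LIM_zero_iff)
 then show ?thesis
  unfolding approx_def
  using assms LIMSEQ_subseq_LIMSEQ[OF lim(1) r(1)] LIMSEQ_subseq_LIMSEQ[OF lim(2) r(1)]
  by (intro conjI exI[of _ "%j. w (r j)"]) (auto simp: o_def)
qed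

lemma approx_sequence:
 assumes "approx S X u g"
 shows "EX w::nat => _. (ALL j. w j : X) & (ALL j. C1 (w j)) &
  (%j. L2 S (%x. w j x - u x)) ---> 0 & (%j. L2 S (%x. grad (w j) x - g x)) ---> 0 &
  (AE x\<in>S in lborel. (%j. w j x) ---> u x)"
 using assms unfolding approx_def by blast

lemma approxD:
 assumes "approx S X u g"
 shows "S : sets borel" "X <= Collect C1" "u : Borel" "g : Borel"
  "L2 S u < \<infinity>" "L2 S g < \<infinity>"
 using assms unfolding approx_def by auto

lemma approx_mono:
 assumes "approx T X u g" "S <= T" "S : sets borel" "X <= Y" "Y <= Collect C1"
 shows "approx S Y u g"
proof -
 obtain w where w: "!!j::nat. w j : X" "!!j. C1 (w j)"
  "(%j. L2 T (%x. w j x - u x)) ---> 0" "(%j. L2 T (%x. grad (w j) x - g x)) ---> 0"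
  "AE x\<in>T in lborel. (%j. w j x) ---> u x"
  using approx_sequence[OF assms(1)] by blast
 show ?thesis
 proof (rule approxI[OF assms(3,5)])
  show "L2 S u < \<infinity>" "L2 S g < \<infinity>"
   using approxD(5,6)[OF assms(1)] L2_mono_set[OF assms(2)] le_less_trans by blast+
  show "w j : Y" for j using w(1) assms(4) by blast
  show "(%j. L2 S (%x. w j x - u x)) ---> 0"
   by (rule ennreal_tendsto_0_le[OF w(3)]) (rule L2_mono_set[OF assms(2)])
  show "(%j. L2 S (%x. grad (w j) x - g x)) ---> 0"
   by (rule ennreal_tendsto_0_le[OF w(4)]) (rule L2_mono_set[OF assms(2)])
 qed (use approxD[OF assms(1)] in auto)
qed

lemma approx_cong:
 assumes "approx S X u g" "u' : Borel" "g' : Borel"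
  "AE x\<in>S in lborel. u' x = u x" "AE x\<in>S in lborel. g' x = g x"
 shows "approx S X u' g'"
proof -
 obtain w where w: "!!j::nat. w j : X" "!!j. C1 (w j)"
  "(%j. L2 S (%x. w j x - u x)) ---> 0" "(%j. L2 S (%x. grad (w j) x - g x)) ---> 0"
  "AE x\<in>S in lborel. (%j. w j x) ---> u x"
  using approx_sequence[OF assms(1)] by blast
 have *: "L2 S u' = L2 S u" "L2 S g' = L2 S g"
  "L2 S (%x. w j x - u' x) = L2 S (%x. w j x - u x)"
  "L2 S (%x. grad (w j) x - g' x) = L2 S (%x. grad (w j) x - g x)" for j
  by (rule L2_cong_AE, use assms(4,5) in eventually_elim, simp)+
 show ?thesis
  by (rule approxI[where w=w]) (use w approxD[OF assms(1)] assms * in auto)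
qed

text \<open>Diagonal choice: one member of X within 1/(j+1) of the j-th pair. The class X is the
  same before and after the limit, so sign and size conditions survive non-smooth operations such as
  the positive part.\<close>

lemma approx_limit:
 assumes a: "!!j::nat. approx S X (u' j) (g' j)"
  and [measurable]: "u : Borel" "g : Borel"
  and lim: "(%j. L2 S (%x. u' j x - u x)) ---> 0" "(%j. L2 S (%x. g' j x - g x)) ---> 0"
 shows "approx S X u g"
proof -
 note D = approxD[OF a]
 have [measurable]: "S : sets borel" "!!j. u' j : Borel" "!!j. g' j : Borel"
  using D by auto
 have "EX w. w : X & L2 S (%x. w x - u' j x) <= ennreal (1 / Suc j) & L2 S (%x. grad w x - g' j x) <= ennreal (1 / Suc j)" for j
 proof -
  obtain w where w: "!!i::nat. w i : X" "!!i. C1 (w i)"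
   "(%i. L2 S (%x. w i x - u' j x)) ---> 0" "(%i. L2 S (%x. grad (w i) x - g' j x)) ---> 0"
   "AE x\<in>S in lborel. (%i. w i x) ---> u' j x"
   using approx_sequence[OF a[of j]] by blast
  have p: "(0::real) < 1 / Suc j" by simp
  from eventually_conj[OF ennreal_tendsto_0D[OF w(3) p] ennreal_tendsto_0D[OF w(4) p]]
  obtain i where "L2 S (%x. w i x - u' j x) < ennreal (1 / Suc j)" "L2 S (%x. grad (w i) x - g' j x) < ennreal (1 / Suc j)"
   by (auto simp: eventually_sequentially)
  then show ?thesis using w(1) less_imp_le by blast
 qed
 then have "ALL j. EX w. w : X & L2 S (%x. w x - u' j x) <= ennreal (1 / Suc j) & L2 S (%x. grad w x - g' j x) <= ennreal (1 / Suc j)"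
  by blast
 from choice[OF this] obtain w where w: "!!j. w j : X" "!!j. L2 S (%x. w j x - u' j x) <= ennreal (1 / Suc j)"
  "!!j. L2 S (%x. grad (w j) x - g' j x) <= ennreal (1 / Suc j)" by blast
 have C: "C1 (w j)" for j using w(1) D(2) by blast
 have [measurable]: "w j : Borel" "grad (w j) : Borel" for j
  using C1_measurable[OF C] grad_measurable[OF C] by auto
 have z: "(%j. ennreal (1 / Suc j)) ---> 0"
  using tendsto_ennrealI[OF LIMSEQ_inverse_real_of_nat] by (simp add: inverse_eq_divide)
 have l1: "(%j. L2 S (%x. w j x - u x)) ---> 0"
 proof (rule ennreal_tendsto_0_le)
  show "(%j. 2 * ennreal (1 / Suc j) + 2 * L2 S (%x. u' j x - u x)) ---> 0"
   by (rule ennreal_tendsto_0_lincomb[OF z lim(1)]) auto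
  show "L2 S (%x. w j x - u x) <= 2 * ennreal (1 / Suc j) + 2 * L2 S (%x. u' j x - u x)" for j
  proof -
   have "L2 S (%x. w j x - u x) <= 2 * L2 S (%x. w j x - u' j x) + 2 * L2 S (%x. u' j x - u x)"
    by (rule L2_triangle) measurable
   also have "\<dots> <= 2 * ennreal (1 / Suc j) + 2 * L2 S (%x. u' j x - u x)"
    by (intro add_mono mult_left_mono w) auto
   finally show ?thesis .
  qed
 qed
 have l2: "(%j. L2 S (%x. grad (w j) x - g x)) ---> 0"
 proof (rule ennreal_tendsto_0_le)
  show "(%j. 2 * ennreal (1 / Suc j) + 2 * L2 S (%x. g' j x - g x)) ---> 0"
   by (rule ennreal_tendsto_0_lincomb[OF z lim(2)]) auto
  show "L2 S (%x. grad (w j) x - g x) <= 2 * ennreal (1 / Suc j) + 2 * L2 S (%x. g' j x - g x)" for j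
  proof -
   have "L2 S (%x. grad (w j) x - g x) <= 2 * L2 S (%x. grad (w j) x - g' j x) + 2 * L2 S (%x. g' j x - g x)"
    by (rule L2_triangle) measurable
   also have "\<dots> <= 2 * ennreal (1 / Suc j) + 2 * L2 S (%x. g' j x - g x)"
    by (intro add_mono mult_left_mono w) auto
   finally show ?thesis .
  qed
 qed
 obtain i where i: "L2 S (%x. u' i x - u x) < ennreal 1" "L2 S (%x. g' i x - g x) < ennreal 1"
  using eventually_conj[OF ennreal_tendsto_0D[OF lim(1), of 1] ennreal_tendsto_0D[OF lim(2), of 1]]
  by (auto simp: eventually_sequentially)
 have "L2 S u < \<infinity>" "L2 S g < \<infinity>"
  by (rule L2_finite_if_close[of "u' i"]; use i D in \<open>auto intro: less_trans\<close>)
   (rule L2_finite_if_close[of "g' i"]; use i D in \<open>auto intro: less_trans\<close>)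
 then show ?thesis
  by (intro approxI[where w=w]) (use D w l1 l2 in auto)
qed

lemma deriv_bound_lipschitz:
 fixes F :: "real => real"
 assumes "!!t. (F has_real_derivative F' t) (at t)" "!!t. \<bar>F' t\<bar> <= M"
 shows "\<bar>F a - F b\<bar> <= M * \<bar>a - b\<bar>"
 using field_differentiable_bound[of UNIV F F' M a b] assms by simp

text \<open>The gradient error splits into F'(w) (grad w - g), controlled by the bound M, and (F'(w)
  - F'(u)) g, which tends to 0 by dominated convergence. The second part is where the almost
  everywhere convergence recorded in \<open>approx\<close> enters.\<close>

lemma approx_chain:
 assumes a: "approx S X u g"
  and F: "!!t. (F has_real_derivative F' t) (at t)" "continuous_on UNIV F'" "!!t. \<bar>F' t\<bar> <= M"
  and Y: "!!w. w : X ==> (%x. F (w x)) : Y" "Y <= Collect C1"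
  and fin: "L2 S (%x. F (u x)) < \<infinity>"
 shows "approx S Y (%x. F (u x)) (%x. F' (u x) *. g x)"
proof -
 note [measurable] = approxD(1,3,4)[OF a]
 obtain w where w: "!!j::nat. w j : X" "!!j. C1 (w j)"
  "(%j. L2 S (%x. w j x - u x)) ---> 0" "(%j. L2 S (%x. grad (w j) x - g x)) ---> 0"
  "AE x\<in>S in lborel. (%j. w j x) ---> u x"
  using approx_sequence[OF a] by blast
 note [measurable] = C1_measurable[OF w(2)] grad_measurable[OF w(2)]
 have M: "0 <= M" using F(3)[of 0] by simp
 have "isCont F t" for t using F(1) DERIV_isCont by blast
 then have "continuous_on UNIV F" by (simp add: continuous_at_imp_continuous_on)
 then have [measurable]: "F : Borel" by (rule borel_measurable_continuous_onI)
 have [measurable]: "F' : Borel" by (rule borel_measurable_continuous_onI[OF F(2)])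
 have gr: "grad (%x. F (w j x)) = (%x. F' (w j x) *. grad (w j) x)" for j
  by (rule grad_compose[OF w(2) F(1,2)])
 show ?thesis
 proof (rule approxI[where w="%j x. F (w j x)"])
  show "(%j. L2 S (%x. F (w j x) - F (u x))) ---> 0"
  proof (rule ennreal_tendsto_0_le)
   show "(%j. ennreal (M\<^sup>2) * L2 S (%x. w j x - u x) + 0 * 0) ---> 0"
    by (rule ennreal_tendsto_0_lincomb[OF w(3) tendsto_const]) auto
   show "L2 S (%x. F (w j x) - F (u x)) <= ennreal (M\<^sup>2) * L2 S (%x. w j x - u x) + 0 * 0" for j
    unfolding mult_zero_left add_0_right
    by (rule L2_bound_mult) (use M deriv_bound_lipschitz[OF F(1,3)] in auto)
  qed
  show "(%j. L2 S (%x. grad (%x. F (w j x)) x - F' (u x) *. g x)) ---> 0"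
  proof (rule ennreal_tendsto_0_le)
   have "(%j. L2 S (%x. (F' (w j x) - F' (u x)) *. g x)) ---> 0"
   proof (rule L2_dominated[where h="%x. (2 * M) *. g x"])
    show "norm ((F' (w j x) - F' (u x)) *. g x) <= norm ((2 * M) *. g x)" for j x
    proof -
     have "\<bar>F' (w j x) - F' (u x)\<bar> <= 2 * M" using F(3)[of "w j x"] F(3)[of "u x"] by simp
     then show ?thesis using M by (simp add: mult_right_mono)
    qed
    have "L2 S (%x. (2 * M) *. g x) <= ennreal ((2 * M)^2) * L2 S g"
     by (rule L2_bound_mult) (use M in auto)
    also have "\<dots> < \<infinity>" using approxD(6)[OF a] by (simp add: ennreal_mult_less_top)
    finally show "L2 S (%x. (2 * M) *. g x) < \<infinity>" .
    show "AE x\<in>S in lborel. (%j. (F' (w j x) - F' (u x)) *. g x) ---> 0"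
     using w(5)
    proof eventually_elim
     fix x assume *: "x : S --> (%j. w j x) ---> u x"
     show "x : S --> (%j. (F' (w j x) - F' (u x)) *. g x) ---> 0"
     proof
      assume "x : S"
      have "isCont F' (u x)" using F(2) by (simp add: continuous_on_eq_continuous_at)
      then have "(%j. F' (w j x)) ---> F' (u x)"
       using * \<open>x : S\<close> isCont_tendsto_compose by blast
      then show "(%j. (F' (w j x) - F' (u x)) *. g x) ---> 0"
       by (auto intro!: tendsto_eq_intros)
     qed
    qed
   qed measurable
   then show "(%j. (2 * ennreal (M\<^sup>2)) * L2 S (%x. grad (w j) x - g x) + 2 * L2 S (%x. (F' (w j x) - F' (u x)) *. g x)) ---> 0"
    by (intro ennreal_tendsto_0_lincomb[OF w(4)]) (auto simp: ennreal_mult_less_top)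
   fix j
   have "L2 S (%x. grad (%x. F (w j x)) x - F' (u x) *. g x)
    = L2 S (%x. F' (w j x) *. (grad (w j) x - g x) + (F' (w j x) - F' (u x)) *. g x)"
    by (simp add: gr algebra_simps)
   also have "\<dots> <= 2 * L2 S (%x. F' (w j x) *. (grad (w j) x - g x)) + 2 * L2 S (%x. (F' (w j x) - F' (u x)) *. g x)"
    by (rule L2_add) measurable
   also have "\<dots> <= 2 * (ennreal (M\<^sup>2) * L2 S (%x. grad (w j) x - g x)) + 2 * L2 S (%x. (F' (w j x) - F' (u x)) *. g x)"
    by (intro add_mono mult_left_mono L2_bound_mult) (use M F(3) in \<open>auto intro!: mult_right_mono\<close>)
   finally show "L2 S (%x. grad (%x. F (w j x)) x - F' (u x) *. g x)
    <= (2 * ennreal (M\<^sup>2)) * L2 S (%x. grad (w j) x - g x) + 2 * L2 S (%x. (F' (w j x) - F' (u x)) *. g x)"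
    by (simp add: mult.assoc)
  qed
  have "L2 S (%x. F' (u x) *. g x) <= ennreal (M\<^sup>2) * L2 S g"
   by (rule L2_bound_mult) (use M F(3) in \<open>auto intro!: mult_right_mono\<close>)
  also have "\<dots> < \<infinity>" using approxD(6)[OF a] by (simp add: ennreal_mult_less_top)
  finally show "L2 S (%x. F' (u x) *. g x) < \<infinity>" .
 qed (use fin Y w(1) in auto)
qed

lemma L2_bound_mult_on:
 fixes f :: "'a::euclidean_space => 'b::euclidean_space"
 assumes [measurable]: "f : Borel" "S : sets borel"
  and "!!x. x : T ==> x : S ==> norm (h x) <= M * norm (f x)" "!!x. x : T ==> x ~: S ==> h x = 0" "0 <= M"
 shows "L2 T h <= ennreal (M\<^sup>2) * L2 S f"
proof -
 have "L2 T h <= L2 S (%x. if x : T then h x else 0)"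
  unfolding L2_def by (intro nn_integral_mono) (auto simp: indicator_def assms)
 also have "\<dots> <= ennreal (M\<^sup>2) * L2 S f"
  by (rule L2_bound_mult) (use assms in auto)
 finally show ?thesis .
qed

text \<open>T may be larger than S: where \<eta> and its gradient vanish, the product is extended by
  zero. Cut-offs thus lead from a ball to the whole space, and functions vanishing near the pole
  from an annulus to a ball.\<close>

lemma approx_mult_C1:
 fixes u :: "real^'n => real"
 assumes a: "approx S X u g" and \<eta>: "C1 \<eta>" and [measurable]: "T : sets borel"
  and bd: "!!x. \<bar>\<eta> x\<bar> <= B" "!!x. norm (grad \<eta> x) <= B"
  and zero: "!!x. x : T ==> x ~: S ==> \<eta> x = 0 & grad \<eta> x = 0"
  and Y: "!!w. w : X ==> (%x. \<eta> x * w x) : Y" "Y <= Collect C1"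
 shows "approx T Y (%x. \<eta> x * u x) (%x. \<eta> x *. g x + u x *. grad \<eta> x)"
proof -
 note [measurable] = approxD(1,3,4)[OF a]
 obtain w where w: "!!j::nat. w j : X" "!!j. C1 (w j)"
  "(%j. L2 S (%x. w j x - u x)) ---> 0" "(%j. L2 S (%x. grad (w j) x - g x)) ---> 0"
  "AE x\<in>S in lborel. (%j. w j x) ---> u x"
  using approx_sequence[OF a] by blast
 note [measurable] = C1_measurable[OF w(2)] grad_measurable[OF w(2)] C1_measurable[OF \<eta>] grad_measurable[OF \<eta>]
 have B: "0 <= B" using bd(2)[of 0] norm_ge_zero order_trans by blast
 have e1: "L2 T (%x. \<eta> x * f x) <= ennreal (B\<^sup>2) * L2 S f" if "f : Borel" for f :: "real^'n => real"
  by (rule L2_bound_mult_on) (use that zero bd B in \<open>auto simp: abs_mult intro!: mult_right_mono\<close>)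
 have e2: "L2 T (%x. \<eta> x *. f x) <= ennreal (B\<^sup>2) * L2 S f" if "f : Borel" for f :: "real^'n => real^'n"
  by (rule L2_bound_mult_on) (use that zero bd B in \<open>auto intro!: mult_right_mono\<close>)
 have e3: "L2 T (%x. f x *. grad \<eta> x) <= ennreal (B\<^sup>2) * L2 S f" if "f : Borel" for f :: "real^'n => real"
  by (rule L2_bound_mult_on) (use that zero bd B in \<open>auto simp: mult.commute[of B] intro!: mult_left_mono\<close>)
 have e4: "L2 T (%x. \<eta> x *. f x + h x *. grad \<eta> x) <= (2 * ennreal (B\<^sup>2)) * L2 S f + (2 * ennreal (B\<^sup>2)) * L2 S h"
  if [measurable]: "f : Borel" "h : Borel" for f :: "real^'n => real^'n" and h
 proof -
  have "L2 T (%x. \<eta> x *. f x + h x *. grad \<eta> x) <= 2 * L2 T (%x. \<eta> x *. f x) + 2 * L2 T (%x. h x *. grad \<eta> x)"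
   by (rule L2_add) measurable
  also have "\<dots> <= 2 * (ennreal (B\<^sup>2) * L2 S f) + 2 * (ennreal (B\<^sup>2) * L2 S h)"
   by (intro add_mono mult_left_mono e2 e3) auto
  finally show ?thesis by (simp add: mult.assoc)
 qed
 have gr: "grad (%x. \<eta> x * w j x) = (%x. \<eta> x *. grad (w j) x + w j x *. grad \<eta> x)" for j
  by (rule grad_mult[OF \<eta> w(2)])
 show ?thesis
 proof (rule approxI[where w="%j x. \<eta> x * w j x"])
  have "L2 T (%x. \<eta> x * u x) <= ennreal (B\<^sup>2) * L2 S u" by (rule e1) measurable
  also have "\<dots> < \<infinity>" using approxD(5)[OF a] by (simp add: ennreal_mult_less_top)
  finally show "L2 T (%x. \<eta> x * u x) < \<infinity>" .
  have "L2 T (%x. \<eta> x *. g x + u x *. grad \<eta> x) <= (2 * ennreal (B\<^sup>2)) * L2 S g + (2 * ennreal (B\<^sup>2)) * L2 S u"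
   by (rule e4) measurable
  also have "\<dots> < \<infinity>" using approxD(5,6)[OF a] by (simp add: ennreal_mult_less_top)
  finally show "L2 T (%x. \<eta> x *. g x + u x *. grad \<eta> x) < \<infinity>" .
  show "(%j. L2 T (%x. \<eta> x * w j x - \<eta> x * u x)) ---> 0"
  proof (rule ennreal_tendsto_0_le)
   show "(%j. ennreal (B\<^sup>2) * L2 S (%x. w j x - u x) + 0 * 0) ---> 0"
    by (rule ennreal_tendsto_0_lincomb[OF w(3) tendsto_const]) auto
   show "L2 T (%x. \<eta> x * w j x - \<eta> x * u x) <= ennreal (B\<^sup>2) * L2 S (%x. w j x - u x) + 0 * 0" for j
    using e1[of "%x. w j x - u x"] by (simp add: right_diff_distrib)
  qed
  show "(%j. L2 T (%x. grad (%x. \<eta> x * w j x) x - (\<eta> x *. g x + u x *. grad \<eta> x))) ---> 0"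
  proof (rule ennreal_tendsto_0_le)
   show "(%j. (2 * ennreal (B\<^sup>2)) * L2 S (%x. grad (w j) x - g x) + (2 * ennreal (B\<^sup>2)) * L2 S (%x. w j x - u x)) ---> 0"
    by (intro ennreal_tendsto_0_lincomb[OF w(4,3)]) (auto simp: ennreal_mult_less_top)
   fix j
   have "L2 T (%x. grad (%x. \<eta> x * w j x) x - (\<eta> x *. g x + u x *. grad \<eta> x))
    = L2 T (%x. \<eta> x *. (grad (w j) x - g x) + (w j x - u x) *. grad \<eta> x)"
    by (simp add: gr algebra_simps)
   also have "\<dots> <= (2 * ennreal (B\<^sup>2)) * L2 S (%x. grad (w j) x - g x) + (2 * ennreal (B\<^sup>2)) * L2 S (%x. w j x - u x)"
    by (rule e4) measurable
   finally show "L2 T (%x. grad (%x. \<eta> x * w j x) x - (\<eta> x *. g x + u x *. grad \<eta> x))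
    <= (2 * ennreal (B\<^sup>2)) * L2 S (%x. grad (w j) x - g x) + (2 * ennreal (B\<^sup>2)) * L2 S (%x. w j x - u x)" .
  qed
 qed (use Y w(1) in auto)
qed

lemma L2_tendsto_mult:
 fixes f :: "nat => 'a::euclidean_space => real" and h :: "nat => 'a => 'b::euclidean_space"
 assumes [measurable]: "!!j. f j : Borel" "!!j. h j : Borel"
  "f' : Borel" "h' : Borel" "S : sets borel"
  and bd: "!!j x. x : S ==> \<bar>f j x\<bar> <= B" "!!x. x : S ==> \<bar>f' x\<bar> <= B"
  and ae: "AE x\<in>S in lborel. (%j. f j x) ---> f' x"
  and lim: "(%j. L2 S (%x. h j x - h' x)) ---> 0" and fin: "L2 S h' < \<infinity>" and B: "0 <= B"
 shows "(%j. L2 S (%x. f j x *. h j x - f' x *. h' x)) ---> 0"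
proof (rule ennreal_tendsto_0_le)
 have "(%j. L2 S (%x. (f j x - f' x) *. h' x)) ---> 0"
 proof (rule L2_dominated[where h="%x. (2 * B) *. h' x"])
  show "norm ((f j x - f' x) *. h' x) <= norm ((2 * B) *. h' x)" if "x : S" for j x
  proof -
   have "\<bar>f j x - f' x\<bar> <= 2 * B" using bd(1)[OF that, of j] bd(2)[OF that] by simp
   then show ?thesis using B by (simp add: mult_right_mono)
  qed
  have "L2 S (%x. (2 * B) *. h' x) <= ennreal ((2 * B)^2) * L2 S h'"
   by (rule L2_bound_mult) (use B in auto)
  also have "\<dots> < \<infinity>" using fin by (simp add: ennreal_mult_less_top)
  finally show "L2 S (%x. (2 * B) *. h' x) < \<infinity>" .
  show "AE x\<in>S in lborel. (%j. (f j x - f' x) *. h' x) ---> 0"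
   using ae by eventually_elim (auto intro!: tendsto_eq_intros)
 qed measurable
 then show "(%j. (2 * ennreal (B\<^sup>2)) * L2 S (%x. h j x - h' x) + 2 * L2 S (%x. (f j x - f' x) *. h' x)) ---> 0"
  by (intro ennreal_tendsto_0_lincomb[OF lim]) (auto simp: ennreal_mult_less_top)
 fix j
 have "L2 S (%x. f j x *. h j x - f' x *. h' x) = L2 S (%x. f j x *. (h j x - h' x) + (f j x - f' x) *. h' x)"
  by (simp add: algebra_simps)
 also have "\<dots> <= 2 * L2 S (%x. f j x *. (h j x - h' x)) + 2 * L2 S (%x. (f j x - f' x) *. h' x)"
  by (rule L2_add) measurable
 also have "\<dots> <= 2 * (ennreal (B\<^sup>2) * L2 S (%x. h j x - h' x)) + 2 * L2 S (%x. (f j x - f' x) *. h' x)"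
  by (intro add_mono mult_left_mono L2_bound_mult) (use B bd in \<open>auto intro!: mult_right_mono\<close>)
 finally show "L2 S (%x. f j x *. h j x - f' x *. h' x) <=
  (2 * ennreal (B\<^sup>2)) * L2 S (%x. h j x - h' x) + 2 * L2 S (%x. (f j x - f' x) *. h' x)"
  by (simp add: mult.assoc)
qed

text \<open>Products of L^2 functions are controlled when the factors are bounded, and this
  uniformly along the approximating sequences; hence the bounds on the members of X and Y
  themselves.\<close>

lemma approx_mult:
 fixes u v :: "real^'n => real"
 assumes a: "approx S X u g" "approx S Y v h"
  and bd: "!!w x. w : X ==> \<bar>w x\<bar> <= B" "!!w x. w : Y ==> \<bar>w x\<bar> <= B"
   "!!x. x : S ==> \<bar>u x\<bar> <= B" "!!x. x : S ==> \<bar>v x\<bar> <= B" "0 <= B"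
  and Z: "!!w w'. w : X ==> w' : Y ==> (%x. w x * w' x) : Z" "Z <= Collect C1"
 shows "approx S Z (%x. u x * v x) (%x. u x *. h x + v x *. g x)"
proof -
 note [measurable] = approxD(1,3,4)[OF a(1)] approxD(1,3,4)[OF a(2)]
 obtain w where w: "!!j::nat. w j : X" "!!j. C1 (w j)"
  "(%j. L2 S (%x. w j x - u x)) ---> 0" "(%j. L2 S (%x. grad (w j) x - g x)) ---> 0"
  "AE x\<in>S in lborel. (%j. w j x) ---> u x"
  using approx_sequence[OF a(1)] by blast
 obtain w' where w': "!!j::nat. w' j : Y" "!!j. C1 (w' j)"
  "(%j. L2 S (%x. w' j x - v x)) ---> 0" "(%j. L2 S (%x. grad (w' j) x - h x)) ---> 0"
  "AE x\<in>S in lborel. (%j. w' j x) ---> v x"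
  using approx_sequence[OF a(2)] by blast
 note [measurable] = C1_measurable[OF w(2)] grad_measurable[OF w(2)] C1_measurable[OF w'(2)] grad_measurable[OF w'(2)]
 note bw = bd(1)[OF w(1)] bd(2)[OF w'(1)]
 have l1: "(%j. L2 S (%x. w j x *. w' j x - u x *. v x)) ---> 0"
  by (rule L2_tendsto_mult[where B=B]) (use w w' bw bd approxD(5)[OF a(2)] in auto)
 have l2: "(%j. L2 S (%x. w j x *. grad (w' j) x - u x *. h x)) ---> 0"
  by (rule L2_tendsto_mult[where B=B]) (use w w' bw bd approxD(6)[OF a(2)] in auto)
 have l3: "(%j. L2 S (%x. w' j x *. grad (w j) x - v x *. g x)) ---> 0"
  by (rule L2_tendsto_mult[where B=B]) (use w w' bw bd approxD(6)[OF a(1)] in auto)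
 have fin: "L2 S (%x. f x *. k x) < \<infinity>"
  if "L2 S k < \<infinity>" "!!x. x : S ==> \<bar>f x\<bar> <= B" "k : Borel" for f and k :: "real^'n => 'c::euclidean_space"
 proof -
  have "L2 S (%x. f x *. k x) <= ennreal (B\<^sup>2) * L2 S k"
   by (rule L2_bound_mult) (use that bd(5) in \<open>auto intro!: mult_right_mono\<close>)
  also have "\<dots> < \<infinity>" using that by (simp add: ennreal_mult_less_top)
  finally show ?thesis .
 qed
 show ?thesis
 proof (rule approxI[where w="%j x. w j x * w' j x"])
  show "L2 S (%x. u x * v x) < \<infinity>" using fin[of v u] approxD(5)[OF a(2)] bd by simp
  have "L2 S (%x. u x *. h x + v x *. g x) <= 2 * L2 S (%x. u x *. h x) + 2 * L2 S (%x. v x *. g x)"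
   by (rule L2_add) measurable
  also have "\<dots> < \<infinity>" using fin[of h u] fin[of g v] approxD(6)[OF a(1)] approxD(6)[OF a(2)] bd
   by (simp add: ennreal_mult_less_top)
  finally show "L2 S (%x. u x *. h x + v x *. g x) < \<infinity>" .
  show "(%j. L2 S (%x. w j x * w' j x - u x * v x)) ---> 0" using l1 by simp
  show "(%j. L2 S (%x. grad (%x. w j x * w' j x) x - (u x *. h x + v x *. g x))) ---> 0"
  proof (rule ennreal_tendsto_0_le[OF ennreal_tendsto_0_lincomb[OF l2 l3, of 2 2]])
   fix j
   have "L2 S (%x. grad (%x. w j x * w' j x) x - (u x *. h x + v x *. g x))
    = L2 S (%x. (w j x *. grad (w' j) x - u x *. h x) + (w' j x *. grad (w j) x - v x *. g x))"
    unfolding grad_mult[OF w(2) w'(2)] by (simp add: add_diff_add)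
   also have "\<dots> <= 2 * L2 S (%x. w j x *. grad (w' j) x - u x *. h x) + 2 * L2 S (%x. w' j x *. grad (w j) x - v x *. g x)"
    by (rule L2_add) measurable
   finally show "L2 S (%x. grad (%x. w j x * w' j x) x - (u x *. h x + v x *. g x))
    <= 2 * L2 S (%x. w j x *. grad (w' j) x - u x *. h x) + 2 * L2 S (%x. w' j x *. grad (w j) x - v x *. g x)" .
  qed auto
 qed (use w w' Z in auto)
qed

subsection \<open>Truncations and cut-offs\<close>

lemma DERIV_join:
 fixes f g :: "real => real"
 assumes "!!t. t <= a ==> (f has_real_derivative f' t) (at t)"
  "!!t. t \<ge> a ==> (g has_real_derivative g' t) (at t)" "f a = g a" "f' a = g' a"
 shows "((%t. if t <= a then f t else g t) has_real_derivative (if t <= a then f' t else g' t)) (at t)"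
proof -
 have "((%t. if t : {..a} then f t else g t) has_vector_derivative (if t : {..a} then f' t else g' t)) (at t within UNIV)"
  by (rule has_vector_derivative_If_within_closures[where T="{a<..}"])
   (use assms in \<open>auto simp: has_real_derivative_iff_has_vector_derivative[symmetric] has_field_derivative_at_within\<close>)
 then show ?thesis by (simp add: has_real_derivative_iff_has_vector_derivative)
qed

lemma continuous_join:
 fixes f g :: "real => real"
 assumes "continuous_on {..a} f" "continuous_on {a..} g" "f a = g a"
 shows "continuous_on UNIV (%t. if t <= a then f t else g t)"
 using assms by (intro continuous_on_cases_le) (auto intro: continuous_on_subset continuous_intros)

text \<open>A C^1 substitute for the positive part, below it and within e of it. This formula also
  satisfies \<open>smooth_pos_le\<close>, the relation between value and derivative that
  Caccioppoli's inequality asks for.\<close>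

definition smooth_pos :: "real => real => real" where
 "smooth_pos e t = (if t <= 0 then 0 else t\<^sup>2 / (t + e))"

definition smooth_pos' :: "real => real => real" where
 "smooth_pos' e t = (if t <= 0 then 0 else 1 - (e / (t + e))\<^sup>2)"

lemma smooth_pos_deriv:
 assumes "e > 0"
 shows "(smooth_pos e has_real_derivative smooth_pos' e t) (at t)"
proof -
 have "((%t. if t <= 0 then 0 else t\<^sup>2 / (t + e)) has_real_derivative
   (if t <= 0 then 0 else 1 - (e / (t + e))\<^sup>2)) (at t)"
 proof (rule DERIV_join)
  fix t :: real assume "0 <= t"
  then have "((%t. t\<^sup>2 / (t + e)) has_real_derivative (2 * t * (t + e) - t\<^sup>2) / (t + e)^2) (at t)"
   using assms by (auto intro!: derivative_eq_intros simp: power2_eq_square)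
  moreover have "(2 * t * (t + e) - t\<^sup>2) / (t + e)^2 = 1 - (e / (t + e))\<^sup>2"
  proof -
   have "2 * t * (t + e) - t\<^sup>2 = (t + e)^2 - e\<^sup>2" by (simp add: power2_eq_square algebra_simps)
   then show ?thesis using assms \<open>0 <= t\<close> by (simp add: power_divide diff_divide_distrib)
  qed
  ultimately show "((%t. t\<^sup>2 / (t + e)) has_real_derivative 1 - (e / (t + e))\<^sup>2) (at t)" by simp
 qed (use assms in auto)
 then show ?thesis by (simp add: smooth_pos_def[abs_def] smooth_pos'_def)
qed

lemma smooth_pos'_continuous:
 assumes "e > 0"
 shows "continuous_on UNIV (smooth_pos' e)"
 unfolding smooth_pos'_def[abs_def]
 by (rule continuous_join) (use assms in \<open>auto intro!: continuous_intros\<close>)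

lemma smooth_pos'_bounds:
 assumes "e > 0"
 shows "0 <= smooth_pos' e t" "smooth_pos' e t <= 1"
proof -
 have "(e / (t + e))^2 <= 1" if "t > 0"
  using assms that by (intro power_le_one) auto
 then show "0 <= smooth_pos' e t" "smooth_pos' e t <= 1" by (auto simp: smooth_pos'_def)
qed

lemma smooth_pos_bounds:
 assumes "e > 0"
 shows "0 <= smooth_pos e t" "smooth_pos e t <= max t 0"
 using assms by (auto simp: smooth_pos_def max_def power2_eq_square field_simps)

lemma smooth_pos_error:
 assumes "e > 0"
 shows "\<bar>smooth_pos e t - max t 0\<bar> <= e"
proof (cases "t <= 0")
 case False
 then have "t\<^sup>2 / (t + e) - t = - (e * t / (t + e))"
  using assms by (simp add: field_simps power2_eq_square)
 moreover have "e * t / (t + e) <= e" using False assms by (simp add: field_simps)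
 moreover have "0 <= e * t / (t + e)" using False assms by simp
 ultimately show ?thesis using False by (simp add: smooth_pos_def)
qed (use assms in \<open>simp add: smooth_pos_def\<close>)

lemma C1_smooth_pos: "C1 w ==> e > 0 ==> C1 (%x. smooth_pos e (w x))"
 by (rule C1_compose[OF _ smooth_pos_deriv smooth_pos'_continuous])

lemma smooth_pos'_tendsto: "(%j. smooth_pos' (1 / Suc j) t) ---> (if t > 0 then 1 else 0)"
proof (cases "t > 0")
 case True
 have "(%j. 1 - (inverse (real (Suc j)) / (t + inverse (real (Suc j))))\<^sup>2) ---> 1 - (0 / (t + 0))\<^sup>2"
  using True by (intro tendsto_intros LIMSEQ_inverse_real_of_nat) auto
 then show ?thesis using True by (simp add: smooth_pos'_def inverse_eq_divide)
qed (simp add: smooth_pos'_def)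

lemma smooth_pos_tendsto: "(%j. smooth_pos (1 / Suc j) t) ---> max t 0"
proof -
 have "(%j. smooth_pos (1 / Suc j) t - max t 0) ---> 0"
  by (rule Lim_null_comparison[OF _ LIMSEQ_inverse_real_of_nat])
   (use smooth_pos_error[of "1 / real (Suc j)" t for j] in \<open>auto simp: inverse_eq_divide\<close>)
 then show ?thesis by (simp add: LIM_zero_iff)
qed

lemma smooth_pos_measurable: "e > 0 ==> smooth_pos e : Borel"
 unfolding smooth_pos_def[abs_def] by measurable

lemma smooth_pos'_measurable: "e > 0 ==> smooth_pos' e : Borel"
 by (rule borel_measurable_continuous_onI[OF smooth_pos'_continuous])

text \<open>The derivatives of the smoothings tend to the indicator of {t > 0}, with value 0 at t =
  0; therefore the gradient is cut off to the strict superlevel set.\<close>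

lemma approx_pos:
 assumes a: "approx S X u g"
  and Y: "!!w e. w : X ==> e > 0 ==> (%x. smooth_pos e (w x)) : Y" "Y <= Collect C1"
 shows "approx S Y (%x. max (u x) 0) (%x. if u x > 0 then g x else 0)"
proof (rule approx_limit[where u'="%j x. smooth_pos (1 / Suc j) (u x)" and g'="%j x. smooth_pos' (1 / Suc j) (u x) *. g x"])
 note [measurable] = approxD(1,3,4)[OF a] smooth_pos_measurable smooth_pos'_measurable
 have bd: "norm (smooth_pos e t) <= norm t" if "e > 0" for e t
  using smooth_pos_bounds[OF that, of t] by (auto simp: max_def split: if_splits)
 show "approx S Y (%x. smooth_pos (1 / Suc j) (u x)) (%x. smooth_pos' (1 / Suc j) (u x) *. g x)" for j
 proof (rule approx_chain[OF a, where M=1])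
  have "L2 S (%x. smooth_pos (1 / real (Suc j)) (u x)) <= L2 S u"
   by (rule L2_mono) (rule bd, simp)
  then show "L2 S (%x. smooth_pos (1 / real (Suc j)) (u x)) < \<infinity>"
   using approxD(5)[OF a] by (rule le_less_trans)
 qed (use Y smooth_pos_deriv smooth_pos'_continuous smooth_pos'_bounds[of "1 / real (Suc j)"] in auto)
 show "(%j. L2 S (%x. smooth_pos (1 / Suc j) (u x) - max (u x) 0)) ---> 0"
 proof (rule L2_dominated[where h=u])
  show "norm (smooth_pos (1 / Suc j) (u x) - max (u x) 0) <= norm (u x)" for j x
   using smooth_pos_bounds[of "1 / Suc j" "u x"] by (auto simp: max_def split: if_splits)
  show "AE x\<in>S in lborel. (%j. smooth_pos (1 / Suc j) (u x) - max (u x) 0) ---> 0"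
   using smooth_pos_tendsto by (auto simp: LIM_zero_iff)
 qed (use approxD(5)[OF a] in auto)
 show "(%j. L2 S (%x. smooth_pos' (1 / Suc j) (u x) *. g x - (if u x > 0 then g x else 0))) ---> 0"
 proof (rule L2_dominated[where h=g])
  show "norm (smooth_pos' (1 / Suc j) (u x) *. g x - (if u x > 0 then g x else 0)) <= norm (g x)" for j x
  proof -
   define s where "s = smooth_pos' (1 / Suc j) (u x)"
   have s: "0 <= s" "s <= 1" using smooth_pos'_bounds[of "1 / Suc j"] by (auto simp: s_def)
   have "s *. g x - (if u x > 0 then g x else 0) = (s - (if u x > 0 then 1 else 0)) *. g x"
    by (simp add: scaleR_left_diff_distrib)
   then have "norm (s *. g x - (if u x > 0 then g x else 0)) = \<bar>s - (if u x > 0 then 1 else 0)\<bar> * norm (g x)"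
    by simp
   also have "\<dots> <= 1 * norm (g x)"
   proof (rule mult_right_mono)
    show "\<bar>s - (if u x > 0 then 1 else 0)\<bar> <= 1" using s by auto
   qed simp
   finally show ?thesis by (simp add: s_def)
  qed
  show "AE x\<in>S in lborel. (%j. smooth_pos' (1 / Suc j) (u x) *. g x - (if u x > 0 then g x else 0)) ---> 0"
  proof (rule AE_I2, rule impI)
   fix x
   have "(%j. smooth_pos' (1 / Suc j) (u x) *. g x) ---> (if u x > 0 then 1 else 0) *. g x"
    by (intro tendsto_intros smooth_pos'_tendsto)
   then show "(%j. smooth_pos' (1 / Suc j) (u x) *. g x - (if u x > 0 then g x else 0)) ---> 0"
    by (simp add: LIM_zero_iff if_distrib[of "%t. t *. _"] cong: if_cong)
  qed
 qed (use approxD(6)[OF a] in auto)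
qed (use approxD(3,4)[OF a] in auto)

definition step :: "real => real" where
 "step y = (if y <= 0 then 0 else if y <= 1 then 3 * y\<^sup>2 - 2 * y ^ 3 else 1)"

definition step' :: "real => real" where
 "step' y = (if y <= 0 then 0 else if y <= 1 then 6 * y - 6 * y\<^sup>2 else 0)"

lemma step_deriv: "(step has_real_derivative step' y) (at y)"
proof -
 have *: "((%y. if y <= 1 then 3 * y\<^sup>2 - 2 * y ^ 3 else 1) has_real_derivative
   (if y <= 1 then 6 * y - 6 * y\<^sup>2 else 0)) (at y)" for y :: real
  by (rule DERIV_join) (auto intro!: derivative_eq_intros simp: power2_eq_square)
 have "((%y. if y <= 0 then 0 else if y <= 1 then 3 * y\<^sup>2 - 2 * y ^ 3 else 1) has_real_derivative
   (if y <= 0 then 0 else if y <= 1 then 6 * y - 6 * y\<^sup>2 else 0)) (at y)"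
  by (rule DERIV_join[OF _ *]) auto
 then show ?thesis by (simp add: step_def[abs_def] step'_def)
qed

lemma step'_continuous: "continuous_on UNIV step'"
proof -
 have *: "continuous_on UNIV (%y::real. if y <= 1 then 6 * y - 6 * y\<^sup>2 else 0)"
  by (rule continuous_join) (auto intro!: continuous_intros)
 show ?thesis unfolding step'_def[abs_def]
  by (rule continuous_join) (auto intro!: continuous_intros continuous_on_subset[OF *])
qed

lemma step'_bound: "\<bar>step' y\<bar> <= 3 / 2"
proof (cases "0 < y & y <= 1")
 case True
 have "6 * y - 6 * y\<^sup>2 = 3 / 2 - 6 * (y - 1 / 2)^2" by (simp add: power2_eq_square algebra_simps)
 moreover have "0 <= 6 * y * (1 - y)" using True by simp
 moreover have "0 <= (y - 1 / 2)^2" by simp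
 moreover have "6 * y * (1 - y) = 6 * y - 6 * y\<^sup>2" by (simp add: power2_eq_square algebra_simps)
 ultimately have "0 <= 6 * y - 6 * y\<^sup>2" "6 * y - 6 * y\<^sup>2 <= 3 / 2" by linarith+
 then show ?thesis using True by (simp add: step'_def)
qed (auto simp: step'_def)

lemma step_bounds: "0 <= step y" "step y <= 1"
proof -
 have "3 * y\<^sup>2 - 2 * y ^ 3 = y\<^sup>2 * (3 - 2 * y)" "1 - (3 * y\<^sup>2 - 2 * y ^ 3) = (1 - y)^2 * (1 + 2 * y)"
  by (simp_all add: power2_eq_square power3_eq_cube algebra_simps)
 moreover have "0 <= y\<^sup>2 * (3 - 2 * y)" "0 <= (1 - y)^2 * (1 + 2 * y)" if "0 < y" "y <= 1"
  using that by (auto intro!: mult_nonneg_nonneg)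
 ultimately show "0 <= step y" "step y <= 1" unfolding step_def by (auto, linarith)
qed

text \<open>The cubic step is applied to a quadratic function of x - z, which keeps the cut-off C^1
  at the centre. The slope 3/2 of the step times 2 |x - z| / (r2^2 - r1^2) is at most 3 / (r2 - r1),
  because |x - z| <= r2 + r1.\<close>

lemma cutoff_exists:
 fixes z :: "real^'n"
 assumes "0 <= r1" "r1 < r2"
 shows "EX \<eta>. C1 \<eta> & (ALL x. 0 <= \<eta> x & \<eta> x <= 1) & (ALL x:cball z r1. \<eta> x = 1 & grad \<eta> x = 0) &
  (ALL x. x ~: ball z r2 --> \<eta> x = 0 & grad \<eta> x = 0) & (ALL x. norm (grad \<eta> x) <= 3 / (r2 - r1))"
proof -
 define d where "d = r2\<^sup>2 - r1\<^sup>2"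
 have dd: "d = (r2 - r1) * (r2 + r1)" by (simp add: d_def power2_eq_square algebra_simps)
 have d: "d > 0" using assms unfolding dd by (intro mult_pos_pos) auto
 define q where "q = (%x::real^'n. (r2\<^sup>2 - (x - z) \<bullet> (x - z)) / d)"
 have qd: "(q has_derivative (%h. ((- 2 / d) *. (x - z)) \<bullet> h)) (at x)" for x
 proof -
  have "((%x. (x - z) \<bullet> (x - z)) has_derivative (%h. 2 * ((x - z) \<bullet> h))) (at x)"
   by (auto intro!: derivative_eq_intros simp: inner_commute)
  from has_derivative_mult_left[OF has_derivative_diff[OF has_derivative_const this], of "r2\<^sup>2" "1 / d"]
  have "((%x. (r2\<^sup>2 - (x - z) \<bullet> (x - z)) * (1 / d)) has_derivative (%h. (0 - 2 * ((x - z) \<bullet> h)) * (1 / d))) (at x)" .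
  moreover have "(%h. (0 - 2 * ((x - z) \<bullet> h)) * (1 / d)) = (%h. ((- 2 / d) *. (x - z)) \<bullet> h)" by (auto simp: fun_eq_iff)
  ultimately show ?thesis by (simp add: q_def)
 qed
 have qc: "continuous_on UNIV (%x. (- 2 / d) *. (x - z))" by (intro continuous_intros)
 have C: "C1 (%x. step (q x))"
  by (rule C1_compose[OF C1I(1)[OF qd qc] step_deriv step'_continuous])
 have gr: "grad (%x. step (q x)) x = step' (q x) *. ((- 2 / d) *. (x - z))" for x
  using grad_compose[OF C1I(1)[OF qd qc] step_deriv step'_continuous] C1I(2)[OF qd qc] by simp
 have in1: "q x \<ge> 1" if "x : cball z r1" for x
 proof -
  have "(norm (x - z))^2 <= r1\<^sup>2" using that by (intro power_mono) (auto simp: dist_norm norm_minus_commute)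
  then show ?thesis using d by (simp add: q_def dot_square_norm d_def)
 qed
 have out: "q x <= 0" if "x ~: ball z r2" for x
 proof -
  have "r2\<^sup>2 <= (norm (x - z))^2" using that assms by (intro power_mono) (auto simp: dist_norm norm_minus_commute)
  then show ?thesis using d by (simp add: q_def dot_square_norm divide_le_0_iff)
 qed
 have gb: "norm (grad (%x. step (q x)) x) <= 3 / (r2 - r1)" for x
 proof (cases "x : ball z r2")
  case True
  then have n: "norm (x - z) <= r2 + r1" using assms by (auto simp: dist_norm norm_minus_commute)
  have "\<bar>- 2 / d\<bar> = 2 / d" using d by simp
  then have "norm (grad (%x. step (q x)) x) = \<bar>step' (q x)\<bar> * (2 / d * norm (x - z))"
   by (simp only: gr norm_scaleR)
  also have "\<dots> <= 3 / 2 * (2 / d * (r2 + r1))"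
   using d n assms by (intro mult_mono step'_bound) auto
  also have "\<dots> = 3 * (r2 + r1) / ((r2 - r1) * (r2 + r1))" unfolding dd by (simp add: divide_simps)
  also have "\<dots> = 3 / (r2 - r1)" using assms by (simp add: divide_simps)
  finally show ?thesis .
 next
  case False
  then show ?thesis using out[OF False] assms by (simp add: gr step'_def)
 qed
 show ?thesis
 proof (intro exI[of _ "%x. step (q x)"] conjI ballI allI impI)
  fix x assume "x : cball z r1"
  from in1[OF this] show "step (q x) = 1" "grad (%x. step (q x)) x = 0"
   unfolding gr by (auto simp: step_def step'_def power2_eq_square)
 next
  fix x assume "x ~: ball z r2"
  from out[OF this] show "step (q x) = 0" "grad (%x. step (q x)) x = 0"
   unfolding gr by (auto simp: step_def step'_def)
 qed (use C gb step_bounds in auto)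
qed

subsection \<open>Test functions\<close>

text \<open>The cut-offs and products built below are only C^1, whereas the weak equations are given
  for smooth test functions; \<open>test_fun_dense\<close> connects the two.\<close>

definition C1c :: "(real^'n) set => (real^'n => real) set" where
 "C1c U = {\<phi>. C1 \<phi> & (EX K. compact K & K <= U & (ALL x. x ~: K --> \<phi> x = 0))}"

lemma C1cI: "C1 \<phi> ==> compact K ==> K <= U ==> (!!x. x ~: K ==> \<phi> x = 0) ==> \<phi> : C1c U"
 by (auto simp: C1c_def)

lemma C1c_C1: "\<phi> : C1c U ==> C1 \<phi>"
 by (simp add: C1c_def)

lemma C1c_mono: "\<phi> : C1c U ==> U <= V ==> \<phi> : C1c V"
 unfolding C1c_def by blast

lemma C1c_mult: "\<eta> : C1c U ==> C1 f ==> (%x. \<eta> x * f x) : C1c U"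
 unfolding C1c_def using C1_mult[of \<eta> f] by auto

lemma C1c_zero:
 assumes "\<phi> : C1c U" "x ~: U"
 shows "\<phi> x = 0" "grad \<phi> x = 0"
proof -
 obtain K where K: "compact K" "K <= U" "ALL x. x ~: K --> \<phi> x = 0" using assms by (auto simp: C1c_def)
 then show "\<phi> x = 0" using assms by blast
 show "grad \<phi> x = 0"
  by (rule grad_zero_outside[of K]) (use K assms compact_imp_closed in auto)
qed

lemma C1c_bounded:
 assumes "\<phi> : C1c U"
 shows "EX B>0. (ALL x. \<bar>\<phi> x\<bar> <= B) & (ALL x. norm (grad \<phi> x) <= B)"
proof -
 obtain K where K: "compact K" "K <= U" "ALL x. x ~: K --> \<phi> x = 0" "C1 \<phi>" using assms by (auto simp: C1c_def)
 have "ALL x. x ~: K --> grad \<phi> x = 0"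
  using grad_zero_outside[of K \<phi>] K compact_imp_closed by blast
 from bounded_compact_support[OF C1_continuous_grad[OF K(4)] this K(1)]
  bounded_compact_support[OF C1_continuous[OF K(4)] K(3,1)]
 obtain B B' where "B > 0" "B' > 0" "ALL z. norm (grad \<phi> z) <= B" "ALL z. norm (\<phi> z) <= B'" by blast
 then show ?thesis by (intro exI[of _ "max B B'"]) (auto simp: max_def intro: order_trans)
qed

lemma integral_reflect:
 fixes f :: "real^'n => real"
 assumes [measurable]: "f : Borel"
 shows "(LBINT y. f (x - y)) = (LBINT y. f y)"
proof -
 have "lborel = distr lborel borel (%y::real^'n. x - y)"
  using lborel_affine[of "-1" x] by (simp add: density_1)
 then have "(LBINT y. f y) = (\<integral>y. f y \<partial>distr lborel borel (%y. x - y))" by simp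
 also have "\<dots> = (LBINT y. f (x - y))" by (rule integral_distr) measurable
 finally show ?thesis by simp
qed

lemma conv_commute:
 assumes [measurable]: "\<kappa> : Borel" "f : Borel"
 shows "conv \<kappa> f = conv f \<kappa>"
proof
 fix x
 show "conv \<kappa> f x = conv f \<kappa> x"
  unfolding conv_def using integral_reflect[of "%y. \<kappa> (x - y) * f y" x] by (simp add: mult.commute)
qed

lemma C1c_integrable:
 assumes "continuous_on UNIV f" "compact K" "ALL x. x ~: K --> f x = 0"
 shows "integrable lborel (f :: real^'n => real)"
proof -
 have "integrable lborel (%x. ind K x *. f x)"
  using assms by (intro borel_integrable_compact) (auto intro: continuous_on_subset)
 moreover have "(%x. ind K x *. f x) = f" using assms(3) by force
 ultimately show ?thesis by simp
qed

text \<open>The convolution of \<phi> with the indicator of a large ball is constant near 0, and its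
  derivative at 0 is the integral of the partial derivative.\<close>

lemma integral_pderiv_zero:
 fixes \<phi> :: "real^'n => real"
 assumes "\<phi> : C1c UNIV"
 shows "(LBINT x. pderiv \<phi> i x) = 0"
proof -
 obtain K where K: "C1 \<phi>" "compact K" "ALL x. x ~: K --> \<phi> x = 0" using assms by (auto simp: C1c_def)
 obtain e where e: "e > 0" "K <= cball 0 e"
  using compact_imp_bounded[OF K(2)] by (metis bounded_pos mem_cball_0 subsetI)
 have z: "ALL x. x ~: cball 0 e --> \<phi> x = 0" using K(3) e(2) by blast
 have pz: "ALL x. x ~: cball 0 e --> pderiv \<phi> i x = 0"
  using pderiv_zero_outside[of "cball 0 e" \<phi>] z by auto
 have m1: "\<phi> : Borel" using K C1_measurable by blast
 have "continuous_on UNIV (%x. grad \<phi> x $ i)"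
  by (intro continuous_intros C1_continuous_grad K)
 then have m2: "pderiv \<phi> i : Borel"
  by (simp add: grad_def borel_measurable_continuous_onI)
 define f where "f = (ind (ball (0::real^'n) (e + 1)) :: _ => real)"
 have f: "integrable lborel f"
  unfolding f_def using emeasure_lborel_ball_finite[of "0::real^'n" "e + 1"] by (intro integrable_real_indicator) auto
 have "conv \<phi> f x = (LBINT y. \<phi> y)" if "x : ball 0 1" for x
 proof -
  have "\<phi> (x - y) * f y = \<phi> (x - y)" for y
  proof (cases "y : ball 0 (e + 1)")
   case False
   then have "x - y ~: cball 0 e" using that norm_triangle_ineq3[of y x] by (auto simp: norm_minus_commute)
   then show ?thesis using z by simp
  qed (simp add: f_def)
  then have "(%y. \<phi> (x - y) * f y) = (%y. \<phi> (x - y))" by (rule ext)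
  then show ?thesis unfolding conv_def using integral_reflect[OF m1, of x] by simp
 qed
 note c = this
 have d: "((%x::real^'n. LBINT y. \<phi> y) has_derivative (%h. 0)) (at 0)" by simp
 have "((conv \<phi> f) has_derivative (%h. 0)) (at 0)"
  by (rule has_derivative_transform_within_open[OF d open_ball[of 0 1]]) (use c in auto)
 from pderiv_eq[OF this, of i] have "conv (pderiv \<phi> i) f 0 = 0"
  using conv_pderiv[OF K(1) z f] by simp
 moreover have "conv (pderiv \<phi> i) f 0 = (LBINT y. pderiv \<phi> i y)"
 proof -
  have "pderiv \<phi> i (0 - y) * f y = pderiv \<phi> i (0 - y)" for y
   using pz by (cases "y : ball 0 (e + 1)") (auto simp: f_def)
  then have "(%y. pderiv \<phi> i (0 - y) * f y) = (%y. pderiv \<phi> i (0 - y))" by (rule ext)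
  then show ?thesis unfolding conv_def using integral_reflect[OF m2, of 0] by simp
 qed
 ultimately show ?thesis by simp
qed

lemma conv_kernel_uniform:
 assumes k: "kernel d \<rho>" and f: "continuous_on UNIV f" "compact K" "ALL x. x ~: K --> f x = 0"
  and osc: "!!x y. norm (x - y) < d ==> \<bar>f y - f x\<bar> <= \<epsilon>" and "0 <= \<epsilon>"
 shows "\<bar>conv \<rho> f x - f x\<bar> <= \<epsilon>"
proof -
 have [measurable]: "\<rho> : Borel" "f : Borel"
  using kernel_measurable[OF k] f(1) borel_measurable_continuous_onI by auto
 have "ennreal \<bar>conv \<rho> f x - f x\<bar> <= (NN y. ennreal (\<rho> (x - y)) * ennreal \<bar>f y - f x\<bar>)"
  by (rule conv_diff_le[OF k C1c_integrable[OF f]])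
 also have "\<dots> <= (NN y. ennreal (\<rho> (x - y)) * ennreal \<epsilon>)"
 proof (rule nn_integral_mono)
  fix y
  show "ennreal (\<rho> (x - y)) * ennreal \<bar>f y - f x\<bar> <= ennreal (\<rho> (x - y)) * ennreal \<epsilon>"
   using osc[of x y] k by (cases "norm (x - y) < d") (auto simp: kernel_def intro!: mult_left_mono ennreal_leI)
 qed
 also have "\<dots> = ennreal \<epsilon>" using kernel_reflect_integral[OF k, of x] by (simp add: nn_integral_multc)
 finally show ?thesis using \<open>0 <= \<epsilon>\<close> by simp
qed

text \<open>Mollification at a scale below the distance of the support to the complement of U. All
  approximants live in one compact set K', so that a merely locally integrable field can be
  integrated against them in \<open>integral_grad_C1c\<close>.\<close>

lemma test_fun_dense:
 fixes \<phi> :: "real^'n => real"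
 assumes "\<phi> : C1c U" "open U"
 shows "EX K'. compact K' & K' <= U & (ALL x. x ~: K' --> \<phi> x = 0) &
  (ALL \<epsilon>>0. EX \<psi>. test_fun U \<psi> & (ALL x. x ~: K' --> \<psi> x = 0) & (ALL x. \<bar>\<psi> x - \<phi> x\<bar> <= \<epsilon>) &
   (ALL x. norm (grad \<psi> x - grad \<phi> x) <= \<epsilon>))"
proof -
 obtain K where K: "C1 \<phi>" "compact K" "K <= U" "ALL x. x ~: K --> \<phi> x = 0" using assms by (auto simp: C1c_def)
 obtain e where e: "e > 0" "(\<Union>x\<in>K. cball x e) <= U"
  using compact_subset_open_imp_cball_epsilon_subset[OF K(2) assms(2) K(3)] by blast
 define K' where "K' = {x + y | x y. x : K & y : cball 0 e}"
 have cK': "compact K'" unfolding K'_def using K(2) compact_cball by (rule compact_sums)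
 have K'U: "K' <= U" using e(2) by (force simp: K'_def dist_norm)
 have KK': "K <= K'" unfolding K'_def using e(1) by force
 obtain R where R: "R > 0" "K <= cball 0 R"
  using compact_imp_bounded[OF K(2)] by (metis bounded_pos mem_cball_0 subsetI)
 have z: "ALL x. x ~: cball 0 R --> \<phi> x = 0" using K(4) R(2) by blast
 have gz: "ALL x. x ~: cball 0 R --> grad \<phi> x = 0"
  using grad_zero_outside[of "cball 0 R" \<phi>] z by auto
 have gzK: "ALL x. x ~: K --> grad \<phi> x = 0"
  using grad_zero_outside[of K \<phi>] K compact_imp_closed by blast
 have [measurable]: "\<phi> : Borel" using K C1_measurable by blast
 have "EX \<psi>. test_fun U \<psi> & (ALL x. x ~: K' --> \<psi> x = 0) & (ALL x. \<bar>\<psi> x - \<phi> x\<bar> <= \<epsilon>) &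
   (ALL x. norm (grad \<psi> x - grad \<phi> x) <= \<epsilon>)" if "\<epsilon> > 0" for \<epsilon> :: real
 proof -
  \<comment> \<open>The norm of a vector is at most the sum of the absolute values of its
    components, each of which will be bounded by \<delta>.\<close>
  define \<delta> where "\<delta> = \<epsilon> / CARD('n)"
  have \<delta>: "\<delta> > 0" "\<delta> <= \<epsilon>" using that by (auto simp: \<delta>_def field_simps)
  obtain d1 where d1: "d1 > 0" "!!a b. dist a b < d1 ==> dist (\<phi> a) (\<phi> b) < \<delta>"
   using uniformly_continuous_compact_support[OF C1_continuous[OF K(1)] z] \<delta>
   unfolding uniformly_continuous_on_def by (metis UNIV_I)
  obtain d2 where d2: "d2 > 0" "!!a b. dist a b < d2 ==> dist (grad \<phi> a) (grad \<phi> b) < \<delta>"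
   using uniformly_continuous_compact_support[OF C1_continuous_grad[OF K(1)] gz] \<delta>
   unfolding uniformly_continuous_on_def by (metis UNIV_I)
  define d where "d = min e (min d1 d2)"
  have d: "d > 0" "d <= e" "d <= d1" "d <= d2" using d1 d2 e by (auto simp: d_def)
  obtain \<rho> :: "real^'n => real" where k: "kernel d \<rho>" using kernel_exists[OF d(1)] by blast
  have [measurable]: "\<rho> : Borel" by (rule kernel_measurable[OF k])
  have ir: "integrable lborel \<rho>"
   using k by (intro integrableI_nonneg) (auto simp: kernel_def)
  define \<psi> where "\<psi> = conv \<rho> \<phi>"
  have \<psi>': "\<psi> = conv \<phi> \<rho>" unfolding \<psi>_def by (rule conv_commute) measurable
  have i\<phi>: "integrable lborel \<phi>" by (rule C1c_integrable[OF C1_continuous[OF K(1)] K(2,4)])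
  have zero: "\<psi> x = 0" if "x ~: K'" for x
  proof -
   have "\<rho> (x - y) * \<phi> y = 0" for y
   proof (cases "y : K")
    case True
    have "x = y + (x - y)" by simp
    then have "x - y ~: cball 0 e" using that True unfolding K'_def by blast
    then show ?thesis using k d by (auto simp: kernel_def)
   qed (use K(4) in auto)
   then have "(%y. \<rho> (x - y) * \<phi> y) = (%y. 0)" by (rule ext)
   then show ?thesis unfolding \<psi>_def conv_def by simp
  qed
  have pc: "continuous_on UNIV (pderiv \<phi> i)" for i
  proof -
   have "continuous_on UNIV (%x. grad \<phi> x $ i)" by (intro continuous_intros C1_continuous_grad K)
   then show ?thesis by (simp add: grad_def)
  qed
  have pd: "pderiv \<psi> i x = conv \<rho> (pderiv \<phi> i) x" for i x
  proof -
   have "pderiv \<psi> i x = conv (pderiv \<phi> i) \<rho> x" unfolding \<psi>' by (rule conv_pderiv[OF K(1) z ir])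
   also have "conv (pderiv \<phi> i) \<rho> = conv \<rho> (pderiv \<phi> i)"
    by (rule conv_commute) (use borel_measurable_continuous_onI[OF pc] in auto)
   finally show ?thesis .
  qed
  have pdiff: "\<bar>pderiv \<psi> i x - pderiv \<phi> i x\<bar> <= \<delta>" for i x
   unfolding pd
  proof (rule conv_kernel_uniform[OF k pc K(2)])
   show "ALL x. x ~: K --> pderiv \<phi> i x = 0" using gzK by (simp add: grad_def vec_eq_iff)
   show "\<bar>pderiv \<phi> i y - pderiv \<phi> i x\<bar> <= \<delta>" if "norm (x - y) < d" for x y
   proof -
    have "\<bar>(grad \<phi> y - grad \<phi> x) $ i\<bar> <= norm (grad \<phi> y - grad \<phi> x)" by (rule component_le_norm_cart)
    also have "\<dots> <= \<delta>" using d2(2)[of x y] d that by (simp add: dist_norm norm_minus_commute)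
    finally show ?thesis by (simp add: grad_def)
   qed
  qed (use \<delta> in auto)
  have "norm (grad \<psi> x - grad \<phi> x) <= \<epsilon>" for x
  proof -
   have "norm (grad \<psi> x - grad \<phi> x) <= (\<Sum>i\<in>UNIV. \<bar>(grad \<psi> x - grad \<phi> x) $ i\<bar>)" by (rule norm_le_l1_cart)
   also have "\<dots> <= (\<Sum>i\<in>(UNIV::'n set). \<delta>)" by (intro sum_mono) (simp add: grad_def pdiff)
   also have "\<dots> = \<epsilon>" by (simp add: \<delta>_def)
   finally show ?thesis .
  qed
  moreover have "\<bar>\<psi> x - \<phi> x\<bar> <= \<epsilon>" for x
   unfolding \<psi>_def
  proof (rule conv_kernel_uniform[OF k C1_continuous[OF K(1)] K(2,4)])
   show "\<bar>\<phi> y - \<phi> x\<bar> <= \<epsilon>" if "norm (x - y) < d" for x y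
    using d1(2)[of x y] d that \<delta> by (simp add: dist_norm norm_minus_commute dist_real_def)
  qed (use that in auto)
  moreover have "test_fun U \<psi>"
   by (rule test_funI[where K=K']) (use conv_kernel_smooth[OF k i\<phi>] zero cK' K'U in \<open>auto simp: \<psi>_def\<close>)
  ultimately show ?thesis using zero by blast
 qed
 then show ?thesis using cK' K'U KK' K(4) by (intro exI[of _ K']) auto
qed

subsection \<open>Weak gradients\<close>

text \<open>The integration by parts identity alone, with respect to the Borel measure;
  integrability is stated where it is used.\<close>

definition wgrad :: "(real^'n) set => (real^'n => real) => (real^'n => real^'n) => bool" where
 "wgrad U u g \<longleftrightarrow> (ALL \<phi> i. test_fun U \<phi> -->
  (LBINT x. u x * pderiv \<phi> i x) = - (LBINT x. g x $ i * \<phi> x))"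

lemma L2_components:
 fixes f :: "'a::euclidean_space => real^'n"
 assumes [measurable]: "f : Borel" "S : sets borel"
 shows "L2 S f = (\<Sum>i\<in>UNIV. L2 S (%x. f x $ i))"
proof -
 have [measurable]: "(%x. f x $ i) : Borel" for i
  using borel_measurable_inner[OF assms(1) borel_measurable_const, of "axis i 1"] by (simp add: inner_axis)
 have n2: "(norm v)^2 = (\<Sum>i\<in>UNIV. (v $ i)^2)" for v :: "real^'n"
  unfolding power2_norm_eq_inner by (simp add: inner_vec_def power2_eq_square)
 have "ennreal ((norm (f x))^2) * ind S x = (\<Sum>i\<in>UNIV. ennreal ((norm (f x $ i))^2) * ind S x)" for x
  unfolding n2 by (simp add: sum_ennreal sum_distrib_right[symmetric])
 then have "(%x. ennreal ((norm (f x))^2) * ind S x) = (%x. \<Sum>i\<in>UNIV. ennreal ((norm (f x $ i))^2) * ind S x)"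
  by (rule ext)
 then have "L2 S f = (NN x. (\<Sum>i\<in>UNIV. ennreal ((norm (f x $ i))^2) * ind S x))"
  by (simp only: L2_def)
 also have "\<dots> = (\<Sum>i\<in>UNIV. L2 S (%x. f x $ i))"
  unfolding L2_def by (rule nn_integral_sum) measurable
 finally show ?thesis .
qed

lemma vec_component_measurable:
 "f : Borel ==> (%x. (f x :: real^'n) $ i) : Borel"
 using borel_measurable_inner[OF _ borel_measurable_const, of f borel "axis i 1"] by (simp add: inner_axis)

text \<open>The reflected kernel centred at x is an admissible test function as long as its support
  stays in S'. At such points the derivatives of the mollification are the mollified weak
  derivatives.\<close>

lemma moll_pderiv:
 assumes w: "wgrad U u g" and k: "kernel e \<rho>" and x: "cball x e <= S'" and SU: "S' <= U"
  and iu: "integrable lborel (%x. ind S' x * u x)"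
 shows "pderiv (conv \<rho> (%x. ind S' x * u x)) i x = conv \<rho> (%x. ind S' x * g x $ i) x"
proof -
 have "pderiv (conv \<rho> (%x. ind S' x * u x)) i x = conv (pderiv \<rho> i) (%x. ind S' x * u x) x"
  by (rule conv_pderiv[OF kernel_C1[OF k] kernel_zero[OF k] iu])
 also have "\<dots> = (LBINT y. u y * (- pderiv (%y. \<rho> (x - y)) i y))"
  unfolding conv_def
 proof (intro Bochner_Integration.integral_cong refl)
  fix y
  have "pderiv \<rho> i (x - y) = 0" if "y ~: S'"
  proof -
   have "y ~: cball x e" using x that by blast
   then show ?thesis
    using pderiv_zero_outside[of "cball 0 e" \<rho> "x - y" i] kernel_zero[OF k]
    by (simp add: dist_norm norm_minus_commute)
  qed
  then show "pderiv \<rho> i (x - y) * (ind S' y * u y) = u y * (- pderiv (%y. \<rho> (x - y)) i y)"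
   by (auto simp: pderiv_reflect[OF kernel_C1[OF k]] indicator_def)
 qed
 also have "\<dots> = - (LBINT y. u y * pderiv (%y. \<rho> (x - y)) i y)" by simp
 also have "\<dots> = (LBINT y. g y $ i * \<rho> (x - y))"
  using w kernel_test_fun[OF k order_trans[OF x SU]] unfolding wgrad_def by simp
 also have "\<dots> = conv \<rho> (%x. ind S' x * g x $ i) x"
  unfolding conv_def
 proof (intro Bochner_Integration.integral_cong refl)
  fix y
  have "\<rho> (x - y) = 0" if "y ~: S'"
  proof -
   have "y ~: cball x e" using x that by blast
   then show ?thesis using kernel_zero[OF k] by (simp add: dist_norm)
  qed
  then show "g y $ i * \<rho> (x - y) = \<rho> (x - y) * (ind S' y * g y $ i)"
   by (auto simp: indicator_def)
 qed
 finally show ?thesis .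
qed

text \<open>The functions converge in L^1 whereas the gradients converge in L^2; L^2 convergence of
  the functions is conditional. This serves the fundamental solution, whose square integrability
  away from the pole is derived from that of its gradient.\<close>

lemma weak_moll_sequence:
 fixes u :: "real^'n => real"
 assumes w: "wgrad U u g" and SU: "S' <= U" and [measurable]: "S : sets borel" "S' : sets borel"
  "u : Borel" "g : Borel"
  and iu: "integrable lborel (%x. ind S' x * u x)"
  and ig: "!!i. integrable lborel (%x. ind S' x * g x $ i)" and fg: "L2 S' g < \<infinity>"
  and e0: "e0 > 0" "!!x. x : S ==> cball x e0 <= S'"
 shows "EX w::nat => _. (ALL j. C1 (w j)) & (%j. NN x. ennreal \<bar>w j x - u x\<bar> * ind S x) ---> 0 &
  (%j. L2 S (%x. grad (w j) x - g x)) ---> 0 &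
  (L2 S' u < \<infinity> --> (%j. L2 S (%x. w j x - u x)) ---> 0)"
proof -
 define e where "e j = e0 / Suc j" for j
 have e: "e j > 0" "e j <= e0" for j using e0 by (auto simp: e_def field_simps)
 have elim: "e ---> 0"
  using tendsto_mult[OF tendsto_const[of e0] LIMSEQ_inverse_real_of_nat] by (simp add: e_def[abs_def] divide_inverse)
 have "ALL j. EX \<rho>::real^'n => real. kernel (e j) \<rho>" using kernel_exists[OF e(1)] by blast
 from choice[OF this] obtain \<rho> :: "nat => real^'n => real" where k: "!!j. kernel (e j) (\<rho> j)" by blast
 define f where "f = (%x. ind S' x * u x)"
 define h where "h = (%i x. ind S' x * g x $ i)"
 define w where "w j = conv (\<rho> j) f" for j
 have SS: "S <= S'" using e0 by (meson centre_in_cball less_imp_le subset_iff)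
 have fS: "f x = u x" if "x : S" for x using that SS by (auto simp: f_def)
 have hS: "h i x = g x $ i" if "x : S" for x i using that SS by (auto simp: h_def)
 have C: "C1 (w j)" for j
  using conv_kernel_smooth[OF k iu] Ck_C1 unfolding w_def f_def smooth_def by blast
 note [measurable] = vec_component_measurable
 have gm [measurable]: "grad (w j) : Borel" for j by (rule grad_measurable[OF C])
 have gr: "(grad (w j) x - g x) $ i = conv (\<rho> j) (h i) x - h i x" if "x : S" for x j i
  using moll_pderiv[OF w k _ SU iu, of x j i] e0(2)[OF that] e(2)[of j] hS[OF that]
  by (simp add: w_def f_def h_def grad_def subset_cball order_trans[OF subset_cball])
 have "(%j. NN x. ennreal \<bar>w j x - u x\<bar> * ind S x) ---> 0"
 proof (rule ennreal_tendsto_0_le[OF moll_L1_tendsto[OF iu k elim]])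
  show "(NN x. ennreal \<bar>w j x - u x\<bar> * ind S x) <=
   (NN x. ennreal \<bar>conv (\<rho> j) (%x. ind S' x * u x) x - ind S' x * u x\<bar>)" for j
   using SS by (intro nn_integral_mono) (auto simp: w_def f_def indicator_def)
 qed
 moreover have "(%j. L2 S (%x. w j x - u x)) ---> 0" if "L2 S' u < \<infinity>"
 proof (rule ennreal_tendsto_0_le)
  have "L2 UNIV f = L2 S' u"
   unfolding L2_def f_def by (intro nn_integral_cong) (auto simp: indicator_def)
  then show "(%j. L2 UNIV (%x. conv (\<rho> j) f x - f x)) ---> 0"
   using that by (intro moll_L2_tendsto[OF _ _ k elim]) (auto simp: f_def iu)
  show "L2 S (%x. w j x - u x) <= L2 UNIV (%x. conv (\<rho> j) f x - f x)" for j
   unfolding L2_def by (intro nn_integral_mono) (auto simp: w_def fS indicator_def)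
 qed
 moreover have "(%j. L2 S (%x. grad (w j) x - g x)) ---> 0"
 proof (rule ennreal_tendsto_0_le)
  have hl: "(%j. L2 UNIV (%x. conv (\<rho> j) (h i) x - h i x)) ---> 0" for i
  proof (rule moll_L2_tendsto[OF _ _ k elim])
   have "L2 UNIV (h i) <= L2 S' g"
    unfolding L2_def h_def
    by (intro nn_integral_mono) (auto simp: indicator_def intro!: ennreal_leI power_mono component_le_norm_cart abs_le_square_iff[THEN iffD1])
   then show "L2 UNIV (h i) < \<infinity>" using fg by (rule le_less_trans)
  qed (simp add: h_def ig)
  have "(%j. \<Sum>i\<in>UNIV. L2 UNIV (%x. conv (\<rho> j) (h i) x - h i x)) ---> (\<Sum>i\<in>(UNIV::'n set). 0)"
   by (intro tendsto_sum hl)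
  then show "(%j. \<Sum>i\<in>UNIV. L2 UNIV (%x. conv (\<rho> j) (h i) x - h i x)) ---> 0" by simp
  fix j
  have "L2 S (%x. grad (w j) x - g x) = (\<Sum>i\<in>UNIV. L2 S (%x. (grad (w j) x - g x) $ i))"
   by (rule L2_components) measurable
  also have "\<dots> <= (\<Sum>i\<in>UNIV. L2 UNIV (%x. conv (\<rho> j) (h i) x - h i x))"
   unfolding L2_def using gr by (intro sum_mono nn_integral_mono) (auto simp: indicator_def simp del: vector_minus_component)
  finally show "L2 S (%x. grad (w j) x - g x) <= (\<Sum>i\<in>UNIV. L2 UNIV (%x. conv (\<rho> j) (h i) x - h i x))" .
 qed
 ultimately show ?thesis using C by blast
qed

lemma weak_approx:
 fixes u :: "real^'n => real"
 assumes "wgrad U u g" "S' <= U" and [measurable]: "S : sets borel" "S' : sets borel"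
  "u : Borel" "g : Borel"
  and "integrable lborel (%x. ind S' x * u x)"
  "!!i. integrable lborel (%x. ind S' x * g x $ i)" and fg: "L2 S' g < \<infinity>"
  and e0: "e0 > 0" "!!x. x : S ==> cball x e0 <= S'" and fu: "L2 S' u < \<infinity>"
 shows "approx S (Collect C1) u g"
proof -
 obtain w :: "nat => _" where w: "ALL j. C1 (w j)" "(%j. L2 S (%x. grad (w j) x - g x)) ---> 0"
  "(%j. L2 S (%x. w j x - u x)) ---> 0"
  using weak_moll_sequence[OF assms(1-11)] fu by blast
 have SS: "S <= S'" using e0 by (meson centre_in_cball less_imp_le subset_iff)
 show ?thesis
  by (rule approxI[where w=w]) (use w L2_mono_set[OF SS] fg fu in \<open>auto intro: le_less_trans\<close>)
qed

subsection \<open>Poincare, Faber--Krahn and Hardy inequalities\<close>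

lemma segment_bound:
 fixes w :: "real^'n => real"
 assumes C: "C1 w"
 shows "ennreal ((w x - w y)^2) <= (NN t. ind {0..1} t * ennreal ((norm (x - y))^2 * (norm (grad w (y + t *. (x - y))))^2))"
proof -
 define f where "f t = grad w (y + t *. (x - y)) \<bullet> (x - y)" for t
 have fc: "continuous_on UNIV f"
  unfolding f_def by (intro continuous_intros continuous_on_compose2[OF C1_continuous_grad[OF C]]) auto
 have [measurable]: "f : Borel" by (rule borel_measurable_continuous_onI[OF fc])
 have "((%t. w (y + t *. (x - y))) has_vector_derivative f t) (at t)" for t
 proof -
  have "((%t. y + t *. (x - y)) has_derivative (%h. h *. (x - y))) (at t)"
   by (auto intro!: derivative_eq_intros)
  from has_derivative_compose[OF this C1D[OF C]] show ?thesis
   by (simp add: has_vector_derivative_def f_def)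
 qed
 then have "has_bochner_integral lborel (%t. ind {0..1} t *. f t) (w (y + 1 *. (x - y)) - w (y + 0 *. (x - y)))"
  by (intro has_bochner_integral_FTC_Icc) (auto intro: has_vector_derivative_at_within continuous_on_subset[OF fc])
 then have hb: "integrable lborel (%t. ind {0..1} t *. f t)" "(LBINT t. ind {0..1} t *. f t) = w x - w y"
  by (auto simp: has_bochner_integral_iff)
 have "ennreal \<bar>w x - w y\<bar> <= (NN t. norm (ind {0..1} t *. f t))"
  using integral_norm_bound_ennreal[OF hb(1)] hb(2) by simp
 also have "\<dots> = (NN t. ind {0..1} t * (ind {0..1} t * ennreal \<bar>f t\<bar>))"
  by (intro nn_integral_cong) (auto simp: indicator_def)
 finally have "(ennreal \<bar>w x - w y\<bar>)^2 <= (NN t. ind {0..1} t * (ind {0..1} t * ennreal \<bar>f t\<bar>))^2"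
  by (rule power_mono) simp
 also have "\<dots> <= (NN t. (ind {0..1} (t::real))^2) * (NN t. (ind {0..1} t * ennreal \<bar>f t\<bar>)^2)"
  by (rule Cauchy_Schwarz_nn_integral) measurable
 also have "(NN t. (ind {0..1} (t::real))^2) = (NN t. ind {0..1} (t::real))"
  by (intro nn_integral_cong) (auto simp: indicator_def)
 also have "\<dots> = 1" by simp
 also have "(NN t. (ind {0..1} t * ennreal \<bar>f t\<bar>)^2) <=
   (NN t. ind {0..1} t * ennreal ((norm (x - y))^2 * (norm (grad w (y + t *. (x - y))))^2))"
 proof (rule nn_integral_mono)
  fix t :: real
  have "\<bar>f t\<bar> <= norm (grad w (y + t *. (x - y))) * norm (x - y)" unfolding f_def by (rule Cauchy_Schwarz_ineq2)
  from power_mono[OF this, of 2] have "\<bar>f t\<bar>\<^sup>2 <= (norm (x - y))^2 * (norm (grad w (y + t *. (x - y))))^2"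
   by (simp add: power_mult_distrib mult.commute)
  then show "(ind {0..1} t * ennreal \<bar>f t\<bar>)^2 <=
    ind {0..1} t * ennreal ((norm (x - y))^2 * (norm (grad w (y + t *. (x - y))))^2)"
   by (auto simp: indicator_def ennreal_power intro!: ennreal_leI)
 qed
 finally show ?thesis by (simp add: ennreal_power)
qed

lemma affine_contraction_le:
 fixes f :: "'a::euclidean_space => ennreal"
 assumes [measurable]: "f : Borel" and "c \<ge> 1 / 2"
 shows "(NN x. f (s + c *. x)) <= ennreal (2 ^ DIM('a)) * (NN x. f x)"
proof -
 let ?X = "(NN x. f (s + c *. x))"
 have "1 <= (2 * c) ^ DIM('a)" using assms by (intro one_le_power) auto
 then have "1 * ?X <= ennreal ((2 * c) ^ DIM('a)) * ?X"
  by (intro mult_right_mono) auto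
 also have "\<dots> = ennreal (2 ^ DIM('a)) * (ennreal (\<bar>c\<bar> ^ DIM('a)) * ?X)"
  using assms(2) by (simp add: power_mult_distrib ennreal_mult mult.assoc)
 also have "\<dots> = ennreal (2 ^ DIM('a)) * (NN x. f x)"
  using nn_integral_affine[of f c s] assms by simp
 finally show ?thesis by simp
qed

text \<open>The difference is bounded along the segment from y to x. For t >= 1/2 the map x -> y + t
  (x - y) has Jacobian at least 2^-n, and for t < 1/2 the same is true in y; integrating first in
  the good variable gives the factor 2^n. The factor 4 R^2 is the squared diameter.\<close>

lemma poincare_C1:
 fixes w :: "real^'n => real"
 assumes C: "C1 w" and R: "R > 0"
 shows "(NN x. (NN y. ennreal ((w x - w y)^2) * ind (ball z R) y) * ind (ball z R) x)
  <= ennreal (4 * R\<^sup>2 * 2 ^ CARD('n)) * (emeasure lborel (ball z R) * L2 (ball z R) (grad w))"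
proof -
 define B where "B = ball z R"
 have [measurable]: "B : sets borel" by (simp add: B_def)
 define h where "h v = ennreal ((norm (grad w v))^2)" for v
 have [measurable]: "grad w : Borel" by (rule grad_measurable[OF C])
 have [measurable]: "h : Borel" unfolding h_def by measurable
 have [measurable]: "w : Borel" by (rule C1_measurable[OF C])
 define F where "F t x y = ind B x * (ind B y * (ind {0..1::real} t * h (y + t *. (x - y))))" for t x y
 have [measurable]: "(%(p::real \<times> (real^'n) \<times> (real^'n)). F (fst p) (fst (snd p)) (snd (snd p))) : Borel"
  unfolding F_def borel_prod[symmetric] by measurable
 have H: "(NN v. ind B v * h v) = L2 B (grad w)"
  by (simp add: L2_def h_def mult.commute)
 have cvx: "y + t *. (x - y) : B" if "x : B" "y : B" "0 <= t" "t <= 1" for x y and t :: real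
 proof -
  have "(1 - t) *. y + t *. x : B"
   using convex_ball[of z R] that unfolding B_def convex_alt by blast
  then show ?thesis by (simp add: algebra_simps)
 qed
 have I: "(NN x. (NN y. F t x y)) <= ind {0..1} t * (ennreal (2 ^ CARD('n)) * (emeasure lborel B * L2 B (grad w)))" for t
 proof (cases "t : {0..1}")
  case True
  show ?thesis
  proof (cases "t \<ge> 1 / 2")
   case t: True
   have "(NN x. (NN y. F t x y)) = (NN y. (NN x. F t x y))"
    unfolding F_def by (rule lborel_pair.Fubini'[symmetric]) measurable
   also have "\<dots> <= (NN y. ind B y * (ennreal (2 ^ CARD('n)) * L2 B (grad w)))"
   proof (rule nn_integral_mono)
    fix y
    have "(NN x. F t x y) <= (NN x. ind B y * (ind B (((1 - t) *. y) + t *. x) * h (((1 - t) *. y) + t *. x)))"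
    proof (rule nn_integral_mono)
     fix x
     have "y + t *. (x - y) = ((1 - t) *. y) + t *. x" by (simp add: algebra_simps)
     then show "F t x y <= ind B y * (ind B (((1 - t) *. y) + t *. x) * h (((1 - t) *. y) + t *. x))"
      using cvx[of x y t] True by (auto simp: F_def indicator_def)
    qed
    also have "\<dots> = ind B y * (NN x. ind B (((1 - t) *. y) + t *. x) * h (((1 - t) *. y) + t *. x))"
     by (rule nn_integral_cmult) measurable
    also have "\<dots> <= ind B y * (ennreal (2 ^ CARD('n)) * L2 B (grad w))"
     using affine_contraction_le[of "%v. ind B v * h v" t "(1 - t) *. y"] t
     by (intro mult_left_mono) (auto simp: H)
    finally show "(NN x. F t x y) <= ind B y * (ennreal (2 ^ CARD('n)) * L2 B (grad w))" .
   qed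
   also have "\<dots> = ennreal (2 ^ CARD('n)) * (emeasure lborel B * L2 B (grad w))"
    by (subst nn_integral_multc) (auto simp: mult.left_commute)
   finally show ?thesis using True by simp
  next
   case t: False
   have "(NN x. (NN y. F t x y)) <= (NN x. ind B x * (ennreal (2 ^ CARD('n)) * L2 B (grad w)))"
   proof (rule nn_integral_mono)
    fix x
    have "(NN y. F t x y) <= (NN y. ind B x * (ind B ((t *. x) + (1 - t) *. y) * h ((t *. x) + (1 - t) *. y)))"
    proof (rule nn_integral_mono)
     fix y
     have "y + t *. (x - y) = (t *. x) + (1 - t) *. y" by (simp add: algebra_simps)
     then show "F t x y <= ind B x * (ind B ((t *. x) + (1 - t) *. y) * h ((t *. x) + (1 - t) *. y))"
      using cvx[of x y t] True by (auto simp: F_def indicator_def)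
    qed
    also have "\<dots> = ind B x * (NN y. ind B ((t *. x) + (1 - t) *. y) * h ((t *. x) + (1 - t) *. y))"
     by (rule nn_integral_cmult) measurable
    also have "\<dots> <= ind B x * (ennreal (2 ^ CARD('n)) * L2 B (grad w))"
     using affine_contraction_le[of "%v. ind B v * h v" "1 - t" "t *. x"] t
     by (intro mult_left_mono) (auto simp: H)
    finally show "(NN y. F t x y) <= ind B x * (ennreal (2 ^ CARD('n)) * L2 B (grad w))" .
   qed
   also have "\<dots> = ennreal (2 ^ CARD('n)) * (emeasure lborel B * L2 B (grad w))"
    by (subst nn_integral_multc) (auto simp: mult.left_commute)
   finally show ?thesis using True by simp
  qed
 qed (simp add: F_def)
 have "(NN x. (NN y. ennreal ((w x - w y)^2) * ind B y) * ind B x)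
   <= (NN x. (NN y. ennreal (4 * R\<^sup>2) * (NN t. F t x y)))"
 proof (rule nn_integral_mono)
  fix x
  have "(NN y. ennreal ((w x - w y)^2) * ind B y) * ind B x =
    (NN y. ennreal ((w x - w y)^2) * ind B y * ind B x)"
   by (rule nn_integral_multc[symmetric]) measurable
  also have "\<dots> <= (NN y. ennreal (4 * R\<^sup>2) * (NN t. F t x y))"
  proof (rule nn_integral_mono)
   fix y
   show "ennreal ((w x - w y)^2) * ind B y * ind B x <= ennreal (4 * R\<^sup>2) * (NN t. F t x y)"
   proof (cases "x : B & y : B")
    case True
    then have "norm (x - y) <= 2 * R"
     using dist_triangle_less_add[of x z R y R] by (auto simp: B_def dist_norm norm_minus_commute)
    then have "(norm (x - y))^2 <= (2 * R)^2" by (intro power_mono) auto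
    then have n: "(norm (x - y))^2 <= 4 * R\<^sup>2" by (simp add: power_mult_distrib)
    have "ennreal ((w x - w y)^2) <= (NN t. ind {0..1} t * ennreal ((norm (x - y))^2 * (norm (grad w (y + t *. (x - y))))^2))"
     by (rule segment_bound[OF C])
    also have "\<dots> <= (NN t. ennreal (4 * R\<^sup>2) * F t x y)"
     using True n by (intro nn_integral_mono)
      (auto simp: F_def h_def indicator_def ennreal_mult[symmetric] intro!: ennreal_leI mult_right_mono)
    also have "\<dots> = ennreal (4 * R\<^sup>2) * (NN t. F t x y)"
     unfolding F_def by (rule nn_integral_cmult) measurable
    finally show ?thesis using True by simp
   qed (auto simp: indicator_def)
  qed
  finally show "(NN y. ennreal ((w x - w y)^2) * ind B y) * ind B x
   <= (NN y. ennreal (4 * R\<^sup>2) * (NN t. F t x y))" .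
 qed
 also have "\<dots> = (NN x. ennreal (4 * R\<^sup>2) * (NN y. (NN t. F t x y)))"
  unfolding F_def by (intro nn_integral_cong nn_integral_cmult) measurable
 also have "\<dots> = ennreal (4 * R\<^sup>2) * (NN x. (NN y. (NN t. F t x y)))"
  unfolding F_def by (intro nn_integral_cmult) measurable
 also have "(NN x. (NN y. (NN t. F t x y))) = (NN x. (NN t. (NN y. F t x y)))"
  unfolding F_def by (intro nn_integral_cong lborel_pair.Fubini') measurable
 also have "\<dots> = (NN t. (NN x. (NN y. F t x y)))"
  unfolding F_def by (intro lborel_pair.Fubini') measurable
 also have "\<dots> <= (NN t. ind {0..1} (t::real) * (ennreal (2 ^ CARD('n)) * (emeasure lborel B * L2 B (grad w))))"
  by (intro nn_integral_mono I)
 also have "\<dots> = ennreal (2 ^ CARD('n)) * (emeasure lborel B * L2 B (grad w))"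
  by (subst nn_integral_multc) auto
 finally show ?thesis
  unfolding B_def[symmetric] by (simp add: ennreal_mult mult.assoc mult_left_mono)
qed

lemma liminf_bound:
 fixes X Y :: "nat => ennreal"
 assumes "!!j. X j <= c + Y j" "Y ---> 0"
 shows "liminf X <= c"
proof -
 have "(%j. c + Y j) ---> c + 0" by (intro tendsto_intros assms(2))
 then have "liminf (%j. c + Y j) = c" using lim_imp_Liminf[OF sequentially_bot] by fastforce
 moreover have "liminf X <= liminf (%j. c + Y j)" by (intro Liminf_mono always_eventually allI assms(1))
 ultimately show ?thesis by simp
qed

lemma L2_grad_split:
 fixes g :: "real^'n => real^'n"
 assumes "h : Borel" "g : Borel" "S : sets borel"
 shows "L2 S h <= 2 * L2 S g + 2 * L2 S (%x. h x - g x)"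
 using L2_add[of g "%x. h x - g x" S] assms by simp

lemma tendsto_ennreal_sq:
 "a ---> l ==> (%j. ennreal ((a j)^2)) ---> ennreal (l\<^sup>2)"
 by (intro tendsto_ennrealI tendsto_intros)

text \<open>Fatou's lemma, first in y and then in x. The functions are supposed to converge only
  almost everywhere because the lemma is applied to the fundamental solution before it is known to
  be in L^2. The constant doubles when the gradients are split into limit and error.\<close>

lemma poincare_limit:
 fixes w :: "nat => real^'n => real"
 assumes C: "!!j. C1 (w j)" and R: "R > 0" and [measurable]: "u : Borel" "g : Borel"
  and ae: "AE x\<in>ball z R in lborel. (%j. w j x) ---> u x"
  and lim: "(%j. L2 (ball z R) (%x. grad (w j) x - g x)) ---> 0"
 shows "(NN x. (NN y. ennreal ((u x - u y)^2) * ind (ball z R) y) * ind (ball z R) x)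
  <= ennreal (8 * R\<^sup>2 * 2 ^ CARD('n)) * (emeasure lborel (ball z R) * L2 (ball z R) g)"
proof -
 define B where "B = ball z R"
 have [measurable]: "B : sets borel" by (simp add: B_def)
 note [measurable] = C1_measurable[OF C] grad_measurable[OF C]
 define \<phi> where "\<phi> j x = (NN y. ennreal ((w j x - w j y)^2) * ind B y)" for j x
 have [measurable]: "\<phi> j : Borel" for j unfolding \<phi>_def by measurable
 let ?K = "ennreal (4 * R\<^sup>2 * 2 ^ CARD('n))"
 have "(NN x. (NN y. ennreal ((u x - u y)^2) * ind B y) * ind B x)
   <= (NN x. liminf (%j. \<phi> j x * ind B x))"
 proof (rule nn_integral_mono_AE, use ae in eventually_elim)
  fix x assume x: "x : ball z R --> (%j. w j x) ---> u x"
  show "(NN y. ennreal ((u x - u y)^2) * ind B y) * ind B x <= liminf (%j. \<phi> j x * ind B x)"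
  proof (cases "x : B")
   case True
   have "(NN y. ennreal ((u x - u y)^2) * ind B y)
    = (NN y. liminf (%j. ennreal ((w j x - w j y)^2) * ind B y))"
   proof (rule nn_integral_cong_AE, use ae in eventually_elim)
    fix y assume y: "y : ball z R --> (%j. w j y) ---> u y"
    have "(%j. ennreal ((w j x - w j y)^2) * ind B y) ---> ennreal ((u x - u y)^2) * ind B y"
    proof (cases "y : B")
     case y': True
     have "(%j. w j x - w j y) ---> u x - u y"
      using x y True y' by (intro tendsto_diff) (auto simp: B_def)
     from tendsto_ennreal_sq[OF this] show ?thesis using y' by simp
    qed simp
    from lim_imp_Liminf[OF sequentially_bot this]
    show "ennreal ((u x - u y)^2) * ind B y = liminf (%j. ennreal ((w j x - w j y)^2) * ind B y)" by simp
   qed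
   also have "\<dots> <= liminf (%j. \<phi> j x)"
    unfolding \<phi>_def by (rule nn_integral_liminf) measurable
   finally show ?thesis using True by simp
  qed simp
 qed
 also have "\<dots> <= liminf (%j. NN x. \<phi> j x * ind B x)"
  by (rule nn_integral_liminf) measurable
 also have "\<dots> <= ?K * (emeasure lborel B * (2 * L2 B g))"
 proof (rule liminf_bound)
  have "(?K * (emeasure lborel B * 2)) < \<infinity>"
   using emeasure_lborel_ball_finite[of z R] by (simp add: B_def ennreal_mult_less_top)
  then show "(%j. (?K * (emeasure lborel B * 2)) * L2 B (%x. grad (w j) x - g x) + 0 * 0) ---> 0"
   by (intro ennreal_tendsto_0_lincomb[OF _ tendsto_const]) (use lim in \<open>auto simp: B_def\<close>)
  fix j
  have "(NN x. \<phi> j x * ind B x) <= ?K * (emeasure lborel B * L2 B (grad (w j)))"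
   unfolding \<phi>_def B_def by (rule poincare_C1[OF C R])
  also have "\<dots> <= ?K * (emeasure lborel B * (2 * L2 B g + 2 * L2 B (%x. grad (w j) x - g x)))"
   by (intro mult_left_mono L2_grad_split) auto
  finally show "(NN x. \<phi> j x * ind B x) <=
   ?K * (emeasure lborel B * (2 * L2 B g)) + ((?K * (emeasure lborel B * 2)) * L2 B (%x. grad (w j) x - g x) + 0 * 0)"
   by (simp add: distrib_left mult.assoc)
 qed
 also have "\<dots> = ennreal (8 * R\<^sup>2 * 2 ^ CARD('n)) * (emeasure lborel B * L2 B g)"
 proof -
  have "ennreal (8 * R\<^sup>2 * 2 ^ CARD('n)) = ?K * 2"
   by (subst ennreal_numeral[symmetric], subst ennreal_mult[symmetric]) (auto simp: algebra_simps)
  then show ?thesis by (simp add: mult_ac)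
 qed
 finally show ?thesis by (simp add: B_def)
qed

lemma poincare_approx:
 assumes a: "approx (ball z R) X u g" and R: "R > 0"
 shows "(NN x. (NN y. ennreal ((u x - u y)^2) * ind (ball z R) y) * ind (ball z R) x)
  <= ennreal (8 * R\<^sup>2 * 2 ^ CARD('n)) * (emeasure lborel (ball z R) * L2 (ball (z::real^'n) R) g)"
proof -
 obtain w where w: "!!j::nat. C1 (w j)" "(%j. L2 (ball z R) (%x. grad (w j) x - g x)) ---> 0"
  "AE x\<in>ball z R in lborel. (%j. w j x) ---> u x"
  using approx_sequence[OF a] by blast
 show ?thesis by (rule poincare_limit[OF w(1) R approxD(3,4)[OF a] w(3,2)])
qed

text \<open>If every constant failed, then in particular every value c = u x would, and integration
  over x contradicts the bound of the double integral. A value of u in place of its mean makes sense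
  for u merely measurable.\<close>

lemma poincare_constant:
 fixes u :: "real^'n => real"
 assumes R: "R > 0" and [measurable]: "u : Borel"
  and P: "(NN x. (NN y. ennreal ((u x - u y)^2) * ind (ball z R) y) * ind (ball z R) x)
   <= K * (emeasure lborel (ball z R) * G)" and K: "K * G < \<infinity>"
 shows "EX c. L2 (ball z R) (%x. u x - c) <= 2 * K * G"
proof (rule ccontr)
 assume "\<not> ?thesis"
 then have n: "2 * K * G < L2 (ball z R) (%x. u x - c)" for c by (simp add: not_le)
 define B where "B = ball z R"
 have [measurable]: "B : sets borel" by (simp add: B_def)
 have b: "0 < emeasure lborel B" "emeasure lborel B < \<infinity>"
  using emeasure_lborel_ball_finite[of z R] R content_ball_pos[of R z]
  by (auto simp: B_def emeasure_eq_ennreal_measure top_unique)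
 have L: "L2 B (%x. u x - c) = (NN y. ennreal ((c - u y)^2) * ind B y)" for c
  by (simp add: L2_def power2_commute)
 have "(2 * K * G) * emeasure lborel B = (NN x. (2 * K * G) * ind B x)"
  by (subst nn_integral_cmult) auto
 also have "\<dots> <= (NN x. (NN y. ennreal ((u x - u y)^2) * ind B y) * ind B x)"
 proof (rule nn_integral_mono)
  fix x
  show "(2 * K * G) * ind B x <= (NN y. ennreal ((u x - u y)^2) * ind B y) * ind B x"
   using n[of "u x"] unfolding B_def[symmetric] L by (intro mult_right_mono) auto
 qed
 also have "\<dots> <= (K * G) * emeasure lborel B" using P by (simp add: B_def mult_ac)
 finally have le: "2 * (K * G) * emeasure lborel B <= (K * G) * emeasure lborel B" by (simp add: mult_ac)
 obtain k where k: "K * G = ennreal k" "k \<ge> 0" using K by (cases "K * G") auto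
 obtain m where m: "emeasure lborel B = ennreal m" "m > 0"
  using b by (cases "emeasure lborel B") auto
 have "2 * (K * G) * emeasure lborel B = ennreal (2 * k * m)"
  unfolding k m using k m by (simp add: ennreal_mult)
 with le have "2 * k * m <= k * m" using k m by (simp add: ennreal_mult[symmetric])
 then have "k = 0" using k m by (simp add: mult_le_0_iff)
 \<comment> \<open>The factor 2 leaves only the case of a vanishing right side. Then the double
   integral is 0, although its inner integral is positive for every x.\<close>
 then have z: "K * G = 0" using k by simp
 have "(NN x. (NN y. ennreal ((u x - u y)^2) * ind B y) * ind B x) = 0"
 proof -
  have e: "K * (emeasure lborel (ball z R) * G) = 0" by (metis mult.left_commute mult_zero_right z)
  show ?thesis using P[unfolded e] unfolding B_def by (rule le_zero_eq[THEN iffD1])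
 qed
 then have "AEL x. (NN y. ennreal ((u x - u y)^2) * ind B y) * ind B x = 0"
  by (subst (asm) nn_integral_0_iff_AE) auto
 then have "AEL x. x ~: B"
 proof eventually_elim
  fix x assume *: "(NN y. ennreal ((u x - u y)^2) * ind B y) * ind B x = 0"
  have "0 < (NN y. ennreal ((u x - u y)^2) * ind B y)"
   using n[of "u x"] unfolding B_def[symmetric] L using le_less_trans[OF zero_le] by blast
  then show "x ~: B" using * by (auto simp: indicator_def)
 qed
 then have "emeasure lborel B = 0" by (subst (asm) AE_iff_measurable[of B]) auto
 then show False using b by simp
qed

text \<open>For y in the zero set Z the difference v x - v y is v x; restricting the double integral
  to such y puts the measure of Z in front of the integral of v^2.\<close>

lemma poincare_zero:
 fixes v :: "real^'n => real"
 assumes a: "approx (ball z R) X v g" and R: "R > 0" and [measurable]: "Z : sets borel"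
  and Z: "Z <= ball z R" "!!x. x : Z ==> v x = 0"
  and \<theta>: "ennreal \<theta> * emeasure lborel (ball z R) <= emeasure lborel Z" "\<theta> > 0"
 shows "L2 (ball z R) v <= ennreal (8 * R\<^sup>2 * 2 ^ CARD('n) / \<theta>) * L2 (ball z R) g"
proof -
 define B where "B = ball z R"
 note [measurable] = approxD(3,4)[OF a]
 have [measurable]: "B : sets borel" by (simp add: B_def)
 have "0 < emeasure lborel B" "emeasure lborel B < \<infinity>"
  using emeasure_lborel_ball_finite[of z R] R content_ball_pos[of R z]
  by (auto simp: B_def emeasure_eq_ennreal_measure top_unique)
 then obtain b where b: "emeasure lborel B = ennreal b" "b > 0" by (cases "emeasure lborel B") auto
 have "ennreal (\<theta> * b) * L2 B v <= emeasure lborel Z * L2 B v"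
  using \<theta> b by (intro mult_right_mono) (auto simp: B_def ennreal_mult)
 also have "\<dots> = (NN x. (ennreal ((v x)^2) * ind B x) * emeasure lborel Z)"
  unfolding L2_def by (subst nn_integral_multc) (auto simp: mult.commute)
 also have "\<dots> <= (NN x. (NN y. ennreal ((v x - v y)^2) * ind B y) * ind B x)"
 proof (rule nn_integral_mono)
  fix x
  have "ennreal ((v x)^2) * emeasure lborel Z = (NN y. ennreal ((v x)^2) * ind Z y)"
   by (subst nn_integral_cmult) auto
  also have "\<dots> <= (NN y. ennreal ((v x - v y)^2) * ind B y)"
   using Z by (intro nn_integral_mono) (auto simp: indicator_def B_def)
  finally show "(ennreal ((v x)^2) * ind B x) * emeasure lborel Z <= (NN y. ennreal ((v x - v y)^2) * ind B y) * ind B x"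
   by (auto simp: indicator_def)
 qed
 also have "\<dots> <= ennreal (8 * R\<^sup>2 * 2 ^ CARD('n)) * (ennreal b * L2 B g)"
  using poincare_approx[OF a R] by (simp add: B_def[symmetric] b)
 finally have *: "ennreal (\<theta> * b) * L2 B v <= ennreal (8 * R\<^sup>2 * 2 ^ CARD('n)) * (ennreal b * L2 B g)" .
 have "L2 B v = ennreal (1 / (\<theta> * b)) * (ennreal (\<theta> * b) * L2 B v)"
  using \<theta>(2) b(2) by (simp add: mult.assoc[symmetric] ennreal_mult[symmetric])
 also have "\<dots> <= ennreal (1 / (\<theta> * b)) * (ennreal (8 * R\<^sup>2 * 2 ^ CARD('n)) * (ennreal b * L2 B g))"
  by (intro mult_left_mono *) simp
 also have "\<dots> = ennreal (8 * R\<^sup>2 * 2 ^ CARD('n) / \<theta>) * L2 B g"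
  using \<theta>(2) b(2) by (simp add: mult.assoc[symmetric] ennreal_mult[symmetric])
 finally show ?thesis by (simp add: B_def)
qed

section \<open>Averages over balls and the Faber-Krahn inequality\<close>

lemma emeasure_ball_eq:
 "0 <= r ==> emeasure lborel (ball (z::real^'n) r) = ennreal (unit_ball_vol (real CARD('n)) * r ^ CARD('n))"
 using emeasure_ball[of r z] by simp

lemma ball_average:
 fixes f :: "real^'n => 'b::euclidean_space"
 assumes [measurable]: "f : Borel" and "\<rho> > 0"
 shows "(NN z. L2 (ball z \<rho>) f) = emeasure lborel (ball (0::real^'n) \<rho>) * L2 UNIV f"
proof -
 define q where "q z x = (if norm (x - z) < \<rho> then 1 else 0 :: ennreal)" for z x :: "real^'n"
 have q: "ind (ball z \<rho>) x = q z x" for z x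
  by (simp add: q_def indicator_def dist_norm norm_minus_commute)
 have q': "q z x = q x z" for z x by (simp add: q_def norm_minus_commute)
 have qm [measurable]: "(%p. q (fst p) (snd p)) : borel_measurable (lborel \<Otimes>\<^sub>M lborel)"
  unfolding q_def by measurable
 have qm' [measurable]: "q z : Borel" for z unfolding q_def by measurable
 have "(NN z. L2 (ball z \<rho>) f) = (NN z. (NN x. ennreal ((norm (f x))^2) * q z x))"
  by (simp add: L2_def q)
 also have "\<dots> = (NN x. (NN z. ennreal ((norm (f x))^2) * q z x))"
  unfolding q_def by (rule lborel_pair.Fubini'[symmetric]) measurable
 also have "\<dots> = (NN x. ennreal ((norm (f x))^2) * emeasure lborel (ball (0::real^'n) \<rho>))"
 proof (rule nn_integral_cong)
  fix x
  have "(NN z. q z x) = emeasure lborel (ball x \<rho>)"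
  proof -
   have "(NN z. q z x) = (NN z. ind (ball x \<rho>) z)"
    by (intro nn_integral_cong trans[OF q' q[symmetric]])
   then show ?thesis by simp
  qed
  also have "\<dots> = emeasure lborel (ball (0::real^'n) \<rho>)"
   using \<open>\<rho> > 0\<close> by (simp add: emeasure_ball_eq)
  finally show "(NN z. ennreal ((norm (f x))^2) * q z x) = ennreal ((norm (f x))^2) * emeasure lborel (ball (0::real^'n) \<rho>)"
   unfolding q'[of _ x] by (subst nn_integral_cmult) auto
 qed
 also have "\<dots> = emeasure lborel (ball (0::real^'n) \<rho>) * L2 UNIV f"
  unfolding L2_def by (subst nn_integral_multc) (auto simp: mult.commute)
 finally show ?thesis .
qed

text \<open>Averaging the Poincare inequality for functions vanishing on half of a ball over all balls of
 radius \<open>\<rho>\<close> gains the factor \<open>\<rho>\<^sup>2\<close>, where \<open>\<rho>\<close> is comparable to the \<open>n\<close>-th root of the measure of the support.\<close>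

lemma faber_krahn:
 fixes v :: "real^'n => real"
 assumes a: "approx UNIV X v g" and \<rho>: "\<rho> > 0"
  and supp: "emeasure lborel {x. v x ~= 0} <= ennreal (unit_ball_vol (real CARD('n)) * \<rho> ^ CARD('n) / 2)"
 shows "L2 UNIV v <= ennreal (16 * \<rho>\<^sup>2 * 2 ^ CARD('n)) * L2 UNIV g"
proof -
 note [measurable] = approxD(3,4)[OF a]
 have X: "X <= Collect C1" using approxD(2)[OF a] .
 define V where "V = unit_ball_vol (real CARD('n)) * \<rho> ^ CARD('n)"
 have V: "V > 0" using \<rho> by (simp add: V_def)
 \<comment> \<open>The support has at most half the measure of a ball of radius \<rho>, so in every
   such ball the zero set has at least half the measure, wherever the support lies.\<close>
 have loc: "L2 (ball z \<rho>) v <= ennreal (16 * \<rho>\<^sup>2 * 2 ^ CARD('n)) * L2 (ball z \<rho>) g" for z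
 proof -
  define Z where "Z = ball z \<rho> \<inter> {x. v x = 0}"
  have [measurable]: "Z : sets borel" unfolding Z_def by measurable
  have "emeasure lborel (ball z \<rho>) <= emeasure lborel Z + emeasure lborel {x. v x ~= 0}"
  proof -
   have "emeasure lborel (ball z \<rho>) <= emeasure lborel (Z \<union> {x. v x ~= 0})"
    by (intro emeasure_mono) (auto simp: Z_def)
   also have "\<dots> <= emeasure lborel Z + emeasure lborel {x. v x ~= 0}"
    by (intro emeasure_subadditive) auto
   finally show ?thesis .
  qed
  also have "\<dots> <= emeasure lborel Z + ennreal (V / 2)" using supp by (intro add_left_mono) (simp add: V_def)
  finally have *: "ennreal V <= emeasure lborel Z + ennreal (V / 2)"
   using \<rho> by (simp add: emeasure_ball_eq V_def)
  have "emeasure lborel Z <= emeasure lborel (ball z \<rho>)" by (intro emeasure_mono) (auto simp: Z_def)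
  then obtain m where m: "emeasure lborel Z = ennreal m" "m \<ge> 0"
   using emeasure_lborel_ball_finite[of z \<rho>] by (cases "emeasure lborel Z") (auto simp: top_unique)
  have "ennreal (V / 2) <= emeasure lborel Z"
   using * m V by (simp add: ennreal_plus[symmetric] del: ennreal_plus)
  then have \<theta>: "ennreal (1 / 2) * emeasure lborel (ball z \<rho>) <= emeasure lborel Z"
  proof -
   have "emeasure lborel (ball z \<rho>) = ennreal V" using emeasure_ball_eq[of \<rho> z] \<rho> by (simp add: V_def)
   moreover have "ennreal (1 / 2) * ennreal V = ennreal (1 / 2 * V)"
    by (rule ennreal_mult[symmetric]) (use V in auto)
   ultimately show ?thesis using \<open>ennreal (V / 2) <= emeasure lborel Z\<close> by simp
  qed
  have ap: "approx (ball z \<rho>) X v g" by (rule approx_mono[OF a]) (use X in auto)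
  have "L2 (ball z \<rho>) v <= ennreal (8 * \<rho>\<^sup>2 * 2 ^ CARD('n) / (1 / 2)) * L2 (ball z \<rho>) g"
   by (rule poincare_zero[OF ap \<rho> \<open>Z : sets borel\<close> _ _ \<theta>]) (auto simp: Z_def)
  moreover have "8 * \<rho>\<^sup>2 * 2 ^ CARD('n) / (1 / 2) = 16 * \<rho>\<^sup>2 * 2 ^ CARD('n)" by simp
  ultimately show ?thesis by (simp only:)
 qed
 have fin: "emeasure lborel (ball (0::real^'n) \<rho>) = ennreal V" using \<rho> by (simp add: emeasure_ball_eq V_def)
 have "ennreal V * L2 UNIV v = (NN z. L2 (ball z \<rho>) v)"
  using ball_average[of v \<rho>] \<rho> fin by simp
 also have "\<dots> <= (NN z. ennreal (16 * \<rho>\<^sup>2 * 2 ^ CARD('n)) * L2 (ball z \<rho>) g)"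
  by (intro nn_integral_mono loc)
 also have "\<dots> = ennreal (16 * \<rho>\<^sup>2 * 2 ^ CARD('n)) * (NN z. L2 (ball z \<rho>) g)"
 proof (rule nn_integral_cmult)
  have "(%z. NN x. ennreal ((norm (g x))^2) * (if norm (x - z) < \<rho> then 1 else 0)) : borel_measurable lborel"
   by measurable
  moreover have "ind (ball z \<rho>) x = (if norm (x - z) < \<rho> then 1 else 0 :: ennreal)" for z x :: "real^'n"
   by (simp add: indicator_def dist_norm norm_minus_commute)
  ultimately show "(%z. L2 (ball z \<rho>) g) : borel_measurable lborel" by (simp add: L2_def)
 qed
 also have "\<dots> = ennreal V * (ennreal (16 * \<rho>\<^sup>2 * 2 ^ CARD('n)) * L2 UNIV g)"
  using ball_average[of g \<rho>] \<rho> fin by (simp add: mult_ac)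
 finally have *: "ennreal V * L2 UNIV v <= ennreal V * (ennreal (16 * \<rho>\<^sup>2 * 2 ^ CARD('n)) * L2 UNIV g)" .
 have c: "X = ennreal (1 / V) * (ennreal V * X)" for X
  using V by (simp add: mult.assoc[symmetric] ennreal_mult[symmetric])
 show ?thesis
  using mult_left_mono[OF *, of "ennreal (1 / V)"] by (simp add: c[symmetric])
qed

section \<open>Hardy's inequality\<close>

lemma coordinate_over_square:
 fixes \<epsilon> :: real
 assumes "\<epsilon> > 0"
 defines "q \<equiv> %x::real^'n. x \<bullet> x + \<epsilon>"
 shows "C1 (%x. x $ i / q x)"
  and "grad (%x. x $ i / q x) = (%x. (1 / q x) *. axis i 1 - (2 * x $ i / (q x)^2) *. x)"
proof -
 have q: "q x > 0" for x unfolding q_def using assms(1) by (simp add: add_nonneg_pos)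
 have qd: "(q has_derivative (%h. 2 * (x \<bullet> h))) (at x)" for x
  unfolding q_def by (auto intro!: derivative_eq_intros simp: inner_commute)
 have vd: "((%x::real^'n. x $ i) has_derivative (%h. h $ i)) (at x)" for x
  by (rule bounded_linear_imp_has_derivative) (rule bounded_linear_vec_nth)
 have d: "((%x. x $ i / q x) has_derivative (%h. ((1 / q x) *. axis i 1 - (2 * x $ i / (q x)^2) *. x) \<bullet> h)) (at x)" for x
 proof -
  have "q x ~= 0" using q[of x] by simp
  from has_derivative_divide'[OF vd qd this]
  have "((%x. x $ i / q x) has_derivative (%h. (h $ i * q x - x $ i * (2 * (x \<bullet> h))) / (q x * q x))) (at x)" .
  moreover have "(%h. (h $ i * q x - x $ i * (2 * (x \<bullet> h))) / (q x * q x)) =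
   (%h. ((1 / q x) *. axis i 1 - (2 * x $ i / (q x)^2) *. x) \<bullet> h)"
   using q[of x] by (auto simp: fun_eq_iff inner_diff_left inner_axis inner_commute[of "axis i 1"] power2_eq_square field_simps)
  ultimately show ?thesis by simp
 qed
 have qc: "continuous_on UNIV q" unfolding q_def by (intro continuous_intros)
 have "continuous_on UNIV (%x. (1 / q x) *. axis i 1 - (2 * x $ i / (q x)^2) *. x)"
  by (intro continuous_intros qc) (use q in \<open>auto simp: less_imp_neq[THEN not_sym]\<close>)
 from C1I[OF d this] show "C1 (%x. x $ i / q x)"
  "grad (%x. x $ i / q x) = (%x. (1 / q x) *. axis i 1 - (2 * x $ i / (q x)^2) *. x)" by auto
qed

text \<open>The divergence of w^2 x / (|x|^2 + \<epsilon>) integrates to 0. The divergence of the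
  field x / (|x|^2 + \<epsilon>) is at least 1 / (|x|^2 + \<epsilon>) because n >= 3, and the mixed
  term is absorbed by Young's inequality, which produces the constant 4. The parameter \<epsilon>
  removes the singularity of the field.\<close>

lemma hardy_C1:
 fixes w :: "real^'n => real"
 assumes w: "w : C1c UNIV" and n: "CARD('n) \<ge> 3" and \<epsilon>: "\<epsilon> > 0"
 shows "(NN x. ennreal ((w x)^2 / (x \<bullet> x + \<epsilon>))) <= 4 * L2 UNIV (grad w)"
proof -
 define q where "q = (%x::real^'n. x \<bullet> x + \<epsilon>)"
 have q: "q x > 0" for x unfolding q_def using \<epsilon> by (simp add: add_nonneg_pos)
 have qc: "continuous_on UNIV q" unfolding q_def by (intro continuous_intros)
 obtain K where K: "C1 w" "compact K" "ALL x. x ~: K --> w x = 0" using w by (auto simp: C1c_def)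
 have gz: "ALL x. x ~: K --> grad w x = 0"
  using grad_zero_outside[of K w] K compact_imp_closed by blast
 have w2: "C1 (%x. w x * w x)" by (rule C1_mult[OF K(1) K(1)])
 define f where "f i x = x $ i / q x" for i and x :: "real^'n"
 have fC: "C1 (f i)" and fg: "grad (f i) = (%x. (1 / q x) *. axis i 1 - (2 * x $ i / (q x)^2) *. x)" for i
  using coordinate_over_square[OF \<epsilon>, of i] unfolding f_def[abs_def] q_def by auto
 have pd: "pderiv (%x. (w x * w x) * f i x) i x = (w x)^2 * (1 / q x - 2 * (x $ i)^2 / (q x)^2) + 2 * w x * (grad w x $ i * (x $ i / q x))" for i x
 proof -
  have "pderiv (%x. (w x * w x) * f i x) i x = grad (%x. (w x * w x) * f i x) x $ i" by (simp add: grad_def)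
  also have "\<dots> = (w x * w x) * (grad (f i) x $ i) + f i x * (2 * w x * grad w x $ i)"
   unfolding grad_mult[OF w2 fC] grad_mult[OF K(1) K(1)] by simp
  also have "grad (f i) x $ i = 1 / q x - 2 * (x $ i)^2 / (q x)^2"
   unfolding fg by (simp add: power2_eq_square)
  finally show ?thesis by (simp add: f_def power2_eq_square)
 qed
 have int0: "(LBINT x. pderiv (%x. (w x * w x) * f i x) i x) = 0" for i
  by (rule integral_pderiv_zero, rule C1cI[where K=K]) (use K C1_mult[OF w2 fC] in auto)
 have pc: "continuous_on UNIV (pderiv (%x. (w x * w x) * f i x) i)" for i
 proof -
  have "continuous_on UNIV (%x. grad (%x. (w x * w x) * f i x) x $ i)"
   by (intro continuous_intros C1_continuous_grad C1_mult[OF w2 fC])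
  then show ?thesis by (simp add: grad_def)
 qed
 have ip: "integrable lborel (pderiv (%x. (w x * w x) * f i x) i)" for i
  by (rule C1c_integrable[OF pc K(2)]) (use K gz pd in auto)
 define A where "A x = (w x)^2 / q x" for x
 define D where "D x = (norm (grad w x))^2" for x
 have "continuous_on UNIV (%x. (w x)^2 / q x)"
  by (intro continuous_intros C1_continuous[OF K(1)] qc) (metis q less_irrefl)
 then have iA: "integrable lborel A" unfolding A_def
  by (rule C1c_integrable[OF _ K(2)]) (use K in auto)
 have iD: "integrable lborel D" unfolding D_def
  by (rule C1c_integrable[OF _ K(2)]) (use K gz in \<open>auto intro!: continuous_intros C1_continuous_grad\<close>)
 have "A x / 2 - 2 * D x <= (\<Sum>i\<in>UNIV. pderiv (%x. (w x * w x) * f i x) i x)" for x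
 proof -
  have "(\<Sum>i\<in>UNIV. pderiv (%x. (w x * w x) * f i x) i x)
   = (w x)^2 * (real CARD('n) / q x - 2 * (x \<bullet> x) / (q x)^2) + 2 * w x * ((grad w x \<bullet> x) / q x)"
   unfolding pd by (simp add: sum.distrib sum_distrib_left[symmetric] sum_subtractf sum_divide_distrib[symmetric]
     inner_vec_def power2_eq_square)
  moreover have "1 / q x <= real CARD('n) / q x - 2 * (x \<bullet> x) / (q x)^2"
  proof -
   have "(x \<bullet> x) / (q x)^2 <= 1 / q x"
    using q[of x] \<epsilon> by (simp add: power2_eq_square divide_simps) (simp add: q_def)
   moreover have "3 / q x <= real CARD('n) / q x" using q[of x] n by (intro divide_right_mono) auto
   ultimately show ?thesis by simp
  qed
  from mult_left_mono[OF this, of "(w x)^2"]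
  have "A x <= (w x)^2 * (real CARD('n) / q x - 2 * (x \<bullet> x) / (q x)^2)" by (simp add: A_def)
  moreover have "- (A x / 2 + 2 * D x) <= 2 * w x * ((grad w x \<bullet> x) / q x)"
  proof -
   define s where "s = sqrt (q x)"
   have s: "s > 0" "q x = s\<^sup>2" using q[of x] by (auto simp: s_def)
   have nx: "norm x <= s" unfolding s_def q_def using \<epsilon> by (simp add: norm_eq_sqrt_inner)
   have "\<bar>2 * w x * ((grad w x \<bullet> x) / q x)\<bar> <= 2 * \<bar>w x\<bar> * (norm (grad w x) * s / q x)"
    using Cauchy_Schwarz_ineq2[of "grad w x" x] nx q[of x]
    by (auto simp: abs_mult abs_divide intro!: mult_left_mono divide_right_mono order_trans[OF Cauchy_Schwarz_ineq2])
   also have "\<dots> = 2 * (\<bar>w x\<bar> / s) * norm (grad w x)" using s by (simp add: power2_eq_square)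
   also have "\<dots> <= (\<bar>w x\<bar> / s)^2 / 2 + 2 * (norm (grad w x))^2"
    using zero_le_power2[of "\<bar>w x\<bar> / s - 2 * norm (grad w x)"] by (simp add: power2_diff power_mult_distrib)
   also have "\<dots> = A x / 2 + 2 * D x" using s by (simp add: A_def D_def power_divide)
   finally show ?thesis by linarith
  qed
  ultimately show ?thesis by linarith
 qed
 then have "(LBINT x. A x / 2 - 2 * D x) <= (LBINT x. (\<Sum>i\<in>UNIV. pderiv (%x. (w x * w x) * f i x) i x))"
  using iA iD ip by (intro integral_mono) auto
 also have "\<dots> = 0" using ip int0 by (subst Bochner_Integration.integral_sum) auto
 finally have le: "(LBINT x. A x) <= 4 * (LBINT x. D x)"
  using iA iD by simp
 have "(NN x. ennreal (A x)) = ennreal (LBINT x. A x)"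
  by (rule nn_integral_eq_integral[OF iA]) (use q in \<open>auto simp: A_def intro!: divide_nonneg_pos\<close>)
 also have "\<dots> <= ennreal (4 * (LBINT x. D x))" using le by (rule ennreal_leI)
 also have "\<dots> = 4 * ennreal (LBINT x. D x)" by (simp add: ennreal_mult')
 also have "ennreal (LBINT x. D x) = (NN x. ennreal (D x))"
  by (rule nn_integral_eq_integral[OF iD, symmetric]) (auto simp: D_def)
 finally show ?thesis by (simp add: A_def D_def q_def L2_def)
qed

text \<open>With \<epsilon> = r^2 the weight is at least 1 / (2 r^2) on the ball. The factor 16 is 2
  times 8, where 8 is Hardy's constant 4 doubled in the passage to the limit.\<close>

lemma hardy_ball:
 fixes v :: "real^'n => real"
 assumes a: "approx UNIV (C1c UNIV) v g" and n: "CARD('n) \<ge> 3" and r: "r > 0"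
 shows "L2 (ball 0 r) v <= ennreal (16 * r\<^sup>2) * L2 UNIV g"
proof -
 note [measurable] = approxD(3,4)[OF a]
 obtain w where w: "!!j::nat. w j : C1c UNIV" "!!j. C1 (w j)" "(%j. L2 UNIV (%x. grad (w j) x - g x)) ---> 0"
  "AE x\<in>UNIV in lborel. (%j. w j x) ---> v x"
  using approx_sequence[OF a] by blast
 note [measurable] = C1_measurable[OF w(2)] grad_measurable[OF w(2)]
 have q: "x \<bullet> x + r\<^sup>2 > 0" for x :: "real^'n" using r by (simp add: add_nonneg_pos)
 have "(NN x. ennreal ((v x)^2 / (x \<bullet> x + r\<^sup>2))) = (NN x. liminf (%j. ennreal ((w j x)^2 / (x \<bullet> x + r\<^sup>2))))"
 proof (rule nn_integral_cong_AE, use w(4) in eventually_elim)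
  fix x :: "real^'n" assume *: "x : UNIV --> (%j. w j x) ---> v x"
  have "(%j. ennreal ((w j x)^2 / (x \<bullet> x + r\<^sup>2))) ---> ennreal ((v x)^2 / (x \<bullet> x + r\<^sup>2))"
   using * q[of x] by (intro tendsto_ennrealI tendsto_intros) auto
  from lim_imp_Liminf[OF sequentially_bot this]
  show "ennreal ((v x)^2 / (x \<bullet> x + r\<^sup>2)) = liminf (%j. ennreal ((w j x)^2 / (x \<bullet> x + r\<^sup>2)))" by simp
 qed
 also have "\<dots> <= liminf (%j. NN x. ennreal ((w j x)^2 / (x \<bullet> x + r\<^sup>2)))"
  by (rule nn_integral_liminf) measurable
 also have "\<dots> <= 8 * L2 UNIV g"
 proof (rule liminf_bound)
  show "(%j. 8 * L2 UNIV (%x. grad (w j) x - g x) + 0 * 0) ---> 0"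
   by (intro ennreal_tendsto_0_lincomb[OF w(3) tendsto_const]) auto
  fix j
  have "(NN x. ennreal ((w j x)^2 / (x \<bullet> x + r\<^sup>2))) <= 4 * L2 UNIV (grad (w j))"
   using hardy_C1[OF w(1) n, of "r\<^sup>2"] r by simp
  also have "\<dots> <= 4 * (2 * L2 UNIV g + 2 * L2 UNIV (%x. grad (w j) x - g x))"
   by (intro mult_left_mono L2_grad_split) auto
  finally show "(NN x. ennreal ((w j x)^2 / (x \<bullet> x + r\<^sup>2))) <=
   8 * L2 UNIV g + (8 * L2 UNIV (%x. grad (w j) x - g x) + 0 * 0)"
   by (simp add: distrib_left mult.assoc[symmetric])
 qed
 finally have *: "(NN x. ennreal ((v x)^2 / (x \<bullet> x + r\<^sup>2))) <= 8 * L2 UNIV g" .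
 have "L2 (ball 0 r) v <= (NN x. ennreal (2 * r\<^sup>2) * ennreal ((v x)^2 / (x \<bullet> x + r\<^sup>2)))"
  unfolding L2_def
 proof (rule nn_integral_mono)
  fix x :: "real^'n"
  show "ennreal ((norm (v x))^2) * ind (ball 0 r) x <= ennreal (2 * r\<^sup>2) * ennreal ((v x)^2 / (x \<bullet> x + r\<^sup>2))"
  proof (cases "x : ball 0 r")
   case True
   then have "(norm x)^2 <= r\<^sup>2" by (intro power_mono) auto
   then have "x \<bullet> x + r\<^sup>2 <= 2 * r\<^sup>2" by (simp add: dot_square_norm)
   then have "1 <= 2 * r\<^sup>2 / (x \<bullet> x + r\<^sup>2)" using q[of x] by (simp add: field_simps)
   from mult_left_mono[OF this, of "(v x)^2"]
   have "(v x)^2 <= 2 * r\<^sup>2 * ((v x)^2 / (x \<bullet> x + r\<^sup>2))" by (simp add: mult_ac)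
   then show ?thesis using True q[of x] by (simp add: ennreal_mult[symmetric] ennreal_leI)
  qed simp
 qed
 also have "\<dots> = ennreal (2 * r\<^sup>2) * (NN x. ennreal ((v x)^2 / (x \<bullet> x + r\<^sup>2)))"
  by (rule nn_integral_cmult) measurable
 also have "\<dots> <= ennreal (2 * r\<^sup>2) * (8 * L2 UNIV g)" by (intro mult_left_mono *) simp
 also have "\<dots> = ennreal (16 * r\<^sup>2) * L2 UNIV g"
 proof -
  have "ennreal (16 * r\<^sup>2) = ennreal (2 * r\<^sup>2) * 8"
   by (subst ennreal_numeral[symmetric], subst ennreal_mult[symmetric]) auto
  then show ?thesis by (simp add: mult.assoc)
 qed
 finally show ?thesis .
qed

subsection \<open>Supersolutions\<close>

lemma L2_inner_bound:
 fixes f h :: "real^'n => real^'n"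
 assumes [measurable]: "f : Borel" "h : Borel" "S : sets borel"
 shows "(NN x. ennreal \<bar>ind S x * (f x \<bullet> h x)\<bar>)^2 <= L2 S f * L2 S h"
proof -
 have "(NN x. ennreal \<bar>ind S x * (f x \<bullet> h x)\<bar>) <=
   (NN x. ennreal (ind S x * norm (f x)) * ennreal (ind S x * norm (h x)))"
  by (intro nn_integral_mono)
   (auto simp: indicator_def ennreal_mult[symmetric] Cauchy_Schwarz_ineq2 intro!: ennreal_leI)
 then have "(NN x. ennreal \<bar>ind S x * (f x \<bullet> h x)\<bar>)^2 <=
   (NN x. ennreal (ind S x * norm (f x)) * ennreal (ind S x * norm (h x)))^2"
  by (rule power_mono) simp
 also have "\<dots> <= (NN x. (ennreal (ind S x * norm (f x)))^2) * (NN x. (ennreal (ind S x * norm (h x)))^2)"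
  by (rule Cauchy_Schwarz_nn_integral) measurable
 also have "(NN x. (ennreal (ind S x * norm (f x)))^2) = L2 S f"
  unfolding L2_def by (intro nn_integral_cong) (auto simp: indicator_def ennreal_power)
 also have "(NN x. (ennreal (ind S x * norm (h x)))^2) = L2 S h"
  unfolding L2_def by (intro nn_integral_cong) (auto simp: indicator_def ennreal_power)
 finally show ?thesis .
qed

lemma L2_inner_integrable:
 fixes f h :: "real^'n => real^'n"
 assumes [measurable]: "f : Borel" "h : Borel" "S : sets borel"
  and fin: "L2 S f < \<infinity>" "L2 S h < \<infinity>"
 shows "integrable lborel (%x. ind S x * (f x \<bullet> h x))"
proof (rule integrableI_bounded)
 have "(NN x. ennreal \<bar>ind S x * (f x \<bullet> h x)\<bar>)^2 < \<infinity>"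
  using L2_inner_bound[of f h S] fin by (simp add: ennreal_mult_less_top le_less_trans)
 then show "(NN x. ennreal (norm (ind S x * (f x \<bullet> h x)))) < \<infinity>"
  by (auto simp: power2_eq_square ennreal_mult_less_top less_top[symmetric])
qed measurable

lemma L2_inner_tendsto:
 fixes f h :: "real^'n => real^'n"
 assumes [measurable]: "f : Borel" "h : Borel" "S : sets borel"
  "!!j. h' j : Borel"
  and fin: "L2 S f < \<infinity>" "L2 S h < \<infinity>" "!!j. L2 S (h' j) < \<infinity>" and lim: "(%j::nat. L2 S (%x. h' j x - h x)) ---> 0"
 shows "(%j. LBINT x. ind S x * (f x \<bullet> h' j x)) ---> (LBINT x. ind S x * (f x \<bullet> h x))"
proof -
 define a where "a j = (LBINT x. ind S x * (f x \<bullet> h' j x)) - (LBINT x. ind S x * (f x \<bullet> h x))" for j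
 have i: "integrable lborel (%x. ind S x * (f x \<bullet> h x))" "integrable lborel (%x. ind S x * (f x \<bullet> h' j x))" for j
  using fin by (auto intro!: L2_inner_integrable)
 have eq: "a j = (LBINT x. ind S x * (f x \<bullet> (h' j x - h x)))" for j
  unfolding a_def using i by (subst Bochner_Integration.integral_diff[symmetric]) (auto simp: inner_diff_right right_diff_distrib)
 have i': "integrable lborel (%x. ind S x * (f x \<bullet> (h' j x - h x)))" for j
  using Bochner_Integration.integrable_diff[OF i(2)[of j] i(1)] by (simp add: inner_diff_right right_diff_distrib)
 have "ennreal ((a j)^2) <= L2 S f * L2 S (%x. h' j x - h x)" for j
 proof -
  have "ennreal \<bar>a j\<bar> <= (NN x. ennreal \<bar>ind S x * (f x \<bullet> (h' j x - h x))\<bar>)"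
   using integral_norm_bound_ennreal[OF i'[of j]] by (simp add: eq)
  then have "(ennreal \<bar>a j\<bar>)^2 <= (NN x. ennreal \<bar>ind S x * (f x \<bullet> (h' j x - h x))\<bar>)^2"
   by (rule power_mono) simp
  also have "\<dots> <= L2 S f * L2 S (%x. h' j x - h x)" by (rule L2_inner_bound) measurable
  finally show ?thesis by (simp add: ennreal_power)
 qed
 moreover have "(%j. L2 S f * L2 S (%x. h' j x - h x)) ---> 0"
  using ennreal_tendsto_0_lincomb[OF lim tendsto_const[of 0], of "L2 S f" 0] fin(1) by simp
 ultimately have "(%j. ennreal ((a j)^2)) ---> 0" by (rule ennreal_tendsto_0_le[rotated])
 then have "(%j. (a j)^2) ---> 0"
  by (subst (asm) ennreal_0[symmetric], subst (asm) tendsto_ennreal_iff) auto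
 then have "(%j. sqrt ((a j)^2)) ---> sqrt 0" by (intro tendsto_real_sqrt)
 then have "a ---> 0" by (simp add: tendsto_rabs_zero_iff)
 then show ?thesis unfolding a_def by (simp add: LIM_zero_iff)
qed

text \<open>All conditions hold at every point and A is Borel, which spares almost everywhere
  arguments; \<open>elliptic_version\<close> replaces a member of \<open>elliptic_class\<close> by
  such a matrix field.\<close>

locale elliptic =
 fixes A :: "real^'n => real^'n^'n" and lam L :: real
 assumes lam_pos: "0 < lam" and lam_le: "lam <= L"
  and A_measurable: "A : Borel"
  and A_sym: "transpose (A x) = A x"
  and A_lower: "lam * (norm \<xi>)^2 <= (A x *v \<xi>) \<bullet> \<xi>"
  and A_upper: "(A x *v \<xi>) \<bullet> \<xi> <= L * (norm \<xi>)^2"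
begin

lemma L_pos: "0 < L" using lam_pos lam_le by simp

lemma A_commute: "(A x *v \<xi>) \<bullet> \<zeta> = (A x *v \<zeta>) \<bullet> \<xi>"
proof -
 have "(A x *v \<xi>) \<bullet> \<zeta> = \<xi> \<bullet> (transpose (A x) *v \<zeta>)"
  by (metis dot_lmul_matrix inner_commute transpose_matrix_vector transpose_transpose)
 then show ?thesis by (simp add: A_sym inner_commute)
qed

lemma A_nonneg: "0 <= (A x *v \<xi>) \<bullet> \<xi>"
 using A_lower[where x=x and \<xi>=\<xi>] lam_pos by (meson order_trans zero_le_power2 mult_nonneg_nonneg less_imp_le)

lemma A_young:
 "2 * \<bar>(A x *v \<xi>) \<bullet> \<zeta>\<bar> <= (A x *v \<xi>) \<bullet> \<xi> + (A x *v \<zeta>) \<bullet> \<zeta>"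
proof -
 have "0 <= (A x *v (\<xi> + \<zeta>)) \<bullet> (\<xi> + \<zeta>)" "0 <= (A x *v (\<xi> - \<zeta>)) \<bullet> (\<xi> - \<zeta>)" by (rule A_nonneg)+
 then show ?thesis
  using A_commute[of x \<xi> \<zeta>]
  by (simp add: matrix_vector_right_distrib matrix_vector_mult_diff_distrib inner_add_left inner_add_right inner_diff_left inner_diff_right)
qed

text \<open>Young's inequality for the form of A with the vectors s \<xi> and A \<xi>, where s
  scales them to equal length; the symmetry of A enters through \<open>A_young\<close>.\<close>

lemma A_norm: "norm (A x *v \<xi>) <= L * norm \<xi>"
proof (cases "\<xi> = 0 \<or> A x *v \<xi> = 0")
 case False
 define \<zeta> where "\<zeta> = A x *v \<xi>"
 define s where "s = norm \<zeta> / norm \<xi>"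
 have s: "s > 0" "norm \<zeta> = s * norm \<xi>" using False by (auto simp: s_def \<zeta>_def)
 have "2 * \<bar>(A x *v (s *. \<xi>)) \<bullet> \<zeta>\<bar> <= L * (norm (s *. \<xi>))^2 + L * (norm \<zeta>)^2"
  using A_young[of x "s *. \<xi>" \<zeta>] A_upper[of x "s *. \<xi>"] A_upper[of x \<zeta>] by linarith
 moreover have "(A x *v (s *. \<xi>)) \<bullet> \<zeta> = s * (norm \<zeta>)^2"
  by (simp add: matrix_vector_mult_scaleR \<zeta>_def dot_square_norm)
 ultimately have "s * (norm \<zeta>)^2 <= L * (norm \<zeta>)^2" using s by (simp add: abs_mult)
 then have "s <= L" using False by (simp add: \<zeta>_def)
 then show ?thesis using s(2) by (simp add: \<zeta>_def mult_right_mono)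
qed (auto simp: L_pos less_imp_le)

lemma A_mult_measurable [measurable (raw)]:
 assumes "g : borel_measurable M"  "f : measurable M borel"
 shows "(%x. A (f x) *v g x) : borel_measurable M"
proof -
 have "(%x. A (f x)) : borel_measurable M" using A_measurable assms(2) by (rule measurable_compose[rotated])
 moreover have "continuous_on UNIV (%x::(real^'n^'n) \<times> (real^'n). fst x *v snd x)"
  unfolding matrix_vector_mult_def
  by (intro continuous_on_vec_lambda continuous_on_sum continuous_on_mult continuous_on_component
   continuous_on_fst continuous_on_snd continuous_on_id)
 ultimately show ?thesis
  using borel_measurable_continuous_Pair[OF _ assms(1), of "%x. A (f x)" "%M v. M *v v"] by blast
qed

lemma L2_A_finite: "g : Borel ==> S : sets borel ==> L2 S g < \<infinity> ==> L2 S (%x. A x *v g x) < \<infinity>"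
 using L2_bound_mult[of g S "%x. A x *v g x" L] A_norm L_pos
 by (auto simp: ennreal_mult_less_top intro: le_less_trans)

text \<open>Weak supersolutions, in terms of the gradient field alone. That a function with gradient
  g is a subsolution is then expressed by \<open>super S (%x. - g x)\<close>.\<close>

definition super :: "(real^'n) set => (real^'n => real^'n) => bool" where
 "super S g \<longleftrightarrow> (ALL \<phi>:C1c S. (ALL x. 0 <= \<phi> x) --> 0 <= (LBINT x. ind S x * ((A x *v g x) \<bullet> grad \<phi> x)))"

lemma C1c_L2_finite:
 assumes "\<phi> : C1c S" "S : sets borel"
 shows "L2 S (grad \<phi>) < \<infinity>"
proof -
 obtain K where K: "compact K" "K <= S" "ALL x. x ~: K --> \<phi> x = 0" using assms by (auto simp: C1c_def)
 obtain B where B: "B > 0" "ALL x. norm (grad \<phi> x) <= B" using C1c_bounded[OF assms(1)] by blast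
 have z: "grad \<phi> x = 0" if "x ~: K" for x
  by (rule grad_zero_outside[of K]) (use K that compact_imp_closed in auto)
 have "L2 S (grad \<phi>) <= L2 K (grad \<phi>)"
  unfolding L2_def by (intro nn_integral_mono) (auto simp: indicator_def z)
 also have "\<dots> <= ennreal (B\<^sup>2) * emeasure lborel K"
  by (rule L2_bounded) (use B K in \<open>auto intro: borel_compact\<close>)
 also have "\<dots> < \<infinity>" using emeasure_compact_finite[OF K(1)] by (simp add: ennreal_mult_less_top)
 finally show ?thesis .
qed

lemma super_approx:
 assumes s: "super S g" and g [measurable]: "g : Borel" and fin: "L2 S g < \<infinity>"
  and a: "approx S {\<phi> : C1c S. ALL x. 0 <= \<phi> x} \<phi> h"
 shows "0 <= (LBINT x. ind S x * ((A x *v g x) \<bullet> h x))"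
proof -
 note [measurable] = approxD(1,3,4)[OF a]
 obtain w where w: "!!j::nat. w j : {\<phi> : C1c S. ALL x. 0 <= \<phi> x}" "!!j. C1 (w j)" "(%j. L2 S (%x. grad (w j) x - h x)) ---> 0"
  using approx_sequence[OF a] by blast
 have "(%j. LBINT x. ind S x * ((A x *v g x) \<bullet> grad (w j) x)) ---> (LBINT x. ind S x * ((A x *v g x) \<bullet> h x))"
 proof (rule L2_inner_tendsto[OF _ _ _ _ L2_A_finite[OF g approxD(1)[OF a] fin] approxD(6)[OF a] _ w(3)])
  show "grad (w j) : Borel" for j by (rule grad_measurable[OF w(2)])
  show "L2 S (grad (w j)) < \<infinity>" for j using C1c_L2_finite[OF _ approxD(1)[OF a]] w(1) by blast
 qed measurable
 then show ?thesis
  by (rule LIMSEQ_le_const) (use s w(1) in \<open>auto simp: super_def\<close>)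
qed

lemma super_test:
 assumes s: "super S g" and a: "approx S X u g"
  and F: "!!t. (F has_real_derivative F' t) (at t)" "continuous_on UNIV F'" "!!t. \<bar>F' t\<bar> <= M" "!!w x. w : X ==> 0 <= F (w x)"
  and fin: "L2 S (%x. F (u x)) < \<infinity>" and \<eta>: "\<eta> : C1c S" "!!x. 0 <= \<eta> x"
 shows "0 <= (LBINT x. ind S x * ((A x *v g x) \<bullet> (\<eta> x *. (F' (u x) *. g x) + F (u x) *. grad \<eta> x)))"
proof -
 have a1: "approx S {w. C1 w & (ALL x. 0 <= w x)} (%x. F (u x)) (%x. F' (u x) *. g x)"
 proof (rule approx_chain[OF a F(1,2,3)])
  show "(%x. F (w x)) : {w. C1 w & (ALL x. 0 <= w x)}" if "w : X" for w
   using that F(4) approxD(2)[OF a] C1_compose[OF _ F(1,2)] by blast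
 qed (use fin in auto)
 obtain B where B: "B > 0" "ALL x. \<bar>\<eta> x\<bar> <= B" "ALL x. norm (grad \<eta> x) <= B" using C1c_bounded[OF \<eta>(1)] by blast
 have "approx S {\<phi> : C1c S. ALL x. 0 <= \<phi> x} (%x. \<eta> x * F (u x)) (%x. \<eta> x *. (F' (u x) *. g x) + F (u x) *. grad \<eta> x)"
  by (rule approx_mult_C1[OF a1 C1c_C1[OF \<eta>(1)], where B=B])
   (use B approxD(1)[OF a] \<eta> C1c_mult[OF \<eta>(1)] C1c_C1 in auto)
 from super_approx[OF s approxD(4,6)[OF a] this] show ?thesis .
qed

text \<open>The test function is \<eta>^2 F(u). The pair p, q splits F(u) in such a way that q^2 is
  dominated by -F'(u): half of the energy with weight q^2 is absorbed, and the weight p^2 remains on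
  the right. With suitable p and q this one inequality covers truncations as well as
  logarithms.\<close>

lemma caccioppoli:
 assumes s: "super S g" and a: "approx S (Collect C1) u g"
  and F: "!!t. (F has_real_derivative F' t) (at t)" "continuous_on UNIV F'" "!!t. \<bar>F' t\<bar> <= M" "!!t. 0 <= F t"
  and fin: "L2 S (%x. F (u x)) < \<infinity>" and \<eta>: "\<eta> : C1c S"
  and pq: "AE x\<in>S in lborel. F (u x) <= p x * q x & (q x)^2 <= - F' (u x) & 0 <= p x & 0 <= q x"
  and [measurable]: "p : Borel" "q : Borel"
 shows "(NN x. ennreal ((\<eta> x)^2 * (q x)^2 * (norm (g x))^2) * ind S x)
  <= ennreal (4 * L / lam) * (NN x. ennreal ((p x)^2 * (norm (grad \<eta> x))^2) * ind S x)"
proof -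
 note [measurable] = approxD(1,3,4)[OF a] C1_measurable[OF C1c_C1[OF \<eta>]] grad_measurable[OF C1c_C1[OF \<eta>]]
  borel_measurable_continuous_onI[OF F(2)]
 have "continuous_on UNIV F" using F(1) DERIV_isCont by (metis continuous_at_imp_continuous_on)
 note [measurable] = borel_measurable_continuous_onI[OF this]
 obtain B where B: "B > 0" "ALL x. \<bar>\<eta> x\<bar> <= B" "ALL x. norm (grad \<eta> x) <= B" using C1c_bounded[OF \<eta>] by blast
 have M: "0 <= M" using F(3)[of 0] by simp
 have \<eta>2: "(%x. \<eta> x * \<eta> x) : C1c S" by (rule C1c_mult[OF \<eta> C1c_C1[OF \<eta>]])
 have g2: "grad (%x. \<eta> x * \<eta> x) = (%x. (2 * \<eta> x) *. grad \<eta> x)"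
  unfolding grad_mult[OF C1c_C1[OF \<eta>] C1c_C1[OF \<eta>]] by (simp add: scaleR_left_distrib[symmetric])
 define I where "I x = (A x *v g x) \<bullet> g x" for x
 define J where "J x = (A x *v grad \<eta> x) \<bullet> grad \<eta> x" for x
 define D where "D x = (A x *v g x) \<bullet> grad \<eta> x" for x
 have [measurable]: "I : Borel" "J : Borel" "D : Borel"
  unfolding I_def J_def D_def by measurable
 have I0: "0 <= I x" "I x <= L * (norm (g x))^2" "lam * (norm (g x))^2 <= I x" for x
  using A_nonneg A_upper A_lower by (auto simp: I_def)
 have J0: "0 <= J x" "J x <= L * (norm (grad \<eta> x))^2" for x
  using A_nonneg A_upper by (auto simp: J_def)
 have fA: "L2 S (%x. A x *v g x) < \<infinity>" using L2_A_finite approxD[OF a] by blast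
 have i1: "integrable lborel (%x. ind S x * ((A x *v g x) \<bullet> ((\<eta> x)^2 *. (F' (u x) *. g x))))"
 proof (rule L2_inner_integrable[OF _ _ _ fA])
  have "L2 S (%x. (\<eta> x)^2 *. (F' (u x) *. g x)) <= ennreal ((B\<^sup>2 * M)^2) * L2 S g"
  proof (rule L2_bound_mult)
   fix x
   have "(\<eta> x)^2 <= B\<^sup>2" using B by (metis abs_le_square_iff abs_of_pos)
   then have "(\<eta> x)^2 * \<bar>F' (u x)\<bar> <= B\<^sup>2 * M"
    using F(3)[of "u x"] by (intro mult_mono) auto
   from mult_right_mono[OF this norm_ge_zero[of "g x"]]
   show "norm ((\<eta> x)^2 *. (F' (u x) *. g x)) <= B\<^sup>2 * M * norm (g x)"
    by (simp only: norm_scaleR abs_of_nonneg[OF zero_le_power2] mult.assoc)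
  qed (use M in auto)
  then show "L2 S (%x. (\<eta> x)^2 *. (F' (u x) *. g x)) < \<infinity>"
   using approxD(6)[OF a] by (auto simp: ennreal_mult_less_top intro: le_less_trans)
 qed measurable
 have i2: "integrable lborel (%x. ind S x * ((A x *v g x) \<bullet> (F (u x) *. ((2 * \<eta> x) *. grad \<eta> x))))"
 proof (rule L2_inner_integrable[OF _ _ _ fA])
  have "L2 S (%x. F (u x) *. ((2 * \<eta> x) *. grad \<eta> x)) <= ennreal ((2 * B * B)^2) * L2 S (%x. F (u x))"
  proof (rule L2_bound_mult)
   fix x
   have "norm (F (u x) *. ((2 * \<eta> x) *. grad \<eta> x)) = (2 * \<bar>\<eta> x\<bar> * norm (grad \<eta> x)) * \<bar>F (u x)\<bar>" by (simp add: abs_mult)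
   also have "\<dots> <= (2 * B * B) * \<bar>F (u x)\<bar>" using B by (intro mult_right_mono mult_mono) auto
   finally show "norm (F (u x) *. ((2 * \<eta> x) *. grad \<eta> x)) <= 2 * B * B * norm (F (u x))" by simp
  qed (use B in auto)
  then show "L2 S (%x. F (u x) *. ((2 * \<eta> x) *. grad \<eta> x)) < \<infinity>"
   using fin by (auto simp: ennreal_mult_less_top intro: le_less_trans)
 qed measurable
 define P where "P x = ind S x * ((\<eta> x)^2 * (- F' (u x)) * I x)" for x
 define Q where "Q x = ind S x * (F (u x) * (2 * \<eta> x) * D x)" for x
 have iP: "integrable lborel P" using Bochner_Integration.integrable_minus[OF i1] by (simp add: P_def[abs_def] I_def mult.assoc)
 have iQ: "integrable lborel Q" using i2 by (simp add: Q_def[abs_def] D_def mult.assoc)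
 have PQ: "(LBINT x. P x) <= (LBINT x. Q x)"
 proof -
  have "0 <= (LBINT x. ind S x * ((A x *v g x) \<bullet> ((\<eta> x * \<eta> x) *. (F' (u x) *. g x) + F (u x) *. grad (%x. \<eta> x * \<eta> x) x)))"
   by (rule super_test[OF s a F fin \<eta>2]) simp
  also have "\<dots> = (LBINT x. Q x - P x)"
   by (intro Bochner_Integration.integral_cong)
    (auto simp: P_def Q_def I_def D_def g2 inner_add_right power2_eq_square algebra_simps)
  also have "\<dots> = (LBINT x. Q x) - (LBINT x. P x)" using iP iQ by simp
  finally show ?thesis by simp
 qed
 define E where "E x = ind S x * ((\<eta> x)^2 * (q x)^2 * I x)" for x
 define H where "H x = ind S x * ((p x)^2 * J x)" for x
 have [measurable]: "E : Borel" "H : Borel" unfolding E_def H_def by measurable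
 have E0: "0 <= E x" and H0: "0 <= H x" for x using I0 J0 by (auto simp: E_def H_def)
 have EP: "AEL x. E x <= P x"
  using pq
 proof eventually_elim
  case (elim x)
  have "(\<eta> x)^2 * (q x)^2 * I x <= (\<eta> x)^2 * (- F' (u x)) * I x" if "x : S"
   using elim that I0(1)[of x] by (intro mult_right_mono mult_left_mono) auto
  then show ?case unfolding E_def P_def by (cases "x : S") auto
 qed
 \<comment> \<open>Finiteness of the energy, without which half of it could not be absorbed.\<close>
 have iE: "integrable lborel E"
  by (rule Bochner_Integration.integrable_bound[OF iP])
   (measurable, use EP E0 in \<open>auto elim!: eventually_mono\<close>)
 have QE: "AEL x. Q x <= E x / 2 + 2 * H x"
  using pq
 proof eventually_elim
  fix x assume *: "x : S --> F (u x) <= p x * q x & (q x)^2 <= - F' (u x) & 0 <= p x & 0 <= q x"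
  show "Q x <= E x / 2 + 2 * H x"
  proof (cases "x : S")
   case True
   have "Q x <= \<bar>F (u x) * (2 * \<eta> x) * D x\<bar>" using True by (simp add: Q_def)
   also have "\<dots> = F (u x) * (2 * \<bar>\<eta> x\<bar> * \<bar>D x\<bar>)" using F(4)[of "u x"] by (simp add: abs_mult)
   also have "\<dots> <= (p x * q x) * (2 * \<bar>\<eta> x\<bar> * \<bar>D x\<bar>)" using * True by (intro mult_right_mono) auto
   also have "\<dots> = 2 * \<bar>(A x *v ((\<eta> x * q x) *. g x)) \<bullet> (p x *. grad \<eta> x)\<bar>"
    using * True by (simp add: matrix_vector_mult_scaleR D_def abs_mult)
   also have "\<dots> <= E x / 2 + 2 * H x"
   proof -
    \<comment> \<open>The factor 1/2 is placed on the energy side, so that after doubling only half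
      of E appears.\<close>
    have "2 * \<bar>(A x *v ((\<eta> x * q x / 2) *. g x)) \<bullet> (p x *. grad \<eta> x)\<bar>
     <= (A x *v ((\<eta> x * q x / 2) *. g x)) \<bullet> ((\<eta> x * q x / 2) *. g x) + (A x *v (p x *. grad \<eta> x)) \<bullet> (p x *. grad \<eta> x)"
     by (rule A_young)
    also have "\<dots> = E x / 4 + H x"
     using True by (simp add: E_def H_def I_def J_def matrix_vector_mult_scaleR power2_eq_square)
    finally show ?thesis by (simp add: matrix_vector_mult_scaleR abs_mult)
   qed
   finally show ?thesis .
  qed (simp add: Q_def E_def H_def)
 qed
 have main: "(NN x. ennreal (E x)) <= 4 * (NN x. ennreal (H x))"
 proof (cases "(NN x. ennreal (H x)) = \<infinity>")
  case False
  then have iH: "integrable lborel H" using H0 by (intro integrableI_nonneg) (auto simp: less_top)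
  have "(LBINT x. E x) <= (LBINT x. P x)" by (rule integral_mono_AE[OF iE iP EP])
  also have "\<dots> <= (LBINT x. Q x)" by (rule PQ)
  also have "\<dots> <= (LBINT x. E x / 2 + 2 * H x)" by (rule integral_mono_AE[OF iQ _ QE]) (use iE iH in auto)
  also have "\<dots> = (LBINT x. E x) / 2 + 2 * (LBINT x. H x)" using iE iH by simp
  finally have "(LBINT x. E x) <= 4 * (LBINT x. H x)" by simp
  then have "ennreal (LBINT x. E x) <= ennreal (4 * (LBINT x. H x))" by (rule ennreal_leI)
  then show ?thesis
   using nn_integral_eq_integral[OF iE] nn_integral_eq_integral[OF iH] E0 H0 by (simp add: ennreal_mult')
 qed (simp add: ennreal_mult_top)
 have "(NN x. ennreal ((\<eta> x)^2 * (q x)^2 * (norm (g x))^2) * ind S x) <= (NN x. ennreal (1 / lam) * ennreal (E x))"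
 proof (rule nn_integral_mono)
  fix x
  have "(norm (g x))^2 <= 1 / lam * I x" using I0(3)[of x] lam_pos by (simp add: field_simps)
  from mult_left_mono[OF this, of "(\<eta> x)^2 * (q x)^2"]
  have "(\<eta> x)^2 * (q x)^2 * (norm (g x))^2 <= 1 / lam * ((\<eta> x)^2 * (q x)^2 * I x)" by (simp add: mult_ac)
  then show "ennreal ((\<eta> x)^2 * (q x)^2 * (norm (g x))^2) * ind S x <= ennreal (1 / lam) * ennreal (E x)"
   using lam_pos I0(1)[of x] by (auto simp: E_def indicator_def ennreal_mult[symmetric] intro!: ennreal_leI)
 qed
 also have "\<dots> = ennreal (1 / lam) * (NN x. ennreal (E x))" by (rule nn_integral_cmult) measurable
 also have "\<dots> <= ennreal (1 / lam) * (4 * (NN x. ennreal (H x)))" by (intro mult_left_mono main) simp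
 also have "(NN x. ennreal (H x)) <= (NN x. ennreal L * (ennreal ((p x)^2 * (norm (grad \<eta> x))^2) * ind S x))"
 proof (rule nn_integral_mono)
  fix x
  have "(p x)^2 * J x <= L * ((p x)^2 * (norm (grad \<eta> x))^2)"
   using mult_left_mono[OF J0(2)[of x], of "(p x)^2"] by (simp add: mult_ac)
  then show "ennreal (H x) <= ennreal L * (ennreal ((p x)^2 * (norm (grad \<eta> x))^2) * ind S x)"
   using L_pos by (auto simp: H_def indicator_def ennreal_mult[symmetric] intro!: ennreal_leI)
 qed
 also have "\<dots> = ennreal L * (NN x. ennreal ((p x)^2 * (norm (grad \<eta> x))^2) * ind S x)"
  by (rule nn_integral_cmult) measurable
 also have "ennreal (1 / lam) * (4 * (ennreal L * (NN x. ennreal ((p x)^2 * (norm (grad \<eta> x))^2) * ind S x)))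
  = ennreal (4 * L / lam) * (NN x. ennreal ((p x)^2 * (norm (grad \<eta> x))^2) * ind S x)"
 proof -
  have "ennreal (4 * L / lam) = ennreal (1 / lam) * (4 * ennreal L)"
   using lam_pos L_pos by (simp add: ennreal_mult[symmetric] ennreal_numeral[symmetric] del: ennreal_numeral)
  then show ?thesis by (simp add: mult.assoc)
 qed
 finally show ?thesis by (auto simp: mult_left_mono)
qed

end

subsection \<open>Local boundedness\<close>

text \<open>De Giorgi's class: Caccioppoli's inequality on superlevel sets, for the levels k >= 0
  which the iteration for the positive part visits. Local boundedness is derived from this class and
  not from an equation, so that it applies to subsolutions and to logarithms of supersolutions
  alike.\<close>

definition DG :: "real => (real^'n) set => (real^'n => real) => (real^'n => real^'n) => bool" where
 "DG \<Lambda> S v g \<longleftrightarrow> (ALL k>=0. ALL \<eta>:C1c S.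
  (NN x. ennreal ((\<eta> x)^2 * (norm (g x))^2) * ind (S \<inter> {x. k < v x}) x)
   <= ennreal \<Lambda> * (NN x. ennreal ((max (v x - k) 0)^2 * (norm (grad \<eta> x))^2) * ind S x))"

text \<open>This is the splitting F <= p q of \<open>caccioppoli\<close>, with p the positive part
  and q^2 the derivative of the smoothing; it amounts to t^2 + e^2 <= (t + e)^2.\<close>

lemma smooth_pos_le:
 assumes "e > 0"
 shows "smooth_pos e t <= max t 0 * sqrt (smooth_pos' e t)"
proof (cases "t <= 0")
 case False
 have "(t / (t + e))^2 <= 1 - (e / (t + e))\<^sup>2"
 proof -
  have "(t / (t + e))^2 + (e / (t + e))^2 = (t\<^sup>2 + e\<^sup>2) / (t + e)^2" by (simp add: power_divide add_divide_distrib)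
  also have "\<dots> <= 1"
  proof -
   have "t\<^sup>2 + e\<^sup>2 <= (t + e)^2" using False assms by (simp add: power2_sum)
   moreover have "0 < (t + e)^2" using False assms by simp
   ultimately show ?thesis by (simp add: divide_le_eq_1_pos)
  qed
  finally show ?thesis by simp
 qed
 then have "t / (t + e) <= sqrt (smooth_pos' e t)"
  using False by (intro real_le_rsqrt) (simp add: smooth_pos'_def)
 from mult_left_mono[OF this, of t] show ?thesis using False by (simp add: smooth_pos_def power2_eq_square)
qed (simp add: smooth_pos_def)

lemma truncation_limit:
 assumes [measurable]: "v : Borel" "f : Borel" "S : sets borel"
  and f0: "!!x. 0 <= f x"
  and bd: "!!j. (NN x. ennreal (f x * smooth_pos' (1 / Suc j) (v x - k)) * ind S x) <= X"
 shows "(NN x. ennreal (f x) * ind (S \<inter> {x. k < v x}) x) <= X"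
proof -
 note [measurable] = smooth_pos'_measurable
 have "(NN x. ennreal (f x) * ind (S \<inter> {x. k < v x}) x)
  = (NN x. liminf (%j. ennreal (f x * smooth_pos' (1 / Suc j) (v x - k)) * ind S x))"
 proof (rule nn_integral_cong)
  fix x
  have "(%j. f x * smooth_pos' (1 / Suc j) (v x - k)) ---> f x * (if v x - k > 0 then 1 else 0)"
   by (intro tendsto_intros smooth_pos'_tendsto)
  then have "(%j. ennreal (f x * smooth_pos' (1 / Suc j) (v x - k))) ---> ennreal (f x * (if v x - k > 0 then 1 else 0))"
   by (rule tendsto_ennrealI)
  then have "(%j. ennreal (f x * smooth_pos' (1 / Suc j) (v x - k)) * ind S x) ---> ennreal (f x) * ind (S \<inter> {x. k < v x}) x"
   by (cases "x : S"; cases "k < v x") auto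
  from lim_imp_Liminf[OF sequentially_bot this]
  show "ennreal (f x) * ind (S \<inter> {x. k < v x}) x = liminf (%j. ennreal (f x * smooth_pos' (1 / Suc j) (v x - k)) * ind S x)"
   by simp
 qed
 also have "\<dots> <= liminf (%j. NN x. ennreal (f x * smooth_pos' (1 / Suc j) (v x - k)) * ind S x)"
  by (rule nn_integral_liminf) measurable
 also have "\<dots> <= X"
  using Liminf_mono[OF always_eventually, of _ "%_. X" sequentially] bd by (simp add: Liminf_const)
 finally show ?thesis .
qed

text \<open>One step of De Giorgi's iteration, with a free radius \<rho>. By Chebyshev's inequality
  the hypothesis \<open>small\<close> bounds the measure where the cut-off function (v - k2)^+ lives
  by half of a ball of radius \<rho>; the Faber-Krahn inequality then gains \<rho>^2. The constant
  1152 is 16 * 2 * 36: Faber-Krahn, the splitting of the gradient, and the squared slope 6 / (r2 -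
  r1) of the cut-off.\<close>

lemma DG_step:
 fixes v :: "real^'n => real"
 assumes dg: "DG \<Lambda> (ball z R) v g" and \<Lambda>: "\<Lambda> \<ge> 0" and a: "approx (ball z R) (Collect C1) v g"
  and r: "0 <= r1" "r1 < r2" "r2 <= R" and k: "0 <= k1" "k1 < k2" and \<rho>: "\<rho> > 0"
  and small: "L2 (ball z r2) (%x. max (v x - k1) 0) <= ennreal (unit_ball_vol (real CARD('n)) * \<rho> ^ CARD('n) / 2 * (k2 - k1)^2)"
 shows "L2 (ball z r1) (%x. max (v x - k2) 0) <=
  ennreal (1152 * (\<Lambda> + 1) * 2 ^ CARD('n) * \<rho>\<^sup>2 / (r2 - r1)^2) * L2 (ball z r2) (%x. max (v x - k1) 0)"
proof -
 \<comment> \<open>The cut-off ends at the midpoint, so that its support is compact in the larger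
   ball.\<close>
 define r' where "r' = (r1 + r2) / 2"
 have r': "r1 < r'" "r' < r2" "r' - r1 = (r2 - r1) / 2" using r by (auto simp: r'_def field_simps)
 define B where "B = ball z R"
 note [measurable] = approxD(1,3,4)[OF a]
 obtain \<eta> where \<eta>: "C1 \<eta>" "ALL x. 0 <= \<eta> x & \<eta> x <= 1" "ALL x:cball z r1. \<eta> x = 1 & grad \<eta> x = 0"
  "ALL x. x ~: ball z r' --> \<eta> x = 0 & grad \<eta> x = 0" "ALL x. norm (grad \<eta> x) <= 3 / (r' - r1)"
  using cutoff_exists[OF r(1) r'(1), of z] by blast
 have \<eta>c: "\<eta> : C1c B"
  by (rule C1cI[OF \<eta>(1) compact_cball[of z r']]) (use \<eta>(4) r' r in \<open>auto simp: B_def subset_eq\<close>)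
 note [measurable] = C1_measurable[OF \<eta>(1)] grad_measurable[OF \<eta>(1)]
 define M where "M = 6 / (r2 - r1)"
 have gM: "norm (grad \<eta> x) <= M" for x using \<eta>(5) r' r by (simp add: M_def)
 have M: "M > 0" using r by (simp add: M_def)
 define \<psi> where "\<psi> x = max (v x - k2) 0" for x
 have [measurable]: "\<psi> : Borel" unfolding \<psi>_def by measurable
 have \<psi>le: "\<bar>\<psi> x\<bar> <= \<bar>max (v x - k1) 0\<bar>" for x using k by (auto simp: \<psi>_def)
 have fB: "emeasure lborel B < \<infinity>" using emeasure_lborel_ball_finite[of z R] by (simp add: B_def)
 have a1: "approx B (Collect C1) (%x. v x - k2) (%x. 1 *. g x)"
 proof (rule approx_chain[where F="%t. t - k2" and F'="%_. 1" and M=1, OF a[folded B_def]])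
  have "L2 B (%x. v x + - k2) <= 2 * L2 B v + 2 * L2 B (%x. - k2)"
   by (rule L2_add) (auto simp: B_def)
  also have "\<dots> < \<infinity>"
   using approxD(5)[OF a] L2_bounded[of B "%x. - k2" "\<bar>k2\<bar>"] fB
   by (auto simp: B_def ennreal_mult_less_top intro: le_less_trans)
  finally show "L2 B (%x. v x - k2) < \<infinity>" by simp
 qed (auto intro!: derivative_eq_intros C1_minus_const)
 have a2: "approx B (Collect C1) \<psi> (%x. if v x - k2 > 0 then 1 *. g x else 0)"
  unfolding \<psi>_def by (rule approx_pos[OF a1]) (auto intro: C1_smooth_pos)
 define h where "h x = \<eta> x *. (if v x - k2 > 0 then 1 *. g x else 0) + \<psi> x *. grad \<eta> x" for x
 have a3: "approx UNIV (Collect C1) (%x. \<eta> x * \<psi> x) h"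
  unfolding h_def
 proof (rule approx_mult_C1[OF a2 \<eta>(1), where B="max 1 M"])
  show "\<bar>\<eta> x\<bar> <= max 1 M" for x using \<eta>(2) by (simp add: le_max_iff_disj)
  show "norm (grad \<eta> x) <= max 1 M" for x using gM by (simp add: le_max_iff_disj)
  show "\<eta> x = 0 & grad \<eta> x = 0" if "x ~: B" for x
   using C1c_zero[OF \<eta>c that] by simp
 qed (use C1_mult[OF \<eta>(1)] in auto)
 define Y where "Y = L2 (ball z r2) (%x. max (v x - k1) 0)"
 have \<psi>Y: "(NN x. ennreal ((\<psi> x)^2 * (norm (grad \<eta> x))^2) * ind B x) <= ennreal (M\<^sup>2) * Y"
 proof -
  have "(NN x. ennreal ((\<psi> x)^2 * (norm (grad \<eta> x))^2) * ind B x) = L2 B (%x. \<psi> x *. grad \<eta> x)"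
   by (simp add: L2_def power_mult_distrib)
  also have "\<dots> <= ennreal (M\<^sup>2) * Y"
   unfolding Y_def
  proof (rule L2_bound_mult_on)
   show "\<psi> x *. grad \<eta> x = 0" if "x ~: ball z r2" for x
    using \<eta>(4) that r' by auto
   show "norm (\<psi> x *. grad \<eta> x) <= M * norm (max (v x - k1) 0)" for x
    using mult_mono[OF \<psi>le[of x] gM[of x]] by (simp add: mult.commute)
  qed (use M in auto)
  finally show ?thesis .
 qed
 have gh: "L2 UNIV h <= ennreal (2 * (\<Lambda> + 1) * M\<^sup>2) * Y"
 proof -
  have "L2 UNIV h <= 2 * L2 UNIV (%x. \<eta> x *. (if v x - k2 > 0 then 1 *. g x else 0)) + 2 * L2 UNIV (%x. \<psi> x *. grad \<eta> x)"
   unfolding h_def by (rule L2_add) measurable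
  also have "L2 UNIV (%x. \<eta> x *. (if v x - k2 > 0 then 1 *. g x else 0)) <=
   (NN x. ennreal ((\<eta> x)^2 * (norm (g x))^2) * ind (B \<inter> {x. k2 < v x}) x)"
   unfolding L2_def using C1c_zero[OF \<eta>c]
   by (intro nn_integral_mono) (auto simp: indicator_def power_mult_distrib)
  also have "\<dots> <= ennreal \<Lambda> * (NN x. ennreal ((\<psi> x)^2 * (norm (grad \<eta> x))^2) * ind B x)"
   using dg k \<eta>c unfolding DG_def B_def[symmetric] \<psi>_def by auto
  also have "\<dots> <= ennreal \<Lambda> * (ennreal (M\<^sup>2) * Y)" by (intro mult_left_mono \<psi>Y) simp
  also have "L2 UNIV (%x. \<psi> x *. grad \<eta> x) <= (NN x. ennreal ((\<psi> x)^2 * (norm (grad \<eta> x))^2) * ind B x)"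
   unfolding L2_def using C1c_zero[OF \<eta>c]
   by (intro nn_integral_mono) (auto simp: indicator_def power_mult_distrib)
  also have "\<dots> <= ennreal (M\<^sup>2) * Y" by (rule \<psi>Y)
  finally have "L2 UNIV h <= 2 * (ennreal \<Lambda> * (ennreal (M\<^sup>2) * Y)) + 2 * (ennreal (M\<^sup>2) * Y)"
   by (simp add: add_mono mult_left_mono)
  also have "\<dots> = ennreal (2 * (\<Lambda> + 1) * M\<^sup>2) * Y"
  proof -
   have "ennreal (2 * (\<Lambda> + 1) * M\<^sup>2) = ennreal (2 * \<Lambda> * M\<^sup>2) + ennreal (2 * M\<^sup>2)"
    using \<Lambda> by (subst ennreal_plus[symmetric]) (auto simp: algebra_simps)
   also have "\<dots> = 2 * (ennreal \<Lambda> * ennreal (M\<^sup>2)) + 2 * ennreal (M\<^sup>2)"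
    using \<Lambda> by (simp add: ennreal_mult ennreal_numeral mult.assoc)
   finally show ?thesis by (simp add: distrib_right mult.assoc)
  qed
  finally show ?thesis .
 qed
 have supp: "emeasure lborel {x. \<eta> x * \<psi> x ~= 0} <= ennreal (unit_ball_vol (real CARD('n)) * \<rho> ^ CARD('n) / 2)"
 proof -
  define c where "c = (k2 - k1)^2"
  have c: "c > 0" using k by (simp add: c_def)
  have "ennreal c * emeasure lborel {x. \<eta> x * \<psi> x ~= 0} = (NN x. ennreal c * ind {x. \<eta> x * \<psi> x ~= 0} x)"
   by (subst nn_integral_cmult) auto
  also have "\<dots> <= Y"
   unfolding Y_def L2_def
  proof (rule nn_integral_mono)
   fix x
   show "ennreal c * ind {x. \<eta> x * \<psi> x ~= 0} x <= ennreal ((norm (max (v x - k1) 0))^2) * ind (ball z r2) x"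
   proof (cases "\<eta> x * \<psi> x ~= 0")
    case True
    then have "x : ball z r2" using \<eta>(4) r' by force
    then have i: "ind {x. \<eta> x * \<psi> x ~= 0} x = (1::ennreal)" "ind (ball z r2) x = (1::ennreal)"
     using True by auto
    have "k2 - k1 <= norm (max (v x - k1) 0)" using True k by (auto simp: \<psi>_def split: if_splits)
    then have "(k2 - k1)^2 <= (norm (max (v x - k1) 0))^2" using k by (intro power_mono) auto
    then show ?thesis unfolding i mult_1_right c_def by (rule ennreal_leI)
   qed simp
  qed
  also have "\<dots> <= ennreal (unit_ball_vol (real CARD('n)) * \<rho> ^ CARD('n) / 2 * c)" using small by (simp add: Y_def c_def)
  finally have "ennreal (1 / c) * (ennreal c * emeasure lborel {x. \<eta> x * \<psi> x ~= 0})
   <= ennreal (1 / c) * ennreal (unit_ball_vol (real CARD('n)) * \<rho> ^ CARD('n) / 2 * c)"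
   by (rule mult_left_mono) simp
  then show ?thesis using c \<rho> by (simp add: mult.assoc[symmetric] ennreal_mult[symmetric])
 qed
 have "L2 (ball z r1) \<psi> <= L2 UNIV (%x. \<eta> x * \<psi> x)"
  unfolding L2_def using \<eta>(3) by (intro nn_integral_mono) (auto simp: indicator_def)
 also have "\<dots> <= ennreal (16 * \<rho>\<^sup>2 * 2 ^ CARD('n)) * L2 UNIV h"
  by (rule faber_krahn[OF a3 \<rho> supp])
 also have "\<dots> <= ennreal (16 * \<rho>\<^sup>2 * 2 ^ CARD('n)) * (ennreal (2 * (\<Lambda> + 1) * M\<^sup>2) * Y)"
  by (intro mult_left_mono gh) simp
 also have "\<dots> = ennreal (16 * \<rho>\<^sup>2 * 2 ^ CARD('n) * (2 * (\<Lambda> + 1) * M\<^sup>2)) * Y"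
  using \<Lambda> by (simp add: ennreal_mult mult.assoc)
 also have "16 * \<rho>\<^sup>2 * 2 ^ CARD('n) * (2 * (\<Lambda> + 1) * M\<^sup>2) = 1152 * (\<Lambda> + 1) * 2 ^ CARD('n) * \<rho>\<^sup>2 / (r2 - r1)^2"
  by (simp add: M_def power_divide)
 finally show ?thesis unfolding Y_def \<psi>_def .
qed

text \<open>De Giorgi's iteration with radii \<rho> + d / 2^j and levels K (1 - 2^-j). The free
  radius in \<open>DG_step\<close> is taken so small that the integrals \<open>Y j\<close> contract
  by a fixed factor \<tau>, and \<tau> is such that the smallness condition reproduces itself at the
  next step.\<close>

lemma local_max:
 assumes "\<Lambda> \<ge> 0"
 shows "EX c0>0. ALL (z::real^'n) R \<rho> K v g. DG \<Lambda> (ball z R) v g --> approx (ball z R) (Collect C1) v g -->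
  0 <= \<rho> --> \<rho> < R --> 0 < K --> L2 (ball z R) (%x. max (v x) 0) <= ennreal (c0 * (R - \<rho>) ^ CARD('n) * K\<^sup>2) -->
  (AE x\<in>ball z \<rho> in lborel. v x <= K)"
proof -
 define n where "n = CARD('n)"
 define V where "V = unit_ball_vol (real n)"
 have V: "V > 0" by (simp add: V_def)
 define C where "C = 4 * 1152 * (\<Lambda> + 1) * 2 ^ n"
 have C: "C > 0" using assms by (simp add: C_def)
 \<comment> \<open>\<tau>^j is the rate at which the right side of the smallness condition shrinks:
   2^-jn from the radius and 4^-j from the squared level gap. Then \<epsilon> is fixed by C
   \<epsilon>^2 = \<tau>, and c0 makes the condition fit exactly at j = 0.\<close>
 define \<tau> :: real where "\<tau> = 1 / (4 * 2 ^ n)"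
 have \<tau>: "\<tau> > 0" "\<tau> < 1" by (auto simp: \<tau>_def field_simps) (metis one_le_power one_le_numeral order_less_le_trans one_less_numeral_iff semiring_norm(76) mult.commute mult_le_cancel_left1 less_le_trans numeral_less_iff not_le mult_1)
 define \<epsilon> where "\<epsilon> = sqrt (\<tau> / C)"
 have \<epsilon>: "\<epsilon> > 0" "C * \<epsilon>\<^sup>2 = \<tau>" using \<tau> C by (auto simp: \<epsilon>_def)
 define c0 where "c0 = V * \<epsilon> ^ n / 8"
 have c0: "c0 > 0" using V \<epsilon> by (simp add: c0_def)
 have "AE x\<in>ball z \<rho> in lborel. v x <= K"
  if dg: "DG \<Lambda> (ball z R) v g" and a: "approx (ball z R) (Collect C1) v g" and \<rho>: "0 <= \<rho>" "\<rho> < R" and K: "0 < K"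
   and Y0: "L2 (ball z R) (%x. max (v x) 0) <= ennreal (c0 * (R - \<rho>) ^ CARD('n) * K\<^sup>2)"
  for z :: "real^'n" and R \<rho> K v g
 proof -
  note [measurable] = approxD(1,3,4)[OF a]
  define d where "d = R - \<rho>"
  have d: "d > 0" using \<rho> by (simp add: d_def)
  define r where "r j = \<rho> + d / 2 ^ j" for j :: nat
  define k where "k j = K * (1 - 1 / 2 ^ j)" for j :: nat
  define Y where "Y j = L2 (ball z (r j)) (%x. max (v x - k j) 0)" for j
  define y0 where "y0 = c0 * d ^ n * K\<^sup>2"
  have y0: "y0 \<ge> 0" using c0 d by (simp add: y0_def)
  have rk: "0 <= r (Suc j)" "r (Suc j) < r j" "r j <= R" "0 <= k j" "k j < k (Suc j)"
    "r j - r (Suc j) = d / 2 ^ Suc j" "k (Suc j) - k j = K / 2 ^ Suc j" for j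
  proof -
   show "0 <= r (Suc j)" "r (Suc j) < r j" using \<rho> d by (auto simp: r_def field_simps)
   have "d / 2 ^ j <= d" using d by (simp add: field_simps)
   then show "r j <= R" by (simp add: r_def d_def)
   show "0 <= k j" using K by (simp add: k_def)
   show "r j - r (Suc j) = d / 2 ^ Suc j" by (simp add: r_def field_simps)
   show "k (Suc j) - k j = K / 2 ^ Suc j" by (simp add: k_def field_simps)
   then show "k j < k (Suc j)" using K by (metis diff_gt_0_iff_gt divide_pos_pos zero_less_numeral zero_less_power)
  qed
  have step: "Y (Suc j) <= ennreal \<tau> * Y j" if le: "Y j <= ennreal (y0 * \<tau> ^ j)" for j
  proof -
   define s where "s = \<epsilon> * d / 2 ^ j"
   have s: "s > 0" using \<epsilon> d by (simp add: s_def)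
   have eq: "y0 * \<tau> ^ j = V * s ^ n / 2 * (k (Suc j) - k j)^2"
   proof -
    have "\<tau> ^ j = 1 / (4 ^ j * (2 ^ j) ^ n)" by (simp add: \<tau>_def power_divide power_mult_distrib power_mult[symmetric] mult.commute)
    moreover have "(K / 2 ^ Suc j)^2 = K\<^sup>2 / (4 * 4 ^ j)"
     by (simp add: power_divide power_mult_distrib power2_eq_square power_mult_distrib[symmetric])
    ultimately show ?thesis unfolding rk(7) y0_def c0_def s_def
     by (auto simp: field_simps)
   qed
   have sm: "L2 (ball z (r j)) (%x. max (v x - k j) 0) <= ennreal (unit_ball_vol (real CARD('n)) * s ^ CARD('n) / 2 * (k (Suc j) - k j)^2)"
    using le[unfolded eq] by (simp only: Y_def V_def n_def)
   have "Y (Suc j) <= ennreal (1152 * (\<Lambda> + 1) * 2 ^ CARD('n) * s\<^sup>2 / (r j - r (Suc j))^2) * Y j"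
    unfolding Y_def by (rule DG_step[OF dg assms a rk(1,2,3,4,5) s sm])
   also have "1152 * (\<Lambda> + 1) * 2 ^ CARD('n) * s\<^sup>2 / (r j - r (Suc j))^2 = C * \<epsilon>\<^sup>2"
   proof -
    have "s\<^sup>2 / (r j - r (Suc j))^2 = (s / (r j - r (Suc j)))^2" by (simp add: power_divide)
    also have "s / (r j - r (Suc j)) = 2 * \<epsilon>" unfolding rk(6) s_def using d by simp
    finally have "s\<^sup>2 / (r j - r (Suc j))^2 = 4 * \<epsilon>\<^sup>2" by (simp add: power_mult_distrib)
    then show ?thesis by (simp add: C_def n_def times_divide_eq_right[symmetric] del: times_divide_eq_right)
   qed
   finally show ?thesis using \<epsilon> by simp
  qed
  have Yj: "Y j <= ennreal (y0 * \<tau> ^ j)" for j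
  proof (induction j)
   case 0
   have "r 0 = R" "k 0 = 0" by (auto simp: r_def k_def d_def)
   then show ?case using Y0 by (simp add: Y_def y0_def d_def n_def)
  next
   case (Suc j)
   have "Y (Suc j) <= ennreal \<tau> * Y j" by (rule step[OF Suc])
   also have "\<dots> <= ennreal \<tau> * ennreal (y0 * \<tau> ^ j)" by (intro mult_left_mono Suc) simp
   also have "\<dots> = ennreal (y0 * \<tau> ^ Suc j)" using \<tau> y0 by (simp add: ennreal_mult[symmetric] mult_ac)
   finally show ?case .
  qed
  have "L2 (ball z \<rho>) (%x. max (v x - K) 0) <= Y j" for j
  proof -
   have "L2 (ball z \<rho>) (%x. max (v x - K) 0) <= L2 (ball z \<rho>) (%x. max (v x - k j) 0)"
   proof (rule L2_mono)
    have "k j <= K" using K by (simp add: k_def field_simps)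
    then show "norm (max (v x - K) 0) <= norm (max (v x - k j) 0)" for x by auto
   qed
   also have "\<dots> <= Y j" unfolding Y_def by (rule L2_mono_set) (use d in \<open>auto simp: r_def intro!: subset_ball\<close>)
   finally show ?thesis .
  qed
  then have le: "L2 (ball z \<rho>) (%x. max (v x - K) 0) <= ennreal (y0 * \<tau> ^ j)" for j using Yj order_trans by blast
  have "(%j. y0 * \<tau> ^ j) ---> y0 * 0" using \<tau> by (intro tendsto_intros LIMSEQ_power_zero) auto
  then have "(%j. ennreal (y0 * \<tau> ^ j)) ---> ennreal (y0 * 0)" by (rule tendsto_ennrealI)
  then have "L2 (ball z \<rho>) (%x. max (v x - K) 0) <= ennreal (y0 * 0)"
   by (rule LIMSEQ_le_const) (use le in auto)
  then have "(NN x. ennreal ((norm (max (v x - K) 0))^2) * ind (ball z \<rho>) x) = 0" by (simp add: L2_def)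
  moreover have [measurable]: "ball z \<rho> : sets borel" by simp
  moreover have "(%x. ennreal ((norm (max (v x - K) 0))^2) * ind (ball z \<rho>) x) : borel_measurable lborel"
   by measurable
  ultimately have "AEL x. ennreal ((norm (max (v x - K) 0))^2) * ind (ball z \<rho>) x = 0"
   using nn_integral_0_iff_AE by blast
  then show ?thesis
   by eventually_elim (auto simp: indicator_def max_def split: if_splits)
 qed
 then show ?thesis using c0 by blast
qed

subsection \<open>Growth of supersolutions and decay of oscillation\<close>

lemma L2_chain_finite:
 assumes [measurable]: "S : sets borel" "u : Borel" and "emeasure lborel S < \<infinity>" "L2 S u < \<infinity>"
  and F: "!!t. (F has_real_derivative F' t) (at t)" "!!t. \<bar>F' t\<bar> <= M"
 shows "L2 S (%x. F (u x)) < \<infinity>"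
proof -
 have "continuous_on UNIV F" using F(1) DERIV_isCont by (metis continuous_at_imp_continuous_on)
 note [measurable] = borel_measurable_continuous_onI[OF this]
 have M: "0 <= M" using F(2)[of 0] by simp
 have "L2 S (%x. F 0 + (F (u x) - F 0)) <= 2 * L2 S (%x. F 0) + 2 * L2 S (%x. F (u x) - F 0)"
  by (rule L2_add) measurable
 also have "\<dots> <= 2 * (ennreal (\<bar>F 0\<bar>\<^sup>2) * emeasure lborel S) + 2 * (ennreal (M\<^sup>2) * L2 S u)"
  using M deriv_bound_lipschitz[OF F, of _ 0]
  by (intro add_mono mult_left_mono L2_bounded L2_bound_mult) auto
 also have "\<dots> < \<infinity>" using assms(3,4) by (simp add: ennreal_mult_less_top)
 finally show ?thesis by simp
qed

lemma C1_affine: "C1 w ==> C1 (%x. a * w x + b)"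
 by (rule C1_compose[where F="%t. a * t + b" and F'="%_. a"]) (auto intro!: derivative_eq_intros)

lemma approx_affine:
 assumes a: "approx S (Collect C1) u g" and "emeasure lborel S < \<infinity>"
 shows "approx S (Collect C1) (%x. a * u x + b) (%x. a *. g x)"
proof (rule approx_chain[OF a, where F="%t. a * t + b" and F'="%_. a" and M="\<bar>a\<bar>"])
 show "L2 S (%x. a * u x + b) < \<infinity>"
  by (rule L2_chain_finite[where F="%t. a * t + b" and F'="%_. a" and M="\<bar>a\<bar>"])
   (use approxD[OF a] assms(2) in \<open>auto intro!: derivative_eq_intros\<close>)
 show "(%x. a * w x + b) : Collect C1" if "w : Collect C1" for w
  using that C1_affine by blast
qed (auto intro!: derivative_eq_intros)

text \<open>Linear continuation below \<delta>. It turns functions singular at 0, such as the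
  logarithm and the reciprocal, into functions on the whole line with bounded derivative, as
  \<open>approx_chain\<close> demands.\<close>

lemma C1_extension:
 fixes f f' :: "real => real"
 assumes "!!t. \<delta> <= t ==> (f has_real_derivative f' t) (at t)"
 shows "EX F. (ALL t. (F has_real_derivative f' (max t \<delta>)) (at t)) & (ALL t>=\<delta>. F t = f t) &
  (ALL t<=\<delta>. F t = f \<delta> + f' \<delta> * (t - \<delta>))"
proof -
 define F where "F t = (if t <= \<delta> then f \<delta> + f' \<delta> * (t - \<delta>) else f t)" for t
 have "(F has_real_derivative (if t <= \<delta> then f' \<delta> else f' t)) (at t)" for t
  unfolding F_def by (rule DERIV_join) (auto intro!: derivative_eq_intros assms)
 moreover have "(if t <= \<delta> then f' \<delta> else f' t) = f' (max t \<delta>)" for t by (simp add: max_def)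
 ultimately show ?thesis by (intro exI[of _ F]) (auto simp: F_def)
qed

lemma continuous_max_compose:
 fixes f' :: "real => real"
 assumes "continuous_on {\<delta>..} f'"
 shows "continuous_on UNIV (%t. f' (max t \<delta>))"
 by (rule continuous_on_compose2[OF assms]) (auto intro!: continuous_intros)

context elliptic
begin

lemma super_mono:
 assumes "super T g" "S <= T"
 shows "super S g"
 unfolding super_def
proof (intro ballI impI)
 fix \<phi> assume \<phi>: "\<phi> : C1c S" "ALL x. 0 <= \<phi> x"
 have "0 <= (LBINT x. ind T x * ((A x *v g x) \<bullet> grad \<phi> x))"
  using assms(1) C1c_mono[OF \<phi>(1) assms(2)] \<phi>(2) by (auto simp: super_def)
 also have "\<dots> = (LBINT x. ind S x * ((A x *v g x) \<bullet> grad \<phi> x))"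
  using C1c_zero(2)[OF \<phi>(1)] assms(2) by (intro Bochner_Integration.integral_cong) (auto simp: indicator_def)
 finally show "0 <= (LBINT x. ind S x * ((A x *v g x) \<bullet> grad \<phi> x))" .
qed

text \<open>Caccioppoli's inequality for the supersolution -v with F(s) the smoothed positive part
  of -s - k; the smoothing is removed by Fatou's lemma.\<close>

lemma sub_DG:
 assumes s: "super S (%x. - g x)" and a: "approx S (Collect C1) v g"
 shows "DG (4 * L / lam) S v g"
 unfolding DG_def
proof (intro allI ballI impI)
 fix k :: real and \<eta> assume k: "0 <= k" and \<eta>: "\<eta> : C1c S"
 note [measurable] = approxD(1,3,4)[OF a] C1_measurable[OF C1c_C1[OF \<eta>]] smooth_pos'_measurable
 have a': "approx S (Collect C1) (%x. - v x) (%x. (-1) *. g x)"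
 proof (rule approx_chain[OF a, where F="%t. - t" and F'="%_. -1" and M=1])
  show "L2 S (%x. - v x) < \<infinity>" using approxD(5)[OF a] by (simp add: L2_def)
  show "(%x. - w x) : Collect C1" if "w : Collect C1" for w
   using that C1_affine[of w "-1" 0] by simp
 qed (auto intro!: derivative_eq_intros)
 show "(NN x. ennreal ((\<eta> x)^2 * (norm (g x))^2) * ind (S \<inter> {x. k < v x}) x)
   <= ennreal (4 * L / lam) * (NN x. ennreal ((max (v x - k) 0)^2 * (norm (grad \<eta> x))^2) * ind S x)"
 proof (rule truncation_limit)
  fix j
  define e where "e = 1 / real (Suc j)"
  have e: "e > 0" by (simp add: e_def)
  define q where "q x = sqrt (smooth_pos' e (v x - k))" for x
  have q2: "(q x)^2 = smooth_pos' e (v x - k)" for x using smooth_pos'_bounds[OF e] by (simp add: q_def)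
  have [measurable]: "q : Borel" unfolding q_def using e by measurable
  have "(NN x. ennreal ((\<eta> x)^2 * (q x)^2 * (norm ((-1) *. g x))^2) * ind S x)
   <= ennreal (4 * L / lam) * (NN x. ennreal ((max (v x - k) 0)^2 * (norm (grad \<eta> x))^2) * ind S x)"
  proof (rule caccioppoli[OF _ a', where F="%s. smooth_pos e (- s - k)" and F'="%s. - smooth_pos' e (- s - k)" and M=1])
   show "super S (%x. (-1) *. g x)" using s by simp
   show "((%s. smooth_pos e (- s - k)) has_real_derivative - smooth_pos' e (- t - k)) (at t)" for t
   proof -
    have "((%s. - s - k) has_real_derivative -1) (at t)" by (auto intro!: derivative_eq_intros)
    from DERIV_chain2[OF smooth_pos_deriv[OF e] this] show ?thesis by simp
   qed
   show "continuous_on UNIV (%s. - smooth_pos' e (- s - k))"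
    by (intro continuous_intros continuous_on_compose2[OF smooth_pos'_continuous[OF e]]) auto
   show "\<bar>- smooth_pos' e (- t - k)\<bar> <= 1" for t using smooth_pos'_bounds[OF e, of "- t - k"] by simp
   show "0 <= smooth_pos e (- t - k)" for t using smooth_pos_bounds[OF e] by simp
   have "L2 S (%x. smooth_pos e (- (- v x) - k)) <= L2 S v"
   proof (rule L2_mono)
    show "norm (smooth_pos e (- (- v x) - k)) <= norm (v x)" for x
     using smooth_pos_bounds[OF e, of "- (- v x) - k"] k by (auto simp: max_def split: if_splits)
   qed
   then show "L2 S (%x. smooth_pos e (- (- v x) - k)) < \<infinity>" using approxD(5)[OF a] by (rule le_less_trans)
   show "AE x\<in>S in lborel. smooth_pos e (- (- v x) - k) <= max (v x - k) 0 * q x &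
     (q x)^2 <= - (- smooth_pos' e (- (- v x) - k)) & 0 <= max (v x - k) 0 & 0 <= q x"
    using smooth_pos_le[OF e] smooth_pos'_bounds[OF e] q2 by (auto simp: q_def)
  qed (use \<eta> in measurable)
  then show "(NN x. ennreal (((\<eta> x)^2 * (norm (g x))^2) * smooth_pos' (1 / real (Suc j)) (v x - k)) * ind S x)
   <= ennreal (4 * L / lam) * (NN x. ennreal ((max (v x - k) 0)^2 * (norm (grad \<eta> x))^2) * ind S x)"
   by (simp add: q2 e_def mult_ac)
  show "(%x. (\<eta> x)^2 * (norm (g x))^2) : Borel" by measurable
 qed (use approxD[OF a] in auto)
qed

text \<open>The test function \<eta>^2 / u gives the energy bound for the logarithm, whose right
  side is free of u; \<eta>^2 (v - k)^+ / u, smoothed, gives the De Giorgi inequality.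
  \<open>max (u x) \<delta>\<close> equals u almost everywhere on S and keeps all expressions
  bounded away from the singularity of the logarithm.\<close>

lemma log_supersolution:
 fixes k0 \<delta> :: real
 assumes s: "super S g" and a: "approx S (Collect C1) u g" and fS: "emeasure lborel S < \<infinity>"
  and \<delta>: "\<delta> > 0" and k0: "k0 > 0" and lb: "AE x\<in>S in lborel. \<delta> <= u x"
 defines "v \<equiv> %x. - ln (max (u x) \<delta> / k0)" and "gv \<equiv> %x. (- 1 / max (u x) \<delta>) *. g x"
 shows "approx S (Collect C1) v gv" and "DG (4 * L / lam) S v gv"
  and "!!\<eta>. \<eta> : C1c S ==> (NN x. ennreal ((\<eta> x)^2 * (norm (gv x))^2) * ind S x)
   <= ennreal (4 * L / lam) * (NN x. ennreal ((norm (grad \<eta> x))^2) * ind S x)"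
proof -
 note [measurable] = approxD(1,3,4)[OF a]
 have vm [measurable]: "v : Borel" "gv : Borel" unfolding v_def gv_def by measurable
 show "approx S (Collect C1) v gv"
 proof -
  obtain F where F: "!!t. (F has_real_derivative (- 1 / max t \<delta>)) (at t)" "!!t. t \<ge> \<delta> ==> F t = - ln (t / k0)"
   using C1_extension[of \<delta> "%t. - ln (t / k0)" "%t. - 1 / t"] \<delta> k0
   by (force intro!: derivative_eq_intros)
  have c: "continuous_on UNIV (%t. - 1 / max t \<delta>)"
   by (rule continuous_max_compose) (use \<delta> in \<open>auto intro!: continuous_intros\<close>)
  have b: "\<bar>- 1 / max t \<delta>\<bar> <= 1 / \<delta>" for t using \<delta> by (auto simp: abs_divide field_simps max_def)
  have "approx S (Collect C1) (%x. F (u x)) (%x. (- 1 / max (u x) \<delta>) *. g x)"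
   by (rule approx_chain[OF a F(1) c b])
    (use C1_compose[OF _ F(1) c] L2_chain_finite[OF approxD(1,3)[OF a] fS approxD(5)[OF a] F(1) b] in auto)
  then show ?thesis
  proof (rule approx_cong)
   show "AE x\<in>S in lborel. v x = F (u x)"
    using lb by eventually_elim (auto simp: v_def F(2) max_def)
   show "AE x\<in>S in lborel. gv x = (- 1 / max (u x) \<delta>) *. g x" by (simp add: gv_def)
  qed (fact vm)+
 qed
 show "(NN x. ennreal ((\<eta> x)^2 * (norm (gv x))^2) * ind S x)
   <= ennreal (4 * L / lam) * (NN x. ennreal ((norm (grad \<eta> x))^2) * ind S x)" if \<eta>: "\<eta> : C1c S" for \<eta>
 proof -
  obtain F where F: "!!t. (F has_real_derivative (- 1 / (max t \<delta>)^2)) (at t)" "!!t. t \<ge> \<delta> ==> F t = 1 / t"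
   "!!t. t <= \<delta> ==> F t = 1 / \<delta> + (- 1 / \<delta>\<^sup>2) * (t - \<delta>)"
   using C1_extension[of \<delta> "%t. 1 / t" "%t. - 1 / t\<^sup>2"] \<delta>
   by (force intro!: derivative_eq_intros simp: power2_eq_square)
  have c: "continuous_on UNIV (%t. - 1 / (max t \<delta>)^2)"
   by (rule continuous_max_compose[where f'="%t. - 1 / t\<^sup>2"]) (use \<delta> in \<open>auto intro!: continuous_intros\<close>)
  have b: "\<bar>- 1 / (max t \<delta>)^2\<bar> <= 1 / \<delta>\<^sup>2" for t
   using \<delta> by (auto simp: abs_divide intro!: divide_left_mono power_mono)
  have F0: "0 <= F t" for t
  proof (cases "t <= \<delta>")
   case True
   have "0 <= (1 / \<delta>\<^sup>2) * (\<delta> - t)" using True by simp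
   moreover have "(- 1 / \<delta>\<^sup>2) * (t - \<delta>) = (1 / \<delta>\<^sup>2) * (\<delta> - t)" by (simp add: right_diff_distrib)
   moreover have "0 <= 1 / \<delta>" using \<delta> by simp
   ultimately show ?thesis using F(3)[OF True] by linarith
  qed (use F(2)[of t] \<delta> in auto)
  have "(NN x. ennreal ((\<eta> x)^2 * (1 / max (u x) \<delta>)^2 * (norm (g x))^2) * ind S x)
   <= ennreal (4 * L / lam) * (NN x. ennreal (1\<^sup>2 * (norm (grad \<eta> x))^2) * ind S x)"
  proof (rule caccioppoli[OF s a F(1) c b F0 L2_chain_finite[OF approxD(1,3)[OF a] fS approxD(5)[OF a] F(1) b] \<eta>])
   show "AE x\<in>S in lborel. F (u x) <= 1 * (1 / max (u x) \<delta>) &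
    (1 / max (u x) \<delta>)^2 <= - (- 1 / (max (u x) \<delta>)^2) & (0::real) <= 1 & 0 <= 1 / max (u x) \<delta>"
    using lb by eventually_elim (use \<delta> in \<open>auto simp: F(2) max_def power_divide\<close>)
  qed measurable
  moreover have "(norm (gv x))^2 = (1 / max (u x) \<delta>)^2 * (norm (g x))^2" for x
   by (simp add: gv_def power_mult_distrib power_divide)
  ultimately show ?thesis by (simp add: mult.assoc)
 qed
 show "DG (4 * L / lam) S v gv"
  unfolding DG_def
 proof (intro allI ballI impI)
  fix k :: real and \<eta> assume k: "0 <= k" and \<eta>: "\<eta> : C1c S"
  note [measurable] = C1_measurable[OF C1c_C1[OF \<eta>]] smooth_pos'_measurable smooth_pos_measurable
  show "(NN x. ennreal ((\<eta> x)^2 * (norm (gv x))^2) * ind (S \<inter> {x. k < v x}) x)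
    <= ennreal (4 * L / lam) * (NN x. ennreal ((max (v x - k) 0)^2 * (norm (grad \<eta> x))^2) * ind S x)"
  proof (rule truncation_limit)
   fix j
   define e where "e = 1 / real (Suc j)"
   have e: "e > 0" by (simp add: e_def)
   define l where "l t = - ln (t / k0) - k" for t
   define f where "f t = smooth_pos e (l t) / t" for t
   \<comment> \<open>Differentiating the quotient gives two terms of the same sign: one is the
     energy weight q^2, and discarding the other yields q^2 <= - F'.\<close>
   define f' where "f' t = - ((smooth_pos' e (l t) + smooth_pos e (l t)) / t\<^sup>2)" for t
   have ld: "(l has_real_derivative - 1 / t) (at t)" if "t > 0" for t
    unfolding l_def using that k0 by (auto intro!: derivative_eq_intros)
   have fd: "(f has_real_derivative f' t) (at t)" if "\<delta> <= t" for t
   proof -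
    have t: "t > 0" using that \<delta> by simp
    have "((%t. smooth_pos e (l t)) has_real_derivative smooth_pos' e (l t) * (- 1 / t)) (at t)"
     by (rule DERIV_chain2[OF smooth_pos_deriv[OF e] ld[OF t]])
    from DERIV_divide[OF this DERIV_ident] t
    have "(f has_real_derivative (smooth_pos' e (l t) * (- 1 / t) * t - smooth_pos e (l t) * 1) / (t * t)) (at t)"
     unfolding f_def by simp
    moreover have "smooth_pos' e (l t) * (- 1 / t) * t = - smooth_pos' e (l t)" using t by simp
    ultimately show ?thesis
     unfolding f'_def by (simp add: power2_eq_square diff_divide_distrib add_divide_distrib)
   qed
   obtain F where F: "!!t. (F has_real_derivative f' (max t \<delta>)) (at t)" "!!t. t \<ge> \<delta> ==> F t = f t"
    "!!t. t <= \<delta> ==> F t = f \<delta> + f' \<delta> * (t - \<delta>)"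
    using C1_extension[of \<delta> f f', OF fd] by blast
   have lc: "continuous_on {\<delta>..} l" unfolding l_def using \<delta> k0 by (intro continuous_intros) auto
   have spc: "continuous_on UNIV (smooth_pos e)"
    using smooth_pos_deriv[OF e] DERIV_isCont by (metis continuous_at_imp_continuous_on)
   have "continuous_on {\<delta>..} f'"
    unfolding f'_def using \<delta>
    by (intro continuous_intros continuous_on_compose2[OF smooth_pos'_continuous[OF e] lc] continuous_on_compose2[OF spc lc]) auto
   then have c: "continuous_on UNIV (%t. f' (max t \<delta>))" by (rule continuous_max_compose)
   define M where "M = (1 + max (l \<delta>) 0) / \<delta>\<^sup>2"
   have b: "\<bar>f' (max t \<delta>)\<bar> <= M" for t
   proof -
    define s where "s = max t \<delta>"
    have s: "\<delta> <= s" "s > 0" using \<delta> by (auto simp: s_def)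
    have "ln (\<delta> / k0) <= ln (s / k0)" using s \<delta> k0 by (simp add: divide_right_mono)
    then have "l s <= l \<delta>" by (simp add: l_def)
    then have "smooth_pos e (l s) <= max (l \<delta>) 0" using smooth_pos_bounds(2)[OF e, of "l s"] by auto
    then have "smooth_pos' e (l s) + smooth_pos e (l s) <= 1 + max (l \<delta>) 0"
     using smooth_pos'_bounds(2)[OF e, of "l s"] by linarith
    moreover have "0 <= smooth_pos' e (l s) + smooth_pos e (l s)"
     using smooth_pos'_bounds(1)[OF e, of "l s"] smooth_pos_bounds(1)[OF e, of "l s"] by linarith
    moreover have "\<delta>\<^sup>2 <= s\<^sup>2" using s \<delta> by (intro power_mono) auto
    ultimately have "(smooth_pos' e (l s) + smooth_pos e (l s)) / s\<^sup>2 <= M"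
     unfolding M_def using \<delta> by (intro frac_le) auto
    then show ?thesis using \<open>0 <= smooth_pos' e (l s) + smooth_pos e (l s)\<close>
     unfolding s_def[symmetric] f'_def by (simp add: abs_of_nonneg)
   qed
   have f0: "0 <= f \<delta>" "f' \<delta> <= 0"
    using smooth_pos_bounds(1)[OF e, of "l \<delta>"] smooth_pos'_bounds(1)[OF e, of "l \<delta>"] \<delta> by (auto simp: f_def f'_def)
   have F0: "0 <= F t" for t
   proof (cases "t <= \<delta>")
    case True
    have "0 <= f' \<delta> * (t - \<delta>)" using True f0 by (simp add: mult_nonpos_nonpos)
    then show ?thesis using F(3)[OF True] f0 by simp
   next
    case False
    then show ?thesis using F(2)[of t] smooth_pos_bounds(1)[OF e, of "l t"] \<delta> by (simp add: f_def)
   qed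
   define q where "q x = sqrt (smooth_pos' e (v x - k)) / max (u x) \<delta>" for x
   have [measurable]: "q : Borel" unfolding q_def using e by measurable
   have q2: "(q x)^2 * (norm (g x))^2 = smooth_pos' e (v x - k) * (norm (gv x))^2" for x
    using smooth_pos'_bounds(1)[OF e] by (simp add: q_def gv_def power_mult_distrib power_divide)
   have "(NN x. ennreal ((\<eta> x)^2 * (q x)^2 * (norm (g x))^2) * ind S x)
    <= ennreal (4 * L / lam) * (NN x. ennreal ((max (v x - k) 0)^2 * (norm (grad \<eta> x))^2) * ind S x)"
   proof (rule caccioppoli[OF s a F(1) c b F0 L2_chain_finite[OF approxD(1,3)[OF a] fS approxD(5)[OF a] F(1) b] \<eta>])
    show "AE x\<in>S in lborel. F (u x) <= max (v x - k) 0 * q x &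
     (q x)^2 <= - f' (max (u x) \<delta>) & 0 <= max (v x - k) 0 & 0 <= q x"
     using lb
    proof (eventually_elim, intro impI)
     fix x assume "x : S --> \<delta> <= u x" "x : S"
     then have ux: "\<delta> <= u x" "max (u x) \<delta> = u x" "u x > 0" using \<delta> by auto
     have lv: "l (u x) = v x - k" by (simp add: l_def v_def ux)
     have "F (u x) = smooth_pos e (v x - k) / u x" using F(2)[OF ux(1)] by (simp add: f_def lv)
     also have "\<dots> <= (max (v x - k) 0 * sqrt (smooth_pos' e (v x - k))) / u x"
      using ux by (intro divide_right_mono smooth_pos_le[OF e]) auto
     also have "\<dots> = max (v x - k) 0 * q x" by (simp add: q_def ux)
     finally have 1: "F (u x) <= max (v x - k) 0 * q x" .
     have "(q x)^2 = smooth_pos' e (v x - k) / (u x)^2"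
      using smooth_pos'_bounds(1)[OF e] by (simp add: q_def ux power_divide)
     also have "\<dots> <= - f' (max (u x) \<delta>)"
      unfolding ux f'_def lv minus_minus using smooth_pos_bounds(1)[OF e, of "v x - k"]
      by (intro divide_right_mono) auto
     finally have 2: "(q x)^2 <= - f' (max (u x) \<delta>)" .
     show "F (u x) <= max (v x - k) 0 * q x & (q x)^2 <= - f' (max (u x) \<delta>) & 0 <= max (v x - k) 0 & 0 <= q x"
      using 1 2 smooth_pos'_bounds(1)[OF e] ux by (auto simp: q_def)
    qed
   qed measurable
   then show "(NN x. ennreal (((\<eta> x)^2 * (norm (gv x))^2) * smooth_pos' (1 / real (Suc j)) (v x - k)) * ind S x)
    <= ennreal (4 * L / lam) * (NN x. ennreal ((max (v x - k) 0)^2 * (norm (grad \<eta> x))^2) * ind S x)"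
    unfolding e_def[symmetric] mult.assoc q2 by (simp add: mult_ac)
   show "(%x. (\<eta> x)^2 * (norm (gv x))^2) : Borel" by measurable
  qed (use approxD[OF a] vm in auto)
 qed
qed

end

text \<open>Let v be the logarithm of k / (u + \<delta>). Its positive part vanishes where u >= k, a
  set of proportion \<theta>, so Poincare's inequality bounds v^+ in L^2 by the energy of the
  logarithm, which has a bound free of u. Local boundedness gives v <= K, that is u + \<delta> >=
  exp(-K) k, with K independent of \<delta>, and \<delta> tends to 0.\<close>

lemma growth:
 assumes lam: "0 < lam" "lam <= L" and \<theta>: "\<theta> > 0"
 shows "EX c. 0 < c & c <= 1 & (ALL (A::real^'n => real^'n^'n) z R u g k. elliptic A lam L --> R > 0 --> k > 0 -->
  elliptic.super A (ball z (2 * R)) g --> approx (ball z (2 * R)) (Collect C1) u g -->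
  (AE x\<in>ball z (2 * R) in lborel. 0 <= u x) -->
  ennreal \<theta> * emeasure lborel (ball z R) <= emeasure lborel {x : ball z R. k <= u x} -->
  (AE x\<in>ball z (R / 2) in lborel. c * k <= u x))"
proof -
 define n where "n = CARD('n)"
 define V where "V = unit_ball_vol (real n)"
 have V: "V > 0" by (simp add: V_def)
 define \<Lambda> where "\<Lambda> = 4 * L / lam"
 have \<Lambda>: "\<Lambda> > 0" using lam by (simp add: \<Lambda>_def)
 obtain c0 where c0: "c0 > 0" and lm: "ALL (z::real^'n) R \<rho> K v g. DG \<Lambda> (ball z R) v g --> approx (ball z R) (Collect C1) v g -->
  0 <= \<rho> --> \<rho> < R --> 0 < K --> L2 (ball z R) (%x. max (v x) 0) <= ennreal (c0 * (R - \<rho>) ^ CARD('n) * K\<^sup>2) -->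
  (AE x\<in>ball z \<rho> in lborel. v x <= K)"
  using local_max[OF less_imp_le[OF \<Lambda>], where 'n='n] by blast
 \<comment> \<open>The product of the Poincare constant, Caccioppoli's constant, the squared slope 6
   / R of the cut-off and the volume of the ball of radius 2R, divided by R^n. K is then solved from
   c0 (R/2)^n K^2 = C' R^n.\<close>
 define C' where "C' = 8 * 2 ^ n / \<theta> * (\<Lambda> * 36 * (V * 2 ^ n))"
 have C': "C' > 0" using \<theta> \<Lambda> V by (simp add: C'_def)
 define K where "K = sqrt (C' * 2 ^ n / c0)"
 have K: "K > 0" "K\<^sup>2 = C' * 2 ^ n / c0" using C' c0 by (auto simp: K_def)
 have "AE x\<in>ball z (R / 2) in lborel. exp (- K) * k <= u x"
  if el: "elliptic A lam L" and R: "R > 0" and k: "k > 0" and s: "elliptic.super A (ball z (2 * R)) g"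
   and a: "approx (ball z (2 * R)) (Collect C1) u g" and u0: "AE x\<in>ball z (2 * R) in lborel. 0 <= u x"
   and meas: "ennreal \<theta> * emeasure lborel (ball z R) <= emeasure lborel {x : ball z R. k <= u x}"
  for A :: "real^'n => real^'n^'n" and z R u g k
 proof -
  interpret elliptic A lam L by (rule el)
  note [measurable] = approxD(1,3,4)[OF a]
  define S where "S = ball z (2 * R)"
  have fS: "emeasure lborel S < \<infinity>" using emeasure_lborel_ball_finite[of z "2 * R"] by (simp add: S_def)
  have BS: "ball z R <= S" using R by (auto simp: S_def)
  have main: "AE x\<in>ball z (R / 2) in lborel. exp (- K) * k <= u x + \<delta>" if \<delta>: "\<delta> > 0" for \<delta>
  proof -
   define w where "w x = u x + \<delta>" for x
   have aw: "approx S (Collect C1) w g"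
    using approx_affine[OF a, of 1 \<delta>] fS by (simp add: w_def[abs_def] S_def)
   have wl: "AE x\<in>S in lborel. \<delta> <= w x" using u0 by eventually_elim (simp add: w_def S_def)
   define v where "v = (%x. - ln (max (w x) \<delta> / k))"
   define gv where "gv = (%x. (- 1 / max (w x) \<delta>) *. g x)"

   have sB: "super (ball z R) g" by (rule super_mono[OF s[folded S_def] BS])
   have awB: "approx (ball z R) (Collect C1) w g" by (rule approx_mono[OF aw BS]) auto
   have fB: "emeasure lborel (ball z R) < \<infinity>" using emeasure_lborel_ball_finite[of z R] by simp
   have wlB: "AE x\<in>ball z R in lborel. \<delta> <= w x" using wl by eventually_elim (use BS in auto)
   note logsB = log_supersolution[OF sB awB fB \<delta> k wlB, folded v_def gv_def]
   note [measurable] = approxD(3,4)[OF logsB(1)]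
   obtain \<eta> where \<eta>: "C1 \<eta>" "ALL x. 0 <= \<eta> x & \<eta> x <= 1" "ALL x:cball z R. \<eta> x = 1 & grad \<eta> x = 0"
    "ALL x. x ~: ball z (3 / 2 * R) --> \<eta> x = 0 & grad \<eta> x = 0" "ALL x. norm (grad \<eta> x) <= 3 / (3 / 2 * R - R)"
    using cutoff_exists[of R "3 / 2 * R" z] R by auto
   have \<eta>c: "\<eta> : C1c S"
    by (rule C1cI[OF \<eta>(1) compact_cball[of z "3 / 2 * R"]]) (use \<eta>(4) R in \<open>auto simp: S_def subset_eq\<close>)
   have "L2 (ball z R) gv <= (NN x. ennreal ((\<eta> x)^2 * (norm (gv x))^2) * ind S x)"
    unfolding L2_def using \<eta>(3) BS by (intro nn_integral_mono) (auto simp: indicator_def)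
   also have "\<dots> <= ennreal \<Lambda> * (NN x. ennreal ((norm (grad \<eta> x))^2) * ind S x)"
    unfolding \<Lambda>_def gv_def by (rule log_supersolution(3)[OF s[folded S_def] aw fS \<delta> k wl \<eta>c])
   also have "(NN x. ennreal ((norm (grad \<eta> x))^2) * ind S x) <= ennreal ((6 / R)^2) * emeasure lborel S"
    using L2_bounded[of S "grad \<eta>" "6 / R"] \<eta>(5) R unfolding L2_def by (auto simp: S_def)
   also have "emeasure lborel S = ennreal (V * (2 * R) ^ n)"
    using emeasure_ball_eq[of "2 * R" z] R by (simp add: S_def V_def n_def)
   finally have E: "L2 (ball z R) gv <= ennreal (\<Lambda> * ((6 / R)^2 * (V * (2 * R) ^ n)))"
    using \<Lambda> V R by (simp add: ennreal_mult mult_left_mono)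
   define Z where "Z = {x : ball z R. k <= u x}"
   have [measurable]: "Z : sets borel" unfolding Z_def by measurable
   have apos: "approx (ball z R) (Collect C1) (%x. max (v x) 0) (%x. if v x > 0 then gv x else 0)"
    by (rule approx_pos[OF logsB(1)]) (auto intro: C1_smooth_pos)
   have "L2 (ball z R) (%x. max (v x) 0) <= ennreal (8 * R\<^sup>2 * 2 ^ CARD('n) / \<theta>) * L2 (ball z R) (%x. if v x > 0 then gv x else 0)"
   proof (rule poincare_zero[OF apos R \<open>Z : sets borel\<close> _ _ meas[folded Z_def] \<theta>])
    show "max (v x) 0 = 0" if "x : Z" for x
    proof -
     have "k <= w x" using that \<delta> by (simp add: Z_def w_def)
     then have "1 <= max (w x) \<delta> / k" using k by (simp add: le_max_iff_disj)
     then show ?thesis by (simp add: v_def)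
    qed
   qed (auto simp: Z_def)
   also have "\<dots> <= ennreal (8 * R\<^sup>2 * 2 ^ n / \<theta>) * ennreal (\<Lambda> * ((6 / R)^2 * (V * (2 * R) ^ n)))"
    unfolding n_def[symmetric] by (intro mult_left_mono order_trans[OF L2_mono E]) auto
   also have "\<dots> = ennreal (8 * R\<^sup>2 * 2 ^ n / \<theta> * (\<Lambda> * ((6 / R)^2 * (V * (2 * R) ^ n))))"
    using \<theta> \<Lambda> V R by (intro ennreal_mult[symmetric]) auto
   also have "8 * R\<^sup>2 * 2 ^ n / \<theta> * (\<Lambda> * ((6 / R)^2 * (V * (2 * R) ^ n))) = c0 * (R - R / 2) ^ CARD('n) * K\<^sup>2"
   proof -
    have "8 * R\<^sup>2 * 2 ^ n / \<theta> * (\<Lambda> * ((6 / R)^2 * (V * (2 * R) ^ n))) = C' * R ^ n"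
     using R unfolding C'_def by (simp add: power_divide power_mult_distrib)
    moreover have "c0 * (R - R / 2) ^ CARD('n) * K\<^sup>2 = C' * R ^ n"
    proof -
     have "(R - R / 2) ^ CARD('n) = R ^ n / 2 ^ n" by (simp add: n_def power_divide[symmetric])
     then show ?thesis unfolding K(2) using c0 by simp
    qed
    ultimately show ?thesis by simp
   qed
   finally have "AE x\<in>ball z (R / 2) in lborel. v x <= K"
    using logsB(2) R K by (intro lm[rule_format, OF _ logsB(1)]) (auto simp: \<Lambda>_def)
   with wlB show ?thesis
   proof eventually_elim
    fix x assume 1: "x : ball z (R / 2) --> v x <= K" and 2: "x : ball z R --> \<delta> <= w x"
    show "x : ball z (R / 2) --> exp (- K) * k <= u x + \<delta>"
    proof
     assume x: "x : ball z (R / 2)"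
     then have w: "max (w x) \<delta> = w x" "w x > 0" using 2 R \<delta> by auto
     have "- K <= ln (w x / k)" using 1 x by (simp add: v_def w)
     then have "exp (- K) <= w x / k" using w k by (metis divide_pos_pos exp_le_cancel_iff exp_ln)
     then show "exp (- K) * k <= u x + \<delta>" using k by (simp add: field_simps w_def)
    qed
   qed
  qed
  have "AEL x. ALL j::nat. x : ball z (R / 2) --> exp (- K) * k <= u x + 1 / Suc j"
   unfolding AE_all_countable using main by simp
  then show ?thesis
  proof eventually_elim
   fix x assume *: "ALL j::nat. x : ball z (R / 2) --> exp (- K) * k <= u x + 1 / Suc j"
   show "x : ball z (R / 2) --> exp (- K) * k <= u x"
   proof
    assume x: "x : ball z (R / 2)"
    have "(%j. u x + inverse (real (Suc j))) ---> u x + 0" by (intro tendsto_intros LIMSEQ_inverse_real_of_nat)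
    then have "exp (- K) * k <= u x + 0"
     by (rule LIMSEQ_le_const) (use * x in \<open>auto simp: inverse_eq_divide\<close>)
    then show "exp (- K) * k <= u x" by simp
   qed
  qed
 qed
 moreover have "exp (- K) <= 1" using K by simp
 ultimately show ?thesis by (intro exI[of _ "exp (- K)"]) auto
qed

section \<open>Decay of the oscillation of solutions\<close>

context elliptic
begin

definition sol :: "(real^'n) set => (real^'n => real^'n) => bool" where
 "sol S g \<longleftrightarrow> super S g & super S (%x. - g x)"

lemma sol_mono: "sol T g ==> S <= T ==> sol S g"
 using super_mono by (auto simp: sol_def)

end

text \<open>One of u - a and b - u is at least (b - a)/2 on half of the ball of radius R/2. Both are
  nonnegative supersolutions, so \<open>growth\<close> improves the corresponding bound by c (b -
  a)/2 on the ball of radius R/4.\<close>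

lemma osc_step:
 assumes lam: "0 < lam" "lam <= L"
 shows "EX \<gamma>. 1 / 2 <= \<gamma> & \<gamma> < 1 & (ALL (A::real^'n => real^'n^'n) z R u g a b. elliptic A lam L --> R > 0 --> a <= b -->
  elliptic.sol A (ball z R) g --> approx (ball z R) (Collect C1) u g -->
  (AE x\<in>ball z R in lborel. a <= u x & u x <= b) -->
  (EX a' b'. a' <= b' & b' - a' <= \<gamma> * (b - a) & (AE x\<in>ball z (R / 4) in lborel. a' <= u x & u x <= b')))"
proof -
 have half: "(0::real) < 1 / 2" by simp
 obtain c where c: "0 < c" "c <= 1" and gr0: "ALL (A::real^'n => real^'n^'n) z R u g k. elliptic A lam L --> R > 0 --> k > 0 -->
  elliptic.super A (ball z (2 * R)) g --> approx (ball z (2 * R)) (Collect C1) u g -->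
  (AE x\<in>ball z (2 * R) in lborel. 0 <= u x) -->
  ennreal (1/2) * emeasure lborel (ball z R) <= emeasure lborel {x : ball z R. k <= u x} -->
  (AE x\<in>ball z (R / 2) in lborel. c * k <= u x)"
  using growth[OF lam half, where 'n='n] by blast
 note gr = gr0[rule_format]
 define \<gamma> where "\<gamma> = 1 - c / 2"
 have "EX a' b'. a' <= b' & b' - a' <= \<gamma> * (b - a) & (AE x\<in>ball z (R / 4) in lborel. a' <= u x & u x <= b')"
  if el: "elliptic A lam L" and R: "R > 0" and ab: "a <= b" and s: "elliptic.sol A (ball z R) g"
   and ap: "approx (ball z R) (Collect C1) u g" and bd: "AE x\<in>ball z R in lborel. a <= u x & u x <= b"
  for A :: "real^'n => real^'n^'n" and z R u g a b
 proof (cases "a = b")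
  case True
  have "AE x\<in>ball z (R / 4) in lborel. a <= u x & u x <= b"
   using bd by eventually_elim (use R in auto)
  then show ?thesis using True by (intro exI[of _ a] exI[of _ b]) auto
 next
  case False
  interpret elliptic A lam L by (rule el)
  note [measurable] = approxD(1,3,4)[OF ap]
  define k where "k = (b - a) / 2"
  have k: "k > 0" using ab False by (simp add: k_def)
  have fB: "emeasure lborel (ball z R) < \<infinity>" using emeasure_lborel_ball_finite[of z R] by simp
  define P where "P = {x : ball z (R / 2). k <= u x - a}"
  define N where "N = {x : ball z (R / 2). k <= b - u x}"
  have [measurable]: "P : sets borel" "N : sets borel" unfolding P_def N_def by measurable
  define W where "W = unit_ball_vol (real CARD('n)) * (R / 2) ^ CARD('n)"
  have W: "W > 0" "emeasure lborel (ball z (R / 2)) = ennreal W"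
   using R emeasure_ball_eq[of "R / 2" z] by (auto simp: W_def)
  have "emeasure lborel (ball z (R / 2)) <= emeasure lborel (P \<union> N)"
   by (intro emeasure_mono) (auto simp: P_def N_def k_def)
  also have "\<dots> <= emeasure lborel P + emeasure lborel N" by (intro emeasure_subadditive) auto
  finally have PN: "ennreal W <= emeasure lborel P + emeasure lborel N" by (simp add: W)
  have "ennreal (1 / 2) * ennreal W = ennreal (W / 2)"
   by (subst ennreal_mult[symmetric]) (use W in auto)
  have ck: "c * k <= k" "a + k <= b" "a <= b - k"
   using mult_left_le_one_le[of k c] c k ab by (auto simp: k_def field_simps)
  have "ennreal (W / 2) <= emeasure lborel P \<or> ennreal (W / 2) <= emeasure lborel N"
  proof (rule ccontr)
   assume "\<not> ?thesis"
   then have "emeasure lborel P + emeasure lborel N < ennreal (W / 2) + ennreal (W / 2)"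
    by (intro add_strict_mono) auto
   also have "\<dots> = ennreal W" using W by (simp add: ennreal_plus[symmetric] del: ennreal_plus)
   finally show False using PN by simp
  qed
  then show ?thesis
  proof
   assume *: "ennreal (W / 2) <= emeasure lborel P"
   have "AE x\<in>ball z (R / 2 / 2) in lborel. c * k <= u x - a"
   proof (rule gr[OF el _ k])
    show "super (ball z (2 * (R / 2))) g" using s by (simp add: sol_def)
    show "approx (ball z (2 * (R / 2))) (Collect C1) (%x. u x - a) g"
     using approx_affine[OF ap fB, of 1 "- a"] by simp
    show "AE x\<in>ball z (2 * (R / 2)) in lborel. 0 <= u x - a" using bd by eventually_elim auto
    show "ennreal (1/2) * emeasure lborel (ball z (R / 2)) <= emeasure lborel {x : ball z (R / 2). k <= u x - a}"
     using * \<open>ennreal (1 / 2) * ennreal W = ennreal (W / 2)\<close> by (simp add: W P_def)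
   qed (use R in auto)
   with bd have "AE x\<in>ball z (R / 4) in lborel. a + c * k <= u x & u x <= b"
    by eventually_elim (use R in auto)
   moreover have "a + c * k <= b" using ck by linarith
   ultimately show ?thesis
    by (intro exI[of _ "a + c * k"] exI[of _ b]) (auto simp: \<gamma>_def k_def algebra_simps)
  next
   assume *: "ennreal (W / 2) <= emeasure lborel N"
   have "AE x\<in>ball z (R / 2 / 2) in lborel. c * k <= b - u x"
   proof (rule gr[OF el _ k])
    show "super (ball z (2 * (R / 2))) (%x. - g x)" using s by (simp add: sol_def)
    show "approx (ball z (2 * (R / 2))) (Collect C1) (%x. b - u x) (%x. - g x)"
     using approx_affine[OF ap fB, of "-1" b] by simp
    show "AE x\<in>ball z (2 * (R / 2)) in lborel. 0 <= b - u x" using bd by eventually_elim auto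
    show "ennreal (1/2) * emeasure lborel (ball z (R / 2)) <= emeasure lborel {x : ball z (R / 2). k <= b - u x}"
     using * \<open>ennreal (1 / 2) * ennreal W = ennreal (W / 2)\<close> by (simp add: W N_def)
   qed (use R in auto)
   with bd have "AE x\<in>ball z (R / 4) in lborel. a <= u x & u x <= b - c * k"
    by eventually_elim (use R in auto)
   moreover have "a <= b - c * k" using ck by linarith
   ultimately show ?thesis
    by (intro exI[of _ a] exI[of _ "b - c * k"]) (auto simp: \<gamma>_def k_def algebra_simps)
  qed
 qed
 moreover have "1 / 2 <= \<gamma>" "\<gamma> < 1" using c by (auto simp: \<gamma>_def)
 ultimately show ?thesis by blast
qed

text \<open>Iteration of \<open>osc_step\<close> along the radii R / 4^j. The exponent is fixed by
  (1/4)^\<alpha> = \<gamma>. The bound \<gamma> >= 1/2 gives \<alpha> < 1 and also the factor 2,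
  which pays for the step lost when r lies between two of these radii.\<close>

lemma osc_decay:
 assumes lam: "0 < lam" "lam <= L"
 shows "EX \<alpha>. 0 < \<alpha> & \<alpha> < 1 & (ALL (A::real^'n => real^'n^'n) z R u g a b r. elliptic A lam L --> 0 < r --> r <= R --> a <= b -->
  elliptic.sol A (ball z R) g --> approx (ball z R) (Collect C1) u g -->
  (AE x\<in>ball z R in lborel. a <= u x & u x <= b) -->
  (EX a' b'. a' <= b' & b' - a' <= 2 * (r / R) powr \<alpha> * (b - a) & (AE x\<in>ball z r in lborel. a' <= u x & u x <= b')))"
proof -
 obtain \<gamma> where \<gamma>: "1 / 2 <= \<gamma>" "\<gamma> < 1" and st0: "ALL (A::real^'n => real^'n^'n) z R u g a b. elliptic A lam L --> R > 0 --> a <= b -->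
  elliptic.sol A (ball z R) g --> approx (ball z R) (Collect C1) u g -->
  (AE x\<in>ball z R in lborel. a <= u x & u x <= b) -->
  (EX a' b'. a' <= b' & b' - a' <= \<gamma> * (b - a) & (AE x\<in>ball z (R / 4) in lborel. a' <= u x & u x <= b'))"
  using osc_step[OF lam, where 'n='n] by blast
 note st = st0[rule_format]
 define \<alpha> where "\<alpha> = - log 4 \<gamma>"
 have "log 4 \<gamma> < 0" using \<gamma> by simp
 moreover have "log 4 (1 / 4) < log 4 \<gamma>" using \<gamma> by (subst log_less_cancel_iff) auto
 then have "- 1 < log 4 \<gamma>" by (simp add: log_divide)
 ultimately have \<alpha>: "0 < \<alpha>" "\<alpha> < 1" by (auto simp: \<alpha>_def)
 have g4: "(1 / 4) powr \<alpha> = \<gamma>"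
 proof -
  have "(1 / 4) powr \<alpha> = 4 powr (- \<alpha>)" by (simp add: powr_minus_divide powr_divide)
  also have "\<dots> = \<gamma>" unfolding \<alpha>_def minus_minus using \<gamma> by (intro powr_log_cancel) auto
  finally show ?thesis .
 qed
 have "EX a' b'. a' <= b' & b' - a' <= 2 * (r / R) powr \<alpha> * (b - a) & (AE x\<in>ball z r in lborel. a' <= u x & u x <= b')"
  if el: "elliptic A lam L" and r: "0 < r" "r <= R" and ab: "a <= b" and s: "elliptic.sol A (ball z R) g"
   and ap: "approx (ball z R) (Collect C1) u g" and bd: "AE x\<in>ball z R in lborel. a <= u x & u x <= b"
  for A :: "real^'n => real^'n^'n" and z R u g a b r
 proof -
  interpret elliptic A lam L by (rule el)
  have R: "R > 0" using r by simp
  have it: "EX a' b'. a' <= b' & b' - a' <= \<gamma> ^ j * (b - a) & (AE x\<in>ball z (R / 4 ^ j) in lborel. a' <= u x & u x <= b')" for j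
  proof (induction j)
   case 0
   then show ?case using ab bd by auto
  next
   case (Suc j)
   then obtain a1 b1 where 1: "a1 <= b1" "b1 - a1 <= \<gamma> ^ j * (b - a)" "AE x\<in>ball z (R / 4 ^ j) in lborel. a1 <= u x & u x <= b1" by blast
   have le: "R / 4 ^ j <= R" using R by (simp add: divide_le_eq)
   have sub: "ball z (R / 4 ^ j) <= ball z R" using le by (rule subset_ball)
   have "EX a' b'. a' <= b' & b' - a' <= \<gamma> * (b1 - a1) & (AE x\<in>ball z (R / 4 ^ j / 4) in lborel. a' <= u x & u x <= b')"
    by (rule st[OF el _ 1(1) sol_mono[OF s sub] approx_mono[OF ap sub] 1(3)]) (use R in auto)
   then obtain a' b' where 2: "a' <= b'" "b' - a' <= \<gamma> * (b1 - a1)" "AE x\<in>ball z (R / 4 ^ j / 4) in lborel. a' <= u x & u x <= b'" by blast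
   have "\<gamma> * (b1 - a1) <= \<gamma> * (\<gamma> ^ j * (b - a))" using \<gamma> 1(2) by (intro mult_left_mono) auto
   then have "b' - a' <= \<gamma> ^ Suc j * (b - a)" using 2(2) by simp
   then show ?case using 2(1,3) by (intro exI[of _ a'] exI[of _ b']) (auto simp: field_simps)
  qed
  have "(%j. (1 / 4::real) ^ j) ---> 0" by (intro LIMSEQ_power_zero) auto
  then have "\<forall>\<^sub>F j in sequentially. (1 / 4) ^ j < r / R" using r R by (intro order_tendstoD) auto
  then have ex: "EX j. (1 / 4) ^ j < r / R" by (auto simp: eventually_sequentially)
  define m where "m = (LEAST j. (1 / 4) ^ j < r / R)"
  have m: "(1 / 4) ^ m < r / R" unfolding m_def by (rule LeastI_ex[OF ex])
  have "m ~= 0"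
  proof
   assume "m = 0"
   then have "1 < r / R" using m by simp
   then show False using r R by simp
  qed
  then obtain j where j: "m = Suc j" using not0_implies_Suc by blast
  have "\<not> (1 / 4) ^ j < r / R" using not_less_Least[of j "%j. (1 / 4) ^ j < r / R"] j by (auto simp: m_def)
  then have rj: "r <= R / 4 ^ j" using R by (simp add: field_simps power_divide)
  obtain a' b' where 1: "a' <= b'" "b' - a' <= \<gamma> ^ j * (b - a)" "AE x\<in>ball z (R / 4 ^ j) in lborel. a' <= u x & u x <= b'"
   using it by blast
  have "\<gamma> ^ m = ((1 / 4) ^ m) powr \<alpha>"
  proof -
   have "\<gamma> ^ m = ((1 / 4) powr \<alpha>) ^ m" by (simp only: g4)
   also have "\<dots> = ((1 / 4) powr \<alpha>) powr (real m)" by (rule powr_realpow[symmetric]) simp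
   also have "\<dots> = ((1 / 4) powr (real m)) powr \<alpha>" by (simp only: powr_powr mult.commute)
   also have "(1 / 4::real) powr (real m) = (1 / 4) ^ m" by (rule powr_realpow) simp
   finally show ?thesis .
  qed
  also have "\<dots> <= (r / R) powr \<alpha>" using m \<alpha> by (intro powr_mono2) auto
  finally have "\<gamma> * \<gamma> ^ j <= (r / R) powr \<alpha>" by (simp add: j)
  moreover have "\<gamma> ^ j <= 2 * (\<gamma> * \<gamma> ^ j)"
   using \<gamma> mult_right_mono[of 1 "2 * \<gamma>" "\<gamma> ^ j"] by simp
  ultimately have "\<gamma> ^ j <= 2 * (r / R) powr \<alpha>" by linarith
  then have "\<gamma> ^ j * (b - a) <= 2 * (r / R) powr \<alpha> * (b - a)" using ab by (intro mult_right_mono) auto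
  moreover have "AE x\<in>ball z r in lborel. a' <= u x & u x <= b'"
   using 1(3) by eventually_elim (use rj in auto)
  ultimately show ?thesis using 1 by (intro exI[of _ a'] exI[of _ b']) auto
 qed
 then show ?thesis using \<alpha> by blast
qed

subsection \<open>The fundamental solution\<close>

text \<open>The L^1 norm of f is the squared L^2 norm of the square root of |f|.\<close>

lemma L1_AE_subseq:
 fixes f :: "nat => real^'n => real"
 assumes [measurable]: "!!j. f j : Borel" "S : sets borel"
  and lim: "(%j. NN x. ennreal \<bar>f j x\<bar> * ind S x) ---> 0"
 shows "EX r::nat => nat. strict_mono r & (AE x\<in>S in lborel. (%j. f (r j) x) ---> 0)"
proof -
 have "(%j. L2 S (%x. sqrt \<bar>f j x\<bar>)) ---> 0" using lim by (simp add: L2_def)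
 then obtain r :: "nat => nat" where r: "strict_mono r" "AE x\<in>S in lborel. (%j. sqrt \<bar>f (r j) x\<bar>) ---> 0"
  using L2_AE_subseq[of "%j x. sqrt \<bar>f j x\<bar>" S] by auto
 have "AE x\<in>S in lborel. (%j. f (r j) x) ---> 0"
  using r(2)
 proof (eventually_elim, intro impI)
  fix x assume "x : S --> (%j. sqrt \<bar>f (r j) x\<bar>) ---> 0" "x : S"
  then have "(%j. (sqrt \<bar>f (r j) x\<bar>)^2) ---> 0\<^sup>2" by (intro tendsto_power) auto
  then show "(%j. f (r j) x) ---> 0" by (simp add: tendsto_rabs_zero_iff)
 qed
 then show ?thesis using r(1) by blast
qed

lemma hole_exists:
 assumes "\<epsilon> > 0"
 shows "EX \<psi>::real^'n => real. C1 \<psi> & (ALL x. 0 <= \<psi> x & \<psi> x <= 1) & (ALL x:cball 0 \<epsilon>. \<psi> x = 0 & grad \<psi> x = 0) &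
  (ALL x. x ~: ball 0 (2 * \<epsilon>) --> \<psi> x = 1 & grad \<psi> x = 0) & (ALL x. norm (grad \<psi> x) <= 3 / \<epsilon>)"
proof -
 obtain \<eta> :: "real^'n => real" where \<eta>: "C1 \<eta>" "ALL x. 0 <= \<eta> x & \<eta> x <= 1" "ALL x:cball 0 \<epsilon>. \<eta> x = 1 & grad \<eta> x = 0"
  "ALL x. x ~: ball 0 (2 * \<epsilon>) --> \<eta> x = 0 & grad \<eta> x = 0" "ALL x. norm (grad \<eta> x) <= 3 / (2 * \<epsilon> - \<epsilon>)"
  using cutoff_exists[of \<epsilon> "2 * \<epsilon>" "0::real^'n"] assms by auto
 have d: "((%t. 1 - t) has_real_derivative -1) (at t)" for t by (auto intro!: derivative_eq_intros)
 have "C1 (%x. 1 - \<eta> x)" "grad (%x. 1 - \<eta> x) = (%x. - grad \<eta> x)"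
  using C1_compose[OF \<eta>(1) d] grad_compose[OF \<eta>(1) d] by auto
 then show ?thesis using \<eta> by (intro exI[of _ "%x. 1 - \<eta> x"]) auto
qed

text \<open>Points have zero capacity for \<open>n \<ge> 3\<close>: the energy of the cut-off at scale \<open>\<epsilon>\<close> is of order \<open>\<epsilon>\<^bsup>n-2\<^esup>\<close>.\<close>

lemma hole_sequence:
 assumes n3: "CARD('n) \<ge> 3"
 shows "EX \<psi>::nat => real^'n => real. (ALL j. C1 (\<psi> j)) & (ALL j x. 0 <= \<psi> j x & \<psi> j x <= 1) &
  (ALL j. ALL x:cball 0 (1 / Suc j). \<psi> j x = 0 & grad (\<psi> j) x = 0) & (ALL j. EX B. ALL x. norm (grad (\<psi> j) x) <= B) &
  (ALL x. x ~= 0 --> (%j. \<psi> j x) ---> 1) & (%j. L2 UNIV (grad (\<psi> j))) ---> 0"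
proof -
 have "ALL j::nat. EX \<psi>::real^'n => real. C1 \<psi> & (ALL x. 0 <= \<psi> x & \<psi> x <= 1) & (ALL x:cball 0 (1 / Suc j). \<psi> x = 0 & grad \<psi> x = 0) &
  (ALL x. x ~: ball 0 (2 * (1 / Suc j)) --> \<psi> x = 1 & grad \<psi> x = 0) & (ALL x. norm (grad \<psi> x) <= 3 / (1 / Suc j))"
  by (intro allI hole_exists) simp
 from choice[OF this] obtain \<psi> :: "nat => real^'n => real" where \<psi>: "!!j. C1 (\<psi> j)" "!!j x. 0 <= \<psi> j x & \<psi> j x <= 1"
  "!!j. ALL x:cball 0 (1 / Suc j). \<psi> j x = 0 & grad (\<psi> j) x = 0"
  "!!j x. x ~: ball 0 (2 * (1 / Suc j)) ==> \<psi> j x = 1 & grad (\<psi> j) x = 0" "!!j x. norm (grad (\<psi> j) x) <= 3 / (1 / Suc j)" by blast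
 have lim1: "(%j. \<psi> j x) ---> 1" if "x ~= 0" for x
 proof -
  have l0: "(%j. 2 * inverse (real (Suc j))) ---> 2 * 0" by (intro tendsto_intros LIMSEQ_inverse_real_of_nat)
  have "\<forall>\<^sub>F j in sequentially. 2 * inverse (real (Suc j)) < norm x" using order_tendstoD(2)[OF l0, of "norm x"] that by simp
  then have "\<forall>\<^sub>F j in sequentially. \<psi> j x = 1"
  proof eventually_elim
   fix j assume "2 * inverse (real (Suc j)) < norm x"
   then have "x ~: ball 0 (2 * (1 / Suc j))" by (simp add: inverse_eq_divide)
   then show "\<psi> j x = 1" using \<psi>(4) by blast
  qed
  then show ?thesis by (rule tendsto_eventually)
 qed
 define V where "V = unit_ball_vol (real CARD('n))"
 have V: "V > 0" by (simp add: V_def)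
 have bd: "L2 UNIV (grad (\<psi> j)) <= ennreal (9 * V * 2 ^ CARD('n) * inverse (real (Suc j)))" for j
 proof -
  define e where "e = 1 / real (Suc j)"
  have e: "0 < e" "e <= 1" by (auto simp: e_def)
  have "L2 UNIV (grad (\<psi> j)) <= L2 (ball 0 (2 * e)) (grad (\<psi> j))"
   unfolding L2_def using \<psi>(4)[of _ j] by (intro nn_integral_mono) (auto simp: indicator_def e_def)
  also have "\<dots> <= ennreal ((3 / e)^2) * emeasure lborel (ball (0::real^'n) (2 * e))"
   by (rule L2_bounded) (use \<psi>(5)[of j] e in \<open>auto simp: e_def\<close>)
  also have "\<dots> = ennreal ((3 / e)^2 * (V * (2 * e) ^ CARD('n)))"
   using e V emeasure_ball_eq[of "2 * e" "0::real^'n"] by (simp add: V_def ennreal_mult)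
  also have "\<dots> <= ennreal (9 * V * 2 ^ CARD('n) * e)"
  proof (rule ennreal_leI)
   obtain m where m: "CARD('n) = m + 3" using n3 by (metis add.commute le_Suc_ex)
   have "(3 / e)^2 * (V * (2 * e) ^ CARD('n)) = 9 * V * 2 ^ CARD('n) * (e * e ^ m)"
    using e by (simp add: m power_add power_mult_distrib power_divide power2_eq_square power3_eq_cube)
   also have "\<dots> <= 9 * V * 2 ^ CARD('n) * (e * 1)"
    using e V by (intro mult_left_mono power_le_one) auto
   finally show "(3 / e)^2 * (V * (2 * e) ^ CARD('n)) <= 9 * V * 2 ^ CARD('n) * e" by simp
  qed
  finally show ?thesis by (simp add: e_def inverse_eq_divide)
 qed
 have "(%j. 9 * V * 2 ^ CARD('n) * inverse (real (Suc j))) ---> 9 * V * 2 ^ CARD('n) * 0"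
  by (intro tendsto_intros LIMSEQ_inverse_real_of_nat)
 from tendsto_ennrealI[OF this] have "(%j. ennreal (9 * V * 2 ^ CARD('n) * inverse (real (Suc j)))) ---> 0" by simp
 then have "(%j. L2 UNIV (grad (\<psi> j))) ---> 0" using bd by (rule ennreal_tendsto_0_le)
 then show ?thesis using \<psi> lim1 by (intro exI[of _ \<psi>]) blast
qed

text \<open>For bounded u the term u grad (\<psi> j) is small in L^2, since the energies of the
  holes tend to 0. Hence bounded functions with square integrable gradient do not see the
  pole.\<close>

lemma hole_mult_tendsto:
 fixes \<psi> :: "nat => real^'n => real"
 assumes \<psi>: "!!j. C1 (\<psi> j)" "!!j x. 0 <= \<psi> j x & \<psi> j x <= 1" "!!x. x ~= 0 ==> (%j. \<psi> j x) ---> 1"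
   "(%j. L2 UNIV (grad (\<psi> j))) ---> 0"
  and [measurable]: "S : sets borel" "u : Borel" "g : Borel"
  and bd: "!!x. x : S ==> \<bar>u x\<bar> <= B" "0 <= B" and fin: "L2 S g < \<infinity>"
 shows "(%j. L2 S (%x. (\<psi> j x *. g x + u x *. grad (\<psi> j) x) - g x)) ---> 0"
proof -
 note [measurable] = C1_measurable[OF \<psi>(1)] grad_measurable[OF \<psi>(1)]
 have ne: "AEL x. x ~= (0::real^'n)" by (rule AE_lborel_singleton)
 have l1: "(%j. L2 S (%x. (\<psi> j x - 1) *. g x)) ---> 0"
 proof (rule L2_dominated[where h=g])
  show "norm ((\<psi> j x - 1) *. g x) <= norm (g x)" for j x
  proof -
   have "\<bar>\<psi> j x - 1\<bar> <= 1" using \<psi>(2)[of j x] by auto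
   then show ?thesis using mult_right_mono[of "\<bar>\<psi> j x - 1\<bar>" 1 "norm (g x)"] by simp
  qed
  show "AE x\<in>S in lborel. (%j. (\<psi> j x - 1) *. g x) ---> 0"
   using ne
  proof (eventually_elim, intro impI)
   fix x :: "real^'n" assume "x ~= 0"
   have "(%j. (\<psi> j x - 1) *. g x) ---> (1 - 1) *. g x" by (intro tendsto_intros \<psi>(3) \<open>x ~= 0\<close>)
   then show "(%j. (\<psi> j x - 1) *. g x) ---> 0" by simp
  qed
 qed (use fin in auto)
 show ?thesis
 proof (rule ennreal_tendsto_0_le[OF ennreal_tendsto_0_lincomb[OF l1 \<psi>(4), of 2 "2 * ennreal (B\<^sup>2)"]])
  fix j
  have "L2 S (%x. (\<psi> j x *. g x + u x *. grad (\<psi> j) x) - g x) = L2 S (%x. (\<psi> j x - 1) *. g x + u x *. grad (\<psi> j) x)"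
   by (simp add: scaleR_left_diff_distrib algebra_simps)
  also have "\<dots> <= 2 * L2 S (%x. (\<psi> j x - 1) *. g x) + 2 * L2 S (%x. u x *. grad (\<psi> j) x)"
   by (rule L2_add) measurable
  also have "L2 S (%x. u x *. grad (\<psi> j) x) <= ennreal (B\<^sup>2) * L2 UNIV (grad (\<psi> j))"
   by (rule L2_bound_mult_on) (use bd in \<open>auto intro!: mult_right_mono\<close>)
  finally show "L2 S (%x. (\<psi> j x *. g x + u x *. grad (\<psi> j) x) - g x)
   <= 2 * L2 S (%x. (\<psi> j x - 1) *. g x) + 2 * ennreal (B\<^sup>2) * L2 UNIV (grad (\<psi> j))"
   by (simp add: mult.assoc mult_left_mono)
 qed (auto simp: ennreal_mult_less_top)
qed

text \<open>A nondecreasing C^1 function whose dilations tend to the indicator of the positive half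
  line; it serves to cut off smoothly at a level of G.\<close>

definition heavy :: "real => real" where
 "heavy y = (if y <= 0 then 0 else y\<^sup>2 / (1 + y\<^sup>2))"

definition heavy' :: "real => real" where
 "heavy' y = (if y <= 0 then 0 else 2 * y / (1 + y\<^sup>2)^2)"

lemma heavy_deriv: "(heavy has_real_derivative heavy' y) (at y)"
proof -
 have "((%y. if y <= 0 then 0 else y\<^sup>2 / (1 + y\<^sup>2)) has_real_derivative (if y <= 0 then 0 else 2 * y / (1 + y\<^sup>2)^2)) (at y)"
 proof (rule DERIV_join)
  fix t :: real
  have p: "1 + t\<^sup>2 > 0" by (simp add: add_pos_nonneg)
  then have "((%y. y\<^sup>2 / (1 + y\<^sup>2)) has_real_derivative (2 * t * (1 + t\<^sup>2) - t\<^sup>2 * (2 * t)) / (1 + t\<^sup>2)^2) (at t)"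
   by (auto intro!: derivative_eq_intros simp: power2_eq_square)
  moreover have "2 * t * (1 + t\<^sup>2) - t\<^sup>2 * (2 * t) = 2 * t" by (simp add: algebra_simps)
  ultimately show "((%y. y\<^sup>2 / (1 + y\<^sup>2)) has_real_derivative 2 * t / (1 + t\<^sup>2)^2) (at t)" by simp
 qed auto
 then show ?thesis by (simp add: heavy_def[abs_def] heavy'_def)
qed

lemma heavy'_continuous: "continuous_on UNIV heavy'"
 unfolding heavy'_def[abs_def]
 by (rule continuous_join) (auto intro!: continuous_intros simp: add_nonneg_eq_0_iff)

lemma heavy'_bounds: "0 <= heavy' y" "heavy' y <= 1"
proof -
 have "2 * y <= 1 + y\<^sup>2" using zero_le_power2[of "1 - y"] by (simp add: power2_diff)
 also have "\<dots> <= (1 + y\<^sup>2)^2" by (rule self_le_power) auto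
 finally have "2 * y <= (1 + y\<^sup>2)^2" .
 then show "0 <= heavy' y" "heavy' y <= 1"
  by (auto simp: heavy'_def divide_le_eq_1 add_pos_nonneg zero_less_power2)
qed

lemma heavy_bounds: "0 <= heavy y" "heavy y <= 1"
 by (auto simp: heavy_def divide_le_eq_1 add_pos_nonneg)

lemma heavy_tendsto: "(%j. heavy (real (Suc j) * y)) ---> (if y > 0 then 1 else 0)"
proof (cases "y > 0")
 case True
 have "heavy (real (Suc j) * y) = y\<^sup>2 / ((inverse (real (Suc j)))^2 + y\<^sup>2)" for j
 proof -
  define s where "s = real (Suc j)"
  have s: "s > 0" by (simp add: s_def)
  have "s\<^sup>2 * (inverse s)^2 = 1" using s by (simp add: power_mult_distrib[symmetric])
  then have "(s * y)^2 / (1 + (s * y)^2) = (s\<^sup>2 * y\<^sup>2) / (s\<^sup>2 * ((inverse s)^2 + y\<^sup>2))"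
   by (simp add: power_mult_distrib distrib_left)
  also have "\<dots> = y\<^sup>2 / ((inverse s)^2 + y\<^sup>2)" using s by (intro mult_divide_mult_cancel_left) simp
  finally have "(real (Suc j) * y)^2 / (1 + (real (Suc j) * y)^2) = y\<^sup>2 / ((inverse (real (Suc j)))^2 + y\<^sup>2)"
   by (simp add: s_def)
  then show ?thesis using True by (simp add: heavy_def not_le)
 qed
 moreover have "(%j. y\<^sup>2 / ((inverse (real (Suc j)))^2 + y\<^sup>2)) ---> y\<^sup>2 / (0\<^sup>2 + y\<^sup>2)"
  using True by (intro tendsto_intros LIMSEQ_inverse_real_of_nat) auto
 ultimately show ?thesis using True by simp
next
 case False
 then have "real (Suc j) * y <= 0" for j by (simp add: mult_nonneg_nonpos)
 then show ?thesis using False by (simp add: heavy_def)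
qed

section \<open>The fundamental solution away from its pole\<close>

definition ann :: "real => real => (real^'n) set" where
 "ann a b = {x. a < norm x & norm x < b}"

lemma ann_measurable [measurable, simp]: "ann a b : sets borel"
 unfolding ann_def by measurable

text \<open>The properties of \<open>fundamental_solution\<close> for Borel representatives, with
  the flux identity extended to C^1 test functions. The decay is stated almost everywhere because
  the representatives are determined up to null sets, while \<open>G_nonneg\<close> is arranged to
  hold everywhere.\<close>

locale fundamental = elliptic A lam L for A :: "real^'n => real^'n^'n" and lam L +
 fixes G :: "real^'n => real" and H :: "real^'n => real^'n"
 assumes n3: "CARD('n) \<ge> 3"
  and G_measurable [measurable]: "G : Borel"
  and H_measurable [measurable]: "H : Borel"
  and G_nonneg: "0 <= G x" and G_pos: "AEL x. 0 < G x"
  and G_int: "integrable lborel (%x. ind (ball 0 r) x * G x)"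
  and H_int: "integrable lborel (%x. ind (ball 0 r) x * H x $ i)"
  and G_wgrad: "wgrad UNIV G H"
  and H_L2: "\<rho> > 0 ==> L2 (- cball 0 \<rho>) H < \<infinity>"
  and flux: "\<phi> : C1c UNIV ==> (LBINT x. (A x *v H x) \<bullet> grad \<phi> x) = \<phi> 0"
  and decay: "\<delta> > 0 ==> EX R>0. AEL x. R <= norm x --> G x < \<delta>"
begin

lemma integrable_on_subset:
 assumes "integrable lborel (%x. ind (ball 0 r) x * f x :: real)" "S <= ball (0::real^'n) r" "S : sets borel"
 shows "integrable lborel (%x. ind S x * f x)"
proof -
 have "integrable lborel (%x. (ind (ball 0 r) x * f x) * ind S x)"
  using assms by (intro integrable_real_mult_indicator) auto
 moreover have "(%x. (ind (ball 0 r) x * f x) * ind S x) = (%x. ind S x * f x)"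
  using assms(2) by (auto simp: indicator_def fun_eq_iff)
 ultimately show ?thesis by simp
qed

text \<open>G is given as locally integrable only. Away from the pole its gradient is square
  integrable, and Poincare's inequality, applied along mollifications converging almost everywhere,
  transfers this to G.\<close>

lemma G_L2_ball:
 assumes "\<rho> > 0" "2 * \<rho> < norm z"
 shows "L2 (ball z \<rho>) G < \<infinity>"
proof -
 define r where "r = norm z + 2 * \<rho>"
 have sub: "ball z (2 * \<rho>) <= ball 0 r"
 proof
  fix x assume "x : ball z (2 * \<rho>)"
  then show "x : ball 0 r" using norm_triangle_ineq2[of x z] by (simp add: r_def dist_norm norm_minus_commute)
 qed
 have HS: "L2 (ball z (2 * \<rho>)) H < \<infinity>"
 proof -
  have "ball z (2 * \<rho>) <= - cball 0 ((norm z - 2 * \<rho>) / 2)"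
  proof
   fix x assume "x : ball z (2 * \<rho>)"
   then have "norm (z - x) < 2 * \<rho>" by (simp add: dist_norm)
   then show "x : - cball 0 ((norm z - 2 * \<rho>) / 2)" using norm_triangle_ineq2[of z x] assms by auto
  qed
  then have "L2 (ball z (2 * \<rho>)) H <= L2 (- cball 0 ((norm z - 2 * \<rho>) / 2)) H" by (rule L2_mono_set)
  also have "\<dots> < \<infinity>" using assms by (intro H_L2) auto
  finally show ?thesis .
 qed
 have cb: "cball x (\<rho> / 2) <= ball z (2 * \<rho>)" if "x : ball z \<rho>" for x
  using that assms by (auto simp: subset_eq) (smt (verit) dist_triangle)
 have "EX w::nat => _. (ALL j. C1 (w j)) & (%j. NN x. ennreal \<bar>w j x - G x\<bar> * ind (ball z \<rho>) x) ---> 0 &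
  (%j. L2 (ball z \<rho>) (%x. grad (w j) x - H x)) ---> 0 &
  (L2 (ball z (2 * \<rho>)) G < \<infinity> --> (%j. L2 (ball z \<rho>) (%x. w j x - G x)) ---> 0)"
  by (rule weak_moll_sequence[OF G_wgrad subset_UNIV _ _ G_measurable H_measurable
   integrable_on_subset[OF G_int sub] integrable_on_subset[OF H_int sub] HS _ cb]) (use assms in auto)
 then obtain w :: "nat => _" where w: "!!j. C1 (w j)" "(%j. NN x. ennreal \<bar>w j x - G x\<bar> * ind (ball z \<rho>) x) ---> 0"
  "(%j. L2 (ball z \<rho>) (%x. grad (w j) x - H x)) ---> 0" by blast
 note [measurable] = C1_measurable[OF w(1)]
 obtain q :: "nat => nat" where q: "strict_mono q" "AE x\<in>ball z \<rho> in lborel. (%j. w (q j) x - G x) ---> 0"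
  using L1_AE_subseq[of "%j x. w j x - G x" "ball z \<rho>"] w(2) by auto
 have ae: "AE x\<in>ball z \<rho> in lborel. (%j. w (q j) x) ---> G x"
  using q(2) by eventually_elim (simp add: LIM_zero_iff)
 have gl: "(%j. L2 (ball z \<rho>) (%x. grad (w (q j)) x - H x)) ---> 0"
  using LIMSEQ_subseq_LIMSEQ[OF w(3) q(1)] by (simp add: o_def)
 note P = poincare_limit[OF w(1) assms(1) G_measurable H_measurable ae gl]
 have HB: "L2 (ball z \<rho>) H < \<infinity>"
  using HS L2_mono_set[of "ball z \<rho>" "ball z (2 * \<rho>)" H] assms by force
 have Kf: "ennreal (8 * \<rho>\<^sup>2 * 2 ^ CARD('n)) * L2 (ball z \<rho>) H < \<infinity>" using HB by (simp add: ennreal_mult_less_top)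
 obtain c where c: "L2 (ball z \<rho>) (%x. G x - c) <= 2 * ennreal (8 * \<rho>\<^sup>2 * 2 ^ CARD('n)) * L2 (ball z \<rho>) H"
  using poincare_constant[OF assms(1) G_measurable P Kf] by blast
 have "L2 (ball z \<rho>) (%x. (G x - c) + c) <= 2 * L2 (ball z \<rho>) (%x. G x - c) + 2 * L2 (ball z \<rho>) (%x. c)"
  by (rule L2_add) auto
 also have "\<dots> < \<infinity>"
  using le_less_trans[OF c] HB L2_bounded[of "ball z \<rho>" "%x. c" "\<bar>c\<bar>"] emeasure_lborel_ball_finite[of z \<rho>]
  by (auto simp: ennreal_mult_less_top intro: le_less_trans)
 finally show ?thesis by simp
qed

text \<open>By compactness the closed annulus is covered by finitely many balls whose radius is a
  quarter of the distance of their centre to the pole.\<close>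

lemma G_L2_ann:
 assumes "0 < a"
 shows "L2 (ann a b) G < \<infinity>"
proof -
 define K where "K = cball (0::real^'n) b - ball 0 a"
 have K: "compact K" unfolding K_def by (intro compact_diff) auto
 have "ALL B:(%z. ball z (norm z / 4)) ` K. open B" by auto
 moreover have "K <= \<Union>((%z. ball z (norm z / 4)) ` K)"
 proof
  fix x assume "x : K"
  then have "norm x / 4 > 0" using assms by (auto simp: K_def)
  then show "x : \<Union>((%z. ball z (norm z / 4)) ` K)" using \<open>x : K\<close> by (auto intro!: bexI[of _ x])
 qed
 ultimately obtain D where D: "D <= K" "finite D" "K <= (\<Union>z\<in>D. ball z (norm z / 4))"
  using compactE_image[OF K, of K "%z. ball z (norm z / 4)"] by auto
 have "L2 (ann a b) G <= (NN x. (\<Sum>z\<in>D. ennreal ((norm (G x))^2) * ind (ball z (norm z / 4)) x))"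
  unfolding L2_def
 proof (rule nn_integral_mono)
  fix x
  show "ennreal ((norm (G x))^2) * ind (ann a b) x <= (\<Sum>z\<in>D. ennreal ((norm (G x))^2) * ind (ball z (norm z / 4)) x)"
  proof (cases "x : ann a b")
   case True
   then have "x : K" by (auto simp: ann_def K_def)
   then obtain z where z: "z : D" "x : ball z (norm z / 4)" using D by auto
   have "ennreal ((norm (G x))^2) * ind (ball z (norm z / 4)) x <= (\<Sum>z\<in>D. ennreal ((norm (G x))^2) * ind (ball z (norm z / 4)) x)"
    by (rule member_le_sum) (use z D in auto)
   then show ?thesis using z True by simp
  qed simp
 qed
 also have "\<dots> = (\<Sum>z\<in>D. L2 (ball z (norm z / 4)) G)"
 proof -
  have [measurable]: "ball z r : sets borel" for z :: "real^'n" and r by simp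
  show ?thesis unfolding L2_def by (rule nn_integral_sum) measurable
 qed
 also have "\<dots> < \<infinity>"
 proof -
  have "L2 (ball z (norm z / 4)) G < \<infinity>" if "z : D" for z
   using that D assms by (intro G_L2_ball) (auto simp: K_def)
  then show ?thesis using D(2) by (simp add: less_top)
 qed
 finally show ?thesis .
qed

lemma ann_finite: "emeasure lborel (ann a b :: (real^'n) set) < \<infinity>"
proof -
 have "emeasure lborel (ann a b :: (real^'n) set) <= emeasure lborel (ball (0::real^'n) b)"
  by (intro emeasure_mono) (auto simp: ann_def)
 then show ?thesis using emeasure_lborel_ball_finite[of "0::real^'n" b] by (auto intro: le_less_trans)
qed

lemma H_L2_ann: "0 < a ==> L2 (ann a b) H < \<infinity>"
 using H_L2[of "a"] L2_mono_set[of "ann a b" "- cball 0 a" H]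
 by (auto simp: ann_def subset_eq intro: le_less_trans)

lemma approx_ann:
 assumes "0 < a"
 shows "approx (ann a b) (Collect C1) G H"
proof (rule weak_approx[OF G_wgrad subset_UNIV, where S'="ann (a / 2) (b + a)" and ?e0.0="a / 4"])
 have sub: "ann (a / 2) (b + a) <= ball (0::real^'n) (b + a)" by (auto simp: ann_def)
 show "integrable lborel (%x. ind (ann (a / 2) (b + a)) x * G x)"
  by (rule integrable_on_subset[OF G_int sub]) simp
 show "integrable lborel (%x. ind (ann (a / 2) (b + a)) x * H x $ i)" for i
  by (rule integrable_on_subset[OF H_int sub]) simp
 show "cball x (a / 4) <= ann (a / 2) (b + a)" if "x : ann a b" for x :: "real^'n"
 proof
  fix y assume "y : cball x (a / 4)"
  then have "norm (x - y) <= a / 4" by (simp add: dist_norm)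
  then have "norm x - norm y <= a / 4" "norm y - norm x <= a / 4"
   using norm_triangle_ineq2[of x y] norm_triangle_ineq2[of y x] by (auto simp: norm_minus_commute)
  then show "y : ann (a / 2) (b + a)" using that assms by (auto simp: ann_def)
 qed
qed (use assms G_L2_ann H_L2_ann in auto)

text \<open>Test functions supported in the annulus vanish at the pole, so the right side of the
  flux identity is 0.\<close>

lemma sol_ann:
 assumes "0 <= a"
 shows "sol (ann a b) H"
proof -
 have z: "(LBINT x. ind (ann a b) x * ((A x *v H x) \<bullet> grad \<phi> x)) = 0" if "\<phi> : C1c (ann a b)" for \<phi>
 proof -
  have "(LBINT x. ind (ann a b) x * ((A x *v H x) \<bullet> grad \<phi> x)) = (LBINT x. (A x *v H x) \<bullet> grad \<phi> x)"
   using C1c_zero(2)[OF that] by (intro Bochner_Integration.integral_cong) (auto simp: indicator_def)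
  also have "\<dots> = \<phi> 0" by (rule flux[OF C1c_mono[OF that]]) simp
  also have "\<phi> 0 = 0" using C1c_zero(1)[OF that] assms by (simp add: ann_def)
  finally show ?thesis .
 qed
 have "(LBINT x. ind (ann a b) x * ((A x *v - H x) \<bullet> grad \<phi> x)) = 0" if "\<phi> : C1c (ann a b)" for \<phi>
 proof -
  have "A x *v - H x = - (A x *v H x)" for x
   using matrix_vector_mult_scaleR[of "A x" "-1" "H x"] by simp
  then show ?thesis using z[OF that] by simp
 qed
 with z show ?thesis by (auto simp: sol_def super_def)
qed

end

section \<open>Truncations of the fundamental solution as supersolutions across the pole\<close>

lemma L2_fatou:
 fixes f :: "nat => 'a::euclidean_space => 'b::euclidean_space"
 assumes [measurable]: "!!j. f j : Borel" "h : Borel" "S : sets borel"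
  and ae: "AE x\<in>S in lborel. (%j. f j x) ---> h x"
  and bd: "!!j. L2 S (f j) <= c + Y j" and Y: "Y ---> 0"
 shows "L2 S h <= c"
proof -
 have "L2 S h <= (NN x. liminf (%j. ennreal ((norm (f j x))^2) * ind S x))"
  unfolding L2_def
 proof (rule nn_integral_mono_AE)
  show "AEL x. ennreal ((norm (h x))^2) * ind S x <= liminf (%j. ennreal ((norm (f j x))^2) * ind S x)"
   using ae
  proof eventually_elim
   fix x assume a: "x : S --> (%j. f j x) ---> h x"
   show "ennreal ((norm (h x))^2) * ind S x <= liminf (%j. ennreal ((norm (f j x))^2) * ind S x)"
   proof (cases "x : S")
    case True
    then have "(%j. ennreal ((norm (f j x))^2)) ---> ennreal ((norm (h x))^2)"
     using a by (intro tendsto_ennreal_sq tendsto_norm) blast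
    then have "liminf (%j. ennreal ((norm (f j x))^2)) = ennreal ((norm (h x))^2)"
     by (intro lim_imp_Liminf) auto
    then show ?thesis using True by simp
   qed simp
  qed
 qed
 also have "\<dots> <= liminf (%j. L2 S (f j))"
  unfolding L2_def by (rule nn_integral_liminf) measurable
 also have "\<dots> <= c" by (rule liminf_bound[OF bd Y])
 finally show ?thesis .
qed

context fundamental
begin

definition Gk :: "real => real^'n => real" where "Gk k x = min (G x) k"

text \<open>The gradient of \<open>Gk k\<close>; the value 0 on the level set {G = k} is the one
  that the positive part of k - G produces.\<close>

definition Hk :: "real => real^'n => real^'n" where "Hk k x = (if G x < k then H x else 0)"

abbreviation between :: "real => (real^'n => real) set" where
 "between k \<equiv> {w. C1 w & (ALL x. 0 <= w x & w x <= k)}"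

lemma Gk_measurable [measurable]: "Gk k : Borel"
 unfolding Gk_def[abs_def] by measurable

lemma Hk_measurable [measurable]: "Hk k : Borel"
 unfolding Hk_def[abs_def] by measurable

lemma Gk_bounds: "k > 0 ==> 0 <= Gk k x" "Gk k x <= k"
 using G_nonneg[of x] by (auto simp: Gk_def)

text \<open>The truncation is k - (k - G)^+. A second positive part, which changes nothing in the
  limit, makes the approximating functions nonnegative, so that they belong to
  \<open>between k\<close>.\<close>

lemma approx_Gk_ann:
 assumes "0 < a" "k > 0"
 shows "approx (ann a b) (between k) (Gk k) (Hk k)"
proof -
 have a1: "approx (ann a b) (Collect C1) (%x. -1 * G x + k) (%x. -1 *. H x)"
  by (rule approx_affine[OF approx_ann[OF assms(1)] ann_finite])
 have a2: "approx (ann a b) {w. C1 w & (ALL x. 0 <= w x)} (%x. max (-1 * G x + k) 0) (%x. if -1 * G x + k > 0 then -1 *. H x else 0)"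
  by (rule approx_pos[OF a1]) (auto simp: C1_smooth_pos smooth_pos_bounds)
 have d: "((%t. k - t) has_real_derivative -1) (at t)" for t by (auto intro!: derivative_eq_intros)
 have a3: "approx (ann a b) {w. C1 w & (ALL x. w x <= k)} (%x. k - max (-1 * G x + k) 0)
   (%x. -1 *. (if -1 * G x + k > 0 then -1 *. H x else 0))"
 proof (rule approx_chain[OF a2 d, where M=1])
  show "(%x. k - w x) : {w. C1 w & (ALL x. w x <= k)}" if "w : {w. C1 w & (ALL x. 0 <= w x)}" for w :: "real^'n => real"
   using that C1_compose[of w "%t. k - t" "%t. -1"] d by auto
  have "L2 (ann a b) (%x. k - max (-1 * G x + k) 0) <= ennreal (k\<^sup>2) * emeasure lborel (ann a b :: (real^'n) set)"
   by (rule L2_bounded) (use assms G_nonneg in \<open>auto simp: max_def\<close>)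
  also have "\<dots> < \<infinity>" using ann_finite[of a b] by (simp add: ennreal_mult_less_top)
  finally show "L2 (ann a b) (%x. k - max (-1 * G x + k) 0) < \<infinity>" .
 qed auto
 have a4: "approx (ann a b) (between k) (%x. max (k - max (-1 * G x + k) 0) 0)
  (%x. if k - max (-1 * G x + k) 0 > 0 then -1 *. (if -1 * G x + k > 0 then -1 *. H x else 0) else 0)"
 proof (rule approx_pos[OF a3])
  show "(%x. smooth_pos e (w x)) : between k" if "w : {w. C1 w & (ALL x. w x <= k)}" "e > 0" for w :: "real^'n => real" and e
  proof -
   have "smooth_pos e (w x) <= k" for x
    using smooth_pos_bounds(2)[OF that(2), of "w x"] that(1) assms(2) by (smt (verit) mem_Collect_eq)
   then show ?thesis using that smooth_pos_bounds(1)[OF that(2)] by (auto intro: C1_smooth_pos)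
  qed
 qed auto
 show ?thesis
 proof (rule approx_cong[OF a4])
  show "AE x\<in>ann a b in lborel. Gk k x = max (k - max (-1 * G x + k) 0) 0"
  proof (intro AE_I2 impI)
   fix x show "Gk k x = max (k - max (-1 * G x + k) 0) 0"
    using G_nonneg[of x] assms(2) by (simp add: Gk_def min_def max_def)
  qed
  show "AE x\<in>ann a b in lborel. Hk k x =
   (if k - max (-1 * G x + k) 0 > 0 then -1 *. (if -1 * G x + k > 0 then -1 *. H x else 0) else 0)"
   using G_pos by eventually_elim (use assms(2) in \<open>auto simp: Hk_def max_def\<close>)
 qed measurable
qed

lemma hole_C1c:
 assumes \<phi>: "\<phi> : C1c (ball 0 R)" and \<psi>: "C1 \<psi>" "ALL x:cball 0 e. \<psi> x = 0 & grad \<psi> x = 0" and e: "0 < e"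
 shows "(%x. \<psi> x * \<phi> x) : C1c (ann (e / 2) R)"
proof -
 from \<phi> obtain K where K: "compact K" "K <= ball 0 R" "!!x. x ~: K ==> \<phi> x = 0" by (auto simp: C1c_def)
 show ?thesis
 proof (rule C1cI)
  show "C1 (%x. \<psi> x * \<phi> x)" by (rule C1_mult[OF \<psi>(1) C1c_C1[OF \<phi>]])
  show "compact (K - ball 0 e)" using K(1) by (rule compact_diff) simp
  show "K - ball 0 e <= ann (e / 2) R" using K(2) e by (auto simp: ann_def subset_eq)
  show "\<psi> x * \<phi> x = 0" if "x ~: K - ball 0 e" for x
   using that K(3)[of x] \<psi>(2) by (cases "x : K") auto
 qed
qed

lemma cutoff_C1c:
 assumes "0 <= r1" "r1 < r2" "r2 < r3"
 shows "EX \<eta>:C1c (ball (0::real^'n) r3). (ALL x. 0 <= \<eta> x & \<eta> x <= 1) & (ALL x:cball 0 r1. \<eta> x = 1 & grad \<eta> x = 0) &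
  (ALL x. x ~: ball 0 r2 --> \<eta> x = 0 & grad \<eta> x = 0) & (ALL x. norm (grad \<eta> x) <= 3 / (r2 - r1))"
proof -
 obtain \<eta> :: "real^'n => real" where \<eta>: "C1 \<eta>" "ALL x. 0 <= \<eta> x & \<eta> x <= 1" "ALL x:cball 0 r1. \<eta> x = 1 & grad \<eta> x = 0"
  "ALL x. x ~: ball 0 r2 --> \<eta> x = 0 & grad \<eta> x = 0" "ALL x. norm (grad \<eta> x) <= 3 / (r2 - r1)"
  using cutoff_exists[OF assms(1,2), of "0::real^'n"] by blast
 have "\<eta> : C1c (ball 0 r3)"
  by (rule C1cI[OF \<eta>(1), of "cball 0 r2"]) (use \<eta>(4) assms in auto)
 then show ?thesis using \<eta> by blast
qed

text \<open>k - G is a subsolution in annuli, and its De Giorgi inequality at level 0 bounds the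
  energy of G on {G < k} by a multiple of k^2 times the energy of the cut-off. With cut-offs that
  exclude shrinking balls around the pole this stays bounded, and Fatou's lemma gives finiteness up
  to the pole.\<close>

lemma Hk_L2_ball:
 assumes "R > 0" "k > 0"
 shows "L2 (ball 0 R) (Hk k) < \<infinity>"
proof -
 obtain \<psi> :: "nat => real^'n => real" where \<psi>: "ALL j. C1 (\<psi> j)" "ALL j x. 0 <= \<psi> j x & \<psi> j x <= 1"
  "ALL j. ALL x:cball 0 (1 / Suc j). \<psi> j x = 0 & grad (\<psi> j) x = 0" "ALL x. x ~= 0 --> (%j. \<psi> j x) ---> 1"
  "(%j. L2 UNIV (grad (\<psi> j))) ---> 0"
  using hole_sequence[where 'n='n, OF n3] by blast
 obtain \<zeta> where \<zeta>: "\<zeta> : C1c (ball (0::real^'n) (3 * R))" "ALL x. 0 <= \<zeta> x & \<zeta> x <= 1" "ALL x:cball 0 R. \<zeta> x = 1 & grad \<zeta> x = 0"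
  using cutoff_C1c[of R "2 * R" "3 * R"] assms by auto
 note C\<psi> = \<psi>(1)[rule_format] and C\<zeta> = C1c_C1[OF \<zeta>(1)]
 note [measurable] = C1_measurable[OF C\<psi>] grad_measurable[OF C\<psi>] C1_measurable[OF C\<zeta>] grad_measurable[OF C\<zeta>]
 define \<Lambda> where "\<Lambda> = 4 * L / lam"
 have \<Lambda>: "\<Lambda> \<ge> 0" using lam_pos L_pos by (simp add: \<Lambda>_def)
 define c where "c = ennreal (\<Lambda> * k\<^sup>2)"
 have bd: "L2 (ball 0 R) (%x. \<psi> j x *. Hk k x) <= c * (2 * L2 UNIV (grad \<zeta>)) + c * (2 * L2 UNIV (grad (\<psi> j)))" for j
 proof -
  define S where "S = (ann (1 / Suc j / 2) (3 * R) :: (real^'n) set)"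
  have [measurable]: "S : sets borel" by (simp add: S_def)
  define \<eta> where "\<eta> = (%x. \<psi> j x * \<zeta> x)"
  have \<eta>: "\<eta> : C1c S" unfolding \<eta>_def S_def by (rule hole_C1c[OF \<zeta>(1) C\<psi>]) (use \<psi>(3) in auto)
  have g\<eta>: "grad \<eta> = (%x. \<psi> j x *. grad \<zeta> x + \<zeta> x *. grad (\<psi> j) x)"
   unfolding \<eta>_def by (rule grad_mult[OF C\<psi> C\<zeta>])
  note [measurable] = C1_measurable[OF C1c_C1[OF \<eta>]] grad_measurable[OF C1c_C1[OF \<eta>]]
  have ap: "approx S (Collect C1) (%x. -1 * G x + k) (%x. -1 *. H x)"
   unfolding S_def by (rule approx_affine[OF approx_ann ann_finite]) simp
  have "super S (%x. - (-1 *. H x))" using sol_ann[of "1 / Suc j / 2" "3 * R"] by (simp add: S_def sol_def)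
  from sub_DG[OF this ap] have dg: "DG \<Lambda> S (%x. -1 * G x + k) (%x. -1 *. H x)" by (simp add: \<Lambda>_def)
  have "L2 (ball 0 R) (%x. \<psi> j x *. Hk k x)
   <= (NN x. ennreal ((\<eta> x)^2 * (norm (-1 *. H x))^2) * ind (S \<inter> {x. 0 < -1 * G x + k}) x)"
   unfolding L2_def
  proof (rule nn_integral_mono)
   fix x
   show "ennreal ((norm (\<psi> j x *. Hk k x))^2) * ind (ball 0 R) x
    <= ennreal ((\<eta> x)^2 * (norm (-1 *. H x))^2) * ind (S \<inter> {x. 0 < -1 * G x + k}) x"
   proof (cases "x : ball 0 R & x : S")
    case True
    then have "\<eta> x = \<psi> j x" using \<zeta>(3) by (simp add: \<eta>_def)
    then show ?thesis using True by (auto simp: Hk_def indicator_def power_mult_distrib)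
   next
    case False
    have "\<psi> j x = 0" if "x : ball 0 R" "x ~: S"
    proof -
     have "norm x <= 1 / Suc j / 2" using that assms(1) unfolding S_def ann_def by simp
     also have "\<dots> <= 1 / Suc j" by (simp add: divide_simps)
     finally show ?thesis using \<psi>(3) by simp
    qed
    then show ?thesis using False by (auto simp: indicator_def)
   qed
  qed
  also have "\<dots> <= ennreal \<Lambda> * (NN x. ennreal ((max (-1 * G x + k - 0) 0)^2 * (norm (grad \<eta> x))^2) * ind S x)"
   using dg \<eta> unfolding DG_def by blast
  also have "\<dots> <= ennreal \<Lambda> * (ennreal (k\<^sup>2) * L2 UNIV (grad \<eta>))"
  proof (rule mult_left_mono)
   have "(NN x. ennreal ((max (-1 * G x + k - 0) 0)^2 * (norm (grad \<eta> x))^2) * ind S x)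
    <= (NN x. ennreal (k\<^sup>2) * (ennreal ((norm (grad \<eta> x))^2) * ind UNIV x))"
   proof (rule nn_integral_mono)
    fix x
    have "(max (-1 * G x + k - 0) 0)^2 <= k\<^sup>2" using G_nonneg[of x] assms(2) by (intro power_mono) auto
    then have "ennreal ((max (-1 * G x + k - 0) 0)^2 * (norm (grad \<eta> x))^2) <= ennreal (k\<^sup>2 * (norm (grad \<eta> x))^2)"
     by (intro ennreal_leI mult_right_mono) auto
    then show "ennreal ((max (-1 * G x + k - 0) 0)^2 * (norm (grad \<eta> x))^2) * ind S x
     <= ennreal (k\<^sup>2) * (ennreal ((norm (grad \<eta> x))^2) * ind UNIV x)"
     by (auto simp: indicator_def ennreal_mult)
   qed
   also have "\<dots> = ennreal (k\<^sup>2) * L2 UNIV (grad \<eta>)" unfolding L2_def by (rule nn_integral_cmult) measurable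
   finally show "(NN x. ennreal ((max (-1 * G x + k - 0) 0)^2 * (norm (grad \<eta> x))^2) * ind S x)
    <= ennreal (k\<^sup>2) * L2 UNIV (grad \<eta>)" .
  qed simp
  also have "\<dots> = c * L2 UNIV (grad \<eta>)" using \<Lambda> by (simp add: c_def ennreal_mult mult.assoc)
  also have "\<dots> <= c * (2 * L2 UNIV (grad \<zeta>) + 2 * L2 UNIV (grad (\<psi> j)))"
  proof (rule mult_left_mono)
   have "L2 UNIV (grad \<eta>) <= 2 * L2 UNIV (%x. \<psi> j x *. grad \<zeta> x) + 2 * L2 UNIV (%x. \<zeta> x *. grad (\<psi> j) x)"
    unfolding g\<eta> by (rule L2_add) measurable
   also have "\<dots> <= 2 * L2 UNIV (grad \<zeta>) + 2 * L2 UNIV (grad (\<psi> j))"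
    using \<psi>(2) \<zeta>(2) by (intro add_mono mult_left_mono L2_mono) (auto simp: mult_left_le_one_le)
   finally show "L2 UNIV (grad \<eta>) <= 2 * L2 UNIV (grad \<zeta>) + 2 * L2 UNIV (grad (\<psi> j))" .
  qed simp
  finally show ?thesis by (simp add: distrib_left)
 qed
 have "(%j. (c * 2) * L2 UNIV (grad (\<psi> j)) + 0 * L2 UNIV (grad (\<psi> j))) ---> 0"
  by (rule ennreal_tendsto_0_lincomb[OF \<psi>(5) \<psi>(5)]) (auto simp: c_def ennreal_mult_less_top)
 then have Y: "(%j. c * (2 * L2 UNIV (grad (\<psi> j)))) ---> 0" by (simp add: mult.assoc)
 have ae: "AE x\<in>ball 0 R in lborel. (%j. \<psi> j x *. Hk k x) ---> Hk k x"
  using AE_lborel_singleton[of "0::real^'n"]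
 proof (eventually_elim, intro impI)
  fix x :: "real^'n" assume "x ~= 0"
  then have "(%j. \<psi> j x *. Hk k x) ---> 1 *. Hk k x" using \<psi>(4) by (intro tendsto_intros) auto
  then show "(%j. \<psi> j x *. Hk k x) ---> Hk k x" by simp
 qed
 have "L2 (ball 0 R) (Hk k) <= c * (2 * L2 UNIV (grad \<zeta>))"
  by (rule L2_fatou[OF _ _ _ ae bd Y]) auto
 also have "\<dots> < \<infinity>"
  using C1c_L2_finite[OF C1c_mono[OF \<zeta>(1) subset_UNIV]] by (simp add: c_def ennreal_mult_less_top)
 finally show ?thesis .
qed

text \<open>The truncation is bounded and has finite energy, so its products with the holes \<psi> j
  converge to it, by \<open>hole_mult_tendsto\<close>; these products only involve annuli.\<close>

lemma approx_Gk:
 assumes "R > 0" "k > 0"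
 shows "approx (ball 0 R) (between k) (Gk k) (Hk k)"
proof -
 obtain \<psi> :: "nat => real^'n => real" where \<psi>: "ALL j. C1 (\<psi> j)" "ALL j x. 0 <= \<psi> j x & \<psi> j x <= 1"
  "ALL j. ALL x:cball 0 (1 / Suc j). \<psi> j x = 0 & grad (\<psi> j) x = 0" "ALL j. EX B. ALL x. norm (grad (\<psi> j) x) <= B"
  "ALL x. x ~= 0 --> (%j. \<psi> j x) ---> 1" "(%j. L2 UNIV (grad (\<psi> j))) ---> 0"
  using hole_sequence[where 'n='n, OF n3] by blast
 note C\<psi> = \<psi>(1)[rule_format]
 note [measurable] = C1_measurable[OF C\<psi>] grad_measurable[OF C\<psi>]
 have fG: "L2 (ball 0 R) (Gk k) < \<infinity>"
 proof -
  have "L2 (ball 0 R) (Gk k) <= ennreal (k\<^sup>2) * emeasure lborel (ball (0::real^'n) R)"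
   by (rule L2_bounded) (use Gk_bounds(1)[OF assms(2)] Gk_bounds(2) assms in auto)
  also have "\<dots> < \<infinity>" using emeasure_lborel_ball_finite[of "0::real^'n" R] by (simp add: ennreal_mult_less_top)
  finally show ?thesis .
 qed
 show ?thesis
 proof (rule approx_limit)
  fix j
  obtain B where B: "ALL x. norm (grad (\<psi> j) x) <= B" using \<psi>(4) by blast
  show "approx (ball 0 R) (between k) (%x. \<psi> j x * Gk k x) (%x. \<psi> j x *. Hk k x + Gk k x *. grad (\<psi> j) x)"
  proof (rule approx_mult_C1[OF approx_Gk_ann[of "1 / Suc j" k R] C\<psi>])
   show "\<bar>\<psi> j x\<bar> <= max B 1" for x using \<psi>(2)[rule_format, of j x] by auto
   show "norm (grad (\<psi> j) x) <= max B 1" for x using B[rule_format, of x] by auto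
   show "\<psi> j x = 0 & grad (\<psi> j) x = 0" if "x : ball 0 R" "x ~: ann (1 / Suc j) R" for x
    using that \<psi>(3) by (auto simp: ann_def)
   show "(%x. \<psi> j x * w x) : between k" if "w : between k" for w
   proof -
    have "\<psi> j x * w x <= k" for x
     using mult_mono[of "\<psi> j x" 1 "w x" k] \<psi>(2) that by auto
    then show ?thesis using that \<psi>(2) C1_mult[OF C\<psi>] by auto
   qed
  qed (use assms in auto)
 next
  show "(%j. L2 (ball 0 R) (%x. \<psi> j x * Gk k x - Gk k x)) ---> 0"
  proof (rule L2_dominated[OF _ _ _ _ fG])
   show "norm (\<psi> j x * Gk k x - Gk k x) <= norm (Gk k x)" for j x
   proof -
    have "\<bar>(\<psi> j x - 1) * Gk k x\<bar> <= 1 * \<bar>Gk k x\<bar>"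
     unfolding abs_mult using \<psi>(2)[rule_format, of j x] by (intro mult_right_mono) auto
    then show ?thesis by (simp add: left_diff_distrib)
   qed
   show "AE x\<in>ball 0 R in lborel. (%j. \<psi> j x * Gk k x - Gk k x) ---> 0"
    using AE_lborel_singleton[of "0::real^'n"]
   proof (eventually_elim, intro impI)
    fix x :: "real^'n" assume "x ~= 0"
    then have "(%j. \<psi> j x * Gk k x - Gk k x) ---> 1 * Gk k x - Gk k x" using \<psi>(5) by (intro tendsto_intros) auto
    then show "(%j. \<psi> j x * Gk k x - Gk k x) ---> 0" by simp
   qed
  qed auto
  show "(%j. L2 (ball 0 R) (%x. \<psi> j x *. Hk k x + Gk k x *. grad (\<psi> j) x - Hk k x)) ---> 0"
   by (rule hole_mult_tendsto[where B=k])
    (use \<psi> Gk_bounds(1)[OF assms(2)] Gk_bounds(2) assms Hk_L2_ball[OF assms] in auto)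
 qed auto
qed

text \<open>G is tested with \<eta> F(G), where F = \<open>F j\<close> is decreasing and tends to
  the indicator of {t < k}. The term with F' has a sign and is dropped; what remains converges to
  the inequality for the truncation.\<close>

lemma Hk_super_ann:
 assumes "0 < a" "\<eta> : C1c (ann a b)" "ALL x. 0 <= \<eta> x"
 shows "0 <= (LBINT x. ind (ann a b) x * ((A x *v Hk k x) \<bullet> grad \<eta> x))"
proof -
 define S where "S = (ann a b :: (real^'n) set)"
 have S [measurable]: "S : sets borel" by (simp add: S_def)
 note C\<eta> = C1c_C1[OF assms(2)]
 note [measurable] = C1_measurable[OF C\<eta>] grad_measurable[OF C\<eta>]
 have fH: "L2 S H < \<infinity>" unfolding S_def by (rule H_L2_ann[OF assms(1)])
 have fAH: "L2 S (%x. A x *v H x) < \<infinity>" by (rule L2_A_finite[OF H_measurable S fH])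
 have f\<eta>: "L2 S (grad \<eta>) < \<infinity>" using C1c_L2_finite[OF assms(2)] by (simp add: S_def)
 obtain B where B: "B > 0" "ALL x. \<bar>\<eta> x\<bar> <= B" using C1c_bounded[OF assms(2)] by blast
 define F where "F = (%(j::nat) t. heavy (real (Suc j) * (k - t)))"
 define F' where "F' = (%(j::nat) t. - (real (Suc j) * heavy' (real (Suc j) * (k - t))))"
 have dF: "(F j has_real_derivative F' j t) (at t)" for j t
 proof -
  have "((%t. real (Suc j) * (k - t)) has_real_derivative - real (Suc j)) (at t)"
   by (auto intro!: derivative_eq_intros)
  from DERIV_chain2[OF heavy_deriv this] show ?thesis unfolding F_def F'_def by (simp add: algebra_simps)
 qed
 have cF': "continuous_on UNIV (F' j)" for j
  unfolding F'_def by (intro continuous_intros continuous_on_compose2[OF heavy'_continuous]) auto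
 have bF': "\<bar>F' j t\<bar> <= real (Suc j)" "F' j t <= 0" for j t
  using heavy'_bounds[of "real (Suc j) * (k - t)"] mult_left_le[of "heavy' (real (Suc j) * (k - t))" "real (Suc j)"]
  by (auto simp: F'_def abs_mult)
 have bF: "0 <= F j t" "F j t <= 1" for j t using heavy_bounds by (auto simp: F_def)
 have [measurable]: "F j : Borel" for j
  using dF[of j] by (intro borel_measurable_continuous_onI) (meson DERIV_isCont continuous_at_imp_continuous_on)
 have [measurable]: "F' j : Borel" for j using cF' by (intro borel_measurable_continuous_onI)
 have le1: "L2 S (%x. F j (G x) *. grad \<eta> x) < \<infinity>" for j
 proof -
  have "L2 S (%x. F j (G x) *. grad \<eta> x) <= L2 S (grad \<eta>)"
   using bF by (intro L2_mono) (auto simp: mult_left_le_one_le)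
  then show ?thesis using f\<eta> by simp
 qed
 have ge: "0 <= (LBINT x. ind S x * ((A x *v H x) \<bullet> (F j (G x) *. grad \<eta> x)))" for j
 proof -
  have fin: "L2 S (%x. F j (G x)) < \<infinity>"
   by (rule L2_chain_finite[OF S G_measurable _ _ dF bF'(1)]) (use ann_finite G_L2_ann[OF assms(1)] in \<open>auto simp: S_def\<close>)
  have "super S H" using sol_ann[of a b] assms(1) by (simp add: S_def sol_def)
  moreover have "approx S (Collect C1) G H" unfolding S_def by (rule approx_ann[OF assms(1)])
  ultimately have "0 <= (LBINT x. ind S x * ((A x *v H x) \<bullet> (\<eta> x *. (F' j (G x) *. H x) + F j (G x) *. grad \<eta> x)))"
   by (rule super_test[where F="F j" and M="real (Suc j)"]) (use dF cF' bF' bF fin assms in \<open>auto simp: S_def\<close>)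
  also have "\<dots> <= (LBINT x. ind S x * ((A x *v H x) \<bullet> (F j (G x) *. grad \<eta> x)))"
  proof (rule integral_mono)
   have fb: "L2 S (%x. \<eta> x *. (F' j (G x) *. H x)) < \<infinity>"
   proof -
    have "L2 S (%x. \<eta> x *. (F' j (G x) *. H x)) <= ennreal ((B * real (Suc j))^2) * L2 S H"
    proof (rule L2_bound_mult)
     fix x
     have "\<bar>\<eta> x\<bar> * \<bar>F' j (G x)\<bar> <= B * real (Suc j)" using B bF'(1)[of j "G x"] by (intro mult_mono) auto
     then show "norm (\<eta> x *. (F' j (G x) *. H x)) <= B * real (Suc j) * norm (H x)"
      using mult_right_mono[of "\<bar>\<eta> x\<bar> * \<bar>F' j (G x)\<bar>" "B * real (Suc j)" "norm (H x)"] by (simp add: abs_mult del: of_nat_Suc)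
    qed (use B in auto)
    then show ?thesis using fH by (auto simp: ennreal_mult_less_top intro: le_less_trans)
   qed
   have "L2 S (%x. \<eta> x *. (F' j (G x) *. H x) + F j (G x) *. grad \<eta> x) < \<infinity>"
   proof -
    have "L2 S (%x. \<eta> x *. (F' j (G x) *. H x) + F j (G x) *. grad \<eta> x)
     <= 2 * L2 S (%x. \<eta> x *. (F' j (G x) *. H x)) + 2 * L2 S (%x. F j (G x) *. grad \<eta> x)" by (rule L2_add) measurable
    also have "\<dots> < \<infinity>" using fb le1[of j] by (simp add: ennreal_mult_less_top)
    finally show ?thesis .
   qed
   then show "integrable lborel (%x. ind S x * ((A x *v H x) \<bullet> (\<eta> x *. (F' j (G x) *. H x) + F j (G x) *. grad \<eta> x)))"
    by (intro L2_inner_integrable fAH) measurable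
   show "integrable lborel (%x. ind S x * ((A x *v H x) \<bullet> (F j (G x) *. grad \<eta> x)))"
    by (intro L2_inner_integrable fAH le1) measurable
   fix x
   have "\<eta> x * (F' j (G x) * ((A x *v H x) \<bullet> H x)) <= 0"
    using assms(3) bF'(2)[of j "G x"] A_nonneg[of x "H x"] by (intro mult_nonneg_nonpos mult_nonpos_nonneg) auto
   then show "ind S x * ((A x *v H x) \<bullet> (\<eta> x *. (F' j (G x) *. H x) + F j (G x) *. grad \<eta> x))
     <= ind S x * ((A x *v H x) \<bullet> (F j (G x) *. grad \<eta> x))"
    by (intro mult_left_mono) (auto simp: inner_add_right)
  qed
  finally show ?thesis .
 qed
 define h where "h = (%x. (if G x < k then 1 else 0 :: real) *. grad \<eta> x)"
 have [measurable]: "h : Borel" unfolding h_def by measurable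
 have fh: "L2 S h < \<infinity>"
 proof -
  have "L2 S h <= L2 S (grad \<eta>)" by (rule L2_mono) (auto simp: h_def)
  then show ?thesis using f\<eta> by simp
 qed
 have l: "(%j. L2 S (%x. F j (G x) *. grad \<eta> x - h x)) ---> 0"
 proof (rule L2_dominated[OF _ _ _ _ f\<eta>])
  show "norm (F j (G x) *. grad \<eta> x - h x) <= norm (grad \<eta> x)" for j x
  proof -
   have "\<bar>F j (G x) - (if G x < k then 1 else 0)\<bar> <= 1" using bF[of j "G x"] by auto
   then have "\<bar>F j (G x) - (if G x < k then 1 else 0)\<bar> * norm (grad \<eta> x) <= 1 * norm (grad \<eta> x)" by (intro mult_right_mono) auto
   then show ?thesis unfolding h_def scaleR_left_diff_distrib[symmetric] by simp
  qed
  show "AE x\<in>S in lborel. (%j. F j (G x) *. grad \<eta> x - h x) ---> 0"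
  proof (intro AE_I2 impI)
   fix x
   have "(%j. F j (G x)) ---> (if G x < k then 1 else 0)" using heavy_tendsto[of "k - G x"] by (simp add: F_def)
   then have "(%j. F j (G x) *. grad \<eta> x - h x) ---> (if G x < k then 1 else 0 :: real) *. grad \<eta> x - h x"
    by (intro tendsto_intros)
   then show "(%j. F j (G x) *. grad \<eta> x - h x) ---> 0" by (simp add: h_def)
  qed
 qed auto
 have "(%j. LBINT x. ind S x * ((A x *v H x) \<bullet> (F j (G x) *. grad \<eta> x))) ---> (LBINT x. ind S x * ((A x *v H x) \<bullet> h x))"
  by (rule L2_inner_tendsto) (use fAH fh le1 l in auto)
 then have "0 <= (LBINT x. ind S x * ((A x *v H x) \<bullet> h x))"     by (rule LIMSEQ_le_const) (use ge in blast)
 also have "\<dots> = (LBINT x. ind S x * ((A x *v Hk k x) \<bullet> grad \<eta> x))"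
  by (intro Bochner_Integration.integral_cong) (auto simp: h_def Hk_def)
 finally show ?thesis by (simp add: S_def)
qed

text \<open>Multiplication by \<psi> j keeps test functions away from the pole. The error vanishes
  in the limit because the truncation has finite energy and the energies of the holes tend to
  0.\<close>

lemma Hk_super:
 assumes "R > 0" "k > 0"
 shows "super (ball 0 R) (Hk k)"
 unfolding super_def
proof (intro ballI impI)
 fix \<phi> :: "real^'n => real" assume \<phi>: "\<phi> : C1c (ball 0 R)" "ALL x. 0 <= \<phi> x"
 obtain \<psi> :: "nat => real^'n => real" where \<psi>: "ALL j. C1 (\<psi> j)" "ALL j x. 0 <= \<psi> j x & \<psi> j x <= 1"
  "ALL j. ALL x:cball 0 (1 / Suc j). \<psi> j x = 0 & grad (\<psi> j) x = 0" "ALL x. x ~= 0 --> (%j. \<psi> j x) ---> 1"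
  "(%j. L2 UNIV (grad (\<psi> j))) ---> 0"
  using hole_sequence[where 'n='n, OF n3] by blast
 note C\<psi> = \<psi>(1)[rule_format] and C\<phi> = C1c_C1[OF \<phi>(1)]
 note [measurable] = C1_measurable[OF C\<psi>] grad_measurable[OF C\<psi>] C1_measurable[OF C\<phi>] grad_measurable[OF C\<phi>]
 obtain B where B: "B > 0" "ALL x. \<bar>\<phi> x\<bar> <= B" using C1c_bounded[OF \<phi>(1)] by blast
 define \<eta> where "\<eta> = (%j x. \<psi> j x * \<phi> x)"
 have \<eta>: "\<eta> j : C1c (ann (1 / Suc j / 2) R)" for j
  unfolding \<eta>_def by (rule hole_C1c[OF \<phi>(1) C\<psi>]) (use \<psi>(3) in auto)
 have \<eta>B: "\<eta> j : C1c (ball 0 R)" for j by (rule C1c_mono[OF \<eta>]) (auto simp: ann_def)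
 note [measurable] = grad_measurable[OF C1c_C1[OF \<eta>B]]
 have g\<eta>: "grad (\<eta> j) = (%x. \<psi> j x *. grad \<phi> x + \<phi> x *. grad (\<psi> j) x)" for j
  unfolding \<eta>_def by (rule grad_mult[OF C\<psi> C\<phi>])
 have ge: "0 <= (LBINT x. ind (ball 0 R) x * ((A x *v Hk k x) \<bullet> grad (\<eta> j) x))" for j
 proof -
  have "0 <= (LBINT x. ind (ann (1 / Suc j / 2) R) x * ((A x *v Hk k x) \<bullet> grad (\<eta> j) x))"
   by (rule Hk_super_ann[OF _ \<eta>]) (use \<phi>(2) \<psi>(2) in \<open>auto simp: \<eta>_def\<close>)
  also have "\<dots> = (LBINT x. ind (ball 0 R) x * ((A x *v Hk k x) \<bullet> grad (\<eta> j) x))"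
   using C1c_zero(2)[OF \<eta>[of j]] by (intro Bochner_Integration.integral_cong) (auto simp: indicator_def ann_def)
  finally show ?thesis .
 qed
 have f\<phi>: "L2 (ball 0 R) (grad \<phi>) < \<infinity>" by (rule C1c_L2_finite[OF \<phi>(1)]) simp
 have l: "(%j. L2 (ball 0 R) (%x. grad (\<eta> j) x - grad \<phi> x)) ---> 0"
  unfolding g\<eta> by (rule hole_mult_tendsto[where B=B]) (use \<psi> B f\<phi> in auto)
 have "(%j. LBINT x. ind (ball 0 R) x * ((A x *v Hk k x) \<bullet> grad (\<eta> j) x))
   ---> (LBINT x. ind (ball 0 R) x * ((A x *v Hk k x) \<bullet> grad \<phi> x))"
  by (rule L2_inner_tendsto) (use L2_A_finite[OF Hk_measurable _ Hk_L2_ball[OF assms]] f\<phi> C1c_L2_finite[OF \<eta>B] l in auto)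
 then show "0 <= (LBINT x. ind (ball 0 R) x * ((A x *v Hk k x) \<bullet> grad \<phi> x))"
  by (rule LIMSEQ_le_const) (use ge in blast)
qed

end

section \<open>Energy of the truncations and their Hardy bound\<close>

context fundamental
begin

lemma level_ball:
 assumes "0 < \<delta>"
 shows "EX R>0. EX \<theta>:C1c (ball (0::real^'n) (3 * R)). (AEL x. R <= norm x --> G x < \<delta>) & (ALL x. 0 <= \<theta> x & \<theta> x <= 1) &
  (ALL x:cball 0 R. \<theta> x = 1 & grad \<theta> x = 0)"
proof -
 obtain R where R: "R > 0" "AEL x. R <= norm x --> G x < \<delta>" using decay[OF assms] by blast
 obtain \<theta> where "\<theta> : C1c (ball (0::real^'n) (3 * R))" "ALL x. 0 <= \<theta> x & \<theta> x <= 1" "ALL x:cball 0 R. \<theta> x = 1 & grad \<theta> x = 0"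
  using cutoff_C1c[of R "2 * R" "3 * R"] R(1) by auto
 then show ?thesis using R by blast
qed

text \<open>The supersolution \<open>Gk k\<close> is tested with \<theta> (k - (Gk k - \<delta>)^+),
  smoothed. Where grad \<theta> is not 0 one has G < \<delta> almost everywhere, so the factor of
  grad \<theta> is the constant k and this term is k times the unit flux. The energy above the level
  \<delta> is therefore at most k, and ellipticity turns this into k / lam.\<close>

lemma Hk_energy_level:
 assumes \<delta>: "0 < \<delta>" "\<delta> <= k"
 shows "(NN x. ennreal ((norm (Hk k x))^2) * ind {x. \<delta> < Gk k x} x) <= ennreal (k / lam)"
proof -
 have k: "k > 0" using \<delta> by simp
 obtain R \<theta> where R: "R > 0" and \<theta>: "\<theta> : C1c (ball (0::real^'n) (3 * R))" and dec: "AEL x. R <= norm x --> G x < \<delta>"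
  and \<theta>b: "ALL x. 0 <= \<theta> x & \<theta> x <= 1" and \<theta>1: "ALL x:cball 0 R. \<theta> x = 1 & grad \<theta> x = 0"
  using level_ball[OF \<delta>(1)] by blast
 define S where "S = ball (0::real^'n) (3 * R)"
 have S [measurable]: "S : sets borel" by (simp add: S_def)
 note C\<theta> = C1c_C1[OF \<theta>]
 note [measurable] = C1_measurable[OF C\<theta>] grad_measurable[OF C\<theta>]
 have fH: "L2 S (Hk k) < \<infinity>" unfolding S_def by (rule Hk_L2_ball) (use R k in auto)
 have fAH: "L2 S (%x. A x *v Hk k x) < \<infinity>" by (rule L2_A_finite[OF Hk_measurable S fH])
 have f\<theta>: "L2 S (grad \<theta>) < \<infinity>" using C1c_L2_finite[OF \<theta>] by (simp add: S_def)
 have lev: "(NN x. ennreal ((norm (Hk k x))^2 * smooth_pos' (1 / Suc j) (Gk k x - \<delta>)) * ind (ball 0 R) x) <= ennreal (k / lam)" for j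
 proof -
  define e where "e = 1 / real (Suc j)"
  have e: "e > 0" by (simp add: e_def)
  note [measurable] = smooth_pos_measurable[OF e] smooth_pos'_measurable[OF e]
  define F where "F = (%t. k - smooth_pos e (t - \<delta>))"
  define F' where "F' = (%t. - smooth_pos' e (t - \<delta>))"
  have [measurable]: "F : Borel" "F' : Borel" unfolding F_def F'_def by measurable
  have Fb: "0 <= F t & F t <= k" if "0 <= t" "t <= k" for t
   using smooth_pos_bounds[OF e, of "t - \<delta>"] that \<delta> by (auto simp: F_def)
  have F'b: "\<bar>F' t\<bar> <= 1" "F' t <= 0" for t using smooth_pos'_bounds[OF e, of "t - \<delta>"] by (auto simp: F'_def)
  have dF: "(F has_real_derivative F' t) (at t)" for t
  proof -
   have "((%t. t - \<delta>) has_real_derivative 1) (at t)" by (auto intro!: derivative_eq_intros)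
   from DERIV_chain2[OF smooth_pos_deriv[OF e] this] show ?thesis
    unfolding F_def F'_def by (auto intro!: derivative_eq_intros)
  qed
  have cF': "continuous_on UNIV F'"
   unfolding F'_def by (intro continuous_intros continuous_on_compose2[OF smooth_pos'_continuous[OF e]]) auto
  have FG: "\<bar>F (Gk k x)\<bar> <= k" for x using Fb[of "Gk k x"] Gk_bounds(1)[OF k, of x] Gk_bounds(2)[of k x] by auto
  have "L2 S (%x. F (Gk k x)) <= ennreal (k\<^sup>2) * emeasure lborel S"
   by (rule L2_bounded) (use FG k in auto)
  then have fin: "L2 S (%x. F (Gk k x)) < \<infinity>"
   using emeasure_lborel_ball_finite[of "0::real^'n" "3 * R"] by (auto simp: S_def ennreal_mult_less_top intro: le_less_trans)
  have sup: "super S (Hk k)" unfolding S_def by (rule Hk_super) (use R k in auto)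
  have ap: "approx S (between k) (Gk k) (Hk k)" unfolding S_def by (rule approx_Gk) (use R k in auto)
  have 1: "0 <= (LBINT x. ind S x * ((A x *v Hk k x) \<bullet> (\<theta> x *. (F' (Gk k x) *. Hk k x) + F (Gk k x) *. grad \<theta> x)))"
   by (rule super_test[OF sup ap dF cF' F'b(1) _ fin]) (use Fb \<theta> \<theta>b in \<open>auto simp: S_def\<close>)
  define h1 where "h1 = (%x. \<theta> x *. (F' (Gk k x) *. Hk k x))"
  define h2 where "h2 = (%x. F (Gk k x) *. grad \<theta> x)"
  have [measurable]: "h1 : Borel" "h2 : Borel" unfolding h1_def h2_def by measurable
  have "L2 S h1 <= L2 S (Hk k)"
  proof (rule L2_mono)
   fix x
   have "\<bar>\<theta> x\<bar> * \<bar>F' (Gk k x)\<bar> <= 1 * 1" using \<theta>b F'b by (intro mult_mono) auto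
   then have "(\<bar>\<theta> x\<bar> * \<bar>F' (Gk k x)\<bar>) * norm (Hk k x) <= (1 * 1) * norm (Hk k x)" by (rule mult_right_mono) simp
   then show "norm (h1 x) <= norm (Hk k x)" by (simp add: h1_def abs_mult)
  qed
  then have i1: "integrable lborel (%x. ind S x * ((A x *v Hk k x) \<bullet> h1 x))"
   using fH by (intro L2_inner_integrable fAH) auto
  have "L2 S h2 <= ennreal (k\<^sup>2) * L2 S (grad \<theta>)"
   by (rule L2_bound_mult) (use FG k in \<open>auto simp: h2_def intro!: mult_right_mono\<close>)
  then have i2: "integrable lborel (%x. ind S x * ((A x *v Hk k x) \<bullet> h2 x))"
   using f\<theta> by (intro L2_inner_integrable fAH) (auto simp: ennreal_mult_less_top intro: le_less_trans)
  have "(LBINT x. ind S x * ((A x *v Hk k x) \<bullet> h2 x)) = (LBINT x. k * ((A x *v H x) \<bullet> grad \<theta> x))"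
  proof (rule integral_cong_AE)
   show "AEL x. ind S x * ((A x *v Hk k x) \<bullet> h2 x) = k * ((A x *v H x) \<bullet> grad \<theta> x)"
    using dec
   proof eventually_elim
    fix x assume d: "R <= norm x --> G x < \<delta>"
    show "ind S x * ((A x *v Hk k x) \<bullet> h2 x) = k * ((A x *v H x) \<bullet> grad \<theta> x)"
    proof (cases "x : S & R < norm x")
     case True
     then have "G x < \<delta>" using d by simp
     then have "Hk k x = H x" "F (Gk k x) = k" using \<delta> by (auto simp: Hk_def F_def Gk_def smooth_pos_def)
     then show ?thesis using True by (simp add: h2_def)
    next
     case False
     then have "grad \<theta> x = 0" using \<theta>1 C1c_zero(2)[OF \<theta>, of x] by (auto simp: S_def)
     then show ?thesis by (simp add: h2_def)
    qed
   qed
  qed measurable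
  also have "\<dots> = k" using flux[OF C1c_mono[OF \<theta> subset_UNIV]] \<theta>1 R by simp
  finally have I2: "(LBINT x. ind S x * ((A x *v Hk k x) \<bullet> h2 x)) = k" .
  have sum: "ind S x * ((A x *v Hk k x) \<bullet> (h1 x + h2 x)) =
    ind S x * ((A x *v Hk k x) \<bullet> h1 x) + ind S x * ((A x *v Hk k x) \<bullet> h2 x)" for x
   by (simp add: inner_add_right distrib_left)
  have I1: "0 <= (LBINT x. ind S x * ((A x *v Hk k x) \<bullet> h1 x)) + k"
   using 1[folded h1_def[THEN fun_cong] h2_def[THEN fun_cong]] unfolding sum Bochner_Integration.integral_add[OF i1 i2] I2 .
  define f where "f = (%x. - (ind S x * ((A x *v Hk k x) \<bullet> h1 x)))"
  have f: "f x = ind S x * (\<theta> x * (smooth_pos' e (Gk k x - \<delta>) * ((A x *v Hk k x) \<bullet> Hk k x)))" for x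
   by (simp add: f_def h1_def F'_def)
  have f0: "0 <= f x" for x
   unfolding f using \<theta>b smooth_pos'_bounds(1)[OF e] A_nonneg by (intro mult_nonneg_nonneg) auto
  have "(NN x. ennreal (f x)) = ennreal (LBINT x. f x)"
   by (rule nn_integral_eq_integral) (use i1 f0 in \<open>auto simp: f_def\<close>)
  also have "\<dots> <= ennreal k" using I1 by (intro ennreal_leI) (simp add: f_def)
  finally have fk: "(NN x. ennreal (f x)) <= ennreal k" .
  have [measurable]: "f : Borel" unfolding f_def by measurable
  have "(NN x. ennreal ((norm (Hk k x))^2 * smooth_pos' e (Gk k x - \<delta>)) * ind (ball 0 R) x)
   <= (NN x. ennreal (1 / lam) * ennreal (f x))"
  proof (rule nn_integral_mono)
   fix x
   show "ennreal ((norm (Hk k x))^2 * smooth_pos' e (Gk k x - \<delta>)) * ind (ball 0 R) x <= ennreal (1 / lam) * ennreal (f x)"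
   proof (cases "x : ball 0 R")
    case True
    then have "x : S" "\<theta> x = 1" using \<theta>1 R by (auto simp: S_def)
    then have fx: "f x = smooth_pos' e (Gk k x - \<delta>) * ((A x *v Hk k x) \<bullet> Hk k x)" unfolding f by simp
    have "smooth_pos' e (Gk k x - \<delta>) * (lam * (norm (Hk k x))^2) <= f x"
     unfolding fx using A_lower smooth_pos'_bounds(1)[OF e] by (intro mult_left_mono) auto
    then have "(norm (Hk k x))^2 * smooth_pos' e (Gk k x - \<delta>) <= 1 / lam * f x" using lam_pos by (simp add: field_simps)
    then show ?thesis using True lam_pos f0 by (simp add: ennreal_mult[symmetric] ennreal_leI)
   qed simp
  qed
  also have "\<dots> = ennreal (1 / lam) * (NN x. ennreal (f x))" by (rule nn_integral_cmult) measurable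
  also have "\<dots> <= ennreal (1 / lam) * ennreal k" by (rule mult_left_mono[OF fk]) simp
  also have "\<dots> = ennreal (k / lam)" using lam_pos k by (simp add: ennreal_mult[symmetric])
  finally show ?thesis by (simp add: e_def)
 qed
 have "(NN x. ennreal ((norm (Hk k x))^2) * ind (ball 0 R \<inter> {x. \<delta> < Gk k x}) x) <= ennreal (k / lam)"
  by (rule truncation_limit[OF _ _ _ _ lev]) auto
 moreover have "(NN x. ennreal ((norm (Hk k x))^2) * ind {x. \<delta> < Gk k x} x)
  = (NN x. ennreal ((norm (Hk k x))^2) * ind (ball 0 R \<inter> {x. \<delta> < Gk k x}) x)"
  by (rule nn_integral_cong_AE) (use dec in eventually_elim, auto simp: indicator_def Gk_def)
 ultimately show ?thesis by simp
qed

text \<open>The levels k / (j+1) tend to 0 and G > 0 almost everywhere, so the superlevel sets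
  exhaust the space.\<close>

lemma Hk_energy:
 assumes k: "k > 0"
 shows "L2 UNIV (Hk k) <= ennreal (k / lam)"
proof (rule L2_fatou)
 define f where "f = (%(j::nat) x. (if k / Suc j < Gk k x then 1 else 0 :: real) *. Hk k x)"
 show "f j : Borel" for j unfolding f_def by measurable
 show "L2 UNIV (f j) <= ennreal (k / lam) + 0" for j
 proof -
  have "L2 UNIV (f j) = (NN x. ennreal ((norm (Hk k x))^2) * ind {x. k / Suc j < Gk k x} x)"
   unfolding L2_def f_def by (intro nn_integral_cong) (auto simp: indicator_def)
  also have "\<dots> <= ennreal (k / lam)" using k by (intro Hk_energy_level) (auto simp: divide_le_eq)
  finally show ?thesis by simp
 qed
 show "AE x\<in>UNIV in lborel. (%j. f j x) ---> Hk k x"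
  using G_pos
 proof (eventually_elim, intro impI)
  fix x assume "0 < G x"
  then have g: "0 < Gk k x" using k by (simp add: Gk_def)
  have l0: "(%j. k * inverse (real (Suc j))) ---> k * 0" by (intro tendsto_intros LIMSEQ_inverse_real_of_nat)
  have "\<forall>\<^sub>F j in sequentially. k * inverse (real (Suc j)) < Gk k x" using order_tendstoD(2)[OF l0, of "Gk k x"] g by simp
  then have "\<forall>\<^sub>F j in sequentially. f j x = Hk k x"
   by eventually_elim (simp add: f_def divide_inverse)
  then show "(%j. f j x) ---> Hk k x" by (rule tendsto_eventually)
 qed
qed auto

text \<open>\<open>hardy_ball\<close> asks for compactly supported approximants. The positive part
  of Gk k - k / (j+1) vanishes almost everywhere outside a ball, because G tends to 0 at infinity; a
  cut-off equal to 1 on that ball changes nothing, and Fatou's lemma removes the level.\<close>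

lemma Gk_hardy:
 assumes k: "k > 0" and r: "r > 0"
 shows "L2 (ball 0 r) (Gk k) <= ennreal (16 * r\<^sup>2 * k / lam)"
proof (rule L2_fatou)
 define f where "f = (%(j::nat) x. max (Gk k x - k / Suc j) 0)"
 show "f j : Borel" for j unfolding f_def by measurable
 show "AE x\<in>ball 0 r in lborel. (%j. f j x) ---> Gk k x"
 proof (intro AE_I2 impI)
  fix x
  have "(%j. max (Gk k x - k * inverse (real (Suc j))) 0) ---> max (Gk k x - k * 0) 0"
   by (intro tendsto_intros LIMSEQ_inverse_real_of_nat)
  then show "(%j. f j x) ---> Gk k x" using Gk_bounds(1)[OF k, of x] by (simp add: f_def divide_inverse)
 qed
 show "L2 (ball 0 r) (f j) <= ennreal (16 * r\<^sup>2 * k / lam) + 0" for j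
 proof -
  define \<delta> where "\<delta> = k / Suc j"
  have \<delta>: "0 < \<delta>" using k by (simp add: \<delta>_def)
  obtain R \<theta> where R: "R > 0" and \<theta>: "\<theta> : C1c (ball (0::real^'n) (3 * R))" and dec: "AEL x. R <= norm x --> G x < \<delta>"
   and \<theta>b: "ALL x. 0 <= \<theta> x & \<theta> x <= 1" and \<theta>1: "ALL x:cball 0 R. \<theta> x = 1 & grad \<theta> x = 0"
   using level_ball[OF \<delta>] by blast
  define S where "S = ball (0::real^'n) (3 * R)"
  obtain B where B: "B > 0" "ALL x. \<bar>\<theta> x\<bar> <= B" "ALL x. norm (grad \<theta> x) <= B" using C1c_bounded[OF \<theta>] by blast
  define g where "g = (%x. if Gk k x - \<delta> > 0 then Hk k x else 0)"
  have [measurable]: "g : Borel" unfolding g_def by measurable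
  have "approx S (between k) (Gk k) (Hk k)" unfolding S_def by (rule approx_Gk) (use R k in auto)
  then have "approx S (Collect C1) (Gk k) (Hk k)" by (rule approx_mono) (auto simp: S_def)
  from approx_affine[OF this, of 1 "- \<delta>"] have "approx S (Collect C1) (%x. Gk k x - \<delta>) (Hk k)"
   using emeasure_lborel_ball_finite[of "0::real^'n" "3 * R"] by (simp add: S_def)
  then have "approx S (Collect C1) (%x. max (Gk k x - \<delta>) 0) (%x. if Gk k x - \<delta> > 0 then Hk k x else 0)"
   by (rule approx_pos) (auto intro: C1_smooth_pos)
  then have ap: "approx S (Collect C1) (f j) g" unfolding f_def g_def by (simp add: \<delta>_def)
  have "approx UNIV (C1c UNIV) (%x. \<theta> x * f j x) (%x. \<theta> x *. g x + f j x *. grad \<theta> x)"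
   by (rule approx_mult_C1[OF ap C1c_C1[OF \<theta>], where B=B])
    (use B C1c_zero[OF \<theta>] C1c_mult[OF C1c_mono[OF \<theta> subset_UNIV]] C1c_C1 in \<open>auto simp: S_def\<close>)
  then have ap: "approx UNIV (C1c UNIV) (f j) g"
  proof (rule approx_cong)
   have eq: "f j x = 0 & g x = 0" if "R <= norm x --> G x < \<delta>" "x ~: ball 0 R" for x
    using that by (auto simp: f_def g_def Gk_def \<delta>_def)
   show "AE x\<in>UNIV in lborel. f j x = \<theta> x * f j x"
    using dec
   proof (eventually_elim, intro impI)
    fix x assume d: "R <= norm x --> G x < \<delta>"
    show "f j x = \<theta> x * f j x" using eq[OF d] \<theta>1 by (cases "x : ball 0 R") auto
   qed
   show "AE x\<in>UNIV in lborel. g x = \<theta> x *. g x + f j x *. grad \<theta> x"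
    using dec
   proof (eventually_elim, intro impI)
    fix x assume d: "R <= norm x --> G x < \<delta>"
    show "g x = \<theta> x *. g x + f j x *. grad \<theta> x" using eq[OF d] \<theta>1 by (cases "x : ball 0 R") auto
   qed
   show "f j : Borel" unfolding f_def by measurable
   show "g : Borel" by measurable
  qed
  have "L2 (ball 0 r) (f j) <= ennreal (16 * r\<^sup>2) * L2 UNIV g" by (rule hardy_ball[OF ap n3 r])
  also have "\<dots> <= ennreal (16 * r\<^sup>2) * ennreal (k / lam)"
  proof (rule mult_left_mono)
   have "L2 UNIV g <= L2 UNIV (Hk k)" by (rule L2_mono) (auto simp: g_def)
   then show "L2 UNIV g <= ennreal (k / lam)" using Hk_energy[OF k] by (rule order_trans)
  qed simp
  also have "\<dots> = ennreal (16 * r\<^sup>2 * k / lam)" using k lam_pos by (simp add: ennreal_mult[symmetric])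
  finally show ?thesis by simp
 qed
qed auto

end

text \<open>On balls around z with |z| = 4r, a bound G <= M makes G equal to its truncation at M,
  and \<open>Gk_hardy\<close> bounds the integral of G^2 by a multiple of r^2 M: linear in M,
  whereas the supremum enters local boundedness squared. Young's inequality turns this gain into an
  iteration that forgets the initial bound and ends at a multiple of r^(2-n). The estimate is
  written with powers of the norm on both sides to avoid a negative exponent.\<close>

lemma upper_bound:
 assumes lam: "0 < lam" "lam <= L"
 shows "EX C>0. ALL (A::real^'n => real^'n^'n) G H. fundamental A lam L G H -->
  (AEL x. G x * norm x ^ CARD('n) <= C * (norm x)^2)"
proof -
 define n where "n = CARD('n)"
 define \<Lambda> where "\<Lambda> = 4 * L / lam"
 have "\<Lambda> \<ge> 0" using lam by (simp add: \<Lambda>_def)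
 from local_max[OF this, where 'n='n] obtain c0 where c0: "c0 > 0" and
  lm: "ALL (z::real^'n) R \<rho> K v g. DG \<Lambda> (ball z R) v g --> approx (ball z R) (Collect C1) v g -->
  0 <= \<rho> --> \<rho> < R --> 0 < K --> L2 (ball z R) (%x. max (v x) 0) <= ennreal (c0 * (R - \<rho>) ^ CARD('n) * K\<^sup>2) -->
  (AE x\<in>ball z \<rho> in lborel. v x <= K)" by blast
 define q :: real where "q = 2 ^ n"
 have q: "q > 0" by (simp add: q_def)
 define D where "D = 576 / (lam * c0)"
 have D: "D > 0" using lam c0 by (simp add: D_def)
 define C where "C = 3 * (D * q\<^sup>2 / 2) * 5 ^ n"
 have C: "C > 0" using D q by (simp add: C_def)
 have loc: "AE x\<in>ball z (norm z / 4) in lborel. G x * norm x ^ n <= C * (norm x)^2"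
  if f: "fundamental A lam L G H" and z: "z ~= 0" for A :: "real^'n => real^'n^'n" and G H z
 proof -
  interpret fundamental A lam L G H by (rule f)
  define r where "r = norm z / 4"
  have r: "r > 0" using z by (simp add: r_def)
  have nz: "norm z = 4 * r" by (simp add: r_def)
  have nx: "norm x <= 4 * r + t & 4 * r - t <= norm x" if "x : ball z t" for x t
   using that norm_triangle_ineq2[of x z] norm_triangle_ineq2[of z x] nz by (auto simp: dist_norm norm_minus_commute)
  have sub: "ball z t <= ann (r / 2) (8 * r)" if "t <= 3 * r" for t
  proof
   fix x assume x: "x : ball z t"
   then have "norm (z - x) < 3 * r" using that by (simp add: dist_norm)
   then have "norm x < 7 * r" "r < norm x"
    using norm_triangle_ineq2[of x z] norm_triangle_ineq2[of z x] nz by (auto simp: norm_minus_commute)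
   then show "x : ann (r / 2) (8 * r)" using r by (simp add: ann_def)
  qed
  have ap: "approx (ball z t) (Collect C1) G H" if "t <= 3 * r" for t
   by (rule approx_mono[OF approx_ann[of "r / 2" "8 * r"] sub[OF that]]) (use r in auto)
  have dg: "DG \<Lambda> (ball z t) G H" if "t <= 3 * r" for t
  proof -
   have "super (ball z t) (%x. - H x)"
    using sol_mono[OF sol_ann sub[OF that]] r by (simp add: sol_def)
   then show ?thesis using sub_DG[OF _ ap[OF that]] by (simp add: \<Lambda>_def)
  qed
  have mG: "(%x. max (G x) 0) = G" using G_nonneg by simp
  \<comment> \<open>Some finite bound to start from, given by local square integrability; the
    iteration will forget its size.\<close>
  obtain b where b: "b > 0" "AE x\<in>ball z (2 * r) in lborel. G x <= b"
  proof -
   obtain X where X: "X \<ge> 0" "L2 (ball z (3 * r)) G = ennreal X"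
    using approxD(5)[OF ap[of "3 * r"]] by (cases "L2 (ball z (3 * r)) G") auto
   define Q where "Q = c0 * r ^ CARD('n)"
   have Q: "Q > 0" using c0 r by (simp add: Q_def)
   define K where "K = X / Q + 1"
   have K: "K \<ge> 1" using X Q by (simp add: K_def)
   have "X = Q * (X / Q)" using Q by simp
   also have "\<dots> <= Q * K\<^sup>2"
   proof (rule mult_left_mono)
    have "X / Q <= K" by (simp add: K_def)
    also have "K <= K\<^sup>2" using K by (intro self_le_power) auto
    finally show "X / Q <= K\<^sup>2" .
   qed (use Q in simp)
   finally have "L2 (ball z (3 * r)) (%x. max (G x) 0) <= ennreal (c0 * (3 * r - 2 * r) ^ CARD('n) * K\<^sup>2)"
    unfolding mG X(2) by (intro ennreal_leI) (simp add: Q_def)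
   then have "AE x\<in>ball z (2 * r) in lborel. G x <= K"
    using lm[rule_format, OF dg[of "3 * r"] ap[of "3 * r"], of "2 * r" K] r K by simp
   then show ?thesis using that[of K] K by simp
  qed
  \<comment> \<open>Solved from c0 (r / 2^(m+1))^n times 4 (M / (2q)) (a q^m) = 576 r^2 M / lam, in
    which m and M cancel; 576 is 16 times 6^2.\<close>
  define a where "a = D * r\<^sup>2 / r ^ n * q\<^sup>2 / 2"
  have a: "a > 0" using D r q by (simp add: a_def)
  have step: "AE x\<in>ball z t in lborel. G x <= K"
   if t: "0 <= t" "t < t'" "t' <= 2 * r" and M: "M > 0" "AE x\<in>ball z t' in lborel. G x <= M" and K: "K > 0"
    "576 * r\<^sup>2 * M / lam <= c0 * (t' - t) ^ n * K\<^sup>2" for t t' M K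
  proof -
   have "L2 (ball z t') (%x. max (G x) 0) = L2 (ball z t') (Gk M)"
    unfolding mG by (rule L2_cong_AE) (use M(2) in eventually_elim, auto simp: Gk_def)
   also have "\<dots> <= L2 (ball 0 (6 * r)) (Gk M)"
   proof (rule L2_mono_set)
    show "ball z t' <= ball 0 (6 * r)"
    proof
     fix x assume "x : ball z t'"
     then have "norm (z - x) < 2 * r" using t by (simp add: dist_norm)
     then show "x : ball 0 (6 * r)" using norm_triangle_ineq2[of x z] nz by (simp add: norm_minus_commute)
    qed
   qed
   also have "\<dots> <= ennreal (16 * (6 * r)^2 * M / lam)" using M r by (intro Gk_hardy) auto
   also have "\<dots> <= ennreal (c0 * (t' - t) ^ CARD('n) * K\<^sup>2)"
    using K(2) by (intro ennreal_leI) (simp add: power_mult_distrib n_def)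
   finally show ?thesis
    using lm[rule_format, OF dg[of t'] ap[of t'], of t K] t K r by simp
  qed
  \<comment> \<open>The gap between consecutive radii halves, so its n-th power shrinks by q = 2^n,
    which the summand a q^m of the new bound compensates. The factor 1 / (2q) on M outweighs this
    growth: the contributions add up to a geometric series of ratio 1/2 with sum at most 2a.\<close>
  have iter: "AE x\<in>ball z r in lborel. G x <= (1 / (2 * q)) ^ m * M + 2 * a * (1 - (1 / 2) ^ m)"
   if "M > 0" "AE x\<in>ball z (2 * r - r * (1 / 2) ^ m) in lborel. G x <= M" for m M
   using that
  proof (induction m arbitrary: M)
   case 0
   then show ?case by simp
  next
   case (Suc m)
   define K where "K = 1 / (2 * q) * M + a * q ^ m"
   have K: "K > 0" using Suc.prems(1) q a by (simp add: K_def add_pos_pos)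
   have le1: "(1 / 2 :: real) ^ m <= 1" by (rule power_le_one) auto
   have "AE x\<in>ball z (2 * r - r * (1 / 2) ^ m) in lborel. G x <= K"
   proof (rule step[OF _ _ _ Suc.prems K])
    show "0 <= 2 * r - r * (1 / 2) ^ m" using mult_left_mono[OF le1, of r] r by simp
    show "2 * r - r * (1 / 2) ^ m < 2 * r - r * (1 / 2) ^ Suc m" using r by simp
    show "2 * r - r * (1 / 2) ^ Suc m <= 2 * r" using r by simp
    have "4 * (1 / (2 * q) * M) * (a * q ^ m) <= K\<^sup>2"
     using zero_le_power2[of "1 / (2 * q) * M - a * q ^ m"] unfolding K_def power2_eq_square by (simp add: algebra_simps)
    then have "c0 * (r * (1 / 2) ^ Suc m) ^ n * (4 * (1 / (2 * q) * M) * (a * q ^ m)) <= c0 * (r * (1 / 2) ^ Suc m) ^ n * K\<^sup>2"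
     using c0 r by (intro mult_left_mono) auto
    moreover have "c0 * (r * (1 / 2) ^ Suc m) ^ n * (4 * (1 / (2 * q) * M) * (a * q ^ m)) = 576 * r\<^sup>2 * M / lam"
    proof -
     have "((1 / 2 :: real) ^ Suc m) ^ n = ((1 / 2) ^ n) ^ Suc m" by (simp only: power_mult[symmetric] mult.commute)
     also have "\<dots> = 1 / (q * q ^ m)" by (simp add: q_def power_divide)
     finally have "((1 / 2 :: real) ^ Suc m) ^ n = 1 / (q * q ^ m)" .
     then show ?thesis using q r c0 lam by (simp add: power_mult_distrib a_def D_def power2_eq_square field_simps del: power_Suc)
    qed
    moreover have "2 * r - r * (1 / 2) ^ Suc m - (2 * r - r * (1 / 2) ^ m) = r * (1 / 2) ^ Suc m" by simp
    ultimately show "576 * r\<^sup>2 * M / lam <= c0 * (2 * r - r * (1 / 2) ^ Suc m - (2 * r - r * (1 / 2) ^ m)) ^ n * K\<^sup>2" by simp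
   qed
   from Suc.IH[OF K this] show ?case
   proof (eventually_elim, intro impI)
    fix x assume h: "x : ball z r --> G x <= (1 / (2 * q)) ^ m * K + 2 * a * (1 - (1 / 2) ^ m)" and x: "x : ball z r"
    have "(1 / (2 * q)) ^ m * q ^ m = (1 / 2) ^ m" using q by (simp add: power_mult_distrib[symmetric])
    then have "(1 / (2 * q)) ^ m * K = (1 / (2 * q)) ^ Suc m * M + a * (1 / 2) ^ m"
     unfolding K_def by (simp add: algebra_simps)
    then show "G x <= (1 / (2 * q)) ^ Suc m * M + 2 * a * (1 - (1 / 2) ^ Suc m)"
     using h x by (simp add: algebra_simps)
   qed
  qed
  have q1: "1 / (2 * q) < 1"
  proof -
   have "1 <= q" unfolding q_def by (rule one_le_power) simp
   then show ?thesis by simp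
  qed
  obtain m where m: "(1 / (2 * q)) ^ m < a / b"
   using real_arch_pow_inv[of "a / b" "1 / (2 * q)"] q1 a b(1) by auto
  have "AE x\<in>ball z (2 * r - r * (1 / 2) ^ m) in lborel. G x <= b"
   using b(2) by eventually_elim (use r in \<open>auto intro: less_trans\<close>)
  from iter[OF b(1) this] show ?thesis
  proof (eventually_elim, intro impI)
   fix x assume h: "x : ball z r --> G x <= (1 / (2 * q)) ^ m * b + 2 * a * (1 - (1 / 2) ^ m)" and x: "x : ball z (norm z / 4)"
   have "(1 / (2 * q)) ^ m * b <= a" using m b(1) by (simp add: field_simps)
   moreover have "2 * a * (1 - (1 / 2) ^ m) <= 2 * a" using a by simp
   ultimately have G3: "G x <= 3 * a" using h x by (simp add: r_def)
   have nb: "norm x <= 5 * r" "3 * r <= norm x" using nx[of x r] x by (auto simp: r_def)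
   have "G x * norm x ^ n <= 3 * a * (5 * r) ^ n"
    using G3 nb a G_nonneg[of x] by (intro mult_mono power_mono) auto
   also have "\<dots> = C * r\<^sup>2" using r by (simp add: a_def C_def power_mult_distrib field_simps)
   also have "\<dots> <= C * (norm x)^2" using nb r C by (intro mult_left_mono power_mono) auto
   finally show "G x * norm x ^ n <= C * (norm x)^2" .
  qed
 qed
 have "AEL x. G x * norm x ^ n <= C * (norm x)^2" if f: "fundamental A lam L G H" for A :: "real^'n => real^'n^'n" and G H
 proof -
  \<comment> \<open>Countably many of the balls cover the complement of the pole, so the exceptional
    null sets can be united.\<close>
  obtain F' where F': "F' <= (%z::real^'n. ball z (norm z / 4)) ` (- {0})" "countable F'"
   "\<Union>F' = \<Union>((%z::real^'n. ball z (norm z / 4)) ` (- {0}))"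
   using Lindelof[of "(%z::real^'n. ball z (norm z / 4)) ` (- {0})"] by auto
  have "ALL B:F'. AE x\<in>B in lborel. G x * norm x ^ n <= C * (norm x)^2"
   using F'(1) loc[OF f] by blast
  then have "AEL x. ALL B:F'. x : B --> G x * norm x ^ n <= C * (norm x)^2"
   using AE_ball_countable[OF F'(2), of "%x B. x : B --> G x * norm x ^ n <= C * (norm x)^2" lborel] by blast
  with AE_lborel_singleton[of "0::real^'n"] show ?thesis
  proof eventually_elim
   fix x :: "real^'n" assume x: "x ~= 0" and h: "ALL B:F'. x : B --> G x * norm x ^ n <= C * (norm x)^2"
   have "x : \<Union>((%z::real^'n. ball z (norm z / 4)) ` (- {0}))" using x by (intro UnionI[of "ball x (norm x / 4)"]) auto
   then show "G x * norm x ^ n <= C * (norm x)^2" using h F'(3) by blast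
  qed
 qed
 then show ?thesis using C unfolding n_def by blast
qed

text \<open>The unit flux passes through the annulus r < |x| < 2r. Where G < k, with k a small
  multiple of r^(2-n), only a fraction of it passes, since the truncation at k has energy at most k
  / lam; the rest passes through the set E where G >= k. There the energy is at most N / lam, with N
  an upper bound of G on |x| >= r, so E has a fixed proportion of the ball. The growth lemma spreads
  the bound G >= c k over the ball of radius r.\<close>

lemma lower_bound:
 assumes lam: "0 < lam" "lam <= L"
 shows "EX c>0. ALL (A::real^'n => real^'n^'n) G H r. fundamental A lam L G H --> r > 0 -->
  (AE x\<in>ball 0 r in lborel. c * r\<^sup>2 <= G x * r ^ CARD('n))"
proof -
 define n where "n = CARD('n)"
 define V where "V = unit_ball_vol (real CARD('n))"
 have V: "V > 0" by (simp add: V_def)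
 have L: "L > 0" using lam by simp
 obtain C where C: "C > 0" and ub: "ALL (A::real^'n => real^'n^'n) G H. fundamental A lam L G H -->
  (AEL x. G x * norm x ^ CARD('n) <= C * (norm x)^2)" using upper_bound[OF lam, where 'n='n] by blast
 \<comment> \<open>\<sigma>, \<epsilon> and \<tau> are solved from the requirement that three terms
   below equal 1/8, 1/8 and 1/4, which leaves half of the flux to the set E; \<theta> is the
   proportion of the ball that this half forces E to have.\<close>
 define \<sigma> where "\<sigma> = 12 * L * V * 2 ^ n"
 define \<epsilon> where "\<epsilon> = lam / (12 * L * \<sigma>)"
 define \<tau> where "\<tau> = lam / (12 * L * C)"
 define \<theta> where "\<theta> = \<tau> / (3 * L * V * 2 ^ n)"
 have pos: "\<sigma> > 0" "\<epsilon> > 0" "\<tau> > 0" "\<theta> > 0" using L V C lam by (auto simp: \<sigma>_def \<epsilon>_def \<tau>_def \<theta>_def)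
 obtain c where c: "0 < c" "c <= 1" and gr: "ALL (A::real^'n => real^'n^'n) z R u g k. elliptic A lam L --> R > 0 --> k > 0 -->
  elliptic.super A (ball z (2 * R)) g --> approx (ball z (2 * R)) (Collect C1) u g -->
  (AE x\<in>ball z (2 * R) in lborel. 0 <= u x) -->
  ennreal \<theta> * emeasure lborel (ball z R) <= emeasure lborel {x : ball z R. k <= u x} -->
  (AE x\<in>ball z (R / 2) in lborel. c * k <= u x)" using growth[OF lam pos(4), where 'n='n] by blast
 have "AE x\<in>ball 0 r in lborel. (c * \<epsilon>) * r\<^sup>2 <= G x * r ^ n"
  if f: "fundamental A lam L G H" and r: "r > 0" for A :: "real^'n => real^'n^'n" and G H r
 proof -
  interpret fundamental A lam L G H by (rule f)
  have rn: "r ^ n > 0" using r by simp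
  define k where "k = \<epsilon> * r\<^sup>2 / r ^ n"
  define N where "N = 2 * C * r\<^sup>2 / r ^ n"
  define s where "s = \<sigma> * r ^ n / r"
  define s' where "s' = \<tau> * r ^ n / r"
  have p: "k > 0" "N > 0" "s > 0" "s' > 0" using r C pos by (auto simp: k_def N_def s_def s'_def)
  have up: "AEL x. r <= norm x --> G x < N"
   using ub[rule_format, OF f]
  proof (eventually_elim, intro impI)
   fix x :: "real^'n" assume h: "G x * norm x ^ CARD('n) <= C * (norm x)^2" and x: "r <= norm x"
   obtain m where m: "n = m + 2" using n3 by (metis add.commute le_Suc_ex n_def numeral_3_eq_3 numeral_2_eq_2 Suc_leD)
   have nx: "norm x > 0" using r x by linarith
   have "G x * norm x ^ m * (norm x)^2 <= C * (norm x)^2" using h unfolding n_def[symmetric] m power_add by (simp add: mult.assoc)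
   then have "G x * norm x ^ m <= C" using nx by simp
   moreover have "G x * r ^ m <= G x * norm x ^ m" using x r G_nonneg[of x] by (intro mult_left_mono power_mono) auto
   ultimately have "G x * r ^ m < 2 * C" using C by linarith
   moreover have "N * r ^ m = 2 * C" using r unfolding N_def m power_add by simp
   ultimately have "G x * r ^ m < N * r ^ m" by simp
   then show "G x < N" using r by simp
  qed
  obtain \<eta> where \<eta>: "\<eta> : C1c (ball (0::real^'n) (3 * r))" "ALL x. 0 <= \<eta> x & \<eta> x <= 1" "ALL x:cball 0 r. \<eta> x = 1 & grad \<eta> x = 0"
   "ALL x. x ~: ball 0 (2 * r) --> \<eta> x = 0 & grad \<eta> x = 0" "ALL x. norm (grad \<eta> x) <= 3 / (2 * r - r)"
   using cutoff_C1c[of r "2 * r" "3 * r"] r by auto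
  note [measurable] = grad_measurable[OF C1c_C1[OF \<eta>(1)]]
  define T where "T = ball (0::real^'n) (2 * r)"
  define E where "E = {x : ball 0 (2 * r). k <= Gk k x}"
  have [measurable]: "T : sets borel" by (simp add: T_def)
  have E [measurable]: "E : sets borel" unfolding E_def by measurable
  have I1: "(LBINT x. (A x *v H x) \<bullet> grad \<eta> x) = 1"
   using flux[OF C1c_mono[OF \<eta>(1) subset_UNIV]] \<eta>(3) r by simp
  then have int: "integrable lborel (%x. (A x *v H x) \<bullet> grad \<eta> x)" using not_integrable_integral_eq by force
  define m where "m = 3 * L / (2 * r)"
  have m: "m > 0" using L r by (simp add: m_def)
  \<comment> \<open>The four terms come from 2 a <= t a^2 + 1 / t, with t = s on {G < k} and t = s'
    on E.\<close>
  define W where "W = (%x. ennreal (m * s) * (ennreal ((norm (Hk k x))^2) * ind UNIV x) + ennreal (m / s) * ind T x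
    + ennreal (m * s') * (ennreal ((norm (Hk N x))^2) * ind UNIV x) + ennreal (m / s') * ind E x)"
  have "ennreal 1 <= (NN x. ennreal (norm ((A x *v H x) \<bullet> grad \<eta> x)))"
   using integral_norm_bound_ennreal[OF int] I1 by simp
  also have "\<dots> <= (NN x. W x)"
  proof (rule nn_integral_mono_AE)
   show "AEL x. ennreal (norm ((A x *v H x) \<bullet> grad \<eta> x)) <= W x"
    using up
   proof eventually_elim
    fix x assume up: "r <= norm x --> G x < N"
    show "ennreal (norm ((A x *v H x) \<bullet> grad \<eta> x)) <= W x"
    proof (cases "x : T & r < norm x")
     case False
     then have "grad \<eta> x = 0" using \<eta>(3,4) by (auto simp: T_def)
     then show ?thesis by simp
    next
     case True
     have "norm ((A x *v H x) \<bullet> grad \<eta> x) <= norm (A x *v H x) * norm (grad \<eta> x)"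
      using Cauchy_Schwarz_ineq2[of "A x *v H x" "grad \<eta> x"] by simp
     also have "\<dots> <= (L * norm (H x)) * (3 / r)" using A_norm[of x "H x"] \<eta>(5) L by (intro mult_mono) auto
     also have "\<dots> = m * (2 * norm (H x))" using r by (simp add: m_def)
     finally have b: "norm ((A x *v H x) \<bullet> grad \<eta> x) <= m * (2 * norm (H x))" .
     have young: "2 * a <= t * a\<^sup>2 + 1 / t" if "t > 0" for a t :: real
     proof -
      have "0 <= (t * a - 1)^2 / t" using that by simp
      also have "\<dots> = t * a\<^sup>2 + 1 / t - 2 * a" using that by (simp add: power2_diff field_simps power2_eq_square)
      finally show ?thesis by simp
     qed
     have GN: "G x < N" using up True by simp
     show ?thesis
     proof (cases "G x < k")
      case g: True
      have "norm ((A x *v H x) \<bullet> grad \<eta> x) <= m * (s * (norm (Hk k x))^2 + 1 / s)"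
       using b mult_left_mono[OF young[OF p(3), of "norm (H x)"], of m] m g unfolding Hk_def by (simp add: algebra_simps)
      also have "\<dots> = m * s * (norm (Hk k x))^2 + m / s" by (simp add: distrib_left)
      finally have "ennreal (norm ((A x *v H x) \<bullet> grad \<eta> x)) <= ennreal (m * s * (norm (Hk k x))^2 + m / s)" by (rule ennreal_leI)
      also have "\<dots> = ennreal (m * s) * (ennreal ((norm (Hk k x))^2) * ind UNIV x) + ennreal (m / s) * ind T x"
       using True m p by (simp add: ennreal_plus ennreal_mult)
      also have "\<dots> <= W x" unfolding W_def by (simp add: add.assoc)
      finally show ?thesis .
     next
      case g: False
      then have xE: "x : E" using True by (simp add: E_def T_def Gk_def)
      have "norm ((A x *v H x) \<bullet> grad \<eta> x) <= m * (s' * (norm (Hk N x))^2 + 1 / s')"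
       using b mult_left_mono[OF young[OF p(4), of "norm (H x)"], of m] m GN unfolding Hk_def by (simp add: algebra_simps)
      also have "\<dots> = m * s' * (norm (Hk N x))^2 + m / s'" by (simp add: distrib_left)
      finally have "ennreal (norm ((A x *v H x) \<bullet> grad \<eta> x)) <= ennreal (m * s' * (norm (Hk N x))^2 + m / s')" by (rule ennreal_leI)
      also have "\<dots> = ennreal (m * s') * (ennreal ((norm (Hk N x))^2) * ind UNIV x) + ennreal (m / s') * ind E x"
       using xE m p by (simp add: ennreal_plus ennreal_mult)
      also have "\<dots> <= W x" unfolding W_def by (simp add: add.assoc add_increasing)
      finally show ?thesis .
     qed
    qed
   qed
  qed
  also have "\<dots> = ennreal (m * s) * L2 UNIV (Hk k) + ennreal (m / s) * emeasure lborel T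
    + ennreal (m * s') * L2 UNIV (Hk N) + ennreal (m / s') * emeasure lborel E"
   unfolding W_def L2_def by (simp add: nn_integral_add nn_integral_cmult)
  also have "\<dots> <= ennreal (m * s) * ennreal (k / lam) + ennreal (m / s) * ennreal (V * (2 * r) ^ n)
    + ennreal (m * s') * ennreal (N / lam) + ennreal (m / s') * emeasure lborel E"
   using Hk_energy[OF p(1)] Hk_energy[OF p(2)] emeasure_ball_eq[of "2 * r" "0::real^'n"] r
   by (intro add_mono mult_left_mono) (auto simp: T_def V_def n_def)
  also have "\<dots> = ennreal (m * s * (k / lam) + m / s * (V * (2 * r) ^ n) + m * s' * (N / lam)) + ennreal (m / s') * emeasure lborel E"
   using m p V r lam by (simp add: ennreal_mult[symmetric] ennreal_plus[symmetric] del: ennreal_plus)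
  also have "m * s * (k / lam) + m / s * (V * (2 * r) ^ n) + m * s' * (N / lam) = 1 / 2"
  proof -
   have "m * s * (k / lam) = 1 / 8" using r lam L pos by (simp add: m_def s_def k_def \<epsilon>_def field_simps power2_eq_square)
   moreover have "m / s * (V * (2 * r) ^ n) = 1 / 8" using r L V by (simp add: m_def s_def \<sigma>_def field_simps power_mult_distrib)
   moreover have "m * s' * (N / lam) = 1 / 4" using r lam L C by (simp add: m_def s'_def N_def \<tau>_def field_simps power2_eq_square)
   ultimately show ?thesis by linarith
  qed
  finally have le: "ennreal 1 <= ennreal (1 / 2) + ennreal (m / s') * emeasure lborel E" .
  have "emeasure lborel E <= emeasure lborel T" by (rule emeasure_mono) (auto simp: E_def T_def)
  then have "emeasure lborel E < \<infinity>" using emeasure_lborel_ball_finite[of "0::real^'n" "2 * r"] by (auto simp: T_def intro: le_less_trans)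
  then obtain e where e: "e \<ge> 0" "emeasure lborel E = ennreal e" by (cases "emeasure lborel E") auto
  have "ennreal 1 <= ennreal (1 / 2 + m / s' * e)"
  proof -
   have "ennreal (1 / 2 + m / s' * e) = ennreal (1 / 2) + ennreal (m / s' * e)" using e m p by (intro ennreal_plus) auto
   also have "ennreal (m / s' * e) = ennreal (m / s') * emeasure lborel E" unfolding e(2) by (rule ennreal_mult''[OF e(1)])
   finally show ?thesis using le by simp
  qed
  then have "1 <= 1 / 2 + m / s' * e" using e m p by (subst (asm) ennreal_le_iff) auto
  then have "1 / 2 <= m / s' * e" by linarith
  then have "s' / (2 * m) <= e" using m p by (simp add: field_simps)
  moreover have "s' / (2 * m) = \<theta> * (V * (2 * r) ^ n)"
   using r L V by (simp add: s'_def m_def \<theta>_def power_mult_distrib field_simps)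
  ultimately have "ennreal \<theta> * emeasure lborel (ball (0::real^'n) (2 * r)) <= emeasure lborel E"
   using e pos V r emeasure_ball_eq[of "2 * r" "0::real^'n"] by (simp add: ennreal_mult[symmetric] V_def n_def ennreal_leI)
  then have big: "ennreal \<theta> * emeasure lborel (ball (0::real^'n) (2 * r)) <= emeasure lborel {x : ball 0 (2 * r). k <= Gk k x}"
   by (simp add: E_def)
  have sup: "super (ball 0 (2 * (2 * r))) (Hk k)" by (rule Hk_super) (use r p in auto)
  have ap: "approx (ball 0 (2 * (2 * r))) (Collect C1) (Gk k) (Hk k)"
   by (rule approx_mono[OF approx_Gk[of "2 * (2 * r)" k]]) (use r p in auto)
  have "AE x\<in>ball 0 (2 * r / 2) in lborel. c * k <= Gk k x"
   using gr[rule_format, OF elliptic_axioms _ p(1) sup ap _ big] r Gk_bounds(1)[OF p(1)] by simp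
  then show ?thesis
  proof (eventually_elim, intro impI)
   fix x :: "real^'n" assume h: "x : ball 0 (2 * r / 2) --> c * k <= Gk k x" and x: "x : ball 0 r"
   then have "c * k <= G x" by (simp add: Gk_def)
   then have "c * k * r ^ n <= G x * r ^ n" using rn by (intro mult_right_mono) auto
   then show "(c * \<epsilon>) * r\<^sup>2 <= G x * r ^ n" using r by (simp add: k_def)
  qed
 qed
 moreover have "c * \<epsilon> > 0" using c pos by simp
 ultimately show ?thesis unfolding n_def by blast
qed

subsection \<open>Decay of the weighted energy\<close>

text \<open>It makes \<Phi>(t) = m^2 (1 - cos (t / m)) uniformly convex on [-m, m], since the second
  derivative is cos (t / m).\<close>

lemma cos_ge_half: "\<bar>t\<bar> <= 1 ==> 1 / 2 <= cos (t::real)"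
proof -
 assume t: "\<bar>t\<bar> <= 1"
 have "(sin (t / 2))^2 <= (t / 2)^2" using abs_sin_x_le_abs_x[of "t / 2"] by (simp only: abs_le_square_iff)
 moreover have "t\<^sup>2 <= 1" using t by (simp add: abs_square_le_1)
 moreover have "cos t = 1 - 2 * (sin (t / 2))^2" using cos_double_sin[of "t / 2"] by simp
 ultimately show ?thesis by (simp add: power_divide)
qed

context fundamental
begin

text \<open>With the weak inequality, \<open>Hk N - Hc k\<close> is exactly the gradient of the
  positive part of \<open>Gk N - k\<close> for k < N: it equals H on {k < G < N} and 0
  elsewhere.\<close>

definition Hc :: "real => real^'n => real^'n" where "Hc k x = (if G x <= k then H x else 0)"

lemma Hc_measurable [measurable]: "Hc k : Borel"
 unfolding Hc_def[abs_def] by measurable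

text \<open>That \<open>H = 0\<close> almost everywhere on a level set of \<open>G\<close> is avoided by letting the level decrease to \<open>k\<close>.\<close>

lemma Hc_super:
 assumes "R > 0" "k > 0"
 shows "super (ball 0 R) (Hc k)" and "L2 (ball 0 R) (Hc k) < \<infinity>"
proof -
 have le: "norm (Hc k x) <= norm (Hk (k + 1) x)" for x by (auto simp: Hc_def Hk_def)
 have fk: "L2 (ball 0 R) (Hk (k + 1)) < \<infinity>" by (rule Hk_L2_ball) (use assms in auto)
 have "L2 (ball 0 R) (Hc k) <= L2 (ball 0 R) (Hk (k + 1))" by (rule L2_mono[OF le])
 then show fc: "L2 (ball 0 R) (Hc k) < \<infinity>" using fk by simp
 define q where "q j = k + inverse (real (Suc j))" for j
 have q: "q j > 0" "k < q j" "q j <= k + 1" for j using assms(2) by (auto simp: q_def inverse_le_1_iff add_pos_pos)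
 have l: "(%j. L2 (ball 0 R) (%x. Hk (q j) x - Hc k x)) ---> 0"
 proof (rule L2_dominated[OF _ _ _ _ fk])
  show "norm (Hk (q j) x - Hc k x) <= norm (Hk (k + 1) x)" for j x
   using q(2,3)[of j] by (auto simp: Hk_def Hc_def)
  show "AE x\<in>ball 0 R in lborel. (%j. Hk (q j) x - Hc k x) ---> 0"
  proof (intro AE_I2 impI)
   fix x
   have "\<forall>\<^sub>F j in sequentially. Hk (q j) x - Hc k x = 0"
   proof (cases "G x <= k")
    case True
    then have "Hk (q j) x - Hc k x = 0" for j using q(2)[of j] by (simp add: Hk_def Hc_def)
    then show ?thesis by simp
   next
    case False
    have l0: "(%j. k + inverse (real (Suc j))) ---> k + 0" by (intro tendsto_intros LIMSEQ_inverse_real_of_nat)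
    have "\<forall>\<^sub>F j in sequentially. q j < G x" unfolding q_def using order_tendstoD(2)[OF l0, of "G x"] False by simp
    then show ?thesis by eventually_elim (use False in \<open>simp add: Hk_def Hc_def\<close>)
   qed
   then show "(%j. Hk (q j) x - Hc k x) ---> 0" by (rule tendsto_eventually)
  qed
 qed auto
 show "super (ball 0 R) (Hc k)"
  unfolding super_def
 proof (intro ballI impI)
  fix \<phi> :: "real^'n => real" assume \<phi>: "\<phi> : C1c (ball 0 R)" "ALL x. 0 <= \<phi> x"
  note [measurable] = grad_measurable[OF C1c_C1[OF \<phi>(1)]]
  have f\<phi>: "L2 (ball 0 R) (grad \<phi>) < \<infinity>" by (rule C1c_L2_finite[OF \<phi>(1)]) simp
  have fA: "L2 (ball 0 R) (%x. A x *v grad \<phi> x) < \<infinity>" by (rule L2_A_finite) (use f\<phi> in auto)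
  have fq: "L2 (ball 0 R) (Hk (q j)) < \<infinity>" for j by (rule Hk_L2_ball[OF assms(1) q(1)])
  have "(%j. LBINT x. ind (ball 0 R) x * ((A x *v grad \<phi> x) \<bullet> Hk (q j) x))
    ---> (LBINT x. ind (ball 0 R) x * ((A x *v grad \<phi> x) \<bullet> Hc k x))"
   by (rule L2_inner_tendsto) (use fA fc fq l in auto)
  then have lim: "(%j. LBINT x. ind (ball 0 R) x * ((A x *v Hk (q j) x) \<bullet> grad \<phi> x))
    ---> (LBINT x. ind (ball 0 R) x * ((A x *v Hc k x) \<bullet> grad \<phi> x))"
   by (simp only: A_commute[of _ "grad \<phi> _"])
  have "0 <= (LBINT x. ind (ball 0 R) x * ((A x *v Hk (q j) x) \<bullet> grad \<phi> x))" for j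
   using Hk_super[OF assms(1) q(1)[of j]] \<phi> unfolding super_def by blast
  with lim show "0 <= (LBINT x. ind (ball 0 R) x * ((A x *v Hc k x) \<bullet> grad \<phi> x))"
   by (intro LIMSEQ_le_const[OF lim]) blast
 qed
qed

lemma sol_approx:
 assumes s: "sol S g" and g: "g : Borel" "L2 S g < \<infinity>"
  and a: "approx S {\<phi> : C1c S. ALL x. 0 <= \<phi> x} \<phi> h"
 shows "(LBINT x. ind S x * ((A x *v g x) \<bullet> h x)) = 0"
proof (rule antisym)
 show "0 <= (LBINT x. ind S x * ((A x *v g x) \<bullet> h x))"
  using s by (intro super_approx[OF _ g a]) (simp add: sol_def)
 have neg: "A x *v - g x = - (A x *v g x)" for x using matrix_vector_mult_scaleR[of "A x" "-1" "g x"] by simp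
 have "0 <= (LBINT x. ind S x * ((A x *v - g x) \<bullet> h x))"
  using s g by (intro super_approx[OF _ _ _ a]) (auto simp: sol_def L2_def)
 then show "(LBINT x. ind S x * ((A x *v g x) \<bullet> h x)) <= 0" by (simp add: neg)
qed

text \<open>The identity behind the estimate is \<open>div(A\<nabla>\<Phi>(u - c)) = \<Phi>''(u - c) A\<nabla>u\<cdot>\<nabla>u\<close> for a solution \<open>u\<close>; a bounded \<open>\<Phi>\<close> that is convex on
 \<open>[-m, m]\<close> makes all truncations of \<open>u\<close> unnecessary.\<close>

lemma energy_truncated:
 assumes \<rho>: "\<rho> > 0" and s: "sol (ball 0 \<rho>) g" and a: "approx (ball 0 \<rho>) (Collect C1) u g" and m: "m > 0"
  and osc: "AE x\<in>ball 0 \<rho> in lborel. \<bar>u x - c\<bar> <= m"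
  and k: "k > 0" "k < N" and out: "AEL x. \<rho> / 2 <= norm x --> G x < k"
 shows "(NN x. ennreal (max (Gk N x - k) 0 * ((A x *v g x) \<bullet> g x)) * ind (ball 0 \<rho>) x) <= ennreal (4 * m\<^sup>2)"
proof -
 define S where "S = ball (0::real^'n) \<rho>"
 have S [measurable]: "S : sets borel" by (simp add: S_def)
 have fS: "emeasure lborel S < \<infinity>" using emeasure_lborel_ball_finite[of "0::real^'n" \<rho>] by (simp add: S_def)
 have N: "N > 0" using k by simp
 note aS = a[folded S_def] and sS = s[folded S_def]
 have um [measurable]: "u : Borel" and gm [measurable]: "g : Borel" and gf: "L2 S g < \<infinity>"
  using approxD[OF aS] by auto
 obtain \<theta> where \<theta>: "\<theta> : C1c S" "ALL x. 0 <= \<theta> x & \<theta> x <= 1" "ALL x:cball 0 (\<rho> / 2). \<theta> x = 1 & grad \<theta> x = 0"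
  using cutoff_C1c[of "\<rho> / 2" "3 * \<rho> / 4" \<rho>] \<rho> unfolding S_def by auto
 note C\<theta> = C1c_C1[OF \<theta>(1)]
 note [measurable] = C1_measurable[OF C\<theta>] grad_measurable[OF C\<theta>]
 obtain B where B: "B > 0" "ALL x. \<bar>\<theta> x\<bar> <= B" "ALL x. norm (grad \<theta> x) <= B" using C1c_bounded[OF \<theta>(1)] by blast
 have fAg: "L2 S (%x. A x *v g x) < \<infinity>" by (rule L2_A_finite[OF gm S gf])
 define p where "p = (%x. max (Gk N x - k) 0)"
 define hp where "hp = (%x. if Gk N x - k > 0 then Hk N x else 0)"
 have [measurable]: "p : Borel" "hp : Borel" unfolding p_def hp_def by measurable
 have pb: "0 <= p x" "p x <= N" for x using Gk_bounds(2)[of N x] k by (auto simp: p_def)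
 have hp_eq: "hp x = Hk N x - Hc k x" for x using k by (auto simp: hp_def Hk_def Hc_def Gk_def)
 let ?P = "{\<phi> : C1c S. ALL x. 0 <= \<phi> x}"
 have P: "?P <= Collect C1" using C1c_C1 by auto
 have zero: "p x = 0 & hp x = 0" if "\<rho> / 2 <= norm x --> G x < k" "x ~: ball 0 (\<rho> / 2)" for x
  using that k by (auto simp: p_def hp_def Gk_def)
 \<comment> \<open>The bound N is part of the class because \<open>approx_mult\<close> asks for
   uniformly bounded approximants.\<close>
 let ?Q = "{\<phi> : C1c S. ALL x. 0 <= \<phi> x & \<phi> x <= N}"
 have ap: "approx S ?Q p hp"
 proof -
  have "approx S (between N) (Gk N) (Hk N)" unfolding S_def by (rule approx_Gk[OF \<rho> N])
  then have "approx S {w. C1 w & (ALL x. w x <= N)} (%x. Gk N x - k) (%x. 1 *. Hk N x)"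
  proof (rule approx_chain[where F="%t. t - k" and M=1])
   show "((%t. t - k) has_real_derivative 1) (at t)" for t by (auto intro!: derivative_eq_intros)
   show "(%x. w x - k) : {w. C1 w & (ALL x. w x <= N)}" if "w : between N" for w
   proof -
    have "w x - k <= N" for x using that k by (smt (verit) mem_Collect_eq)
    then show ?thesis using that C1_minus_const by auto
   qed
   have "L2 S (%x. Gk N x - k) <= ennreal (N\<^sup>2) * emeasure lborel S"
   proof (rule L2_bounded)
    fix x show "norm (Gk N x - k) <= N" using Gk_bounds(1)[OF N, of x] Gk_bounds(2)[of N x] k by simp
   qed (use N in auto)
   then show "L2 S (%x. Gk N x - k) < \<infinity>" using fS by (auto simp: ennreal_mult_less_top intro: le_less_trans)
  qed auto
  then have "approx S (between N) p (%x. if Gk N x - k > 0 then 1 *. Hk N x else 0)"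
   unfolding p_def
  proof (rule approx_pos)
   show "(%x. smooth_pos e (w x)) : between N" if "w : {w. C1 w & (ALL x. w x <= N)}" "e > 0" for w :: "real^'n => real" and e
   proof -
    have "smooth_pos e (w x) <= N" for x
     using smooth_pos_bounds(2)[OF that(2), of "w x"] that(1) N by (smt (verit) mem_Collect_eq)
    then show ?thesis using that smooth_pos_bounds(1)[OF that(2)] by (auto intro: C1_smooth_pos)
   qed
  qed auto
  then have a1: "approx S (between N) p hp" unfolding hp_def scaleR_one by assumption
  have "approx S ?Q (%x. \<theta> x * p x) (%x. \<theta> x *. hp x + p x *. grad \<theta> x)"
  proof (rule approx_mult_C1[OF a1 C\<theta>, where B=B])
   show "(%x. \<theta> x * w x) : ?Q" if "w : between N" for w
   proof -
    have "\<theta> x * w x <= N" for x using mult_mono[of "\<theta> x" 1 "w x" N] \<theta>(2) that by auto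
    then show ?thesis using that \<theta>(2) C1c_mult[OF \<theta>(1)] by auto
   qed
  qed (use B P in auto)
  then show ?thesis
  proof (rule approx_cong)
   show "AE x\<in>S in lborel. p x = \<theta> x * p x"
    using out
   proof (eventually_elim, intro impI)
    fix x assume d: "\<rho> / 2 <= norm x --> G x < k"
    show "p x = \<theta> x * p x" using zero[OF d] \<theta>(3) by (cases "x : ball 0 (\<rho> / 2)") auto
   qed
   show "AE x\<in>S in lborel. hp x = \<theta> x *. hp x + p x *. grad \<theta> x"
    using out
   proof (eventually_elim, intro impI)
    fix x assume d: "\<rho> / 2 <= norm x --> G x < k"
    show "hp x = \<theta> x *. hp x + p x *. grad \<theta> x" using zero[OF d] \<theta>(3) by (cases "x : ball 0 (\<rho> / 2)") auto
   qed
  qed measurable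
 qed
 \<comment> \<open>For \<Phi>(t) = m^2 (1 - cos (t / m)) one has \<Phi>' = m sin (t / m) and
   \<Phi>'' = cos (t / m). \<open>v\<close> is \<Phi>'(u - c) shifted by m, since test functions
   have to be nonnegative; the term \<open>t4\<close> undoes the shift.\<close>
 define v where "v = (%x. m + m * sin ((u x - c) / m))"
 define co where "co = (%x. cos ((u x - c) / m))"
 define \<Phi> where "\<Phi> = (%x. m\<^sup>2 * (1 - cos ((u x - c) / m)))"
 define d where "d = (%x. (m * sin ((u x - c) / m)) *. g x)"
 have [measurable]: "v : Borel" "co : Borel" "\<Phi> : Borel" "d : Borel"
  unfolding v_def co_def \<Phi>_def d_def by measurable
 have sb: "0 <= m + m * sin t & m + m * sin t <= 2 * m" for t
  using m mult_left_mono[OF sin_ge_minus_one, of m t] mult_left_mono[OF sin_le_one, of m t] by simp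
 have cb: "0 <= m\<^sup>2 * (1 - cos t) & m\<^sup>2 * (1 - cos t) <= 2 * m\<^sup>2" for t
  using m mult_left_mono[of "1 - cos t" 2 "m\<^sup>2"] cos_ge_minus_one[of t] by (auto simp: mult_nonneg_nonneg)
 have fin: "L2 S f < \<infinity>" if "!!x. \<bar>f x\<bar> <= b" "0 <= b" for f :: "real^'n => real" and b
 proof -
  have "L2 S f <= ennreal (b\<^sup>2) * emeasure lborel S" by (rule L2_bounded) (use that in auto)
  also have "\<dots> < \<infinity>" using fS by (simp add: ennreal_mult_less_top)
  finally show ?thesis .
 qed
 have av: "approx S {w. C1 w & (ALL x. 0 <= w x & w x <= 2 * m)} v (%x. co x *. g x)"
  unfolding v_def co_def
 proof (rule approx_chain[OF aS, where F="%t. m + m * sin ((t - c) / m)" and M=1])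
  have d: "((%t. m + m * sin ((t - c) / m)) has_real_derivative cos ((t - c) / m)) (at t)" for t
   using m by (auto intro!: derivative_eq_intros)
  show "((%t. m + m * sin ((t - c) / m)) has_real_derivative cos ((t - c) / m)) (at t)" for t by (rule d)
  have cc: "continuous_on UNIV (%t. cos ((t - c) / m))" using m by (intro continuous_intros) auto
  show "continuous_on UNIV (%t. cos ((t - c) / m))" by (rule cc)
  show "(%x. m + m * sin ((w x - c) / m)) : {w. C1 w & (ALL x. 0 <= w x & w x <= 2 * m)}" if "w : Collect C1" for w :: "real^'n => real"
   using C1_compose[OF _ d cc, of w] that sb by auto
  show "L2 S (%x. m + m * sin ((u x - c) / m)) < \<infinity>" using sb m by (intro fin[of _ "2 * m"]) auto
 qed auto
 have a\<Phi>: "approx S {w. C1 w & (ALL x. 0 <= w x & w x <= 2 * m\<^sup>2)} \<Phi> d"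
  unfolding \<Phi>_def d_def
 proof (rule approx_chain[OF aS, where F="%t. m\<^sup>2 * (1 - cos ((t - c) / m))" and M=m])
  have d: "((%t. m\<^sup>2 * (1 - cos ((t - c) / m))) has_real_derivative m * sin ((t - c) / m)) (at t)" for t
   using m by (auto intro!: derivative_eq_intros simp: power2_eq_square)
  show "((%t. m\<^sup>2 * (1 - cos ((t - c) / m))) has_real_derivative m * sin ((t - c) / m)) (at t)" for t by (rule d)
  have cc: "continuous_on UNIV (%t. m * sin ((t - c) / m))" using m by (intro continuous_intros) auto
  show "continuous_on UNIV (%t. m * sin ((t - c) / m))" by (rule cc)
  show "\<bar>m * sin ((t - c) / m)\<bar> <= m" for t using m by (simp add: abs_mult mult_left_le)
  show "(%x. m\<^sup>2 * (1 - cos ((w x - c) / m))) : {w. C1 w & (ALL x. 0 <= w x & w x <= 2 * m\<^sup>2)}" if "w : Collect C1" for w :: "real^'n => real"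
   using C1_compose[OF _ d cc, of w] that cb by auto
  show "L2 S (%x. m\<^sup>2 * (1 - cos ((u x - c) / m))) < \<infinity>" using cb m by (intro fin[of _ "2 * m\<^sup>2"]) auto
 qed auto
 have \<Phi>b: "0 <= \<Phi> x" "\<Phi> x <= 2 * m\<^sup>2" for x using cb by (auto simp: \<Phi>_def)
 have a\<Psi>: "approx S {w. C1 w & (ALL x. 0 <= w x & w x <= 2 * m\<^sup>2)} (%x. 2 * m\<^sup>2 - \<Phi> x) (%x. -1 *. d x)"
 proof (rule approx_chain[OF a\<Phi>, where F="%t. 2 * m\<^sup>2 - t" and M=1])
  have d: "((%t. 2 * m\<^sup>2 - t) has_real_derivative -1) (at t)" for t by (auto intro!: derivative_eq_intros)
  show "((%t. 2 * m\<^sup>2 - t) has_real_derivative -1) (at t)" for t by (rule d)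
  show "(%x. 2 * m\<^sup>2 - w x) : {w. C1 w & (ALL x. 0 <= w x & w x <= 2 * m\<^sup>2)}"
   if "w : {w. C1 w & (ALL x. 0 <= w x & w x <= 2 * m\<^sup>2)}" for w :: "real^'n => real"
   using C1_compose[OF _ d, of w] that by auto
  show "L2 S (%x. 2 * m\<^sup>2 - \<Phi> x) < \<infinity>" using \<Phi>b by (intro fin[of _ "2 * m\<^sup>2"]) auto
 qed auto
 have mult\<theta>: "approx S ?P (%x. \<theta> x * w x) (%x. \<theta> x *. e x + w x *. grad \<theta> x)"
  if "approx S {w. C1 w & (ALL x. 0 <= w x & w x <= 2 * m\<^sup>2)} w e" for w e
  by (rule approx_mult_C1[OF that C\<theta>, where B=B]) (use B P \<theta> C1c_mult[OF \<theta>(1)] in auto)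
 \<comment> \<open>\<open>t1\<close> tests the supersolution truncated at N with \<theta> \<Phi>,
   and \<open>t2\<close> the one truncated at k with \<theta> (2 m^2 - \<Phi>), both nonnegative.
   The opposite signs of \<Phi> combine the two inequalities into one for the difference of the
   truncations, at the price of 2 m^2 times the unit flux. \<open>t3\<close> and \<open>t4\<close>
   test the equation of u with p v and with p.\<close>
 define t1 where "t1 = (%x. ind S x * ((A x *v Hk N x) \<bullet> (\<theta> x *. d x + \<Phi> x *. grad \<theta> x)))"
 define t2 where "t2 = (%x. ind S x * ((A x *v Hc k x) \<bullet> (\<theta> x *. (-1 *. d x) + (2 * m\<^sup>2 - \<Phi> x) *. grad \<theta> x)))"
 define t3 where "t3 = (%x. ind S x * ((A x *v g x) \<bullet> (p x *. (co x *. g x) + v x *. hp x)))"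
 define t4 where "t4 = (%x. ind S x * ((A x *v g x) \<bullet> hp x))"
 define f where "f = (%x. ind S x * ((A x *v g x) \<bullet> ((p x * co x) *. g x)))"
 have 1: "0 <= (LBINT x. t1 x)" "integrable lborel t1"
 proof -
  have fH: "L2 S (Hk N) < \<infinity>" unfolding S_def by (rule Hk_L2_ball[OF \<rho> N])
  show "0 <= (LBINT x. t1 x)" unfolding t1_def
   by (rule super_approx[OF _ Hk_measurable fH mult\<theta>[OF a\<Phi>]]) (use Hk_super[OF \<rho> N] in \<open>simp add: S_def\<close>)
  show "integrable lborel t1" unfolding t1_def
   by (rule L2_inner_integrable[OF _ _ S L2_A_finite[OF Hk_measurable S fH] approxD(6)[OF mult\<theta>[OF a\<Phi>]]]) measurable
 qed
 have 2: "0 <= (LBINT x. t2 x)" "integrable lborel t2"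
 proof -
  have fH: "L2 S (Hc k) < \<infinity>" unfolding S_def by (rule Hc_super(2)[OF \<rho> k(1)])
  show "0 <= (LBINT x. t2 x)" unfolding t2_def
   by (rule super_approx[OF _ Hc_measurable fH mult\<theta>[OF a\<Psi>]]) (use Hc_super(1)[OF \<rho> k(1)] in \<open>simp add: S_def\<close>)
  show "integrable lborel t2" unfolding t2_def
   by (rule L2_inner_integrable[OF _ _ S L2_A_finite[OF Hc_measurable S fH] approxD(6)[OF mult\<theta>[OF a\<Psi>]]]) measurable
 qed
 have 3: "(LBINT x. t3 x) = 0" "integrable lborel t3"
 proof -
  have a3: "approx S ?P (%x. p x * v x) (%x. p x *. (co x *. g x) + v x *. hp x)"
  proof (rule approx_mult[OF ap av, where B="N + 2 * m"])
   show "\<bar>w x\<bar> <= N + 2 * m" if "w : ?Q" for w x using that m by (smt (verit) mem_Collect_eq)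
   show "\<bar>w x\<bar> <= N + 2 * m" if "w : {w. C1 w & (ALL x. 0 <= w x & w x <= 2 * m)}" for w x using that N by (smt (verit) mem_Collect_eq)
   show "\<bar>p x\<bar> <= N + 2 * m" for x using pb[of x] m by simp
   show "\<bar>v x\<bar> <= N + 2 * m" for x using sb[of "(u x - c) / m"] N by (simp add: v_def)
  qed (use N m P C1c_mult in auto)
  show "(LBINT x. t3 x) = 0" unfolding t3_def by (rule sol_approx[OF sS gm gf a3])
  show "integrable lborel t3" unfolding t3_def
   by (rule L2_inner_integrable[OF _ _ S fAg approxD(6)[OF a3]]) measurable
 qed
 have 4: "(LBINT x. t4 x) = 0" "integrable lborel t4"
 proof -
  have a4: "approx S ?P p hp" by (rule approx_mono[OF ap]) (use P in auto)
  show "(LBINT x. t4 x) = 0" unfolding t4_def by (rule sol_approx[OF sS gm gf a4])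
  show "integrable lborel t4" unfolding t4_def
   by (rule L2_inner_integrable[OF _ _ S fAg approxD(6)[OF a4]]) measurable
 qed
 have 5: "integrable lborel f"
 proof -
  have "L2 S (%x. (p x * co x) *. g x) <= ennreal (N\<^sup>2) * L2 S g"
  proof (rule L2_bound_mult)
   fix x
   have "\<bar>p x\<bar> * \<bar>co x\<bar> <= N * 1" using pb[of x] N by (intro mult_mono) (auto simp: co_def)
   then show "norm ((p x * co x) *. g x) <= N * norm (g x)" by (simp add: abs_mult mult_right_mono)
  qed (use N in auto)
  then have "L2 S (%x. (p x * co x) *. g x) < \<infinity>" using gf by (auto simp: ennreal_mult_less_top intro: le_less_trans)
  then show ?thesis unfolding f_def by (intro L2_inner_integrable[OF _ _ S fAg]) measurable
 qed
 have I6: "(LBINT x. (A x *v H x) \<bullet> grad \<theta> x) = 1"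
  using flux[OF C1c_mono[OF \<theta>(1) subset_UNIV]] \<theta>(3) \<rho> by simp
 then have 6: "integrable lborel (%x. (A x *v H x) \<bullet> grad \<theta> x)" using not_integrable_integral_eq by force
 have "(LBINT x. f x + (t1 x + t2 x)) = (LBINT x. 2 * m\<^sup>2 * ((A x *v H x) \<bullet> grad \<theta> x) + (t3 x - m * t4 x))"
 proof (rule integral_cong_AE)
  \<comment> \<open>In the inner ball grad \<theta> vanishes and the terms with hp cancel. Outside
    it both truncations have gradient H and p vanishes, so the terms with \<Phi> cancel and only the
    flux against grad \<theta> is left.\<close>
  show "AEL x. f x + (t1 x + t2 x) = 2 * m\<^sup>2 * ((A x *v H x) \<bullet> grad \<theta> x) + (t3 x - m * t4 x)"
   using out
  proof eventually_elim
   fix x assume dx: "\<rho> / 2 <= norm x --> G x < k"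
   have dv: "d x = (v x - m) *. g x" by (simp add: d_def v_def)
   show "f x + (t1 x + t2 x) = 2 * m\<^sup>2 * ((A x *v H x) \<bullet> grad \<theta> x) + (t3 x - m * t4 x)"
   proof (cases "x : S")
    case False
    then show ?thesis using C1c_zero(2)[OF \<theta>(1)] by (simp add: f_def t1_def t2_def t3_def t4_def)
   next
    case True
    have c: "(A x *v g x) \<bullet> hp x = (A x *v Hk N x) \<bullet> g x - (A x *v Hc k x) \<bullet> g x"
     unfolding hp_eq by (simp add: inner_diff_right A_commute[of x "g x"])
    show ?thesis
    proof (cases "x : ball 0 (\<rho> / 2)")
     case in1: True
     then have "\<theta> x = 1" "grad \<theta> x = 0" using \<theta>(3) by auto
     then show ?thesis using True unfolding f_def t1_def t2_def t3_def t4_def dv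
      by (simp add: c inner_add_right algebra_simps)
    next
     case False
     then have "G x < k" using dx by simp
     then have "Hk N x = H x" "Hc k x = H x" using k by (auto simp: Hk_def Hc_def)
     moreover have "p x = 0" "hp x = 0" using zero[OF dx False] by auto
     ultimately show ?thesis using True unfolding f_def t1_def t2_def t3_def t4_def
      by (simp add: inner_add_right algebra_simps)
    qed
   qed
  qed
 qed (use 1 2 3 4 5 6 in auto)
 then have "(LBINT x. f x) + ((LBINT x. t1 x) + (LBINT x. t2 x)) = 2 * m\<^sup>2 * 1 + (0 - m * 0)"
  using 1 2 3 4 5 6 I6 by simp
 then have fle: "(LBINT x. f x) <= 2 * m\<^sup>2" using 1 2 by simp
 have fge: "AEL x. ind S x * (p x * ((A x *v g x) \<bullet> g x)) <= 2 * f x"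
  using osc
 proof eventually_elim
  fix x assume o: "x : ball 0 \<rho> --> \<bar>u x - c\<bar> <= m"
  show "ind S x * (p x * ((A x *v g x) \<bullet> g x)) <= 2 * f x"
  proof (cases "x : S")
   case True
   then have "\<bar>(u x - c) / m\<bar> <= 1" using o m by (simp add: S_def)
   then have "1 / 2 <= co x" unfolding co_def by (rule cos_ge_half)
   then have "(p x * ((A x *v g x) \<bullet> g x)) * (1 / 2) <= (p x * ((A x *v g x) \<bullet> g x)) * co x"
    using pb[of x] A_nonneg[of x "g x"] by (intro mult_left_mono) auto
   then show ?thesis using True by (simp add: f_def mult_ac)
  qed (simp add: f_def)
 qed
 have "(NN x. ennreal (max (Gk N x - k) 0 * ((A x *v g x) \<bullet> g x)) * ind (ball 0 \<rho>) x) <= (NN x. ennreal (2 * f x))"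
  by (rule nn_integral_mono_AE) (use fge in eventually_elim, auto simp: p_def S_def indicator_def intro!: ennreal_leI)
 also have "\<dots> = ennreal (LBINT x. 2 * f x)"
 proof (rule nn_integral_eq_integral)
  show "AEL x. 0 <= 2 * f x"
   using fge
  proof eventually_elim
   fix x assume h: "ind S x * (p x * ((A x *v g x) \<bullet> g x)) <= 2 * f x"
   have "0 <= ind S x * (p x * ((A x *v g x) \<bullet> g x))" using pb[of x] A_nonneg[of x "g x"] by simp
   then show "0 <= 2 * f x" using h by linarith
  qed
 qed (use 5 in simp)
 also have "\<dots> <= ennreal (4 * m\<^sup>2)" using fle by (intro ennreal_leI) simp
 finally show ?thesis .
qed

text \<open>N tends to infinity in \<open>energy_truncated\<close>. Square roots of the integrands
  bring the integrals into the form of \<open>L2_fatou\<close>.\<close>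

lemma energy_small:
 assumes "\<rho> > 0" "sol (ball 0 \<rho>) g" and a: "approx (ball 0 \<rho>) (Collect C1) u g" and "m > 0"
  "AE x\<in>ball 0 \<rho> in lborel. \<bar>u x - c\<bar> <= m"
  and k: "k > 0" and "AEL x. \<rho> / 2 <= norm x --> G x < k"
 shows "(NN x. ennreal (max (G x - k) 0 * ((A x *v g x) \<bullet> g x)) * ind (ball 0 \<rho>) x) <= ennreal (4 * m\<^sup>2)"
proof -
 have [measurable]: "g : Borel" using approxD[OF a] by simp
 define q where "q = (%x. (A x *v g x) \<bullet> g x)"
 have q0: "0 <= q x" for x using A_nonneg by (simp add: q_def)
 have [measurable]: "q : Borel" unfolding q_def by measurable
 have e: "L2 (ball 0 \<rho>) (%x. sqrt (f x * q x)) = (NN x. ennreal (f x * q x) * ind (ball 0 \<rho>) x)"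
  if "!!x. 0 <= f x" for f :: "real^'n => real"
  unfolding L2_def using that q0 by (intro nn_integral_cong) simp
 have "L2 (ball 0 \<rho>) (%x. sqrt (max (G x - k) 0 * q x)) <= ennreal (4 * m\<^sup>2)"
 proof (rule L2_fatou[where Y="%j. 0"])
  show "L2 (ball 0 \<rho>) (%x. sqrt (max (Gk (k + real (Suc j)) x - k) 0 * q x)) <= ennreal (4 * m\<^sup>2) + 0" for j
   using energy_truncated[OF assms(1-6) _ assms(7), of "k + real (Suc j)"] by (subst e) (auto simp: q_def)
  show "AE x\<in>ball 0 \<rho> in lborel. (%j. sqrt (max (Gk (k + real (Suc j)) x - k) 0 * q x)) ---> sqrt (max (G x - k) 0 * q x)"
  proof (intro AE_I2 impI)
   fix x
   obtain j0 where "G x <= real j0" using real_arch_simple by blast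
   then have "ALL j>=j0. Gk (k + real (Suc j)) x = G x" using k by (auto simp: Gk_def)
   then have "\<forall>\<^sub>F j in sequentially. sqrt (max (Gk (k + real (Suc j)) x - k) 0 * q x) = sqrt (max (G x - k) 0 * q x)"
    unfolding eventually_sequentially by (metis (no_types, lifting))
   then show "(%j. sqrt (max (Gk (k + real (Suc j)) x - k) 0 * q x)) ---> sqrt (max (G x - k) 0 * q x)" by (rule tendsto_eventually)
  qed
 qed auto
 then show ?thesis by (subst (asm) e) (auto simp: q_def)
qed

end

section \<open>Hoelder continuous representatives\<close>

lemma powr_add_le:
 fixes a b \<alpha> :: real
 assumes "0 <= a" "0 <= b" "0 < \<alpha>" "\<alpha> <= 1"
 shows "(a + b) powr \<alpha> <= a powr \<alpha> + b powr \<alpha>"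
proof (cases "a + b = 0")
 case False
 define s where "s = a + b"
 have s: "s > 0" using False assms by (simp add: s_def)
 have *: "x / s <= (x / s) powr \<alpha>" if "0 <= x" "x <= s" for x
 proof (cases "x = 0")
  case False
  then have "0 < x / s" "x / s <= 1" using that s by auto
  then have "(x / s) powr 1 <= (x / s) powr \<alpha>" using assms by (intro powr_mono') auto
  then show ?thesis using powr_one[of "x / s"] \<open>0 < x / s\<close> by linarith
 qed simp
 have "1 = a / s + b / s" using s by (simp add: s_def add_divide_distrib[symmetric])
 also have "\<dots> <= (a / s) powr \<alpha> + (b / s) powr \<alpha>" using assms by (intro add_mono *) (auto simp: s_def)
 also have "\<dots> = (a powr \<alpha> + b powr \<alpha>) / s powr \<alpha>" using assms s by (simp add: powr_divide add_divide_distrib)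
 finally show ?thesis using s by (simp add: s_def pos_le_divide_eq)
qed (use assms in auto)

text \<open>McShane's extension, the infimum over y in S of u y + K d(x, y)^\<alpha>: for \<alpha>
  <= 1 the power of the distance still satisfies the triangle inequality.\<close>

lemma holder_extension:
 fixes u :: "'a::metric_space => real"
 assumes \<alpha>: "0 < \<alpha>" "\<alpha> <= 1" and K: "0 <= K"
  and h: "!!x y. x : S ==> y : S ==> \<bar>u x - u y\<bar> <= K * dist x y powr \<alpha>"
 shows "EX v. (ALL x:S. v x = u x) & (ALL x y. \<bar>v x - v y\<bar> <= K * dist x y powr \<alpha>)"
proof (cases "S = {}")
 case True
 then show ?thesis using K by (intro exI[of _ "%x. 0"]) auto
next
 case False
 define v where "v x = (INF y\<in>S. u y + K * dist x y powr \<alpha>)" for x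
 have tri: "K * dist x z powr \<alpha> <= K * dist x y powr \<alpha> + K * dist y z powr \<alpha>" for x y z
 proof -
  have "dist x z powr \<alpha> <= (dist x y + dist y z) powr \<alpha>" using \<alpha> dist_triangle[of x z y] by (intro powr_mono2) auto
  also have "\<dots> <= dist x y powr \<alpha> + dist y z powr \<alpha>" using \<alpha> by (intro powr_add_le) auto
  finally show ?thesis using K by (metis distrib_left mult_left_mono)
 qed
 have bdd: "bdd_below ((%y. u y + K * dist x y powr \<alpha>) ` S)" for x
 proof -
  obtain y0 where y0: "y0 : S" using False by auto
  show ?thesis
  proof (rule bdd_belowI2)
   fix y assume "y : S"
   then show "u y0 - K * dist y0 x powr \<alpha> <= u y + K * dist x y powr \<alpha>"
    using h[OF y0, of y] tri[of y0 y x] by (simp add: abs_le_iff)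
  qed
 qed
 have le: "v x <= v y + K * dist x y powr \<alpha>" for x y
 proof -
  have "v x - K * dist x y powr \<alpha> <= v y"
   unfolding v_def[of y]
  proof (rule cINF_greatest[OF False])
   fix w assume w: "w : S"
   have "v x <= u w + K * dist x w powr \<alpha>" unfolding v_def by (rule cINF_lower[OF bdd w])
   then show "v x - K * dist x y powr \<alpha> <= u w + K * dist y w powr \<alpha>" using tri[of x w y] by simp
  qed
  then show ?thesis by simp
 qed
 have "v x = u x" if x: "x : S" for x
 proof (rule antisym)
  show "v x <= u x" using cINF_lower[OF bdd x, of x] by (simp add: v_def)
  show "u x <= v x" unfolding v_def
  proof (rule cINF_greatest[OF False])
   show "u x <= u y + K * dist x y powr \<alpha>" if "y : S" for y using h[OF x that] by linarith
  qed
 qed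
 moreover have "\<bar>v x - v y\<bar> <= K * dist x y powr \<alpha>" for x y
  using le[of x y] le[of y x] by (simp add: abs_le_iff dist_commute)
 ultimately show ?thesis by blast
qed

text \<open>The bounds for balls with centres in a countable dense set and rational radii hold
  outside one null set. Two good points at distance e lie in a common ball of this kind with radius
  below 2e, which gives the Hoelder estimate on the good set; the extension of u from there is the
  representative.\<close>

lemma holder_representative:
 fixes u :: "'a::euclidean_space => real"
 assumes \<alpha>: "0 < \<alpha>" "\<alpha> <= 1" and K: "0 <= K" and U: "open U"
  and osc: "!!z r. z : U ==> 0 < r ==> EX a b. b - a <= K * r powr \<alpha> & (AE x\<in>U \<inter> ball z r in lborel. a <= u x & u x <= b)"
 shows "EX v K'. (AE x\<in>U in lborel. u x = v x) & (ALL x y. \<bar>v x - v y\<bar> <= K' * dist x y powr \<alpha>)"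
proof -
 obtain D :: "'a set" where D: "countable D" "!!X. open X ==> X ~= {} ==> EX d:D. d : X" by (rule countable_dense_setE) blast
 define I where "I = (D \<inter> U) \<times> {r::real. r : \<rat> & 0 < r}"
 have cI: "countable I"
 proof -
  have "{r::real. r : \<rat> & 0 < r} <= \<rat>" by auto
  then have "countable {r::real. r : \<rat> & 0 < r}" using countable_rat countable_subset by blast
  then show ?thesis unfolding I_def using D(1) by (intro countable_SIGMA) auto
 qed
 define T where "T i a b \<longleftrightarrow> b - a <= K * snd i powr \<alpha> & (AE x\<in>U \<inter> ball (fst i) (snd i) in lborel. a <= u x & u x <= b)"
  for i :: "'a \<times> real" and a b
 have "ALL i:I. EX a b. T i a b" using osc unfolding T_def by (auto simp: I_def)
 then obtain a b where "!!i. i : I ==> T i (a i) (b i)" by metis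
 then have ab: "!!i. i : I ==> b i - a i <= K * snd i powr \<alpha>"
  "!!i. i : I ==> AE x\<in>U \<inter> ball (fst i) (snd i) in lborel. a i <= u x & u x <= b i" unfolding T_def by blast+
 define good where "good x \<longleftrightarrow> (ALL i:I. x : U \<inter> ball (fst i) (snd i) --> a i <= u x & u x <= b i)" for x
 have ae: "AEL x. good x"
  unfolding good_def
  using AE_ball_countable[OF cI, of "%x i. x : U \<inter> ball (fst i) (snd i) --> a i <= u x & u x <= b i" lborel] ab(2) by blast
 have h: "\<bar>u x - u y\<bar> <= (2 * K) * dist x y powr \<alpha>" if x: "x : {x : U. good x}" and y: "y : {x : U. good x}" for x y
 proof (cases "x = y")
  case False
  define e where "e = dist x y"
  have e: "e > 0" using False by (simp add: e_def)
  have "open (U \<inter> ball x (e / 2))" "U \<inter> ball x (e / 2) ~= {}" using U x e by auto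
  then obtain z where z: "z : D" "z : U" "dist x z < e / 2" using D(2) by force
  obtain q where q: "q : \<rat>" "3 * e / 2 < q" "q < 2 * e" using Rats_dense_in_real[of "3 * e / 2" "2 * e"] e by auto
  have i: "(z, q) : I" using z q e by (simp add: I_def)
  have "dist z y <= dist x z + dist x y" using dist_triangle[of z y x] by (simp add: dist_commute)
  then have "x : U \<inter> ball z q" "y : U \<inter> ball z q" using z q x y e by (auto simp: e_def dist_commute)
  then have "a (z, q) <= u x & u x <= b (z, q)" "a (z, q) <= u y & u y <= b (z, q)"
   using x y i unfolding good_def by force+
  then have "\<bar>u x - u y\<bar> <= K * q powr \<alpha>" using ab(1)[OF i] by (simp add: abs_le_iff)
  also have "\<dots> <= K * (2 * e powr \<alpha>)"
  proof (rule mult_left_mono[OF _ K])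
   have "q powr \<alpha> <= (e + e) powr \<alpha>" using q e \<alpha> by (intro powr_mono2) auto
   also have "\<dots> <= e powr \<alpha> + e powr \<alpha>" using e \<alpha> by (intro powr_add_le) auto
   finally show "q powr \<alpha> <= 2 * e powr \<alpha>" by simp
  qed
  finally show ?thesis by (simp add: e_def)
 qed simp
 have "EX v. (ALL x:{x : U. good x}. v x = u x) & (ALL x y. \<bar>v x - v y\<bar> <= (2 * K) * dist x y powr \<alpha>)"
  by (rule holder_extension[OF \<alpha>]) (use K in simp, erule (1) h)
 then obtain v where v: "ALL x:{x : U. good x}. v x = u x" "ALL x y. \<bar>v x - v y\<bar> <= (2 * K) * dist x y powr \<alpha>" by blast
 have "AE x\<in>U in lborel. u x = v x" using ae by eventually_elim (use v(1) in auto)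
 then show ?thesis using v(2) by blast
qed

section \<open>The decay estimate and Hoelder continuity for Borel data\<close>

context elliptic
begin

text \<open>\<open>local_max\<close> is applied to u - c and to c - u. Its conclusion is passed on
  as the hypothesis \<open>lm\<close>, so that the constant c0 stays the same for all balls and
  solutions.\<close>

lemma local_bound:
 fixes c :: real
 assumes lm: "ALL (z::real^'n) R \<rho> K v g. DG (4 * L / lam) (ball z R) v g --> approx (ball z R) (Collect C1) v g -->
  0 <= \<rho> --> \<rho> < R --> 0 < K --> L2 (ball z R) (%x. max (v x) 0) <= ennreal (c0 * (R - \<rho>) ^ CARD('n) * K\<^sup>2) -->
  (AE x\<in>ball z \<rho> in lborel. v x <= K)"
  and s: "sol (ball z R) g" and a: "approx (ball z R) (Collect C1) u g" and r: "0 <= \<rho>" "\<rho> < R" "0 < K"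
  and le: "L2 (ball z R) (%x. u x - c) <= ennreal (c0 * (R - \<rho>) ^ CARD('n) * K\<^sup>2)"
 shows "AE x\<in>ball z \<rho> in lborel. c - K <= u x & u x <= c + K"
proof -
 have fin: "emeasure lborel (ball z R) < \<infinity>" by (rule emeasure_lborel_ball_finite)
 have b: "AE x\<in>ball z \<rho> in lborel. e * u x + (- e * c) <= K" if e: "e = 1 \<or> e = -1" for e :: real
 proof -
  have ap: "approx (ball z R) (Collect C1) (%x. e * u x + (- e * c)) (%x. e *. g x)" by (rule approx_affine[OF a fin])
  have "super (ball z R) (%x. - (e *. g x))" using s e by (auto simp: sol_def)
  then have dg: "DG (4 * L / lam) (ball z R) (%x. e * u x + (- e * c)) (%x. e *. g x)" by (rule sub_DG[OF _ ap])
  have "L2 (ball z R) (%x. max (e * u x + (- e * c)) 0) <= L2 (ball z R) (%x. u x - c)"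
   using e by (intro L2_mono) auto
  then have "L2 (ball z R) (%x. max (e * u x + (- e * c)) 0) <= ennreal (c0 * (R - \<rho>) ^ CARD('n) * K\<^sup>2)" using le by (rule order_trans)
  then show ?thesis using lm[rule_format, OF dg ap r] by blast
 qed
 from b[OF disjI1[OF refl]] b[OF disjI2[OF refl]] show ?thesis by eventually_elim auto
qed

end

text \<open>If R <= 4 M r, the estimate follows from monotonicity of the energy in the radius.
  Otherwise put \<rho> = 2 M r and let k bound G outside the ball of radius \<rho> / 2. The
  two-sided bounds give G >= 2 k, hence G <= 2 (G - k)^+, on the ball of radius r, and
  \<open>energy_small\<close> bounds the energy there by the squared oscillation at radius \<rho>.
  This decays from radius R / 2, where local boundedness, Poincare's inequality and G >= c1 R^(2-n)
  bound it by the energy at radius R. The radius 7/8 leaves room for mollification inside the unit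
  ball.\<close>

theorem energy_decay_and_holder:
 assumes n3: "CARD('n) \<ge> 3" and lam: "0 < lam" "lam <= L"
 shows "EX \<alpha> C. 0 < \<alpha> & \<alpha> < 1 & C > 0 &
  (ALL (A::real^'n => real^'n^'n) G H u g. fundamental A lam L G H --> elliptic.sol A (ball 0 (7/8)) g -->
   approx (ball 0 (7/8)) (Collect C1) u g -->
   (ALL r R. 0 < r & r < R & R <= 1/2 -->
     (NN x. ennreal (G x * ((A x *v g x) \<bullet> g x)) * ind (ball 0 r) x)
      <= ennreal (C * (r / R) powr (2 * \<alpha>)) * (NN x. ennreal (G x * ((A x *v g x) \<bullet> g x)) * ind (ball 0 R) x)) &
   (EX v K. (AE x\<in>ball 0 (1/2) in lborel. u x = v x) & (ALL x y. \<bar>v x - v y\<bar> <= K * dist x y powr \<alpha>)))"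
proof -
 define n where "n = CARD('n)"
 have "4 * L / lam \<ge> 0" using lam by simp
 from local_max[OF this, where 'n='n] obtain c0 where c0: "c0 > 0" and
  lm: "ALL (z::real^'n) R \<rho> K v g. DG (4 * L / lam) (ball z R) v g --> approx (ball z R) (Collect C1) v g -->
  0 <= \<rho> --> \<rho> < R --> 0 < K --> L2 (ball z R) (%x. max (v x) 0) <= ennreal (c0 * (R - \<rho>) ^ CARD('n) * K\<^sup>2) -->
  (AE x\<in>ball z \<rho> in lborel. v x <= K)" by blast
 obtain \<alpha> where \<alpha>: "0 < \<alpha>" "\<alpha> < 1" and od: "ALL (A::real^'n => real^'n^'n) z R u g a b r. elliptic A lam L --> 0 < r --> r <= R --> a <= b -->
  elliptic.sol A (ball z R) g --> approx (ball z R) (Collect C1) u g -->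
  (AE x\<in>ball z R in lborel. a <= u x & u x <= b) -->
  (EX a' b'. a' <= b' & b' - a' <= 2 * (r / R) powr \<alpha> * (b - a) & (AE x\<in>ball z r in lborel. a' <= u x & u x <= b'))"
  using osc_decay[OF lam, where 'n='n] by blast
 obtain C2 where C2: "C2 > 0" and ub: "ALL (A::real^'n => real^'n^'n) G H. fundamental A lam L G H -->
  (AEL x. G x * norm x ^ CARD('n) <= C2 * (norm x)^2)" using upper_bound[OF lam, where 'n='n] by blast
 obtain c1 where c1: "c1 > 0" and lb: "ALL (A::real^'n => real^'n^'n) G H r. fundamental A lam L G H --> r > 0 -->
  (AE x\<in>ball 0 r in lborel. c1 * r\<^sup>2 <= G x * r ^ CARD('n))" using lower_bound[OF lam, where 'n='n] by blast
 \<comment> \<open>Chosen so that 4 C2 <= c1 M <= c1 M^(n-2), where the last step uses n >= 3; this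
   is what G >= 2 k on the ball of radius r comes down to.\<close>
 define M where "M = 1 + 4 * C2 / c1"
 have M: "M \<ge> 1" using C2 c1 by (simp add: M_def)
 \<comment> \<open>B brings the Poincare bound of u - c into the form c0 (R/2)^n K^2 expected by
   \<open>local_bound\<close>, with B X in the role of K^2, where X is the energy at radius
   R.\<close>
 define B where "B = 16 * 4 ^ n / (lam * c0 * c1)"
 have B: "B > 0" using lam c0 c1 by (simp add: B_def)
 define Q where "Q = (4 * M) powr (2 * \<alpha>)"
 have Q: "Q > 0" using M by (simp add: Q_def)
 \<comment> \<open>Q pays for the case R <= 4 M r and 128 Q B for the main case.\<close>
 define C where "C = Q + 128 * Q * B"
 have C: "C > 0" using Q B by (simp add: C_def add_pos_pos)
 obtain m0 where m0: "n = m0 + 3" using n3 by (metis add.commute le_Suc_ex n_def)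
 have decay: "(NN x. ennreal (G x * ((A x *v g x) \<bullet> g x)) * ind (ball 0 r) x)
   <= ennreal (C * (r / R) powr (2 * \<alpha>)) * (NN x. ennreal (G x * ((A x *v g x) \<bullet> g x)) * ind (ball 0 R) x)"
  if f: "fundamental A lam L G H" and s: "elliptic.sol A (ball 0 (7/8)) g" and a: "approx (ball 0 (7/8)) (Collect C1) u g"
   and r: "0 < r" "r < R" "R <= 1/2" for A :: "real^'n => real^'n^'n" and G H u g r R
 proof -
  interpret fundamental A lam L G H by (rule f)
  have gm [measurable]: "g : Borel" and um [measurable]: "u : Borel" using approxD[OF a] by auto
  define q where "q = (%x. (A x *v g x) \<bullet> g x)"
  have q0: "0 <= q x" for x using A_nonneg by (simp add: q_def)
  have [measurable]: "q : Borel" unfolding q_def by measurable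
  define E where "E t = (NN x. ennreal (G x * q x) * ind (ball 0 t) x)" for t
  have [measurable]: "ball (0::real^'n) t : sets borel" for t by simp
  have sb: "ball (0::real^'n) t <= ball 0 t'" if "t <= t'" for t t' using that by auto
  have sB: "sol (ball 0 t) g" if "t <= 1/2" for t using sol_mono[OF s sb] that by simp
  have aB: "approx (ball 0 t) (Collect C1) u g" if "t <= 1/2" for t using approx_mono[OF a sb] that by simp
  have rR: "(r / R) powr (2 * \<alpha>) > 0" using r by simp
  have pm: "(4 * M * (r / R)) powr (2 * \<alpha>) = Q * (r / R) powr (2 * \<alpha>)" using r M unfolding Q_def by (subst powr_mult) auto
  have "E r <= ennreal (C * (r / R) powr (2 * \<alpha>)) * E R"
  proof (cases "R <= 4 * M * r")
   case True
   have "E r <= E R" unfolding E_def using r by (intro nn_integral_mono) (auto simp: indicator_def)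
   also have "\<dots> = ennreal 1 * E R" by simp
   also have "\<dots> <= ennreal (C * (r / R) powr (2 * \<alpha>)) * E R"
   proof (intro mult_right_mono ennreal_leI)
    have "1 <= 4 * M * (r / R)" using True r by (simp add: field_simps)
    then have "1 <= (4 * M * (r / R)) powr (2 * \<alpha>)" using \<alpha> by (intro ge_one_powr_ge_zero) auto
    also have "\<dots> <= C * (r / R) powr (2 * \<alpha>)" unfolding pm using Q B rR by (intro mult_right_mono) (auto simp: C_def)
    finally show "1 <= C * (r / R) powr (2 * \<alpha>)" .
   qed simp
   finally show ?thesis .
  next
   case False
   define \<rho> where "\<rho> = 2 * M * r"
   have \<rho>: "0 < \<rho>" "\<rho> <= R / 2" using False M r by (auto simp: \<rho>_def)
   define k where "k = 2 * C2 * (\<rho> / 2)^2 / (\<rho> / 2) ^ n"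
   have k: "k > 0" using C2 \<rho> by (simp add: k_def)
   have out: "AEL x. \<rho> / 2 <= norm x --> G x < k"
    using ub[rule_format, OF f]
   proof (eventually_elim, intro impI)
    fix x :: "real^'n" assume h: "G x * norm x ^ CARD('n) <= C2 * (norm x)^2" and x: "\<rho> / 2 <= norm x"
    define t where "t = \<rho> / 2"
    have t: "t > 0" "t <= norm x" using \<rho> x by (auto simp: t_def)
    have nm: "n = Suc m0 + 2" using m0 by simp
    have nx: "norm x > 0" using t by linarith
    have "G x * norm x ^ Suc m0 * (norm x)^2 <= C2 * (norm x)^2" using h unfolding n_def[symmetric] nm power_add by (simp add: mult.assoc)
    then have "G x * norm x ^ Suc m0 <= C2" using nx by (simp del: power_Suc)
    moreover have "G x * t ^ Suc m0 <= G x * norm x ^ Suc m0" using t G_nonneg[of x] by (intro mult_left_mono power_mono) auto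
    ultimately have "G x * t ^ Suc m0 < 2 * C2" using C2 by linarith
    moreover have "k * t ^ Suc m0 = 2 * C2" using t unfolding k_def nm power_add t_def[symmetric] by simp
    ultimately have "G x * t ^ Suc m0 < k * t ^ Suc m0" by simp
    then show "G x < k" using t by (simp del: power_Suc)
   qed
   have inn: "AE x\<in>ball 0 r in lborel. 2 * k <= G x"
    using lb[rule_format, OF f r(1)]
   proof (eventually_elim, intro impI)
    fix x :: "real^'n" assume h: "x : ball 0 r --> c1 * r\<^sup>2 <= G x * r ^ CARD('n)" and x: "x : ball 0 r"
    have nm: "n = Suc m0 + 2" using m0 by simp
    have "2 * k * r ^ n = 4 * C2 / M ^ Suc m0 * r\<^sup>2"
     using r M unfolding k_def \<rho>_def nm power_add by (simp add: power_mult_distrib field_simps)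
    also have "\<dots> <= c1 * r\<^sup>2"
    proof (rule mult_right_mono)
     have "4 * C2 <= c1 * M" using c1 by (simp add: M_def distrib_left)
     also have "\<dots> <= c1 * M ^ Suc m0" using M c1 self_le_power[of M "Suc m0"] by (intro mult_left_mono) auto
     finally show "4 * C2 / M ^ Suc m0 <= c1" using M by (simp add: pos_divide_le_eq)
    qed simp
    also have "\<dots> <= G x * r ^ n" using h x by (simp add: n_def)
    finally show "2 * k <= G x" using r by simp
   qed
   show ?thesis
   proof (cases "E R = \<infinity>")
    case True
    have "ennreal (C * (r / R) powr (2 * \<alpha>)) * \<infinity> = \<infinity>" using C rR by (simp add: ennreal_mult_eq_top_iff)
    then show ?thesis using True by simp
   next
    case False
    then obtain X where X: "X \<ge> 0" "E R = ennreal X" by (cases "E R") auto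
    have R: "R > 0" using r by simp
    define D where "D = R ^ n / (lam * c1 * R\<^sup>2)"
    have D: "D > 0" using R lam c1 by (simp add: D_def)
    have gL2: "L2 (ball 0 R) g <= ennreal (D * X)"
    proof -
     have "L2 (ball 0 R) g <= (NN x. ennreal D * (ennreal (G x * q x) * ind (ball 0 R) x))"
      unfolding L2_def
     proof (rule nn_integral_mono_AE)
      show "AEL x. ennreal ((norm (g x))^2) * ind (ball 0 R) x <= ennreal D * (ennreal (G x * q x) * ind (ball 0 R) x)"
       using lb[rule_format, OF f R]
      proof eventually_elim
       fix x :: "real^'n" assume h: "x : ball 0 R --> c1 * R\<^sup>2 <= G x * R ^ CARD('n)"
       show "ennreal ((norm (g x))^2) * ind (ball 0 R) x <= ennreal D * (ennreal (G x * q x) * ind (ball 0 R) x)"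
       proof (cases "x : ball 0 R")
        case True
        then have h: "c1 * R\<^sup>2 <= G x * R ^ n" using h by (simp add: n_def)
        have e1: "(norm (g x))^2 = D / R ^ n * ((c1 * R\<^sup>2) * (lam * (norm (g x))^2))"
         using R lam c1 by (simp add: D_def)
        have "(c1 * R\<^sup>2) * (lam * (norm (g x))^2) <= (G x * R ^ n) * q x"
         by (rule mult_mono[OF h]) (use A_lower[of "g x" x] R lam G_nonneg[of x] in \<open>auto simp: q_def\<close>)
        then have "D / R ^ n * ((c1 * R\<^sup>2) * (lam * (norm (g x))^2)) <= D / R ^ n * ((G x * R ^ n) * q x)"
         by (rule mult_left_mono) (use D R in simp)
        also have "\<dots> = D * (G x * q x)" using R by simp
        finally have "ennreal ((norm (g x))^2) <= ennreal (D * (G x * q x))" using e1 by (intro ennreal_leI) linarith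
        then show ?thesis using True D G_nonneg[of x] q0[of x] by (simp add: ennreal_mult)
       qed simp
      qed
     qed
     also have "\<dots> = ennreal D * E R" unfolding E_def by (rule nn_integral_cmult) measurable
     also have "\<dots> = ennreal (D * X)" using X D by (simp add: ennreal_mult)
     finally show ?thesis .
    qed
    define K0 where "K0 = 8 * R\<^sup>2 * 2 ^ CARD('n)"
    have aR: "approx (ball 0 R) (Collect C1) u g" by (rule aB) (use r in simp)
    have Kf: "ennreal K0 * L2 (ball 0 R) g < \<infinity>" using gL2 by (auto simp: ennreal_mult_less_top intro: le_less_trans)
    obtain c where c: "L2 (ball 0 R) (%x. u x - c) <= 2 * ennreal K0 * L2 (ball 0 R) g"
     using poincare_constant[OF R um poincare_approx[OF aR R, folded K0_def] Kf] by blast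
    have cB: "L2 (ball 0 R) (%x. u x - c) <= ennreal (c0 * (R - R / 2) ^ CARD('n) * (B * X))"
    proof -
     have "2 * ennreal K0 * L2 (ball 0 R) g <= 2 * ennreal K0 * ennreal (D * X)" by (rule mult_left_mono[OF gL2]) simp
     also have "\<dots> = ennreal (2 * K0 * (D * X))"
     proof -
      have "ennreal (2 * K0 * (D * X)) = ennreal (2 * K0) * ennreal (D * X)" by (rule ennreal_mult'') (use X D in simp)
      moreover have "ennreal (2 * K0) = ennreal 2 * ennreal K0" by (rule ennreal_mult'') (simp add: K0_def)
      ultimately show ?thesis by simp
     qed
     also have "2 * K0 * (D * X) = c0 * (R - R / 2) ^ CARD('n) * (B * X)"
     proof -
      have "(4::real) ^ n = 2 ^ n * 2 ^ n" by (simp add: power_mult_distrib[symmetric])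
      then show ?thesis using R lam c0 c1 unfolding K0_def D_def B_def n_def[symmetric]
       by (simp add: power_divide field_simps power2_eq_square)
     qed
     finally show ?thesis using c by simp
    qed
    have small: "E r <= ennreal (128 * Q * (r / R) powr (2 * \<alpha>) * K\<^sup>2)" if K: "K > 0" "B * X <= K\<^sup>2" for K
    proof -
     have "L2 (ball 0 R) (%x. u x - c) <= ennreal (c0 * (R - R / 2) ^ CARD('n) * K\<^sup>2)"
      using cB by (rule order_trans) (use K R c0 in \<open>auto intro!: ennreal_leI mult_left_mono\<close>)
     then have bd: "AE x\<in>ball 0 (R / 2) in lborel. c - K <= u x & u x <= c + K"
      by (rule local_bound[OF lm sB aR, rotated -1]) (use r R K in auto)
     obtain a' b' where ab: "a' <= b'" "b' - a' <= 2 * (\<rho> / (R / 2)) powr \<alpha> * ((c + K) - (c - K))"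
      "AE x\<in>ball 0 \<rho> in lborel. a' <= u x & u x <= b'"
      using od[rule_format, OF elliptic_axioms \<rho> _ sB aB bd] K r by auto
     define m where "m = 4 * (4 * M * (r / R)) powr \<alpha> * K"
     have "4 * M * (r / R) > 0" using M r by simp
     then have "(4 * M * (r / R)) powr \<alpha> > 0" by (metis less_irrefl powr_gt_zero)
     then have m: "m > 0" unfolding m_def using K by (intro mult_pos_pos) auto
     have eq: "\<rho> / (R / 2) = 4 * M * (r / R)" by (simp add: \<rho>_def)
     have mb: "b' - a' <= m" using ab(2) unfolding eq m_def by (simp add: algebra_simps)
     have osc: "AE x\<in>ball 0 \<rho> in lborel. \<bar>u x - a'\<bar> <= m"
      using ab(3) by eventually_elim (use mb in auto)
     have "E r <= (NN x. 2 * (ennreal (max (G x - k) 0 * q x) * ind (ball 0 \<rho>) x))"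
      unfolding E_def
     proof (rule nn_integral_mono_AE)
      show "AEL x. ennreal (G x * q x) * ind (ball 0 r) x <= 2 * (ennreal (max (G x - k) 0 * q x) * ind (ball 0 \<rho>) x)"
       using inn
      proof eventually_elim
       fix x :: "real^'n" assume h: "x : ball 0 r --> 2 * k <= G x"
       show "ennreal (G x * q x) * ind (ball 0 r) x <= 2 * (ennreal (max (G x - k) 0 * q x) * ind (ball 0 \<rho>) x)"
       proof (cases "x : ball 0 r")
        case True
        have "r <= \<rho>" using M r mult_right_mono[of 1 "2 * M" r] by (simp add: \<rho>_def)
        then have x: "x : ball 0 \<rho>" using True by simp
        have "G x <= 2 * max (G x - k) 0" using h True k by (simp add: max_def)
        then have "G x * q x <= 2 * max (G x - k) 0 * q x" by (rule mult_right_mono[OF _ q0])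
        then have "ennreal (G x * q x) <= ennreal (2 * (max (G x - k) 0 * q x))" by (intro ennreal_leI) (simp add: mult.assoc)
        then show ?thesis using x True q0[of x] by (simp add: ennreal_mult)
       qed simp
      qed
     qed
     also have "\<dots> = 2 * (NN x. ennreal (max (G x - k) 0 * q x) * ind (ball 0 \<rho>) x)" by (rule nn_integral_cmult) measurable
     also have "\<dots> <= 2 * ennreal (4 * m\<^sup>2)"
      unfolding q_def using r \<rho> by (intro mult_left_mono energy_small[OF \<rho>(1) sB aB m osc k out]) auto
     also have "\<dots> = ennreal (8 * m\<^sup>2)" by (simp add: ennreal_mult)
     also have "8 * m\<^sup>2 = 128 * Q * (r / R) powr (2 * \<alpha>) * K\<^sup>2"
     proof -
      have "((4 * M * (r / R)) powr \<alpha>)^2 = Q * (r / R) powr (2 * \<alpha>)"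
       unfolding pm[symmetric] by (simp add: power2_eq_square powr_add[symmetric])
      then show ?thesis by (simp add: m_def power_mult_distrib)
     qed
     finally show ?thesis .
    qed
    define P where "P = 128 * Q * (r / R) powr (2 * \<alpha>)"
    have P: "P > 0" using Q rR by (simp add: P_def)
    have "E r <= ennreal (P * (B * X))"
    proof (rule ennreal_le_epsilon)
     fix e :: real assume e: "e > 0"
     \<comment> \<open>\<open>small\<close> asks for K > 0, but X may be 0; hence K^2 exceeds B X by
       e / P, and e is arbitrary.\<close>
     define K where "K = sqrt (B * X + e / P)"
     have p: "0 < B * X + e / P" using B X e P by (simp add: add_nonneg_pos)
     have K: "K > 0" "K\<^sup>2 = B * X + e / P" using p by (auto simp: K_def)
     have "E r <= ennreal (P * K\<^sup>2)" unfolding P_def by (rule small) (use K e P in auto)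
     also have "P * K\<^sup>2 = P * (B * X) + e" using P by (simp add: K(2) distrib_left)
     also have "ennreal \<dots> = ennreal (P * (B * X)) + ennreal e" using P B X e by (intro ennreal_plus) auto
     finally show "E r <= ennreal (P * (B * X)) + ennreal e" .
    qed
    also have "\<dots> <= ennreal (C * (r / R) powr (2 * \<alpha>) * X)"
    proof (rule ennreal_leI)
     have "P * (B * X) = 128 * Q * B * ((r / R) powr (2 * \<alpha>) * X)" by (simp add: P_def)
     also have "\<dots> <= C * ((r / R) powr (2 * \<alpha>) * X)" using Q X by (intro mult_right_mono) (auto simp: C_def)
     finally show "P * (B * X) <= C * (r / R) powr (2 * \<alpha>) * X" by (simp add: mult.assoc)
    qed
    also have "\<dots> = ennreal (C * (r / R) powr (2 * \<alpha>)) * E R" using X C by (simp add: ennreal_mult'')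
    finally show ?thesis .
   qed
  qed
  then show ?thesis by (simp add: E_def q_def)
 qed
 have holder: "EX v K. (AE x\<in>ball 0 (1/2) in lborel. u x = v x) & (ALL x y. \<bar>v x - v y\<bar> <= K * dist x y powr \<alpha>)"
  if f: "fundamental A lam L G H" and s: "elliptic.sol A (ball 0 (7/8)) g" and a: "approx (ball 0 (7/8)) (Collect C1) u g"
   for A :: "real^'n => real^'n^'n" and G H u g
 proof -
  interpret fundamental A lam L G H by (rule f)
  obtain X where X: "X \<ge> 0" "L2 (ball 0 (7/8)) u = ennreal X" using approxD(5)[OF a] by (cases "L2 (ball 0 (7/8)) u") auto
  define W where "W = c0 * (7/8 - 3/4) ^ CARD('n)"
  have W: "W > 0" using c0 by (simp add: W_def)
  define b where "b = X / W + 1"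
  have b: "b \<ge> 1" using X W by (simp add: b_def)
  have "X <= W * b\<^sup>2"
  proof -
   have "X = W * (X / W)" using W by simp
   also have "\<dots> <= W * b" using W by (intro mult_left_mono) (auto simp: b_def)
   also have "\<dots> <= W * b\<^sup>2" using W b self_le_power[of b 2] by (intro mult_left_mono) auto
   finally show ?thesis .
  qed
  then have "L2 (ball 0 (7/8)) (%x. u x - 0) <= ennreal (c0 * (7/8 - 3/4) ^ CARD('n) * b\<^sup>2)"
   using X by (simp add: W_def ennreal_leI)
  then have bd: "AE x\<in>ball 0 (3/4) in lborel. 0 - b <= u x & u x <= 0 + b"
   by (rule local_bound[OF lm s a, rotated -1]) (use b in auto)
  \<comment> \<open>A factor 4 b from the oscillation estimate on balls of radius 1/4 and a factor 4
    >= 4^\<alpha> from that radius. For r > 1/4 the same constant covers the trivial oscillation 2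
    b.\<close>
  define K where "K = 16 * b"
  show ?thesis
  proof (rule holder_representative[where K=K])
   show "0 <= K" using b by (simp add: K_def)
   fix z :: "real^'n" and r :: real assume z: "z : ball 0 (1/2)" and r: "0 < r"
   show "EX a b. b - a <= K * r powr \<alpha> & (AE x\<in>ball 0 (1/2) \<inter> ball z r in lborel. a <= u x & u x <= b)"
   proof (cases "r <= 1/4")
    case True
    have sub: "ball z (1/4) <= ball 0 (3/4)"
    proof
     fix x assume "x : ball z (1/4)"
     then show "x : ball 0 (3/4)" using z norm_triangle_ineq2[of x z] by (simp add: dist_norm norm_minus_commute)
    qed
    then have sub': "ball z (1/4) <= ball 0 (7/8)" by (rule order_trans) auto
    have "AE x\<in>ball z (1/4) in lborel. - b <= u x & u x <= b"
     using bd by eventually_elim (use sub in auto)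
    moreover have "approx (ball z (1/4)) (Collect C1) u g" by (rule approx_mono[OF a sub']) auto
    ultimately obtain a' b' where ab: "b' - a' <= 2 * (r / (1/4)) powr \<alpha> * (b - (- b))"
      "AE x\<in>ball z r in lborel. a' <= u x & u x <= b'"
     using od[rule_format, OF elliptic_axioms r True, of "- b" b z g u] sol_mono[OF s sub'] b by auto
    have "2 * (r / (1/4)) powr \<alpha> * (b - (- b)) = 4 * b * (4 powr \<alpha> * r powr \<alpha>)"
     using r by (simp add: powr_mult[symmetric] mult_ac)
    also have "\<dots> <= 4 * b * (4 * r powr \<alpha>)"
     using b \<alpha> powr_mono[of \<alpha> 1 4] by (intro mult_left_mono mult_right_mono) auto
    finally have le: "2 * (r / (1/4)) powr \<alpha> * (b - (- b)) <= 4 * b * (4 * r powr \<alpha>)" .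
    have "b' - a' <= K * r powr \<alpha>" using order_trans[OF ab(1) le] by (simp add: K_def)
    moreover have "AE x\<in>ball 0 (1/2) \<inter> ball z r in lborel. a' <= u x & u x <= b'"
     using ab(2) by eventually_elim auto
    ultimately show ?thesis by blast
   next
    case False
    have "1 / 4 <= r powr \<alpha>"
    proof -
     have "(1/4) powr 1 <= (1/4::real) powr \<alpha>" using \<alpha> by (intro powr_mono') auto
     also have "\<dots> <= r powr \<alpha>" using False \<alpha> by (intro powr_mono2) auto
     finally show ?thesis by simp
    qed
    then have "K * (1 / 4) <= K * r powr \<alpha>" using b by (intro mult_left_mono) (auto simp: K_def)
    then have "b - (- b) <= K * r powr \<alpha>" using b by (simp add: K_def)
    moreover have "AE x\<in>ball 0 (1/2) \<inter> ball z r in lborel. - b <= u x & u x <= b"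
     using bd by eventually_elim auto
    ultimately show ?thesis by blast
   qed
  qed (use \<alpha> in auto)
 qed
 show ?thesis
 proof (rule exI[of _ \<alpha>], rule exI[of _ C], intro conjI allI impI)
  show "0 < \<alpha>" "\<alpha> < 1" "0 < C" using \<alpha> C by auto
 qed (elim conjE, erule (5) decay, erule (2) holder)
qed

subsection \<open>Borel representatives\<close>

lemma lebesgue_measurable_AE:
 fixes f f' :: "'a::euclidean_space => real"
 assumes "f' : Borel" and ae: "AEL x. f x = f' x"
 shows "f : borel_measurable lebesgue"
proof (rule measurableI)
 have f': "f' : borel_measurable lebesgue" using assms(1) by (intro measurable_completion) simp
 define N where "N = {x. f x ~= f' x}"
 have N: "N : null_sets lebesgue"
  using AE_completion[OF ae] by (simp add: completion.AE_iff_null_sets N_def)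
 fix S :: "real set" assume "S : sets borel"
 then have "f' -` S \<inter> space lebesgue : sets lebesgue" by (rule measurable_sets[OF f'])
 then have "f' -` S : sets lebesgue" by simp
 moreover have "f -` S \<inter> N : null_sets lebesgue" by (rule completion.complete2[OF _ N]) auto
 ultimately have "(f' -` S - N) \<union> (f -` S \<inter> N) : sets lebesgue"
  using N by (intro sets.Un sets.Diff) (auto simp: null_sets_def)
 also have "(f' -` S - N) \<union> (f -` S \<inter> N) = f -` S \<inter> space lebesgue" by (auto simp: N_def)
 finally show "f -` S \<inter> space lebesgue : sets lebesgue" .
qed simp

lemma
 fixes f f' :: "'a::euclidean_space => real"
 assumes m: "f' : Borel" and ae: "AEL x. f x = f' x"
 shows integrable_lebesgue_transfer: "integrable lebesgue f \<longleftrightarrow> integrable lborel f'"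
  and integral_lebesgue_transfer: "(\<integral>x. f x \<partial>lebesgue) = (LBINT x. f' x)"
proof -
 have f: "f : borel_measurable lebesgue" by (rule lebesgue_measurable_AE[OF assms])
 have f': "f' : borel_measurable lebesgue" using m by (intro measurable_completion) simp
 have m': "f' : borel_measurable lborel" using m by simp
 have ae': "AE x in lebesgue. f x = f' x" by (rule AE_completion[OF ae])
 show "integrable lebesgue f \<longleftrightarrow> integrable lborel f'"
  using integrable_cong_AE[OF f f' ae'] integrable_completion[OF m'] by simp
 show "(\<integral>x. f x \<partial>lebesgue) = (LBINT x. f' x)"
  using integral_cong_AE[OF f f' ae'] integral_completion[OF m'] by simp
qed

text \<open>Local integrability yields measurability on compact subsets, so U is exhausted by
  compact sets and the function is obtained as the limit of its restrictions.\<close>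

lemma borel_version:
 fixes f :: "real^'n => real"
 assumes U: "open U" and f: "loc_integrable U f"
 shows "EX f':borel_measurable borel. AE x\<in>U in lborel. f x = f' x"
proof -
 obtain C :: "nat => (real^'n) set" where C: "!!j. compact (C j)" "!!j. C j <= U" "!!j. C j <= interior (C (Suc j))" "\<Union>(range C) = U"
  using open_Union_compact_subsets[OF U] by metis
 have inc: "C j <= C (j + i)" for i j using C(3) interior_subset by (induction i) (auto, blast)
 have "(%x. ind U x * f x) : borel_measurable lebesgue"
 proof (rule borel_measurable_LIMSEQ_real)
  show "(%x. ind (C j) x * f x) : borel_measurable lebesgue" for j
   using f C(1,2) by (auto simp: loc_integrable_def set_integrable_def dest!: borel_measurable_integrable)
  fix x
  show "(%j. ind (C j) x * f x) ---> ind U x * f x"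
  proof (cases "x : U")
   case True
   then obtain j where "x : C j" using C(4) by blast
   then have "ALL i>=j. x : C i" using inc[of j] by (metis le_Suc_ex subsetD)
   then have "\<forall>\<^sub>F i in sequentially. ind (C i) x * f x = ind U x * f x"
    unfolding eventually_sequentially using True by force
   then show ?thesis by (rule tendsto_eventually)
  next
   case False
   then have "x ~: C j" for j using C(2) by blast
   then show ?thesis using False by simp
  qed
 qed
 then obtain f' where f': "f' : borel_measurable lborel" "AEL x. ind U x * f x = f' x"
  using completion_ex_borel_measurable_real by blast
 have "AE x\<in>U in lborel. f x = f' x" using f'(2) by eventually_elim auto
 then show ?thesis using f'(1) by auto
qed

lemma vec_lambda_measurable:
 fixes f :: "'n::finite => 'a => 'b::euclidean_space"
 assumes "!!i. f i : borel_measurable M"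
 shows "(%x. \<chi> i. f i x) : borel_measurable M"
 unfolding borel_measurable_euclidean_space[of "%x. \<chi> i. f i x"]
proof
 fix b :: "'b^'n" assume "b : Basis"
 then obtain i c where b: "b = axis i c" "c : Basis" by (auto simp: Basis_vec_def)
 have "(%x. f i x \<bullet> c) : borel_measurable M" using assms by measurable
 then show "(%x. (\<chi> i. f i x) \<bullet> b) : borel_measurable M" by (simp add: b inner_axis)
qed

lemma vector_version:
 fixes f :: "real^'m => 'b::euclidean_space^'n"
 assumes "!!i. EX f':borel_measurable borel. AE x\<in>U in lborel. f x $ i = f' x"
 shows "EX f':borel_measurable borel. AE x\<in>U in lborel. f x = f' x"
proof -
 have "ALL i. EX h. h : Borel & (AE x\<in>U in lborel. f x $ i = h x)" using assms by blast
 from choice[OF this] obtain h where h: "!!i. h i : Borel" "!!i. AE x\<in>U in lborel. f x $ i = h i x" by blast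
 have "AEL x. ALL i:UNIV. x : U --> f x $ i = h i x" using h(2) by (intro AE_finite_allI) auto
 then have "AE x\<in>U in lborel. f x = (\<chi> i. h i x)" by eventually_elim (auto simp: vec_eq_iff)
 then show ?thesis using vec_lambda_measurable[of h, OF h(1)] by (rule bexI)
qed

text \<open>On a Borel null set containing all exceptional points the matrix is replaced by lam
  times the identity, which satisfies both bounds because lam <= L.\<close>

lemma elliptic_version:
 assumes A: "(A :: real^'n => real^'n^'n) : elliptic_class lam L" and lam: "0 < lam" "lam <= L"
 shows "EX A'. elliptic A' lam L & (AEL x. A x = A' x)"
proof -
 have "EX f':borel_measurable borel. AE x\<in>UNIV in lborel. A x $ i $ j = f' x" for i j
 proof -
  have "(%x. A x $ i $ j) : borel_measurable lebesgue" using A by (simp add: elliptic_class_def)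
  then obtain f' where "f' : borel_measurable lborel" "AEL x. A x $ i $ j = f' x"
   using completion_ex_borel_measurable_real by blast
  then show ?thesis by auto
 qed
 then have "EX f':borel_measurable borel. AE x\<in>UNIV in lborel. A x $ i = f' x" for i
  by (rule vector_version)
 then have "EX f':borel_measurable borel. AE x\<in>UNIV in lborel. A x = f' x" by (rule vector_version)
 then obtain A0 where A0: "A0 : Borel" "AEL x. A x = A0 x" by auto
 define P where "P B \<longleftrightarrow> transpose B = B & (ALL \<xi>. lam * (norm \<xi>)^2 <= (B *v \<xi>) \<bullet> \<xi> & (B *v \<xi>) \<bullet> \<xi> <= L * (norm \<xi>)^2)"
  for B :: "real^'n^'n"
 have "AE x in lebesgue. P (A x)" using A by (simp add: elliptic_class_def P_def)
 then have "AEL x. P (A x)" by (simp add: AE_completion_iff)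
 with A0(2) have "AEL x. P (A0 x)" by eventually_elim simp
 then obtain N where N: "{x. \<not> P (A0 x)} <= N" "emeasure lborel N = 0" "N : sets borel"
  by (auto elim!: AE_E)
 define A' where "A' = (%x. if x : N then lam *. mat 1 else A0 x)"
 have "lam * (norm \<xi>)^2 = ((lam *. mat 1) *v \<xi>) \<bullet> \<xi>" for \<xi> :: "real^'n"
  by (simp add: scaleR_matrix_vector_assoc[symmetric] power2_norm_eq_inner)
 then have "P (lam *. mat 1)"
  unfolding P_def using lam by (metis mult_right_mono order_refl transpose_mat transpose_scalar zero_le_power2)
 then have PA: "P (A' x)" for x using N(1) by (auto simp: A'_def)
 have "elliptic A' lam L"
 proof
  show "A' : Borel" unfolding A'_def using A0(1) N(3) by (intro measurable_If_set) auto
 qed (use lam PA in \<open>auto simp: P_def\<close>)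
 moreover have "AEL x. A x = A' x"
 proof -
  have "AEL x. x ~: N" using N by (intro AE_not_in) (auto simp: null_sets_def)
  with A0(2) show ?thesis by eventually_elim (simp add: A'_def)
 qed
 ultimately show ?thesis by blast
qed

lemma loc_integrable_lborel:
 assumes f: "loc_integrable U f" and [measurable]: "f' : Borel" and ae: "AE x\<in>U in lborel. f x = f' x"
  and K: "compact K" "K <= U" and S: "S : sets borel" "S <= K"
 shows "integrable lborel (%x. ind S x * f' x)"
proof -
 have [measurable]: "K : sets borel" using compact_imp_closed[OF K(1)] by simp
 have "AEL x. ind K x *. f x = ind K x * f' x" using ae by eventually_elim (use K in \<open>auto simp: indicator_def\<close>)
 then have "integrable lborel (%x. ind K x * f' x)"
  using f K integrable_lebesgue_transfer[of "%x. ind K x * f' x" "%x. ind K x *. f x"]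
  by (auto simp: loc_integrable_def set_integrable_def)
 then have "integrable lborel (%x. (ind K x * f' x) * ind S x)" using S by (intro integrable_real_mult_indicator) auto
 moreover have "(%x. (ind K x * f' x) * ind S x) = (%x. ind S x * f' x)"
  using S(2) by (auto simp: indicator_def fun_eq_iff)
 ultimately show ?thesis by simp
qed

lemma test_fun_C1: "test_fun U \<phi> ==> C1 \<phi>"
 by (auto simp: test_fun_def smooth_def intro: Ck_C1)

lemma test_fun_outside:
 assumes "test_fun U \<phi>" "x ~: U"
 shows "\<phi> x = 0" "grad \<phi> x = 0" "pderiv \<phi> i x = 0"
proof -
 have x: "x ~: closure {x. \<phi> x ~= 0}" using assms by (auto simp: test_fun_def)
 have z: "\<phi> y = 0" if "y ~: closure {x. \<phi> x ~= 0}" for y using that closure_subset[of "{x. \<phi> x ~= 0}"] by auto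
 show "\<phi> x = 0" by (rule z[OF x])
 show "grad \<phi> x = 0" by (rule grad_zero_outside[OF z closed_closure x])
 show "pderiv \<phi> i x = 0" by (rule pderiv_zero_outside[OF z closed_closure x])
qed

lemma weak_grad_wgrad:
 fixes u u' :: "real^'n => real"
 assumes w: "weak_grad U u g" and [measurable]: "u' : Borel" "g' : Borel"
  and ae: "AE x\<in>U in lborel. u x = u' x" "AE x\<in>U in lborel. g x = g' x"
 shows "wgrad U u' g'"
 unfolding wgrad_def
proof (intro allI impI)
 fix \<phi> :: "real^'n => real" and i assume \<phi>: "test_fun U \<phi>"
 note C = test_fun_C1[OF \<phi>]
 note [measurable] = C1_measurable[OF C]
 have [measurable]: "pderiv \<phi> i : Borel"
  using vec_component_measurable[OF grad_measurable[OF C], of i] by (simp add: grad_def)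
 have [measurable]: "(%x. g' x $ i) : Borel" by (rule vec_component_measurable) measurable
 have "(\<integral>x. u x * pderiv \<phi> i x \<partial>lebesgue) = (LBINT x. u' x * pderiv \<phi> i x)"
 proof (rule integral_lebesgue_transfer)
  show "AEL x. u x * pderiv \<phi> i x = u' x * pderiv \<phi> i x"
   using ae(1)
  proof eventually_elim
   fix x assume "x : U --> u x = u' x"
   then show "u x * pderiv \<phi> i x = u' x * pderiv \<phi> i x" using test_fun_outside(3)[OF \<phi>, of x i] by (cases "x : U") auto
  qed
 qed measurable
 moreover have "(\<integral>x. g x $ i * \<phi> x \<partial>lebesgue) = (LBINT x. g' x $ i * \<phi> x)"
 proof (rule integral_lebesgue_transfer)
  show "AEL x. g x $ i * \<phi> x = g' x $ i * \<phi> x"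
   using ae(2)
  proof eventually_elim
   fix x assume "x : U --> g x = g' x"
   then show "g x $ i * \<phi> x = g' x $ i * \<phi> x" using test_fun_outside(1)[OF \<phi>, of x] by (cases "x : U") auto
  qed
 qed measurable
 ultimately show "(LBINT x. u' x * pderiv \<phi> i x) = - (LBINT x. g' x $ i * \<phi> x)"
  using w \<phi> unfolding weak_grad_def by simp
qed

lemma square_integrable_L2:
 fixes f f' :: "'a::euclidean_space => real"
 assumes f: "set_integrable lebesgue S (%x. (f x)^2)" and [measurable]: "S : sets borel" "f' : Borel"
  and ae: "AE x\<in>S in lborel. f x = f' x"
 shows "L2 S f' < \<infinity>"
proof -
 have "L2 S f' = (NN x. ennreal (norm (ind S x *. (f x)\<^sup>2)))"
  unfolding L2_def
 proof (rule nn_integral_cong_AE)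
  show "AEL x. ennreal ((norm (f' x))^2) * ind S x = ennreal (norm (ind S x *. (f x)\<^sup>2))"
   using ae
  proof eventually_elim
   fix x assume h: "x : S --> f x = f' x"
   show "ennreal ((norm (f' x))^2) * ind S x = ennreal (norm (ind S x *. (f x)\<^sup>2))"
    using h by (cases "x : S") auto
  qed
 qed
 also have "\<dots> = (\<integral>\<^sup>+x. ennreal (norm (ind S x *. (f x)\<^sup>2)) \<partial>lebesgue)" by (rule nn_integral_completion[symmetric])
 also have "\<dots> < \<infinity>" using f unfolding set_integrable_def integrable_iff_bounded by simp
 finally show ?thesis .
qed

lemma square_integrable_L2_vec:
 fixes g' :: "real^'n => real^'n"
 assumes "!!i. set_integrable lebesgue S (%x. (g x $ i)^2)" and S: "S : sets borel" and g': "g' : Borel"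
  and ae: "AE x\<in>S in lborel. g x = g' x"
 shows "L2 S g' < \<infinity>"
proof -
 have "L2 S (%x. g' x $ i) < \<infinity>" for i
  by (rule square_integrable_L2[OF assms(1) S vec_component_measurable[OF g']]) (use ae in eventually_elim, auto)
 then show ?thesis unfolding L2_components[OF g' S] by (simp add: less_top)
qed

text \<open>The approximating test functions share one compact support, on which F is integrable, so
  uniform closeness of the gradients suffices. The constant c is 1 for the fundamental solution and
  0 for a solution.\<close>

lemma integral_grad_C1c:
 fixes F :: "real^'n => real^'n"
 assumes U: "open U" and [measurable]: "F : Borel"
  and int: "!!K. compact K ==> K <= U ==> integrable lborel (%x. ind K x *. F x)"
  and test: "!!\<psi>. test_fun U \<psi> ==> (LBINT x. F x \<bullet> grad \<psi> x) = c * \<psi> 0"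
  and \<phi>: "\<phi> : C1c U"
 shows "(LBINT x. F x \<bullet> grad \<phi> x) = c * \<phi> 0"
proof -
 obtain K where K: "compact K" "K <= U" "ALL x. x ~: K --> \<phi> x = 0" and
  dense: "ALL \<epsilon>>0. EX \<psi>. test_fun U \<psi> & (ALL x. x ~: K --> \<psi> x = 0) & (ALL x. \<bar>\<psi> x - \<phi> x\<bar> <= \<epsilon>) & (ALL x. norm (grad \<psi> x - grad \<phi> x) <= \<epsilon>)"
  using test_fun_dense[OF \<phi> U] by blast
 have cK: "closed K" using K(1) by (rule compact_imp_closed)
 then have [measurable]: "K : sets borel" by simp
 note [measurable] = grad_measurable[OF C1c_C1[OF \<phi>]]
 define I where "I = (LBINT x. norm (ind K x *. F x))"
 have nI: "integrable lborel (%x. norm (ind K x *. F x))" using int[OF K(1,2)] by (rule integrable_norm)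
 have I0: "0 <= I" unfolding I_def by (rule integral_nonneg_AE) simp
 have zero: "grad f x = 0" if "ALL x. x ~: K --> f x = 0" "x ~: K" for f x
  by (rule grad_zero_outside[OF _ cK that(2)]) (use that in auto)
 obtain B where B: "B > 0" "ALL x. norm (grad \<phi> x) <= B" using C1c_bounded[OF \<phi>] by blast
 have ib: "integrable lborel (%x. F x \<bullet> h x)"
  if [measurable]: "h : Borel" and "!!x. norm (h x) <= b" "!!x. x ~: K ==> h x = 0" for h b
 proof (rule Bochner_Integration.integrable_bound[OF integrable_mult_right[OF nI, of b]])
  show "AEL x. norm (F x \<bullet> h x) <= norm (b * norm (ind K x *. F x))"
  proof (rule AE_I2)
   fix x
   show "norm (F x \<bullet> h x) <= norm (b * norm (ind K x *. F x))"
   proof (cases "x : K")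
    case True
    have "\<bar>F x \<bullet> h x\<bar> <= norm (F x) * norm (h x)" by (rule Cauchy_Schwarz_ineq2)
    also have "\<dots> <= norm (F x) * \<bar>b\<bar>" using that(2)[of x] by (intro mult_left_mono) auto
    finally show ?thesis using True by (simp add: abs_mult mult.commute)
   qed (simp add: that(3))
  qed
 qed measurable
 define d where "d = (LBINT x. F x \<bullet> grad \<phi> x) - c * \<phi> 0"
 have le: "\<bar>d\<bar> <= (I + \<bar>c\<bar>) * \<epsilon>" if \<epsilon>: "\<epsilon> > 0" for \<epsilon>
 proof -
  obtain \<psi> where \<psi>: "test_fun U \<psi>" "ALL x. x ~: K --> \<psi> x = 0" "ALL x. \<bar>\<psi> x - \<phi> x\<bar> <= \<epsilon>" "ALL x. norm (grad \<psi> x - grad \<phi> x) <= \<epsilon>"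
   using dense \<epsilon> by blast
  note [measurable] = grad_measurable[OF test_fun_C1[OF \<psi>(1)]]
  have i1: "integrable lborel (%x. F x \<bullet> grad \<phi> x)" by (rule ib[of _ B]) (use B zero[OF K(3)] in auto)
  have i2: "integrable lborel (%x. F x \<bullet> (grad \<psi> x - grad \<phi> x))"
   by (rule ib[of _ \<epsilon>]) (use \<psi>(4) zero[OF K(3)] zero[OF \<psi>(2)] in auto)
  have "(LBINT x. F x \<bullet> grad \<psi> x) = (LBINT x. F x \<bullet> grad \<phi> x + F x \<bullet> (grad \<psi> x - grad \<phi> x))"
   by (simp add: inner_diff_right)
  also have "\<dots> = (LBINT x. F x \<bullet> grad \<phi> x) + (LBINT x. F x \<bullet> (grad \<psi> x - grad \<phi> x))"
   by (rule Bochner_Integration.integral_add[OF i1 i2])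
  finally have "d = c * (\<psi> 0 - \<phi> 0) - (LBINT x. F x \<bullet> (grad \<psi> x - grad \<phi> x))"
   using test[OF \<psi>(1)] by (simp add: d_def right_diff_distrib)
  moreover have "\<bar>c * (\<psi> 0 - \<phi> 0)\<bar> <= \<bar>c\<bar> * \<epsilon>" using \<psi>(3) unfolding abs_mult by (intro mult_left_mono) auto
  moreover have "\<bar>(LBINT x. F x \<bullet> (grad \<psi> x - grad \<phi> x))\<bar> <= \<epsilon> * I"
  proof -
   have "\<bar>(LBINT x. F x \<bullet> (grad \<psi> x - grad \<phi> x))\<bar> <= (LBINT x. \<bar>F x \<bullet> (grad \<psi> x - grad \<phi> x)\<bar>)"
    by (rule integral_abs_bound)
   also have "\<dots> <= (LBINT x. \<epsilon> * norm (ind K x *. F x))"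
   proof (rule integral_mono)
    show "integrable lborel (%x. \<bar>F x \<bullet> (grad \<psi> x - grad \<phi> x)\<bar>)" using i2 by (rule integrable_abs)
    show "integrable lborel (%x. \<epsilon> * norm (ind K x *. F x))" using nI by (rule integrable_mult_right)
    fix x
    show "\<bar>F x \<bullet> (grad \<psi> x - grad \<phi> x)\<bar> <= \<epsilon> * norm (ind K x *. F x)"
    proof (cases "x : K")
     case True
     have "\<bar>F x \<bullet> (grad \<psi> x - grad \<phi> x)\<bar> <= norm (F x) * norm (grad \<psi> x - grad \<phi> x)" by (rule Cauchy_Schwarz_ineq2)
     also have "\<dots> <= norm (F x) * \<epsilon>" using \<psi>(4) by (intro mult_left_mono) auto
     finally show ?thesis using True by (simp add: mult.commute)
    qed (simp add: zero[OF K(3)] zero[OF \<psi>(2)])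
   qed
   also have "\<dots> = \<epsilon> * I" by (simp add: I_def)
   finally show ?thesis .
  qed
  ultimately show ?thesis by (simp add: algebra_simps)
 qed
 have "d = 0"
 proof (rule ccontr)
  assume d: "d ~= 0"
  define M where "M = I + \<bar>c\<bar>"
  have M: "M \<ge> 0" using I0 by (simp add: M_def)
  have "\<bar>d\<bar> <= M * (\<bar>d\<bar> / (M + 1))" using le[of "\<bar>d\<bar> / (M + 1)"] d M by (simp add: M_def)
  then show False using d M by (simp add: field_simps)
 qed
 then show ?thesis by (simp add: d_def)
qed

lemma (in elliptic) A_loc_integrable:
 assumes [measurable]: "g : Borel" and K [measurable]: "K : sets borel"
  and int: "!!i. integrable lborel (%x. ind K x * g x $ i)"
 shows "integrable lborel (%x. ind K x *. (A x *v g x))"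
proof (rule Bochner_Integration.integrable_bound)
 show "integrable lborel (%x. L * (\<Sum>i\<in>UNIV. \<bar>ind K x * g x $ i\<bar>))"
  using int by (intro integrable_mult_right Bochner_Integration.integrable_sum integrable_abs) auto
 show "AEL x. norm (ind K x *. (A x *v g x)) <= norm (L * (\<Sum>i\<in>UNIV. \<bar>ind K x * g x $ i\<bar>))"
 proof (rule AE_I2)
  fix x
  have "norm (ind K x *. (A x *v g x)) <= L * (ind K x * norm (g x))"
   using A_norm[of x "g x"] by (simp add: indicator_def)
  also have "\<dots> <= L * (\<Sum>i\<in>UNIV. \<bar>ind K x * g x $ i\<bar>)"
   using norm_le_l1_cart[of "g x"] L_pos by (intro mult_left_mono) (auto simp: indicator_def)
  finally show "norm (ind K x *. (A x *v g x)) <= norm (L * (\<Sum>i\<in>UNIV. \<bar>ind K x * g x $ i\<bar>))"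
   by simp
 qed
qed measurable

lemma integral_flux_transfer:
 assumes e: "elliptic A' lam L" and A: "AEL x. A x = A' x" and U: "open U"
  and g': "g' : Borel" and g: "AE x\<in>U in lborel. g x = g' x"
  and int: "!!i. loc_integrable U (%x. g x $ i)"
  and test: "!!\<psi>. test_fun U \<psi> ==> (\<integral>x. (A x *v g x) \<bullet> grad \<psi> x \<partial>lebesgue) = c * \<psi> 0"
  and \<phi>: "\<phi> : C1c U"
 shows "(LBINT x. (A' x *v g' x) \<bullet> grad \<phi> x) = c * \<phi> 0"
proof (rule integral_grad_C1c[OF U _ _ _ \<phi>])
 interpret elliptic A' lam L by (rule e)
 note [measurable] = g'
 show "(%x. A' x *v g' x) : Borel" by measurable
 show "integrable lborel (%x. ind K x *. (A' x *v g' x))" if K: "compact K" "K <= U" for K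
 proof (rule A_loc_integrable[OF g'])
  show b: "K : sets borel" using compact_imp_closed[OF K(1)] by simp
  show "integrable lborel (%x. ind K x * g' x $ i)" for i
   by (rule loc_integrable_lborel[OF int vec_component_measurable[OF g'] _ K b subset_refl]) (use g in eventually_elim, auto)
 qed
 fix \<psi> :: "real^'a => real" assume \<psi>: "test_fun U \<psi>"
 note [measurable] = grad_measurable[OF test_fun_C1[OF \<psi>]]
 have "(\<integral>x. (A x *v g x) \<bullet> grad \<psi> x \<partial>lebesgue) = (LBINT x. (A' x *v g' x) \<bullet> grad \<psi> x)"
 proof (rule integral_lebesgue_transfer)
  show "AEL x. (A x *v g x) \<bullet> grad \<psi> x = (A' x *v g' x) \<bullet> grad \<psi> x"
   using A g
  proof eventually_elim
   fix x assume "A x = A' x" "x : U --> g x = g' x"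
   then show "(A x *v g x) \<bullet> grad \<psi> x = (A' x *v g' x) \<bullet> grad \<psi> x"
    using test_fun_outside(2)[OF \<psi>, of x] by (cases "x : U") auto
  qed
 qed measurable
 then show "(LBINT x. (A' x *v g' x) \<bullet> grad \<psi> x) = c * \<psi> 0" using test[OF \<psi>] by simp
qed

text \<open>The positive part is taken after the passage to a Borel representative: the sign of G is
  given only off the pole, and the representative may differ from G on a null set.\<close>

lemma fundamental_version:
 assumes F: "fundamental_solution (A :: real^'n => real^'n^'n) G D" and e: "elliptic A' lam L" and A: "AEL x. A x = A' x"
  and n3: "CARD('n) \<ge> 3"
 shows "EX G' H. fundamental A' lam L G' H & (AEL x. G x = G' x)"
proof -
 have pos: "ALL x. x ~= 0 --> G x > 0" and w: "weak_grad UNIV G D"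
  and sq: "ALL \<rho>>0. ALL i. set_integrable lebesgue (- cball 0 \<rho>) (%x. (D x $ i)^2)"
  and fl: "ALL \<phi>. test_fun UNIV \<phi> --> (\<integral>x. (A x *v D x) \<bullet> grad \<phi> x \<partial>lebesgue) = \<phi> 0"
  and lim: "(G \<longlongrightarrow> 0) at_infinity" using F unfolding fundamental_solution_def by auto
 have lG: "loc_integrable UNIV G" and lD: "!!i. loc_integrable UNIV (%x. D x $ i)" using w by (auto simp: weak_grad_def)
 obtain G0 where G0 [measurable]: "G0 : Borel" and aG0: "AEL x. G x = G0 x"
  using borel_version[OF open_UNIV lG] by auto
 obtain H where H [measurable]: "H : Borel" and aH: "AE x\<in>UNIV in lborel. D x = H x"
  using vector_version[of UNIV D] borel_version[OF open_UNIV lD] by blast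
 define G' where "G' = (%x. max (G0 x) 0)"
 have G' [measurable]: "G' : Borel" unfolding G'_def by measurable
 have ne: "AEL x. x ~= (0::real^'n)" by (rule AE_lborel_singleton)
 have aG: "AE x\<in>UNIV in lborel. G x = G' x"
  using aG0 ne
 proof eventually_elim
  fix x :: "real^'n" assume "G x = G0 x" "x ~= 0"
  then show "x : UNIV --> G x = G' x" using pos[rule_format, of x] by (simp add: G'_def)
 qed
 have cb: "compact (cball (0::real^'n) r)" "ball (0::real^'n) r <= cball 0 r" for r by auto
 have aHi: "AE x\<in>UNIV in lborel. D x $ i = H x $ i" for i using aH by eventually_elim auto
 interpret elliptic A' lam L by (rule e)
 have "fundamental A' lam L G' H"
 proof
  show "3 <= CARD('n)" by (rule n3)
  show "0 <= G' x" for x by (simp add: G'_def)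
  show "AEL x. 0 < G' x" using aG ne by eventually_elim (use pos in force)
  show "integrable lborel (%x. ind (ball 0 r) x * G' x)" for r
   by (rule loc_integrable_lborel[OF lG G' aG cb(1) subset_UNIV _ cb(2)]) simp
  show "integrable lborel (%x. ind (ball 0 r) x * H x $ i)" for r i
   by (rule loc_integrable_lborel[OF lD vec_component_measurable[OF H] aHi cb(1) subset_UNIV _ cb(2)]) simp
  show "wgrad UNIV G' H" by (rule weak_grad_wgrad[OF w G' H aG aH])
  show "L2 (- cball 0 \<rho>) H < \<infinity>" if "\<rho> > 0" for \<rho>
   by (rule square_integrable_L2_vec[where g=D]) (use sq that aH H in auto)
  show "(LBINT x. (A' x *v H x) \<bullet> grad \<phi> x) = \<phi> 0" if "\<phi> : C1c UNIV" for \<phi>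
   using integral_flux_transfer[OF e A open_UNIV H aH lD _ that, of 1] fl by simp
  show "EX R>0. AEL x. R <= norm x --> G' x < \<delta>" if \<delta>: "\<delta> > 0" for \<delta>
  proof -
   obtain b where b: "ALL x. b <= norm x --> dist (G x) 0 < \<delta>"
    using tendstoD[OF lim \<delta>] by (auto simp: eventually_at_infinity)
   have "AEL x. max b 1 <= norm x --> G' x < \<delta>"
    using aG
   proof (eventually_elim, intro impI)
    fix x :: "real^'n" assume "x : UNIV --> G x = G' x" "max b 1 <= norm x"
    then show "G' x < \<delta>" using b[rule_format, of x] by (simp add: dist_real_def)
   qed
   then show ?thesis by (intro exI[of _ "max b 1"]) auto
  qed
 qed measurable
 then show ?thesis using aG by auto
qed

text \<open>Mollification needs a collar: first from the unit ball to radius 15/16, whose closure is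
  compact in it, and then to radius 7/8, with kernels of radius at most 1/32.\<close>

lemma solution_version:
 assumes W: "weak_solution (A :: real^'n => real^'n^'n) (ball 0 1) u Du" and e: "elliptic A' lam L" and A: "AEL x. A x = A' x"
 shows "EX u' g. elliptic.sol A' (ball 0 (7/8)) g & approx (ball 0 (7/8)) (Collect C1) u' g &
  (AE x\<in>ball 0 1 in lborel. u x = u' x) & (AE x\<in>ball 0 1 in lborel. Du x = g x)"
proof -
 define U where "U = ball (0::real^'n) 1"
 have U: "open U" by (simp add: U_def)
 have w: "weak_grad U u Du" and squ: "set_integrable lebesgue U (%x. (u x)^2)" and sqg: "ALL i. set_integrable lebesgue U (%x. (Du x $ i)^2)"
  and eq: "ALL \<phi>. test_fun U \<phi> --> (\<integral>x. (A x *v Du x) \<bullet> grad \<phi> x \<partial>lebesgue) = 0"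
  using W unfolding weak_solution_def H1_def U_def by auto
 have lu: "loc_integrable U u" and lD: "!!i. loc_integrable U (%x. Du x $ i)" using w by (auto simp: weak_grad_def)
 obtain u' where u' [measurable]: "u' : Borel" and au: "AE x\<in>U in lborel. u x = u' x"
  using borel_version[OF U lu] by auto
 obtain g where g [measurable]: "g : Borel" and ag: "AE x\<in>U in lborel. Du x = g x"
  using vector_version[of U Du] borel_version[OF U lD] by blast
 have agi: "AE x\<in>U in lborel. Du x $ i = g x $ i" for i using ag by eventually_elim auto
 have K: "compact (cball (0::real^'n) (15/16))" "cball (0::real^'n) (15/16) <= U" "ball (0::real^'n) (15/16) <= cball 0 (15/16)"
  by (auto simp: U_def)
 have "L2 U u' < \<infinity>" by (rule square_integrable_L2[OF squ _ u' au]) (simp add: U_def)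
 then have fu: "L2 (ball 0 (15/16)) u' < \<infinity>" using L2_mono_set[of "ball 0 (15/16)" U u'] by (force simp: U_def)
 have "L2 U g < \<infinity>" by (rule square_integrable_L2_vec[where g=Du]) (use sqg g ag in \<open>auto simp: U_def\<close>)
 then have fg: "L2 (ball 0 (15/16)) g < \<infinity>" using L2_mono_set[of "ball 0 (15/16)" U g] by (force simp: U_def)
 have ap: "approx (ball 0 (7/8)) (Collect C1) u' g"
 proof (rule weak_approx[OF weak_grad_wgrad[OF w u' g au ag], where S'="ball 0 (15/16)" and ?e0.0="1/32"])
  show "integrable lborel (%x. ind (ball 0 (15/16)) x * u' x)"
   by (rule loc_integrable_lborel[OF lu u' au K(1,2) _ K(3)]) simp
  show "integrable lborel (%x. ind (ball 0 (15/16)) x * g x $ i)" for i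
   by (rule loc_integrable_lborel[OF lD vec_component_measurable[OF g] agi K(1,2) _ K(3)]) simp
  show "cball x (1/32) <= ball 0 (15/16)" if "x : ball 0 (7/8)" for x :: "real^'n"
  proof
   fix y assume "y : cball x (1/32)"
   then show "y : ball 0 (15/16)" using that norm_triangle_ineq2[of y x] by (simp add: dist_norm norm_minus_commute)
  qed
 qed (use fu fg in \<open>auto simp: U_def\<close>)
 interpret elliptic A' lam L by (rule e)
 have z: "(LBINT x. ind (ball 0 (7/8)) x * ((A' x *v g x) \<bullet> grad \<phi> x)) = 0" if \<phi>: "\<phi> : C1c (ball 0 (7/8))" for \<phi>
 proof -
  have "(LBINT x. ind (ball 0 (7/8)) x * ((A' x *v g x) \<bullet> grad \<phi> x)) = (LBINT x. (A' x *v g x) \<bullet> grad \<phi> x)"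
   using C1c_zero(2)[OF \<phi>] by (intro Bochner_Integration.integral_cong) (auto simp: indicator_def)
  also have "\<dots> = 0"
  proof -
   have "ball (0::real^'n) (7/8) <= U" by (auto simp: U_def)
   from integral_flux_transfer[OF e A U g ag lD _ C1c_mono[OF \<phi> this], of 0] show ?thesis using eq by simp
  qed
  finally show ?thesis .
 qed
 have "A' x *v - g x = - (A' x *v g x)" for x using matrix_vector_mult_scaleR[of "A' x" "-1" "g x"] by simp
 with z have "sol (ball 0 (7/8)) g" by (auto simp: sol_def super_def)
 then show ?thesis using ap au ag unfolding U_def by blast
qed

theorem theorem1p3:
  fixes lam L :: real
  assumes "CARD('n) \<ge> 3" and "0 < lam" and "lam \<le> L"
  shows "\<exists>\<alpha> C. 0 < \<alpha> \<and> \<alpha> < 1 \<and> C > 0 \<and>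
    (\<forall>(A :: real^'n \<Rightarrow> real^'n^'n) G DG u Du.
       A \<in> elliptic_class lam L \<and> fundamental_solution A G DG \<and> weak_solution A (ball 0 1) u Du \<longrightarrow>
       (\<forall>r R. 0 < r \<and> r < R \<and> R \<le> 1/2 \<longrightarrow>
          (\<integral>\<^sup>+ x\<in>ball 0 r. ennreal (G x * ((A x *v Du x) \<bullet> Du x)) \<partial>lebesgue)
            \<le> ennreal (C * (r / R) powr (2 * \<alpha>)) *
              (\<integral>\<^sup>+ x\<in>ball 0 R. ennreal (G x * ((A x *v Du x) \<bullet> Du x)) \<partial>lebesgue)) \<and>
       holder_class \<alpha> (ball 0 (1/2)) u)"
proof -
 obtain \<alpha> C where \<alpha>: "0 < \<alpha>" "\<alpha> < 1" "C > 0" and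
  main: "ALL (A::real^'n => real^'n^'n) G H u g. fundamental A lam L G H --> elliptic.sol A (ball 0 (7/8)) g -->
   approx (ball 0 (7/8)) (Collect C1) u g -->
   (ALL r R. 0 < r & r < R & R <= 1/2 -->
     (NN x. ennreal (G x * ((A x *v g x) \<bullet> g x)) * ind (ball 0 r) x)
      <= ennreal (C * (r / R) powr (2 * \<alpha>)) * (NN x. ennreal (G x * ((A x *v g x) \<bullet> g x)) * ind (ball 0 R) x)) &
   (EX v K. (AE x\<in>ball 0 (1/2) in lborel. u x = v x) & (ALL x y. \<bar>v x - v y\<bar> <= K * dist x y powr \<alpha>))"
  using energy_decay_and_holder[where 'n='n, OF assms] by blast
 have "(ALL r R. 0 < r & r < R & R <= 1/2 -->
     (\<integral>\<^sup>+ x\<in>ball 0 r. ennreal (G x * ((A x *v Du x) \<bullet> Du x)) \<partial>lebesgue)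
      <= ennreal (C * (r / R) powr (2 * \<alpha>)) *
       (\<integral>\<^sup>+ x\<in>ball 0 R. ennreal (G x * ((A x *v Du x) \<bullet> Du x)) \<partial>lebesgue)) &
   holder_class \<alpha> (ball 0 (1/2)) u"
  if A: "A : elliptic_class lam L" and F: "fundamental_solution A G DG" and W: "weak_solution A (ball 0 1) u Du"
  for A :: "real^'n => real^'n^'n" and G DG u Du
 proof -
  obtain A' where e: "elliptic A' lam L" and aA: "AEL x. A x = A' x" using elliptic_version[OF A assms(2,3)] by blast
  obtain G' H where f: "fundamental A' lam L G' H" and aG: "AEL x. G x = G' x"
   using fundamental_version[OF F e aA assms(1)] by blast
  obtain u' g where s: "elliptic.sol A' (ball 0 (7/8)) g" and ap: "approx (ball 0 (7/8)) (Collect C1) u' g"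
   and au: "AE x\<in>ball 0 1 in lborel. u x = u' x" and ag: "AE x\<in>ball 0 1 in lborel. Du x = g x"
   using solution_version[OF W e aA] by blast
  note m = main[rule_format, OF f s ap]
  have eq: "(\<integral>\<^sup>+ x\<in>ball 0 t. ennreal (G x * ((A x *v Du x) \<bullet> Du x)) \<partial>lebesgue)
   = (NN x. ennreal (G' x * ((A' x *v g x) \<bullet> g x)) * ind (ball 0 t) x)" if "t <= 1/2" for t
   unfolding nn_integral_completion
   by (rule nn_integral_cong_AE) (use aA aG ag in eventually_elim, use that in \<open>auto simp: indicator_def\<close>)
  have "holder_class \<alpha> (ball 0 (1/2)) u"
  proof -
   obtain v K where v: "AE x\<in>ball 0 (1/2) in lborel. u' x = v x" "ALL x y. \<bar>v x - v y\<bar> <= K * dist x y powr \<alpha>"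
    using m by blast
   have "AE x\<in>ball 0 (1/2) in lborel. u x = v x" using v(1) au by eventually_elim auto
   then show ?thesis unfolding holder_class_def using v(2) AE_completion by blast
  qed
  then show ?thesis using m eq by auto
 qed
 then show ?thesis using \<alpha> by blast
qed

end
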